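(* In the setting of the context, fix $j_0\in\mathbb N$, $j_0\ge1$. Let $u^\dagger\in L^2(\mathcal B_1)$ satisfy $\|P_{\le j_0}^\perp\Phi u^\dagger\|_2\le r$ for some $r\ge0$, and let $t_1,\dots,t_m$ be i.i.d. samples drawn from the uniform distribution on $\{x\in\mathbb R^2:|x|\le N\}$, where $N=\lceil Cj_0\rceil$ with $C$ the constant fixed in the context. Let $y_k=(u^\dagger*\kappa_b)(t_k)+\varepsilon_k$ for $k=1,\dots,m$, with $|\varepsilon_k|\le\beta$, $\beta\ge 0$. Let $s\in\mathbb N$ with $2\le s\le M_{\le j_0}$, and set $$\tau=j_0^2\,2^{2j_0}s.$$ There exist constants $C_0,C_1,C_2,C_3>0$, depending only on $b$ and on the wavelet dictionary, for which the following holds. Let $W=\mathrm{diag}(2^{bj})_{(j,n)\in\Lambda_{\le j_0}}$ and let $\widehat u$ be a solution of $$\min_u\|W^{-1}\Phi u\|_1\ :\quad\frac1m\sum_{k=1}^m|(u*\kappa_b)(t_k)-y_k|^2\le\bigl(\beta+C_3\,j_0\,2^{-bj_0}r\bigr)^2,$$ where the minimum is taken over $u\in\mathrm{span}(\phi_{j,n})_{(j,n)\in\Lambda_{\le j_0}}$. Let $\gamma\in(0,1)$. If $$m\ge C_0\,\tau\max\{j_0\log^3\tau,\ \log(1/\gamma)\},$$ then, with probability exceeding $1-\gamma$, $$\|u^\dagger-\widehat u\|_{L^2}\le C_1\,2^{bj_0}\frac{\sigma_s(W^{-1}P_{\le j_0}\Phi u^\dagger)_1}{\sqrt s}+C_2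\,j_0\bigl(2^{bj_0}\beta+j_0r\bigr).$$
   Context: $\mathbb N$ denotes the non-negative integers; $\mathcal B_1$ is the open unit ball of $\mathbb R^2$; functions in $L^2(\mathcal B_1)$ are extended by zero to $\mathbb R^2$. Wavelets: a multiresolution approximation (MRA) of $L^2(\mathbb R)$ is an increasing sequence $(V_j)_{j\in\mathbb Z}$ of closed subspaces with trivial intersection and dense union, with $f\in V_j\iff f(2\cdot)\in V_{j+1}$, and such that $V_0$ has a Riesz basis $(g(\cdot-n))_{n\in\mathbb Z}$; it is $\rho$-regular ($\rho\in\mathbb N$) if $g$ can be chosen in $C^\rho$ with all derivatives of order $\le\rho$ rapidly decreasing. Let $\psi,\varphi$ be the compactly supported scaling function and wavelet of a $\rho$-regular MRA of $L^2(\mathbb R)$ (their translates generate orthonormal bases of $V_0$ and of the orthogonal complement of $V_0$ in $V_1$). Put $\varphi^0=\psi$, $\varphi^1=\varphi$. The functions $\psi(x_1-n_1)\psi(x_2-n_2)$, $n\in\mathbb Z^2$ (assigned to scale $j=0$), and $2^j\varphi^{\varepsilon_1}(2^jx_1-n_1)\varphi^{\varepsilon_2}(2^jx_2-n_2)$, $j\in\mathbb N$, $n\in\mathbb Z^2$, $\varepsilon\in\{0,1\}^2\setminus\{(0,0)\}$ (scale $j$), form an orthonormal basis of $L^2(\mathbb R^2)$. The wavelet dictionary $(\phi_{j,n})_{(j,n)\in\Gamma}$ is the subfamily of those basis functions whose support intersects $\mathcal B_1$; $j$ is the scale and $n$ collects translation and type. $\mathcal H_1$ is the closed linear span of the dictionary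 in $L^2(\mathbb R^2)$ (it contains $L^2(\mathcal B_1)$); $\Phi:\mathcal H_1\to\ell^2(\Gamma)$, $\Phi u=(\langle u,\phi_{j,n}\rangle)$. $\Lambda_{\le j}=\{(j',n)\in\Gamma:j'\le j\}$ (finite), $M_{\le j}=|\Lambda_{\le j}|$; $P_{\le j}$ is the orthogonal projection of $\ell^2(\Gamma)$ onto sequences supported in $\Lambda_{\le j}$, $P_{\le j}^\perp=I-P_{\le j}$, $\iota_{\le j}:\ell^2(\Lambda_{\le j})\to\ell^2(\Gamma)$ is extension by zero. $\sigma_s(x)_1=\inf\{\|x-y\|_1:|\mathrm{supp}(y)|\le s\}$. Standing assumption: $2<b<\rho$. $\kappa_b=\mathcal F^{-1}((1+|\cdot|^2)^{-b/2})$, with $\mathcal Fu(\xi)=\int e^{-2\pi i\xi\cdot x}u(x)\,dx$; $U:\mathcal H_1\to L^2(\mathbb R^2)$, $Uu=\kappa_b*u$ (a continuous function, so point values make sense). Choice of $C$: let $c>0$ be a constant, depending only on $b$ and the dictionary, with $c\sum_{\Gamma}2^{-2bj}|x_{j,n}|^2\le\|U\Phi^*x\|_{L^2}^2$ for all $x\in\ell^2(\Gamma)$. $C>0$ is a constant, depending only on $b$ and the dictionary, such that for every $j_0\ge1$ and $N=\lceil Cj_0\rceil$ the balancing property with $\theta=\sqrt{c/2}$ holds: $\|\mathbf 1_{\{|x|>N\}}U\Phi^*\iota_{\le j_0}\|_{\ell^2(\Lambda_{\le j_0})\to L^2(\mathbb R^2)}^2\le\frac c2\,2^{-2bj_0}$.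 Such constants exist. *)

theory Defs
  imports "HOL-Probability.Probability"
begin

section \<open>Complex \<open>L\<^sup>2\<close> functions on a Euclidean space\<close>

text \<open>
  Elements of \<open>L\<^sup>2\<close> are represented by Borel functions; two functions that agree almost everywhere
  represent the same element.  Subspaces of \<open>L\<^sup>2\<close> are sets of representatives.
\<close>

definition Ltwo :: "('a::euclidean_space \<Rightarrow> complex) set" where
  "Ltwo = {f. f \<in> borel_measurable lborel \<and> integrable lborel (\<lambda>x. (cmod (f x))\<^sup>2)}"

definition Ltwo_inner :: "('a::euclidean_space \<Rightarrow> complex) \<Rightarrow> ('a \<Rightarrow> complex) \<Rightarrow> complex" where
  "Ltwo_inner f g = (LINT x|lborel. f x * cnj (g x))"

definition Ltwo_norm :: "('a::euclidean_space \<Rightarrow> complex) \<Rightarrow> real" where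
  "Ltwo_norm f = sqrt (LINT x|lborel. (cmod (f x))\<^sup>2)"

text \<open>The support of a function as an element of \<open>L\<^sup>2\<close>: it is insensitive to changes on null sets
  and agrees with the usual support for continuous functions.\<close>

definition ess_support :: "('a::euclidean_space \<Rightarrow> complex) \<Rightarrow> 'a set" where
  "ess_support f = {x. \<forall>e>0. \<not> (AE y in lborel. y \<in> ball x e \<longrightarrow> f y = 0)}"

definition fun_span :: "('i \<Rightarrow> 'a \<Rightarrow> complex) \<Rightarrow> 'i set \<Rightarrow> ('a \<Rightarrow> complex) set" where
  "fun_span e I = {(\<lambda>x. \<Sum>i\<in>S. a i * e i x) | S a. finite S \<and> S \<subseteq> I}"

definition Ltwo_closed_span ::
  "('i \<Rightarrow> 'a::euclidean_space \<Rightarrow> complex) \<Rightarrow> 'i set \<Rightarrow> ('a \<Rightarrow> complex) set" where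
  "Ltwo_closed_span e I =
     {f \<in> Ltwo. \<forall>\<delta>>0. \<exists>g\<in>fun_span e I. Ltwo_norm (\<lambda>x. f x - g x) < \<delta>}"

text \<open>The last clause makes the subspace closed in norm, and in particular closed under
  almost-everywhere equality.\<close>

definition Ltwo_closed_subspace :: "('a::euclidean_space \<Rightarrow> complex) set \<Rightarrow> bool" where
  "Ltwo_closed_subspace S \<longleftrightarrow>
     S \<subseteq> Ltwo \<and> (\<lambda>x. 0) \<in> S \<and>
     (\<forall>f\<in>S. \<forall>g\<in>S. (\<lambda>x. f x + g x) \<in> S) \<and>
     (\<forall>a. \<forall>f\<in>S. (\<lambda>x. a * f x) \<in> S) \<and>
     (\<forall>F f. (\<forall>n::nat. F n \<in> S) \<and> f \<in> Ltwo \<and>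
        (\<lambda>n. Ltwo_norm (\<lambda>x. F n x - f x)) \<longlonglongrightarrow> 0 \<longrightarrow> f \<in> S)"

definition orthonormal_basis_of ::
  "('i \<Rightarrow> 'a::euclidean_space \<Rightarrow> complex) \<Rightarrow> 'i set \<Rightarrow> ('a \<Rightarrow> complex) set \<Rightarrow> bool" where
  "orthonormal_basis_of e I S \<longleftrightarrow>
     (\<forall>i\<in>I. e i \<in> S) \<and>
     (\<forall>i\<in>I. \<forall>k\<in>I. Ltwo_inner (e i) (e k) = (if i = k then 1 else 0)) \<and>
     Ltwo_closed_span e I = S"

definition riesz_basis_of ::
  "('i \<Rightarrow> 'a::euclidean_space \<Rightarrow> complex) \<Rightarrow> 'i set \<Rightarrow> ('a \<Rightarrow> complex) set \<Rightarrow> bool" where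
  "riesz_basis_of e I S \<longleftrightarrow>
     (\<forall>i\<in>I. e i \<in> S) \<and>
     Ltwo_closed_span e I = S \<and>
     (\<exists>A>0. \<exists>B>0. \<forall>F a. finite F \<and> F \<subseteq> I \<longrightarrow>
        A * (\<Sum>i\<in>F. (cmod (a i))\<^sup>2) \<le> (Ltwo_norm (\<lambda>x. \<Sum>i\<in>F. a i * e i x))\<^sup>2 \<and>
        (Ltwo_norm (\<lambda>x. \<Sum>i\<in>F. a i * e i x))\<^sup>2 \<le> B * (\<Sum>i\<in>F. (cmod (a i))\<^sup>2))"

section \<open>Multiresolution approximations\<close>

definition translate :: "(real \<Rightarrow> complex) \<Rightarrow> int \<Rightarrow> real \<Rightarrow> complex" where
  "translate g n x = g (x - of_int n)"

text \<open>\<open>V\<close> is an MRA of \<open>L\<^sup>2(\<real>)\<close>, except for the Riesz basis of \<open>V 0\<close>, which is part of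
  \<open>regular_mra\<close>.\<close>

definition mra_ladder :: "(int \<Rightarrow> (real \<Rightarrow> complex) set) \<Rightarrow> bool" where
  "mra_ladder V \<longleftrightarrow>
     (\<forall>j. Ltwo_closed_subspace (V j)) \<and>
     (\<forall>j. V j \<subseteq> V (j + 1)) \<and>
     (\<Inter>j. V j) = {f \<in> Ltwo. AE x in lborel. f x = 0} \<and>
     (\<forall>f\<in>Ltwo. \<forall>\<delta>>0. \<exists>j. \<exists>g\<in>V j. Ltwo_norm (\<lambda>x. f x - g x) < \<delta>) \<and>
     (\<forall>j f. f \<in> V j \<longleftrightarrow> (\<lambda>x. f (2 * x)) \<in> V (j + 1))"

text \<open>\<open>g\<close> is of class \<open>C\<^sup>\<rho>\<close> and all its derivatives \<open>D k\<close> of order \<open>k \<le> \<rho>\<close> are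
  rapidly decreasing.\<close>

definition rapidly_decreasing_C :: "nat \<Rightarrow> (real \<Rightarrow> complex) \<Rightarrow> bool" where
  "rapidly_decreasing_C \<rho> g \<longleftrightarrow>
     (\<exists>D :: nat \<Rightarrow> real \<Rightarrow> complex. D 0 = g \<and>
        (\<forall>k<\<rho>. \<forall>x. (D k has_vector_derivative D (Suc k) x) (at x)) \<and>
        (\<forall>k\<le>\<rho>. continuous_on UNIV (D k)) \<and>
        (\<forall>k\<le>\<rho>. \<forall>p::nat. \<exists>K. \<forall>x. (1 + \<bar>x\<bar>) ^ p * cmod (D k x) \<le> K))"

definition regular_mra :: "nat \<Rightarrow> (int \<Rightarrow> (real \<Rightarrow> complex) set) \<Rightarrow> bool" where
  "regular_mra \<rho> V \<longleftrightarrow>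
     mra_ladder V \<and>
     (\<exists>g. riesz_basis_of (translate g) UNIV (V 0) \<and> rapidly_decreasing_C \<rho> g)"

definition scaling_function :: "(int \<Rightarrow> (real \<Rightarrow> complex) set) \<Rightarrow> (real \<Rightarrow> complex) \<Rightarrow> bool" where
  "scaling_function V \<psi> \<longleftrightarrow> orthonormal_basis_of (translate \<psi>) UNIV (V 0)"

definition mra_wavelet :: "(int \<Rightarrow> (real \<Rightarrow> complex) set) \<Rightarrow> (real \<Rightarrow> complex) \<Rightarrow> bool" where
  "mra_wavelet V \<phi> \<longleftrightarrow>
     orthonormal_basis_of (translate \<phi>) UNIV {f \<in> V 1. \<forall>g\<in>V 0. Ltwo_inner f g = 0}"

section \<open>The wavelet dictionary of the unit disc\<close>

text \<open>An index \<open>(j, n, \<epsilon>)\<close> consists of the scale, the translation and the type; \<open>False\<close> stands for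
  type \<open>0\<close> (the scaling function \<open>\<psi>\<close>) and \<open>True\<close> for type \<open>1\<close> (the wavelet \<open>\<phi>\<close>).\<close>

type_synonym windex = "nat \<times> (int \<times> int) \<times> (bool \<times> bool)"

definition scale :: "windex \<Rightarrow> nat" where
  "scale i = fst i"

fun watom :: "(real \<Rightarrow> complex) \<Rightarrow> (real \<Rightarrow> complex) \<Rightarrow> windex \<Rightarrow> real ^ 2 \<Rightarrow> complex" where
  "watom \<psi> \<phi> (j, (n1, n2), (e1, e2)) x =
     2 ^ j * (if e1 then \<phi> else \<psi>) (2 ^ j * x $ 1 - of_int n1)
           * (if e2 then \<phi> else \<psi>) (2 ^ j * x $ 2 - of_int n2)"

text \<open>The type \<open>(0, 0)\<close> occurs only at scale \<open>0\<close>.\<close>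

definition dict_index :: "(real \<Rightarrow> complex) \<Rightarrow> (real \<Rightarrow> complex) \<Rightarrow> windex set" where
  "dict_index \<psi> \<phi> =
     {(j, n, e). (e = (False, False) \<longrightarrow> j = 0) \<and>
                 ess_support (watom \<psi> \<phi> (j, n, e)) \<inter> ball 0 1 \<noteq> {}}"

definition dict_index_le :: "(real \<Rightarrow> complex) \<Rightarrow> (real \<Rightarrow> complex) \<Rightarrow> nat \<Rightarrow> windex set" where
  "dict_index_le \<psi> \<phi> j = {i \<in> dict_index \<psi> \<phi>. scale i \<le> j}"

definition dict_space :: "(real \<Rightarrow> complex) \<Rightarrow> (real \<Rightarrow> complex) \<Rightarrow> (real ^ 2 \<Rightarrow> complex) set" where
  "dict_space \<psi> \<phi> = Ltwo_closed_span (watom \<psi> \<phi>) (dict_index \<psi> \<phi>)"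

text \<open>\<open>L\<^sup>2\<close> of the open unit disc, with functions extended by zero.\<close>

definition Ltwo_disc :: "(real ^ 2 \<Rightarrow> complex) set" where
  "Ltwo_disc = {u \<in> Ltwo. \<forall>x. x \<notin> ball 0 1 \<longrightarrow> u x = 0}"

section \<open>Sequences\<close>

text \<open>Sequences indexed by a set \<open>A\<close> are functions vanishing outside \<open>A\<close>.  In particular, for
  \<open>A \<subseteq> B\<close> the extension by zero from \<open>ell2 A\<close> to \<open>ell2 B\<close> is the inclusion map.\<close>

definition ell2 :: "'i set \<Rightarrow> ('i \<Rightarrow> complex) set" where
  "ell2 A = {x. (\<forall>i. i \<notin> A \<longrightarrow> x i = 0) \<and> (\<lambda>i. (cmod (x i))\<^sup>2) summable_on A}"

definition ell2_inner :: "'i set \<Rightarrow> ('i \<Rightarrow> complex) \<Rightarrow> ('i \<Rightarrow> complex) \<Rightarrow> complex" where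
  "ell2_inner A x y = (\<Sum>\<^sub>\<infinity>i\<in>A. x i * cnj (y i))"

definition ell2_norm :: "'i set \<Rightarrow> ('i \<Rightarrow> complex) \<Rightarrow> real" where
  "ell2_norm A x = sqrt (\<Sum>\<^sub>\<infinity>i\<in>A. (cmod (x i))\<^sup>2)"

definition ell1_norm :: "'i set \<Rightarrow> ('i \<Rightarrow> complex) \<Rightarrow> real" where
  "ell1_norm A x = (\<Sum>\<^sub>\<infinity>i\<in>A. cmod (x i))"

text \<open>\<open>\<sigma>\<^sub>s(x)\<^sub>1\<close> for a sequence indexed by a finite set \<open>A\<close>.\<close>

definition best_approx1 :: "'i set \<Rightarrow> nat \<Rightarrow> ('i \<Rightarrow> complex) \<Rightarrow> real" where
  "best_approx1 A s x =
     Inf {ell1_norm A (\<lambda>i. x i - y i) | y.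
            {i. y i \<noteq> 0} \<subseteq> A \<and> finite {i. y i \<noteq> 0} \<and> card {i. y i \<noteq> 0} \<le> s}"

text \<open>The operator norm from \<open>ell2 A\<close> to \<open>L\<^sup>2\<close>, with values in \<open>[0, \<infinity>]\<close>.\<close>

definition opnorm_ell2_Ltwo ::
  "'i set \<Rightarrow> (('i \<Rightarrow> complex) \<Rightarrow> 'a::euclidean_space \<Rightarrow> complex) \<Rightarrow> ennreal" where
  "opnorm_ell2_Ltwo A T = (SUP x\<in>{x \<in> ell2 A. ell2_norm A x \<le> 1}. ennreal (Ltwo_norm (T x)))"

definition analysis_op ::
  "(real \<Rightarrow> complex) \<Rightarrow> (real \<Rightarrow> complex) \<Rightarrow> (real ^ 2 \<Rightarrow> complex) \<Rightarrow> windex \<Rightarrow> complex" where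
  "analysis_op \<psi> \<phi> u i = (if i \<in> dict_index \<psi> \<phi> then Ltwo_inner u (watom \<psi> \<phi> i) else 0)"

text \<open>The Hilbert space adjoint of \<open>analysis_op\<close>, as an operator from \<open>ell2 (dict_index \<psi> \<phi>)\<close> to
  \<open>dict_space \<psi> \<phi>\<close>; the choice is only among representatives of one element of \<open>L\<^sup>2\<close>.\<close>

definition synthesis_op ::
  "(real \<Rightarrow> complex) \<Rightarrow> (real \<Rightarrow> complex) \<Rightarrow> (windex \<Rightarrow> complex) \<Rightarrow> real ^ 2 \<Rightarrow> complex" where
  "synthesis_op \<psi> \<phi> x =
     (SOME u. u \<in> dict_space \<psi> \<phi> \<and>
        (\<forall>v\<in>dict_space \<psi> \<phi>. Ltwo_inner u v = ell2_inner (dict_index \<psi> \<phi>) x (analysis_op \<psi> \<phi> v)))"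

definition proj_le ::
  "(real \<Rightarrow> complex) \<Rightarrow> (real \<Rightarrow> complex) \<Rightarrow> nat \<Rightarrow> (windex \<Rightarrow> complex) \<Rightarrow> windex \<Rightarrow> complex" where
  "proj_le \<psi> \<phi> j x i = (if i \<in> dict_index_le \<psi> \<phi> j then x i else 0)"

definition proj_le_perp ::
  "(real \<Rightarrow> complex) \<Rightarrow> (real \<Rightarrow> complex) \<Rightarrow> nat \<Rightarrow> (windex \<Rightarrow> complex) \<Rightarrow> windex \<Rightarrow> complex" where
  "proj_le_perp \<psi> \<phi> j x i = x i - proj_le \<psi> \<phi> j x i"

text \<open>The inverse of the diagonal matrix \<open>W\<close> with entries \<open>2\<^bsup>b j\<^esup>\<close>.\<close>

definition W_inv :: "real \<Rightarrow> (windex \<Rightarrow> complex) \<Rightarrow> windex \<Rightarrow> complex" where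
  "W_inv b x i = x i / of_real (2 powr (b * real (scale i)))"

section \<open>The convolution operator\<close>

definition inverse_fourier :: "('a::euclidean_space \<Rightarrow> complex) \<Rightarrow> 'a \<Rightarrow> complex" where
  "inverse_fourier g x = (LINT \<xi>|lborel. cis (2 * pi * (\<xi> \<bullet> x)) * g \<xi>)"

text \<open>For \<open>b > 2\<close> the integrand is absolutely integrable over the plane.\<close>

definition bessel_kernel :: "real \<Rightarrow> real ^ 2 \<Rightarrow> complex" where
  "bessel_kernel b = inverse_fourier (\<lambda>\<xi>. of_real ((1 + (norm \<xi>)\<^sup>2) powr (- b / 2)))"

definition bessel_conv :: "real \<Rightarrow> (real ^ 2 \<Rightarrow> complex) \<Rightarrow> real ^ 2 \<Rightarrow> complex" where
  "bessel_conv b u x = (LINT y|lborel. bessel_kernel b (x - y) * u y)"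

section \<open>The constants \<open>c\<close> and \<open>C\<close>\<close>

definition lower_bound_const ::
  "(real \<Rightarrow> complex) \<Rightarrow> (real \<Rightarrow> complex) \<Rightarrow> real \<Rightarrow> real \<Rightarrow> bool" where
  "lower_bound_const \<psi> \<phi> b c \<longleftrightarrow>
     (\<forall>x\<in>ell2 (dict_index \<psi> \<phi>).
        c * (\<Sum>\<^sub>\<infinity>i\<in>dict_index \<psi> \<phi>. 2 powr (- 2 * b * real (scale i)) * (cmod (x i))\<^sup>2)
          \<le> (Ltwo_norm (bessel_conv b (synthesis_op \<psi> \<phi> x)))\<^sup>2)"

text \<open>The balancing property with \<open>\<theta>\<^sup>2 = c / 2\<close>, at every truncation scale, for the
  sampling radius \<open>N = \<lceil>C * j0\<rceil>\<close>.\<close>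

definition balancing_const ::
  "(real \<Rightarrow> complex) \<Rightarrow> (real \<Rightarrow> complex) \<Rightarrow> real \<Rightarrow> real \<Rightarrow> real \<Rightarrow> bool" where
  "balancing_const \<psi> \<phi> b c C \<longleftrightarrow>
     (\<forall>j0::nat. 1 \<le> j0 \<longrightarrow>
        (opnorm_ell2_Ltwo (dict_index_le \<psi> \<phi> j0)
           (\<lambda>x t. indicator {t. real_of_int \<lceil>C * real j0\<rceil> < norm t} t
                    * bessel_conv b (synthesis_op \<psi> \<phi> x) t))\<^sup>2
          \<le> ennreal (c / 2 * 2 powr (- 2 * b * real j0)))"

section \<open>Sampling and recovery\<close>

text \<open>The joint law of \<open>m\<close> i.i.d. samples \<open>t 1, \<dots>, t m\<close>, uniform on the closed disc of radius \<open>N\<close>.\<close>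

definition iid_uniform_disc :: "nat \<Rightarrow> real \<Rightarrow> (nat \<Rightarrow> real ^ 2) measure" where
  "iid_uniform_disc m N = Pi\<^sub>M {1..m} (\<lambda>k. uniform_measure lborel (cball 0 N))"

definition recovery_solution ::
  "(real \<Rightarrow> complex) \<Rightarrow> (real \<Rightarrow> complex) \<Rightarrow> real \<Rightarrow> nat \<Rightarrow> nat \<Rightarrow> (nat \<Rightarrow> real ^ 2) \<Rightarrow> (nat \<Rightarrow> complex)
     \<Rightarrow> real \<Rightarrow> (real ^ 2 \<Rightarrow> complex) \<Rightarrow> bool" where
  "recovery_solution \<psi> \<phi> b j0 m t y \<eta> u \<longleftrightarrow>
     is_arg_min
       (\<lambda>u. ell1_norm (dict_index_le \<psi> \<phi> j0) (W_inv b (analysis_op \<psi> \<phi> u)))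
       (\<lambda>u. u \<in> fun_span (watom \<psi> \<phi>) (dict_index_le \<psi> \<phi> j0) \<and>
            1 / real m * (\<Sum>k=1..m. (cmod (bessel_conv b u (t k) - y k))\<^sup>2) \<le> \<eta>\<^sup>2)
       u"

end

theory Submission imports Defs begin

text \<open>
  The diagonal preconditioner \<open>W\<close> makes all measurement functions \<open>2\<^bsup>b j\<^esup> U \<phi>\<^bsub>j,n\<^esub>\<close> of size at most
  a constant times \<open>2\<^bsup>j0\<^esup>\<close>, because the wavelet has vanishing moments and so \<open>U\<close> gains the factor
  \<open>2\<^bsup>- b j\<^esup>\<close> in mean square. The constants \<open>c\<close> and \<open>C\<close> give a lower bound for the mean of \<open>\<bar>f\<bar>\<^sup>2\<close> over
  the disc of radius \<open>N\<close>, where \<open>f\<close> is the forward image of a vector \<open>z\<close>. Instead of the restricted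
  isometry property it suffices that, with high probability, the empirical mean of \<open>\<bar>f\<bar>\<^sup>2\<close> is at least a
  constant times its expectation minus a small multiple of \<open>\<parallel>z\<parallel>\<^sub>1\<^sup>2 / s\<close>. Such a one-sided bound over the
  \<open>\<ell>\<^sup>1\<close> ball follows from Maurey's empirical method, applied separately on each level set of \<open>\<bar>f\<bar>\<close>, and
  from Chernoff bounds. On the cone of errors of an \<open>\<ell>\<^sup>1\<close> minimiser the subtracted term is absorbed. The
  truncation error enters only as a noise term, bounded by one more Chernoff estimate, which uses the
  mean-square gain of \<open>U\<close> on the scales above \<open>j0\<close>.
\<close>

section \<open>Empirical lower bounds over the convex hull of a finite dictionary\<close>

text \<open>The sample size is governed by the ratio of the squared sup bound of the dictionary to
  the tolerated error of the empirical mean. After the l1 ball is scaled to radius of order sqrt s,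
  the squared sup bound is of order 2^(2 j0) s; the tolerance is of order 1/N^2, hence 1/j0^2,
  because a uniform density on the disc of radius \<open>N\<close> dilutes the lower bound by the
  area. This ratio is \<open>\<tau>\<close> up to a constant. The obstacle is the union bound. One
  Maurey approximation fine enough for the smallest relevant value of |f| needs lists of length
  about the ratio itself, and the sample size would then grow like the square of the ratio. With a
  list length and a deviation chosen separately for each dyadic level, the long lists occur only
  where the weight of the level is small, and the price is merely the number of levels, a logarithm.
  Since the truncation error depends on the unknown function, it gets an event of its own; each of
  the two events may fail with probability \<open>\<gamma> / 2\<close>.\<close>

lemma exp_le_add_exp_square: "exp x \<le> x + exp (x\<^sup>2)" for x :: real
proof -
  have 1: "1 + x\<^sup>2 \<le> exp (x\<^sup>2)" by (rule exp_ge_add_one_self)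
  consider "x < -1" | "-1 \<le> x" "x \<le> 0" | "0 \<le> x" "x \<le> 1" | "1 < x" by linarith
  then show ?thesis
  proof cases
    case 1
    have "exp x \<le> 1" using 1 by simp
    moreover have "0 \<le> x * (x + 1)" using 1 by (intro mult_nonpos_nonpos) auto
    then have "0 \<le> x + x\<^sup>2" by (simp add: distrib_left power2_eq_square)
    ultimately show ?thesis using \<open>1 + x\<^sup>2 \<le> exp (x\<^sup>2)\<close> by linarith
  next
    case 2
    have "1 - x \<le> exp (-x)" using exp_ge_add_one_self[of "-x"] by simp
    have "1 = exp x * exp (-x)" by (simp add: exp_minus)
    moreover have "exp x * (1 - x) \<le> exp x * exp (-x)" using \<open>1 - x \<le> exp (-x)\<close> by simp
    ultimately have "exp x * (1 - x) \<le> 1" by simp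
    also have "1 \<le> (1 - x) * (1 + x + x\<^sup>2)"
    proof -
      have "(1 - x) * (1 + x + x\<^sup>2) = 1 + x\<^sup>2 * (- x)" by (simp add: algebra_simps power2_eq_square)
      moreover have "0 \<le> x\<^sup>2 * (- x)" using 2 by (intro mult_nonneg_nonneg) auto
      ultimately show ?thesis by simp
    qed
    finally have "(1 - x) * exp x \<le> (1 - x) * (1 + x + x\<^sup>2)" by (simp add: mult.commute)
    then have "exp x \<le> 1 + x + x\<^sup>2" using 2 by (subst (asm) mult_le_cancel_left_pos) auto
    then show ?thesis using \<open>1 + x\<^sup>2 \<le> exp (x\<^sup>2)\<close> by linarith
  next
    case 3
    then show ?thesis using exp_bound[of x] 1 by linarith
  next
    case 4
    then have "x \<le> x\<^sup>2" by (simp add: power2_eq_square)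
    then have "exp x \<le> exp (x\<^sup>2)" by simp
    then show ?thesis using 4 by linarith
  qed
qed

section \<open>Chernoff bounds with fixed constant factors\<close>

lemma exp_minus_le_unit: "exp (- x) \<le> 1 - x / 2" if "0 \<le> x" "x \<le> 1" for x :: real
proof -
  have "exp (-x) * (1 + x) \<le> exp (-x) * exp x" by simp
  also have "\<dots> = 1" by (simp add: exp_minus)
  also have "1 \<le> (1 - x/2) * (1 + x)"
  proof -
    have "x * x \<le> x * 1" using that by (intro mult_left_mono) auto
    then show ?thesis by (simp add: algebra_simps)
  qed
  finally show ?thesis using that by (subst (asm) mult_le_cancel_right_pos) auto
qed

lemma exp_le_unit: "exp x \<le> 1 + 2 * x" if "0 \<le> x" "x \<le> 1" for x :: real
proof -
  have "x * x \<le> x * 1" using that by (intro mult_left_mono) auto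
  then show ?thesis using exp_bound[OF that] by (simp add: power2_eq_square)
qed

text \<open>Markov's inequality for the exponential of the sum; independence turns its mean into an
  m-th power. The bound \<open>c\<close> on the logarithm of the moment may be negative, which is
  how the lower tail is obtained.\<close>

lemma (in prob_space) sum_sample_exp_moment:
  fixes h :: "'a \<Rightarrow> real"
  assumes "integrable M (\<lambda>x. exp (h x))" "expectation (\<lambda>x. exp (h x)) \<le> exp c"
    and [measurable]: "h \<in> borel_measurable M"
  shows "measure (Pi\<^sub>M {1..m} (\<lambda>_. M))
      {t \<in> space (Pi\<^sub>M {1..m} (\<lambda>_. M)). x + real m * c \<le> (\<Sum>k=1..m. h (t k))} \<le> exp (- x)"
proof -
  let ?Q = "Pi\<^sub>M {1..m} (\<lambda>_. M)"
  interpret Q: product_prob_space "\<lambda>_. M" "{1..m}" by unfold_locales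
  have eq: "exp (\<Sum>k=1..m. h (t k)) = (\<Prod>k=1..m. exp (h (t k)))" for t :: "nat \<Rightarrow> 'a"
    by (simp add: exp_sum)
  have int: "integrable ?Q (\<lambda>t. exp (\<Sum>k=1..m. h (t k)))"
    unfolding eq by (rule Q.product_integrable_prod) (use assms in auto)
  have "(LINT t|?Q. exp (\<Sum>k=1..m. h (t k))) = (\<Prod>k=1..m. expectation (\<lambda>x. exp (h x)))"
    unfolding eq by (rule Q.product_integral_prod) (use assms in auto)
  also have "\<dots> = expectation (\<lambda>x. exp (h x)) ^ m" by simp
  also have "\<dots> \<le> exp c ^ m"
    by (intro power_mono assms) simp
  finally have le: "(LINT t|?Q. exp (\<Sum>k=1..m. h (t k))) \<le> exp (real m * c)"
    by (simp add: exp_of_nat_mult)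
  have "{t \<in> space ?Q. x + real m * c \<le> (\<Sum>k=1..m. h (t k))}
      = {t \<in> space ?Q. exp (x + real m * c) \<le> exp (\<Sum>k=1..m. h (t k))}" by simp
  also have "measure ?Q \<dots> \<le> (LINT t|?Q. exp (\<Sum>k=1..m. h (t k))) / exp (x + real m * c)"
    by (rule integral_Markov_inequality_measure[where A="{}"]) (use int in auto)
  also have "\<dots> \<le> exp (real m * c) / exp (x + real m * c)"
    by (intro divide_right_mono le) simp
  also have "\<dots> = exp (- x)" by (simp add: exp_add exp_minus field_simps)
  finally show ?thesis .
qed

text \<open>Giving up a factor 1/2 in the mean makes the deviation \<open>x\<close> purely additive:
  it depends neither on \<open>m\<close> nor on the size of the mean, and so can be prescribed
  freely for each dyadic level.\<close>

lemma (in prob_space) chernoff_lower: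
  fixes h :: "'a \<Rightarrow> real"
  assumes [measurable]: "h \<in> borel_measurable M"
    and h: "\<And>x. x \<in> space M \<Longrightarrow> 0 \<le> h x \<and> h x \<le> 1"
  shows "measure (Pi\<^sub>M {1..m} (\<lambda>_. M))
      {t \<in> space (Pi\<^sub>M {1..m} (\<lambda>_. M)). (\<Sum>k=1..m. h (t k)) \<le> real m * (expectation h / 2) - x} \<le> exp (- x)"
proof -
  have hi: "integrable M h"
    by (rule integrable_const_bound[where B=1]) (use h in auto)
  have i: "integrable M (\<lambda>x. exp (- h x))"
    by (rule integrable_const_bound[where B=1]) (use h in auto)
  have "expectation (\<lambda>x. exp (- h x)) \<le> expectation (\<lambda>x. 1 - h x / 2)"
    by (intro integral_mono_AE i AE_I2 exp_minus_le_unit) (use h hi in auto)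
  also have "\<dots> = 1 + - (expectation h / 2)" using hi by (simp add: prob_space)
  also have "\<dots> \<le> exp (- (expectation h / 2))" by (rule exp_ge_add_one_self)
  finally have "measure (Pi\<^sub>M {1..m} (\<lambda>_. M))
      {t \<in> space (Pi\<^sub>M {1..m} (\<lambda>_. M)). x + real m * (- (expectation h / 2)) \<le> (\<Sum>k=1..m. - h (t k))} \<le> exp (- x)"
    by (intro sum_sample_exp_moment i) auto
  moreover have "x + real m * (- (expectation h / 2)) \<le> (\<Sum>k=1..m. - h (t k)) \<longleftrightarrow>
     (\<Sum>k=1..m. h (t k)) \<le> real m * (expectation h / 2) - x" for t :: "nat \<Rightarrow> 'a"
    by (simp add: sum_negf) linarith
  ultimately show ?thesis by simp
qed

lemma (in prob_space) chernoff_upper: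
  fixes h :: "'a \<Rightarrow> real"
  assumes [measurable]: "h \<in> borel_measurable M"
    and h: "\<And>x. x \<in> space M \<Longrightarrow> 0 \<le> h x \<and> h x \<le> 1"
  shows "measure (Pi\<^sub>M {1..m} (\<lambda>_. M))
      {t \<in> space (Pi\<^sub>M {1..m} (\<lambda>_. M)). x + real m * (2 * expectation h) \<le> (\<Sum>k=1..m. h (t k))} \<le> exp (- x)"
proof -
  have hi: "integrable M h"
    by (rule integrable_const_bound[where B=1]) (use h in auto)
  have i: "integrable M (\<lambda>x. exp (h x))"
    by (rule integrable_const_bound[where B="exp 1"]) (use h in auto)
  have "expectation (\<lambda>x. exp (h x)) \<le> expectation (\<lambda>x. 1 + 2 * h x)"
    by (intro integral_mono_AE i AE_I2 exp_le_unit) (use h hi in auto)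
  also have "\<dots> = 1 + 2 * expectation h" using hi by (simp add: prob_space)
  also have "\<dots> \<le> exp (2 * expectation h)" by (rule exp_ge_add_one_self)
  finally show ?thesis
    by (intro sum_sample_exp_moment i) auto
qed

section \<open>Maurey's empirical method\<close>

text \<open>The approximating list must be good for the distribution and for the sample at once.
  Adding the two measures, of total mass 2, turns this into a single selection problem.\<close>

definition (in prob_space) pooled_mean :: "'k set \<Rightarrow> ('k \<Rightarrow> 'a) \<Rightarrow> ('a \<Rightarrow> real) \<Rightarrow> real" where
  "pooled_mean K t h = expectation h + (\<Sum>k\<in>K. h (t k)) / real (card K)"

lemma (in prob_space) pooled_mean_sum:
  assumes "\<And>i. i \<in> I \<Longrightarrow> integrable M (h i)"
  shows "pooled_mean K t (\<lambda>x. \<Sum>i\<in>I. p i * h i x) = (\<Sum>i\<in>I. p i * pooled_mean K t (h i))"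
proof -
  have "expectation (\<lambda>x. \<Sum>i\<in>I. p i * h i x) = (\<Sum>i\<in>I. p i * expectation (h i))"
    using assms by (subst Bochner_Integration.integral_sum) auto
  moreover have "(\<Sum>k\<in>K. \<Sum>i\<in>I. p i * h i (t k)) = (\<Sum>i\<in>I. p i * (\<Sum>k\<in>K. h i (t k)))"
    unfolding sum_distrib_left by (rule sum.swap)
  ultimately show ?thesis
    by (simp add: pooled_mean_def distrib_left sum.distrib) (simp add: sum_divide_distrib sum_distrib_left)
qed

lemma (in prob_space) pooled_mean_cmult: "pooled_mean K t (\<lambda>x. c * h x) = c * pooled_mean K t h"
  by (simp add: pooled_mean_def distrib_left flip: sum_distrib_left)

lemma (in prob_space) pooled_mean_mono:
  assumes "integrable M h" "integrable M g" "\<And>x. x \<in> space M \<Longrightarrow> h x \<le> g x" "t \<in> K \<rightarrow> space M"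
  shows "pooled_mean K t h \<le> pooled_mean K t g"
  unfolding pooled_mean_def using assms
  by (intro add_mono integral_mono_AE AE_I2 divide_right_mono sum_mono) auto

text \<open>The summands are chosen greedily: at each step an average over the weights \<open>p\<close> shows that
  some choice increases the exponential potential by at most the factor \<open>exp (4 \<theta>\<^sup>2 B\<^sup>2)\<close>.\<close>

lemma (in prob_space) greedy_selection:
  fixes e :: "'i \<Rightarrow> 'a \<Rightarrow> complex" and p :: "'i \<Rightarrow> real"
  assumes I: "finite I" and p: "\<And>i. i \<in> I \<Longrightarrow> 0 \<le> p i" "(\<Sum>i\<in>I. p i) = 1"
    and [measurable]: "\<And>i. i \<in> I \<Longrightarrow> e i \<in> borel_measurable M"
    and bd: "\<And>i x. i \<in> I \<Longrightarrow> x \<in> space M \<Longrightarrow> cmod (e i x) \<le> 2 * B"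
    and mean: "\<And>x. x \<in> space M \<Longrightarrow> (\<Sum>i\<in>I. of_real (p i) * e i x) = 0"
    and K: "finite K" "K \<noteq> {}" "t \<in> K \<rightarrow> space M"
  shows "\<exists>ks. length ks = q \<and> set ks \<subseteq> I \<and>
     (\<Sum>\<sigma>\<in>{1, -1, \<i>, -\<i>}. pooled_mean K t (\<lambda>x. exp (\<theta> * Re (\<sigma> * (\<Sum>i\<leftarrow>ks. e i x)))))
       \<le> 8 * exp (real q * (4 * \<theta>\<^sup>2 * B\<^sup>2))"
proof (induction q)
  case 0
  \<comment> \<open>Four rotations times the total mass 2 give the initial potential 8.\<close>
  have "card {1, -1, \<i>, -\<i>} \<le> (4::nat)" by (simp add: card_insert_if)
  then have "real (card {1, -1, \<i>, -\<i>}) \<le> 4" by linarith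
  moreover have "pooled_mean K t (\<lambda>x. 1) = 2" using K by (simp add: pooled_mean_def prob_space)
  ultimately show ?case by (intro exI[of _ "[]"]) simp
next
  case (Suc q)
  define \<Sigma> :: "complex set" where "\<Sigma> = {1, -1, \<i>, -\<i>}"
  have \<Sigma>: "finite \<Sigma>" "\<And>\<sigma>. \<sigma> \<in> \<Sigma> \<Longrightarrow> cmod \<sigma> = 1" by (auto simp: \<Sigma>_def)
  define E where "E ks = (\<Sum>\<sigma>\<in>\<Sigma>. pooled_mean K t (\<lambda>x. exp (\<theta> * Re (\<sigma> * (\<Sum>i\<leftarrow>ks. e i x)))))" for ks
  define F where "F = exp (4 * \<theta>\<^sup>2 * B\<^sup>2)"
  obtain ks where ks: "length ks = q" "set ks \<subseteq> I"
    and Eis: "E ks \<le> 8 * exp (real q * (4 * \<theta>\<^sup>2 * B\<^sup>2))"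
    using Suc unfolding E_def \<Sigma>_def by blast
  have meas: "(\<lambda>x. \<Sum>i\<leftarrow>js. e i x) \<in> borel_measurable M" if "set js \<subseteq> I" for js
    using that by (induction js) auto
  have bdl: "cmod (\<Sum>i\<leftarrow>js. e i x) \<le> real (length js) * (2 * B)" if "set js \<subseteq> I" "x \<in> space M" for js x
    using that
  proof (induction js)
    case (Cons j js)
    then have "cmod (e j x + (\<Sum>i\<leftarrow>js. e i x)) \<le> 2 * B + real (length js) * (2 * B)"
      by (intro norm_triangle_mono bd) auto
    then show ?case by (simp add: algebra_simps)
  qed simp
  have int: "integrable M (\<lambda>x. exp (\<theta> * Re (\<sigma> * (\<Sum>i\<leftarrow>js. e i x))))" if "set js \<subseteq> I" "\<sigma> \<in> \<Sigma>" for js \<sigma>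
  proof (rule integrable_const_bound)
    note [measurable] = meas[OF that(1)]
    show "(\<lambda>x. exp (\<theta> * Re (\<sigma> * (\<Sum>i\<leftarrow>js. e i x)))) \<in> borel_measurable M" by measurable
    show "AE x in M. norm (exp (\<theta> * Re (\<sigma> * (\<Sum>i\<leftarrow>js. e i x)))) \<le> exp (\<bar>\<theta>\<bar> * (real (length js) * (2 * B)))"
    proof (rule AE_I2)
      fix x assume x: "x \<in> space M"
      have "\<bar>\<theta> * Re (\<sigma> * (\<Sum>i\<leftarrow>js. e i x))\<bar> \<le> \<bar>\<theta>\<bar> * cmod (\<sigma> * (\<Sum>i\<leftarrow>js. e i x))"
        unfolding abs_mult by (intro mult_left_mono abs_Re_le_cmod) auto
      also have "\<dots> \<le> \<bar>\<theta>\<bar> * (real (length js) * (2 * B))"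
        using bdl[OF that(1) x] \<Sigma>(2)[OF that(2)] by (simp add: norm_mult mult_left_mono)
      finally show "norm (exp (\<theta> * Re (\<sigma> * (\<Sum>i\<leftarrow>js. e i x)))) \<le> exp (\<bar>\<theta>\<bar> * (real (length js) * (2 * B)))"
        by simp
    qed
  qed
  have "(\<Sum>i\<in>I. p i * E (i # ks)) \<le> F * E ks"
  proof -
    have "(\<Sum>i\<in>I. p i * E (i # ks)) =
      (\<Sum>\<sigma>\<in>\<Sigma>. pooled_mean K t (\<lambda>x. \<Sum>i\<in>I. p i * exp (\<theta> * Re (\<sigma> * (\<Sum>i\<leftarrow>i # ks. e i x)))))"
    proof -
      have "(\<Sum>i\<in>I. p i * E (i # ks)) =
        (\<Sum>\<sigma>\<in>\<Sigma>. \<Sum>i\<in>I. p i * pooled_mean K t (\<lambda>x. exp (\<theta> * Re (\<sigma> * (\<Sum>i\<leftarrow>i # ks. e i x)))))"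
        unfolding E_def sum_distrib_left by (rule sum.swap)
      also have "\<dots> = (\<Sum>\<sigma>\<in>\<Sigma>. pooled_mean K t (\<lambda>x. \<Sum>i\<in>I. p i * exp (\<theta> * Re (\<sigma> * (\<Sum>i\<leftarrow>i # ks. e i x)))))"
      proof (rule sum.cong[OF refl])
        fix \<sigma> assume s: "\<sigma> \<in> \<Sigma>"
        have ii: "integrable M (\<lambda>x. exp (\<theta> * Re (\<sigma> * (\<Sum>i\<leftarrow>i # ks. e i x))))" if "i \<in> I" for i
          using int[of "i # ks" \<sigma>] that ks(2) s by auto
        show "(\<Sum>i\<in>I. p i * pooled_mean K t (\<lambda>x. exp (\<theta> * Re (\<sigma> * (\<Sum>i\<leftarrow>i # ks. e i x))))) =
          pooled_mean K t (\<lambda>x. \<Sum>i\<in>I. p i * exp (\<theta> * Re (\<sigma> * (\<Sum>i\<leftarrow>i # ks. e i x))))"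
          using ii by (subst pooled_mean_sum) auto
      qed
      finally show ?thesis .
    qed
    also have "\<dots> \<le> (\<Sum>\<sigma>\<in>\<Sigma>. pooled_mean K t (\<lambda>x. F * exp (\<theta> * Re (\<sigma> * (\<Sum>i\<leftarrow>ks. e i x)))))"
    proof (intro sum_mono pooled_mean_mono K(3))
      fix \<sigma> assume s: "\<sigma> \<in> \<Sigma>"
      show "integrable M (\<lambda>x. F * exp (\<theta> * Re (\<sigma> * (\<Sum>i\<leftarrow>ks. e i x))))"
        using int[OF ks(2) s] by auto
      show "integrable M (\<lambda>x. \<Sum>i\<in>I. p i * exp (\<theta> * Re (\<sigma> * (\<Sum>i\<leftarrow>i # ks. e i x))))"
      proof (intro Bochner_Integration.integrable_sum integrable_mult_right)
        fix i assume "i \<in> I"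
        then show "integrable M (\<lambda>x. exp (\<theta> * Re (\<sigma> * (\<Sum>i\<leftarrow>i # ks. e i x))))"
          using ks(2) s by (intro int) auto
      qed
      fix x assume x: "x \<in> space M"
      define y where "y i = \<theta> * Re (\<sigma> * e i x)" for i
      \<comment> \<open>The form of \<open>exp_le_add_exp_square\<close> is made for this place: the
        linear term averages to zero under \<open>p\<close> at every point \<open>x\<close>, and the
        square is bounded uniformly, so only the factor \<open>F\<close> is left.\<close>
      have "(\<Sum>i\<in>I. p i * exp (y i)) \<le> (\<Sum>i\<in>I. p i * (y i + F))"
      proof (intro sum_mono mult_left_mono p)
        fix i assume i: "i \<in> I"
        have "\<bar>y i\<bar> \<le> \<bar>\<theta>\<bar> * cmod (\<sigma> * e i x)"
          unfolding y_def abs_mult by (intro mult_left_mono abs_Re_le_cmod) auto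
        also have "\<dots> \<le> \<bar>\<theta>\<bar> * (2 * B)" using bd[OF i x] \<Sigma>(2)[OF s] by (simp add: norm_mult mult_left_mono)
        finally have "(y i)\<^sup>2 \<le> (\<bar>\<theta>\<bar> * (2 * B))\<^sup>2" using abs_le_square_iff by fastforce
        also have "\<dots> = 4 * \<theta>\<^sup>2 * B\<^sup>2" by (simp add: power_mult_distrib)
        finally show "exp (y i) \<le> y i + F"
          using exp_le_add_exp_square[of "y i"] unfolding F_def by (smt (verit) exp_le_cancel_iff)
      qed
      also have "\<dots> = (\<Sum>i\<in>I. p i * y i) + F"
        using p(2) by (simp add: distrib_left sum.distrib flip: sum_distrib_right)
      also have "(\<Sum>i\<in>I. p i * y i) = \<theta> * Re (\<sigma> * (\<Sum>i\<in>I. of_real (p i) * e i x))"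
        unfolding sum_distrib_left Re_sum y_def
        by (intro sum.cong refl) (simp add: algebra_simps)
      also have "\<dots> = 0" using mean[OF x] by simp
      finally have le: "(\<Sum>i\<in>I. p i * exp (y i)) \<le> F" by simp
      have "(\<Sum>i\<in>I. p i * exp (\<theta> * Re (\<sigma> * (\<Sum>i\<leftarrow>i # ks. e i x)))) =
        (\<Sum>i\<in>I. p i * exp (y i)) * exp (\<theta> * Re (\<sigma> * (\<Sum>i\<leftarrow>ks. e i x)))"
        unfolding sum_distrib_right
      proof (intro sum.cong refl)
        fix i
        have "\<theta> * Re (\<sigma> * (\<Sum>i\<leftarrow>i # ks. e i x)) = y i + \<theta> * Re (\<sigma> * (\<Sum>i\<leftarrow>ks. e i x))"
          by (simp add: y_def algebra_simps)
        then show "p i * exp (\<theta> * Re (\<sigma> * (\<Sum>i\<leftarrow>i # ks. e i x))) = p i * exp (y i) * exp (\<theta> * Re (\<sigma> * (\<Sum>i\<leftarrow>ks. e i x)))"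
          by (simp add: exp_add)
      qed
      then show "(\<Sum>i\<in>I. p i * exp (\<theta> * Re (\<sigma> * (\<Sum>i\<leftarrow>i # ks. e i x)))) \<le> F * exp (\<theta> * Re (\<sigma> * (\<Sum>i\<leftarrow>ks. e i x)))"
        using le by (simp add: mult_right_mono)
    qed
    also have "\<dots> = F * E ks"
      unfolding E_def by (simp add: sum_distrib_left pooled_mean_cmult)
    finally show ?thesis .
  qed
  then have "\<exists>i\<in>I. E (i # ks) \<le> F * E ks"
  proof (rule contrapos_pp)
    assume "\<not> (\<exists>i\<in>I. E (i # ks) \<le> F * E ks)"
    then have gt: "F * E ks < E (i # ks)" if "i \<in> I" for i using that by auto
    have "\<exists>i\<in>I. p i > 0" using p sum_nonpos[of I p] by (metis not_one_le_zero not_le)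
    then obtain a where "a \<in> I" "p a * (F * E ks) < p a * E (a # ks)" using gt by auto
    moreover have "p i * (F * E ks) \<le> p i * E (i # ks)" if "i \<in> I" for i
      using gt[OF that] p(1)[OF that] by (intro mult_left_mono) auto
    ultimately have "(\<Sum>i\<in>I. p i * (F * E ks)) < (\<Sum>i\<in>I. p i * E (i # ks))"
      using I by (intro sum_strict_mono_ex1) auto
    then show "\<not> (\<Sum>i\<in>I. p i * E (i # ks)) \<le> F * E ks"
      using p(2) by (simp flip: sum_distrib_right)
  qed
  then obtain i where i: "i \<in> I" "E (i # ks) \<le> F * E ks" by blast
  have "E (i # ks) \<le> 8 * exp (real (Suc q) * (4 * \<theta>\<^sup>2 * B\<^sup>2))"
  proof -
    have "F * E ks \<le> F * (8 * exp (real q * (4 * \<theta>\<^sup>2 * B\<^sup>2)))"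
      using Eis by (intro mult_left_mono) (auto simp: F_def)
    also have "\<dots> = 8 * exp (real (Suc q) * (4 * \<theta>\<^sup>2 * B\<^sup>2))"
      by (simp add: F_def algebra_simps exp_add)
    finally show ?thesis using i(2) by linarith
  qed
  then show ?case using i(1) ks unfolding E_def \<Sigma>_def by (intro exI[of _ "i # ks"]) auto
qed


text \<open>Replaces the modulus by four real linear functionals, each with its own exponential
  moment, at the cost of a factor 2.\<close>

lemma Re_rotation_ge_half: "\<exists>\<sigma>\<in>{1, -1, \<i>, -\<i>}. cmod z / 2 \<le> Re (\<sigma> * z)"
proof -
  have "cmod z \<le> \<bar>Re z\<bar> + \<bar>Im z\<bar>" by (rule cmod_le)
  then have "cmod z / 2 \<le> Re z \<or> cmod z / 2 \<le> - Re z \<or> cmod z / 2 \<le> Im z \<or> cmod z / 2 \<le> - Im z"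
    by linarith
  then show ?thesis by auto
qed

text \<open>Maurey's random choice made deterministic. The list from \<open>greedy_selection\<close>
  has a small exponential potential, and Markov's inequality turns this into a small pooled mass of
  the points where the average of the list deviates from the convex combination by more than
  \<open>r\<close>.\<close>

lemma (in prob_space) maurey_approximation:
  fixes d :: "'i \<Rightarrow> 'a \<Rightarrow> complex" and p :: "'i \<Rightarrow> real"
  assumes I: "finite I" and p: "\<And>i. i \<in> I \<Longrightarrow> 0 \<le> p i" "(\<Sum>i\<in>I. p i) = 1"
    and meas[measurable]: "\<And>i. i \<in> I \<Longrightarrow> d i \<in> borel_measurable M"
    and bd: "\<And>i x. i \<in> I \<Longrightarrow> x \<in> space M \<Longrightarrow> cmod (d i x) \<le> B"
    and K: "finite K" "K \<noteq> {}" "t \<in> K \<rightarrow> space M"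
    and q: "0 < q" and "0 < B" "0 < r"
  shows "\<exists>ks. length ks = q \<and> set ks \<subseteq> I \<and>
     pooled_mean K t (\<lambda>x. of_bool (r < cmod ((\<Sum>i\<in>I. of_real (p i) * d i x) - (\<Sum>i\<leftarrow>ks. d i x) / of_nat q)))
       \<le> 8 * exp (- (real q * r\<^sup>2 / (64 * B\<^sup>2)))"
proof -
  define f where "f x = (\<Sum>i\<in>I. of_real (p i) * d i x)" for x
  define e where "e i x = f x - d i x" for i x
  \<comment> \<open>The minimiser of the exponent
    \<open>4 * \<theta>\<^sup>2 * B\<^sup>2 - \<theta> * r / 2\<close>; the minimum is
    \<open>- r\<^sup>2 / (64 * B\<^sup>2)\<close>.\<close>
  define \<theta> where "\<theta> = r / (16 * B\<^sup>2)"
  have \<theta>: "0 < \<theta>" using assms by (simp add: \<theta>_def)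
  have [measurable]: "f \<in> borel_measurable M" unfolding f_def by measurable
  have fb: "cmod (f x) \<le> B" if "x \<in> space M" for x
  proof -
    have "cmod (f x) \<le> (\<Sum>i\<in>I. p i * B)"
      unfolding f_def using p bd that by (intro sum_norm_le) (auto simp: norm_mult intro!: mult_left_mono)
    also have "\<dots> = B" using p(2) by (simp flip: sum_distrib_right)
    finally show ?thesis .
  qed
  have "\<exists>ks. length ks = q \<and> set ks \<subseteq> I \<and>
     (\<Sum>\<sigma>\<in>{1, -1, \<i>, -\<i>}. pooled_mean K t (\<lambda>x. exp (\<theta> * Re (\<sigma> * (\<Sum>i\<leftarrow>ks. e i x)))))
       \<le> 8 * exp (real q * (4 * \<theta>\<^sup>2 * B\<^sup>2))"
  proof (rule greedy_selection[OF I p _ _ _ K])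
    show "e i \<in> borel_measurable M" if "i \<in> I" for i unfolding e_def using that by measurable
    show "cmod (e i x) \<le> 2 * B" if "i \<in> I" "x \<in> space M" for i x
      unfolding e_def using norm_triangle_ineq4[of "f x" "d i x"] fb[OF that(2)] bd[OF that] by linarith
    show "(\<Sum>i\<in>I. of_real (p i) * e i x) = 0" for x
      using p(2) unfolding e_def right_diff_distrib sum_subtractf
      by (simp add: f_def flip: sum_distrib_right of_real_sum)
  qed
  then obtain ks where ks: "length ks = q" "set ks \<subseteq> I" and le:
     "(\<Sum>\<sigma>\<in>{1, -1, \<i>, -\<i>}. pooled_mean K t (\<lambda>x. exp (\<theta> * Re (\<sigma> * (\<Sum>i\<leftarrow>ks. e i x)))))
       \<le> 8 * exp (real q * (4 * \<theta>\<^sup>2 * B\<^sup>2))" by blast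
  have [measurable]: "(\<lambda>x. \<Sum>i\<leftarrow>ks. d i x) \<in> borel_measurable M"
    using ks(2) by (induction ks) auto
  have Se: "(\<Sum>i\<leftarrow>ks. e i x) = of_nat q * f x - (\<Sum>i\<leftarrow>ks. d i x)" for x
    unfolding e_def ks(1)[symmetric] by (induction ks) (auto simp: algebra_simps)
  have Sed: "cmod (\<Sum>i\<leftarrow>ks. e i x) = real q * cmod (f x - (\<Sum>i\<leftarrow>ks. d i x) / of_nat q)" for x
    unfolding Se using q by (subst norm_of_nat[symmetric], subst norm_mult[symmetric]) (simp add: right_diff_distrib)
  have intg: "integrable M (\<lambda>x. exp (\<theta> * Re (\<sigma> * (\<Sum>i\<leftarrow>ks. e i x))))" if "cmod \<sigma> = 1" for \<sigma>
  proof (rule integrable_const_bound)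
    show "(\<lambda>x. exp (\<theta> * Re (\<sigma> * (\<Sum>i\<leftarrow>ks. e i x)))) \<in> borel_measurable M"
      unfolding Se by measurable
    show "AE x in M. norm (exp (\<theta> * Re (\<sigma> * (\<Sum>i\<leftarrow>ks. e i x)))) \<le> exp (\<theta> * (real q * (2 * B)))"
    proof (rule AE_I2)
      fix x assume x: "x \<in> space M"
      have s1: "cmod (e i x) \<le> 2 * B" if "i \<in> I" for i
        unfolding e_def using norm_triangle_ineq4[of "f x" "d i x"] fb[OF x] bd[OF that x] by linarith
      have "cmod (\<Sum>i\<leftarrow>ks. e i x) \<le> real q * (2 * B)"
        unfolding ks(1)[symmetric] using ks(2)
      proof (induction ks)
        case (Cons j js)
        then have "cmod (e j x + (\<Sum>i\<leftarrow>js. e i x)) \<le> 2 * B + real (length js) * (2 * B)"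
          by (intro norm_triangle_mono s1) auto
        then show ?case by (simp add: algebra_simps)
      qed simp
      then have "Re (\<sigma> * (\<Sum>i\<leftarrow>ks. e i x)) \<le> real q * (2 * B)"
        using complex_Re_le_cmod[of "\<sigma> * (\<Sum>i\<leftarrow>ks. e i x)"] that by (simp add: norm_mult)
      then show "norm (exp (\<theta> * Re (\<sigma> * (\<Sum>i\<leftarrow>ks. e i x)))) \<le> exp (\<theta> * (real q * (2 * B)))"
        using \<theta> by (simp add: mult_left_mono)
    qed
  qed
  define b where "b x = (of_bool (r < cmod (f x - (\<Sum>i\<leftarrow>ks. d i x) / of_nat q)) :: real)" for x
  have [measurable]: "b \<in> borel_measurable M" unfolding b_def by measurable
  have "exp (\<theta> * (real q * r / 2)) * pooled_mean K t b = pooled_mean K t (\<lambda>x. exp (\<theta> * (real q * r / 2)) * b x)"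
    by (simp add: pooled_mean_cmult)
  also have "\<dots> \<le> pooled_mean K t (\<lambda>x. \<Sum>\<sigma>\<in>{1, -1, \<i>, -\<i>}. 1 * exp (\<theta> * Re (\<sigma> * (\<Sum>i\<leftarrow>ks. e i x))))"
  proof (intro pooled_mean_mono K(3))
    show "integrable M (\<lambda>x. exp (\<theta> * (real q * r / 2)) * b x)"
      by (intro integrable_mult_right integrable_const_bound[where B=1]) (auto simp: b_def)
    show "integrable M (\<lambda>x. \<Sum>\<sigma>\<in>{1, -1, \<i>, -\<i>}. 1 * exp (\<theta> * Re (\<sigma> * (\<Sum>i\<leftarrow>ks. e i x))))"
      by (intro Bochner_Integration.integrable_sum integrable_mult_right intg) auto
    fix x assume x: "x \<in> space M"
    show "exp (\<theta> * (real q * r / 2)) * b x \<le> (\<Sum>\<sigma>\<in>{1, -1, \<i>, -\<i>}. 1 * exp (\<theta> * Re (\<sigma> * (\<Sum>i\<leftarrow>ks. e i x))))"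
    proof (cases "r < cmod (f x - (\<Sum>i\<leftarrow>ks. d i x) / of_nat q)")
      case True
      obtain \<sigma> where s: "\<sigma> \<in> {1, -1, \<i>, -\<i>}" "cmod (\<Sum>i\<leftarrow>ks. e i x) / 2 \<le> Re (\<sigma> * (\<Sum>i\<leftarrow>ks. e i x))"
        using Re_rotation_ge_half by blast
      have "real q * r / 2 \<le> cmod (\<Sum>i\<leftarrow>ks. e i x) / 2"
        unfolding Sed using True by (intro divide_right_mono mult_left_mono) auto
      with s(2) have "\<theta> * (real q * r / 2) \<le> \<theta> * Re (\<sigma> * (\<Sum>i\<leftarrow>ks. e i x))"
        using \<theta> by (intro mult_left_mono) auto
      then have "exp (\<theta> * (real q * r / 2)) * b x \<le> exp (\<theta> * Re (\<sigma> * (\<Sum>i\<leftarrow>ks. e i x)))"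
        by (simp add: b_def)
      also have "\<dots> \<le> (\<Sum>\<sigma>\<in>{1, -1, \<i>, -\<i>}. exp (\<theta> * Re (\<sigma> * (\<Sum>i\<leftarrow>ks. e i x))))"
        by (rule member_le_sum[OF s(1)]) auto
      finally show ?thesis by simp
    next
      case False
      then have "b x = 0" by (simp add: b_def)
      then show ?thesis by (simp add: sum_nonneg)
    qed
  qed
  also have "\<dots> = (\<Sum>\<sigma>\<in>{1, -1, \<i>, -\<i>}. 1 * pooled_mean K t (\<lambda>x. exp (\<theta> * Re (\<sigma> * (\<Sum>i\<leftarrow>ks. e i x)))))"
    by (intro pooled_mean_sum intg) auto
  also have "\<dots> \<le> 8 * exp (real q * (4 * \<theta>\<^sup>2 * B\<^sup>2))" using le by simp
  finally have "pooled_mean K t b \<le> 8 * exp (real q * (4 * \<theta>\<^sup>2 * B\<^sup>2)) / exp (\<theta> * (real q * r / 2))"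
    by (simp add: field_simps)
  also have "\<dots> = 8 * exp (real q * (4 * \<theta>\<^sup>2 * B\<^sup>2) - \<theta> * (real q * r / 2))"
    by (simp add: exp_diff)
  also have "real q * (4 * \<theta>\<^sup>2 * B\<^sup>2) - \<theta> * (real q * r / 2) = - (real q * r\<^sup>2 / (64 * B\<^sup>2))"
    using \<open>0 < B\<close> by (simp add: \<theta>_def field_simps power2_eq_square)
  finally show ?thesis using ks unfolding b_def f_def by blast
qed

section \<open>Dyadic level sets\<close>

text \<open>The largest level that does not exceed \<open>a\<close> is at least
  \<open>a / 2\<close>, which costs the factor 4. If \<open>a\<close> lies below all
  \<open>L\<close> levels, then \<open>a / 2\<close> is at most \<open>B / 2 ^ L\<close>, and the
  subtracted term pays.\<close>

lemma dyadic_levels_lower: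
  fixes a B :: real
  assumes "0 \<le> a" "a \<le> B"
  shows "a\<^sup>2 / 4 - (B / 2 ^ L)\<^sup>2 \<le> (\<Sum>l<L. (B / 2 ^ l)\<^sup>2 * of_bool (B / 2 ^ l \<le> a))"
proof (induction L)
  case 0
  have "a\<^sup>2 \<le> B\<^sup>2" "0 \<le> B\<^sup>2" using assms by (auto intro: power_mono)
  then have "a\<^sup>2 / 4 - B\<^sup>2 \<le> 0" by linarith
  then show ?case by simp
next
  case (Suc L)
  have e: "(B / 2 ^ Suc L)\<^sup>2 = (B / 2 ^ L)\<^sup>2 / 4" by (simp add: power2_eq_square)
  show ?case
  proof (cases "B / 2 ^ L \<le> a")
    case True
    have "0 \<le> (B / 2 ^ L)\<^sup>2" by (rule zero_le_power2)
    moreover have "(\<Sum>l<Suc L. (B / 2 ^ l)\<^sup>2 * of_bool (B / 2 ^ l \<le> a))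
        = (\<Sum>l<L. (B / 2 ^ l)\<^sup>2 * of_bool (B / 2 ^ l \<le> a)) + (B / 2 ^ L)\<^sup>2" using True by simp
    ultimately show ?thesis using Suc unfolding e by linarith
  next
    case False
    then have "a\<^sup>2 \<le> (B / 2 ^ L)\<^sup>2" using assms by (intro power_mono) auto
    then have "a\<^sup>2 / 4 - (B / 2 ^ Suc L)\<^sup>2 \<le> 0" unfolding e by simp
    also have "0 \<le> (\<Sum>l<Suc L. (B / 2 ^ l)\<^sup>2 * of_bool (B / 2 ^ l \<le> a))" by (intro sum_nonneg) auto
    finally show ?thesis .
  qed
qed

text \<open>The squares that occur form a geometric series of ratio 1/4, dominated by the first
  level that does not exceed \<open>a\<close>; hence the factor 4/3.\<close>

lemma dyadic_levels_upper:
  fixes a B :: real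
  assumes "0 \<le> a" "0 \<le> B"
  shows "(\<Sum>l<L. (B / 2 ^ l)\<^sup>2 * of_bool (B / 2 ^ l \<le> a)) \<le> 4 / 3 * (min B a)\<^sup>2"
  using assms(2)
proof (induction L arbitrary: B)
  case (Suc L)
  have "(\<Sum>l<Suc L. (B / 2 ^ l)\<^sup>2 * of_bool (B / 2 ^ l \<le> a))
     = B\<^sup>2 * of_bool (B \<le> a) + (\<Sum>l<L. (B / 2 / 2 ^ l)\<^sup>2 * of_bool (B / 2 / 2 ^ l \<le> a))"
    by (subst sum.lessThan_Suc_shift) (simp add: field_simps)
  also have "\<dots> \<le> B\<^sup>2 * of_bool (B \<le> a) + 4 / 3 * (min (B / 2) a)\<^sup>2"
    using Suc by (intro add_left_mono Suc.IH) auto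
  also have "\<dots> \<le> 4 / 3 * (min B a)\<^sup>2"
  proof (cases "B \<le> a")
    case True
    then have "min (B/2) a = B/2" "min B a = B" using Suc.prems by auto
    then show ?thesis using True by (simp add: power2_eq_square)
  next
    case False
    have "(min (B / 2) a)\<^sup>2 \<le> (min B a)\<^sup>2" using False Suc.prems assms by (intro power_mono) auto
    then show ?thesis using False by simp
  qed
  finally show ?case .
qed simp


text \<open>Because the exponent doubles from level to level, the failure probabilities sum to at
  most \<open>\<gamma> / 2\<close> whatever the number \<open>L\<close> of levels is.\<close>

lemma sum_exp_dyadic_le:
  fixes \<gamma> y :: real
  assumes "0 < \<gamma>" "\<gamma> < 1" "2 + ln (1 / \<gamma>) \<le> y"
  shows "(\<Sum>l<L. exp (- (y * 2 ^ l))) \<le> \<gamma> / 2"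
proof -
  have g: "0 \<le> ln (1 / \<gamma>)" using assms by simp
  have "exp (- (y * 2 ^ l)) \<le> \<gamma> / 4 * (1 / 2) ^ l" for l :: nat
  proof -
    have "real l + 1 \<le> 2 ^ l" using Suc_leI[OF less_exp[of l]] by (metis of_nat_Suc of_nat_le_iff of_nat_numeral of_nat_power add.commute)
    then have "(2 + ln (1 / \<gamma>)) * (real l + 1) \<le> y * 2 ^ l"
      using assms(3) g by (intro mult_mono) linarith+
    moreover have "0 \<le> ln (1 / \<gamma>) * real l" using g by simp
    ultimately have "2 + ln (1 / \<gamma>) + 2 * real l \<le> y * 2 ^ l"
      by (simp add: algebra_simps)
    moreover have "ln (1/\<gamma>) = - ln \<gamma>" using assms by (simp add: ln_div)
    ultimately have "- (y * 2 ^ l) \<le> ln \<gamma> + (- 2) + real l * (- 2)" by simp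
    then have "exp (- (y * 2 ^ l)) \<le> exp (ln \<gamma> + (- 2) + real l * (- 2))" by simp
    also have "\<dots> = \<gamma> * exp (- 2) * exp (-2) ^ l"
      unfolding exp_add exp_of_nat_mult using assms by simp
    also have "\<dots> \<le> \<gamma> * (1 / 4) * (1 / 2) ^ l"
    proof -
      have "2 \<le> exp (1::real)" using exp_ge_add_one_self[of 1] by simp
      then have "2 * 2 \<le> exp (1::real) * exp 1" by (intro mult_mono) auto
      then have "4 \<le> exp (2::real)" by (simp flip: exp_add)
      then have e: "exp (-2) \<le> 1 / (4::real)" by (simp add: exp_minus field_simps)
      then have "exp (-2 :: real) ^ l \<le> (1 / 2) ^ l" by (intro power_mono) auto
      then show ?thesis using e assms by (intro mult_mono) auto
    qed
    finally show ?thesis by simp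
  qed
  then have "(\<Sum>l<L. exp (- (y * 2 ^ l))) \<le> (\<Sum>l<L. \<gamma> / 4 * (1 / 2) ^ l)" by (intro sum_mono) auto
  also have "\<dots> = \<gamma> / 4 * (2 - 2 * (1 / 2) ^ L)"
    unfolding sum_distrib_left[symmetric] by (simp add: sum_gp_strict)
  also have "\<dots> \<le> \<gamma> / 4 * 2" using assms by (intro mult_left_mono) auto
  finally show ?thesis by simp
qed

text \<open>The values \<open>\<bar>f\<bar> \<approx> B / 2\<^sup>l\<close> are treated separately for each level \<open>l\<close>. On level \<open>l\<close> the function \<open>f\<close>
  is replaced by an average of about \<open>4\<^sup>l\<close> dictionary elements, which costs a union bound over
  \<open>card I ^ q l\<close> lists, while the admissible deviation of the empirical measure also grows like
  \<open>4\<^sup>l\<close>.\<close>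

theorem (in prob_space) sampling_lower_bound:
  fixes d :: "'i \<Rightarrow> 'a \<Rightarrow> complex"
  assumes I: "finite I" "I \<noteq> {}"
    and meas[measurable]: "\<And>i. i \<in> I \<Longrightarrow> d i \<in> borel_measurable M"
    and bd: "\<And>i x. i \<in> I \<Longrightarrow> x \<in> space M \<Longrightarrow> cmod (d i x) \<le> B"
    and B: "0 < B" and \<delta>: "0 < \<delta>" and \<gamma>: "0 < \<gamma>" "\<gamma> < 1" and m: "0 < m"
    and L: "0 < L" "B\<^sup>2 / \<delta> \<le> 4 ^ L"
    and \<Lambda>: "ln (16 * B\<^sup>2 / \<delta>) \<le> \<Lambda>" "1 \<le> \<Lambda>"
    and m1: "2050 * real L * \<Lambda> * ln (real (card I)) \<le> real m * \<delta> / B\<^sup>2"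
    and m2: "4 * (2 + ln (1 / \<gamma>)) \<le> real m * \<delta> / B\<^sup>2"
  shows "\<exists>E\<in>sets (Pi\<^sub>M {1..m} (\<lambda>_. M)). 1 - \<gamma> / 2 \<le> measure (Pi\<^sub>M {1..m} (\<lambda>_. M)) E \<and>
    (\<forall>t\<in>E. \<forall>p. (\<forall>i\<in>I. 0 \<le> p i) \<and> (\<Sum>i\<in>I. p i) = 1 \<longrightarrow>
       3 / 128 * expectation (\<lambda>x. (cmod (\<Sum>i\<in>I. of_real (p i) * d i x))\<^sup>2) - \<delta>
         \<le> (\<Sum>k=1..m. (cmod (\<Sum>i\<in>I. of_real (p i) * d i (t k)))\<^sup>2) / real m)"
proof -
  let ?Q = "Pi\<^sub>M {1..m} (\<lambda>_. M)"
  interpret Q: product_prob_space "\<lambda>_. M" "{1..m}" by unfold_locales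
  define X where "X = real m * \<delta> / B\<^sup>2"
  define lam where "lam l = B / 2 ^ l" for l :: nat
  \<comment> \<open>Maurey's exponent with radius \<open>lam l / 4\<close> is
    \<open>q l / (1024 * 4 ^ l)\<close>, where 1024 = 64 * 16; this length makes it at least
    \<open>\<Lambda>\<close>.\<close>
  define q where "q l = nat \<lceil>1024 * 4 ^ l * \<Lambda>\<rceil>" for l :: nat
  \<comment> \<open>The first summand absorbs the union bound over the lists of level
    \<open>l\<close>, the second leaves a failure probability that is summable in \<open>l\<close>.
    Weighted with \<open>(lam l)\<^sup>2 / m\<close> and summed over the levels, each of the two
    contributes at most \<open>\<delta> / 2\<close>.\<close>
  define xx where "xx l = X * 4 ^ l / (2 * real L) + X * 2 ^ l / 4" for l :: nat
  define g where "g l ks x = (\<Sum>i\<leftarrow>ks. d i x) / of_nat (q l)" for l ks x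
  \<comment> \<open>The threshold 3/4 lies midway between 1/2 and 1: with an approximation error of
    at most \<open>lam l / 4\<close> the indicator is implied by |f| at least \<open>lam l\<close>
    and implies |f| at least \<open>lam l / 2\<close>.\<close>
  define h where "h l ks x = (of_bool (3 / 4 * lam l \<le> cmod (g l ks x)) :: real)" for l ks x
  define T where "T l = {ks. set ks \<subseteq> I \<and> length ks = q l}" for l
  define Bad where "Bad l ks = {t \<in> space ?Q. (\<Sum>k=1..m. h l ks (t k)) \<le> real m * (expectation (h l ks) / 2) - xx l}" for l ks
  have X: "0 < X" using B \<delta> m by (simp add: X_def)
  have lam: "0 < lam l" "lam l \<le> B" for l
    using B by (auto simp: lam_def field_simps)
  have lam2: "(lam l)\<^sup>2 = B\<^sup>2 / 4 ^ l" for l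
    proof -
    have "((2::real) ^ l)\<^sup>2 = 4 ^ l" by (simp add: power2_eq_square flip: power_mult_distrib)
    then show ?thesis by (simp add: lam_def power_divide)
  qed
  have q: "0 < q l" "1024 * 4 ^ l * \<Lambda> \<le> real (q l)" "real (q l) \<le> 1025 * 4 ^ l * \<Lambda>" for l
  proof -
    have "1 * 1 \<le> 4 ^ l * \<Lambda>" using \<Lambda> by (intro mult_mono) auto
    then have 1: "1 \<le> 4 ^ l * \<Lambda>" by simp
    show "1024 * 4 ^ l * \<Lambda> \<le> real (q l)" unfolding q_def by linarith
    with 1 have "0 < real (q l)" by linarith
    then show "0 < q l" by simp
    have "real (q l) \<le> 1024 * 4 ^ l * \<Lambda> + 1" unfolding q_def using 1 by linarith
    then show "real (q l) \<le> 1025 * 4 ^ l * \<Lambda>" using 1 by linarith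
  qed
  have gm: "g l ks \<in> borel_measurable M" if "set ks \<subseteq> I" for l ks
  proof -
    have "(\<lambda>x. \<Sum>i\<leftarrow>ks. d i x) \<in> borel_measurable M" using that by (induction ks) auto
    then show ?thesis unfolding g_def by measurable
  qed
  have hm: "h l ks \<in> borel_measurable M" if "set ks \<subseteq> I" for l ks
    using gm[OF that] unfolding h_def by measurable
  have Bad_sets: "Bad l ks \<in> sets ?Q" if "set ks \<subseteq> I" for l ks
  proof -
    note [measurable] = hm[OF that]
    show ?thesis unfolding Bad_def by measurable
  qed
  have Bad_le: "measure ?Q (Bad l ks) \<le> exp (- xx l)" if "set ks \<subseteq> I" for l ks
    unfolding Bad_def by (rule chernoff_lower[OF hm[OF that]]) (auto simp: h_def)
  have T: "finite (T l)" "card (T l) = card I ^ q l" for l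
    unfolding T_def using I by (auto simp: finite_lists_length_eq card_lists_length_eq)
  \<comment> \<open>Only the finitely many lists are excluded, before any weights \<open>p\<close>
    are fixed; the estimate on \<open>E\<close> is therefore uniform in \<open>p\<close>.\<close>
  define E where "E = space ?Q - (\<Union>l<L. \<Union>ks\<in>T l. Bad l ks)"
  have U_sets: "(\<Union>l<L. \<Union>ks\<in>T l. Bad l ks) \<in> sets ?Q"
    by (intro sets.finite_UN T finite_lessThan Bad_sets) (auto simp: T_def)
  have "measure ?Q (\<Union>l<L. \<Union>ks\<in>T l. Bad l ks) \<le> (\<Sum>l<L. measure ?Q (\<Union>ks\<in>T l. Bad l ks))"
    by (intro measure_UNION_le sets.finite_UN T Bad_sets) (auto simp: T_def)
  also have "\<dots> \<le> (\<Sum>l<L. exp (- (X / 4 * 2 ^ l)))"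
  proof (rule sum_mono)
    fix l assume l: "l \<in> {..<L}"
    have "measure ?Q (\<Union>ks\<in>T l. Bad l ks) \<le> (\<Sum>ks\<in>T l. measure ?Q (Bad l ks))"
      by (intro measure_UNION_le T Bad_sets) (auto simp: T_def)
    also have "\<dots> \<le> (\<Sum>ks\<in>T l. exp (- xx l))"
      by (intro sum_mono Bad_le) (auto simp: T_def)
    also have "\<dots> = real (card I) ^ q l * exp (- xx l)" by (simp add: T)
    also have "real (card I) ^ q l = exp (real (q l) * ln (real (card I)))"
      using I by (subst exp_of_nat_mult) (simp add: card_gt_0_iff)
    also have "\<dots> * exp (- xx l) = exp (real (q l) * ln (real (card I)) - xx l)"
      by (simp add: exp_diff exp_minus field_simps)
    \<comment> \<open>The entropy \<open>q l * ln (real (card I))\<close> is at most the first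
      summand of \<open>xx l\<close>: 1025 allows for rounding up 1024, and 2050 = 2 * 1025 in
      \<open>m1\<close> matches the divisor \<open>2 * real L\<close>.\<close>
    also have "\<dots> \<le> exp (- (X / 4 * 2 ^ l))"
    proof -
      have n: "0 \<le> ln (real (card I))" using I by (simp add: Suc_leI card_gt_0_iff)
      have "real (q l) * ln (real (card I)) \<le> 1025 * 4 ^ l * \<Lambda> * ln (real (card I))"
        by (intro mult_right_mono q n)
      also have "\<dots> = 2050 * real L * \<Lambda> * ln (real (card I)) * (4 ^ l / (2 * real L))"
        using L by (simp add: field_simps)
      also have "\<dots> \<le> X * (4 ^ l / (2 * real L))"
        using m1 by (intro mult_right_mono) (auto simp: X_def)
      finally show ?thesis by (simp add: xx_def)
    qed
    finally show "measure ?Q (\<Union>ks\<in>T l. Bad l ks) \<le> exp (- (X / 4 * 2 ^ l))" .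
  qed
  also have "\<dots> \<le> \<gamma> / 2"
    proof (rule sum_exp_dyadic_le[OF \<gamma>])
    have "4 * (2 + y) \<le> X \<Longrightarrow> 2 + y \<le> X / 4" for y by simp
    then show "2 + ln (1 / \<gamma>) \<le> X / 4" using m2 unfolding X_def .
  qed
  finally have "measure ?Q (\<Union>l<L. \<Union>ks\<in>T l. Bad l ks) \<le> \<gamma> / 2" .
  then have measE: "1 - \<gamma> / 2 \<le> measure ?Q E"
    unfolding E_def using Q.prob_compl[OF U_sets] by simp
  have E_sets: "E \<in> sets ?Q" unfolding E_def using U_sets by auto
  show ?thesis
  proof (intro bexI[OF _ E_sets] conjI measE ballI allI impI)
    fix t and p :: "'i \<Rightarrow> real" assume tE: "t \<in> E" and "(\<forall>i\<in>I. 0 \<le> p i) \<and> (\<Sum>i\<in>I. p i) = 1"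
    then have p: "\<And>i. i \<in> I \<Longrightarrow> 0 \<le> p i" "(\<Sum>i\<in>I. p i) = 1" by auto
    have tQ: "t \<in> space ?Q" using tE by (simp add: E_def)
    then have ts: "t k \<in> space M" if "k \<in> {1..m}" for k
      using that by (auto simp: space_PiM PiE_iff)
    define f where "f x = (\<Sum>i\<in>I. of_real (p i) * d i x)" for x
    have [measurable]: "f \<in> borel_measurable M" unfolding f_def by measurable
    have fb: "cmod (f x) \<le> B" if "x \<in> space M" for x
    proof -
      have "cmod (f x) \<le> (\<Sum>i\<in>I. p i * B)"
        unfolding f_def using p bd that by (intro sum_norm_le) (auto simp: norm_mult intro!: mult_left_mono)
      also have "\<dots> = B" using p(2) by (simp flip: sum_distrib_right)
      finally show ?thesis .
    qed
    define A where "A u = (\<Sum>k=1..m. u (t k)) / real m" for u :: "'a \<Rightarrow> real"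
    have pm: "pooled_mean {1..m} t u = expectation u + A u" for u
      by (simp add: pooled_mean_def A_def)
    have A_mono: "A u \<le> A v" if "\<And>x. x \<in> space M \<Longrightarrow> u x \<le> v x" for u v
      unfolding A_def using that ts by (intro divide_right_mono sum_mono) auto
    have A_sum: "A (\<lambda>x. \<Sum>l<L. c l * u l x) = (\<Sum>l<L. c l * A (u l))" for c u
      unfolding A_def by (simp add: sum_distrib_left sum_divide_distrib) (rule sum.swap)
    have A_diff: "A (\<lambda>x. u x - v x) = A u - A v" for u v
      unfolding A_def by (simp add: sum_subtractf diff_divide_distrib)
    have A_cmult: "A (\<lambda>x. c * u x) = c * A u" for c u
      unfolding A_def by (simp flip: sum_distrib_left)
    \<comment> \<open>The pooled mass on which the list may be a bad approximation. It is charged at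
      every level, and since the squared levels sum to at most \<open>4 / 3 * B\<^sup>2\<close>, the
      total charge is at most \<open>2 / 3 * \<delta>\<close>.\<close>
    define \<eta> where "\<eta> = \<delta> / (2 * B\<^sup>2)"
    have "\<exists>ks. length ks = q l \<and> set ks \<subseteq> I \<and>
       pooled_mean {1..m} t (\<lambda>x. of_bool (lam l / 4 < cmod (f x - g l ks x))) \<le> \<eta>" for l
    proof -
      have "8 * exp (- (real (q l) * (lam l / 4)\<^sup>2 / (64 * B\<^sup>2))) \<le> \<eta>"
      proof -
        have "\<Lambda> = 1024 * 4 ^ l * \<Lambda> * ((lam l / 4)\<^sup>2 / (64 * B\<^sup>2))"
          unfolding power_divide lam2 using B by (simp add: field_simps)
        also have "\<dots> \<le> real (q l) * ((lam l / 4)\<^sup>2 / (64 * B\<^sup>2))"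
          by (intro mult_right_mono q) auto
        finally have "- (real (q l) * (lam l / 4)\<^sup>2 / (64 * B\<^sup>2)) \<le> - ln (16 * B\<^sup>2 / \<delta>)" using \<Lambda> by simp
        also have "\<dots> = ln (\<delta> / (16 * B\<^sup>2))" using B \<delta> by (simp add: ln_div)
        finally have "exp (- (real (q l) * (lam l / 4)\<^sup>2 / (64 * B\<^sup>2))) \<le> exp (ln (\<delta> / (16 * B\<^sup>2)))"
          by (simp only: exp_le_cancel_iff)
        also have "\<dots> = \<delta> / (16 * B\<^sup>2)" using B \<delta> by (intro exp_ln) auto
        finally have "exp (- (real (q l) * (lam l / 4)\<^sup>2 / (64 * B\<^sup>2))) \<le> \<delta> / (16 * B\<^sup>2)" .
        then show ?thesis using B by (simp add: \<eta>_def field_simps)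
      qed
      moreover have "\<exists>ks. length ks = q l \<and> set ks \<subseteq> I \<and>
         pooled_mean {1..m} t (\<lambda>x. of_bool (lam l / 4 < cmod ((\<Sum>i\<in>I. of_real (p i) * d i x) - (\<Sum>i\<leftarrow>ks. d i x) / of_nat (q l))))
          \<le> 8 * exp (- (real (q l) * (lam l / 4)\<^sup>2 / (64 * B\<^sup>2)))"
        by (rule maurey_approximation[OF I(1) p meas bd]) (use m q lam B ts in auto)
      ultimately show ?thesis unfolding f_def g_def by fastforce
    qed
    then obtain ks where ks: "\<And>l. length (ks l) = q l" "\<And>l. set (ks l) \<subseteq> I"
      and bad: "\<And>l. pooled_mean {1..m} t (\<lambda>x. of_bool (lam l / 4 < cmod (f x - g l (ks l) x))) \<le> \<eta>" by metis
    define b where "b l x = (of_bool (lam l / 4 < cmod (f x - g l (ks l) x)) :: real)" for l x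
    define hh where "hh l = h l (ks l)" for l
    have [measurable]: "g l (ks l) \<in> borel_measurable M" "hh l \<in> borel_measurable M" for l
      using gm hm ks(2) by (auto simp: hh_def)
    have [measurable]: "b l \<in> borel_measurable M" for l unfolding b_def by measurable
    have bint: "integrable M (b l)" "integrable M (hh l)" for l
    proof -
      show "integrable M (b l)" by (rule integrable_const_bound[where B=1]) (auto simp: b_def)
      show "integrable M (hh l)"
        by (rule integrable_const_bound[where B=1]) (use hm[OF ks(2)] in \<open>auto simp: hh_def h_def\<close>)
    qed
    have Ahh: "expectation (hh l) / 2 - xx l / real m \<le> A (hh l)" if "l < L" for l
    proof -
      have "t \<notin> Bad l (ks l)" using tE that ks by (auto simp: E_def T_def)
      then have "real m * (expectation (hh l) / 2) - xx l \<le> (\<Sum>k=1..m. hh l (t k))"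
        using tQ by (auto simp: Bad_def hh_def)
      then have "(real m * (expectation (hh l) / 2) - xx l) / real m \<le> A (hh l)"
        unfolding A_def by (intro divide_right_mono) auto
      then show ?thesis using m by (simp add: diff_divide_distrib)
    qed
    define lo where "lo l x = (of_bool (lam l \<le> cmod (f x)) :: real)" for l x
    define up where "up l x = (of_bool (lam l \<le> 2 * cmod (f x)) :: real)" for l x
    have [measurable]: "lo l \<in> borel_measurable M" for l unfolding lo_def by measurable
    have loint: "integrable M (lo l)" for l
      by (rule integrable_const_bound[where B=1]) (auto simp: lo_def)
    have lo_hh: "lo l x - b l x \<le> hh l x" for l x
    proof -
      have "cmod (f x) \<le> cmod (f x - g l (ks l) x) + cmod (g l (ks l) x)"
        by (metis diff_add_cancel norm_triangle_ineq)
      then show ?thesis by (auto simp: lo_def b_def hh_def h_def)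
    qed
    have hh_up: "hh l x - b l x \<le> up l x" for l x
    proof -
      have "cmod (g l (ks l) x) \<le> cmod (f x - g l (ks l) x) + cmod (f x)"
        by (metis norm_minus_commute diff_add_cancel norm_triangle_ineq)
      then show ?thesis by (auto simp: up_def b_def hh_def h_def)
    qed
    \<comment> \<open>The transfer from distribution to sample: \<open>lo\<close> is below
      \<open>hh\<close> up to \<open>b\<close> in expectation, Chernoff's bound compares
      \<open>hh\<close> with its sample mean, and there \<open>hh\<close> is below \<open>up\<close>
      up to \<open>b\<close>. Both losses together are one pooled mean of \<open>b\<close>.\<close>
    have level: "expectation (lo l) / 2 - xx l / real m - \<eta> \<le> A (up l)" if "l < L" for l
    proof -
      have "A (\<lambda>x. hh l x - b l x) \<le> A (up l)" by (rule A_mono[OF hh_up])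
      moreover have "expectation (\<lambda>x. lo l x - b l x) \<le> expectation (hh l)"
        by (intro integral_mono_AE AE_I2 lo_hh Bochner_Integration.integrable_diff loint bint)
      moreover have "expectation (\<lambda>x. lo l x - b l x) = expectation (lo l) - expectation (b l)"
        by (intro Bochner_Integration.integral_diff loint bint)
      moreover have "0 \<le> expectation (b l)" by (intro integral_nonneg_AE) (simp add: b_def)
      moreover have "expectation (b l) + A (b l) \<le> \<eta>" using bad[of l] unfolding pm b_def .
      ultimately show ?thesis using Ahh[OF that] unfolding A_diff by linarith
    qed
    have geo: "(\<Sum>l<L. (lam l)\<^sup>2) \<le> 4 / 3 * B\<^sup>2"
      using dyadic_levels_upper[of B B L] lam B by (simp add: lam_def[symmetric])
    have low: "(\<Sum>l<L. (lam l)\<^sup>2 * expectation (lo l)) \<ge> expectation (\<lambda>x. (cmod (f x))\<^sup>2) / 4 - \<delta>"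
    proof -
      have fint: "integrable M (\<lambda>x. (cmod (f x))\<^sup>2)"
        by (rule integrable_const_bound[where B="B\<^sup>2"]) (auto intro!: AE_I2 power_mono fb)
      have "(B / 2 ^ L)\<^sup>2 = B\<^sup>2 / 4 ^ L" using lam2[of L] by (simp add: lam_def)
      also have "\<dots> \<le> \<delta>" using L \<delta> by (simp add: field_simps)
      finally have BL: "(B / 2 ^ L)\<^sup>2 \<le> \<delta>" .
      have "expectation (\<lambda>x. (cmod (f x))\<^sup>2) / 4 - \<delta> = expectation (\<lambda>x. (cmod (f x))\<^sup>2 / 4 - \<delta>)"
        using fint by (simp add: prob_space)
      also have "\<dots> \<le> expectation (\<lambda>x. \<Sum>l<L. (lam l)\<^sup>2 * lo l x)"
      proof (intro integral_mono_AE AE_I2)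
        fix x assume "x \<in> space M"
        then show "(cmod (f x))\<^sup>2 / 4 - \<delta> \<le> (\<Sum>l<L. (lam l)\<^sup>2 * lo l x)"
          using dyadic_levels_lower[of "cmod (f x)" B L] fb[of x] BL unfolding lam_def lo_def by auto
      qed (use fint loint in auto)
      also have "\<dots> = (\<Sum>l<L. (lam l)\<^sup>2 * expectation (lo l))"
        using loint by (subst Bochner_Integration.integral_sum) auto
      finally show ?thesis .
    qed
    have upp: "(\<Sum>l<L. (lam l)\<^sup>2 * A (up l)) \<le> 16 / 3 * A (\<lambda>x. (cmod (f x))\<^sup>2)"
    proof -
      have "(\<Sum>l<L. (lam l)\<^sup>2 * A (up l)) = A (\<lambda>x. \<Sum>l<L. (lam l)\<^sup>2 * up l x)" by (rule A_sum[symmetric])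
      also have "\<dots> \<le> A (\<lambda>x. 16 / 3 * (cmod (f x))\<^sup>2)"
      proof (rule A_mono)
        fix x
        have "(\<Sum>l<L. (lam l)\<^sup>2 * up l x) \<le> 4 / 3 * (min B (2 * cmod (f x)))\<^sup>2"
          unfolding lam_def up_def using B by (intro dyadic_levels_upper) auto
        also have "\<dots> \<le> 4 / 3 * (2 * cmod (f x))\<^sup>2" using B by (intro mult_left_mono power_mono) auto
        finally show "(\<Sum>l<L. (lam l)\<^sup>2 * up l x) \<le> 16 / 3 * (cmod (f x))\<^sup>2" by (simp add: power_mult_distrib)
      qed
      finally show ?thesis unfolding A_cmult .
    qed
    have dev: "(\<Sum>l<L. (lam l)\<^sup>2 * (xx l / real m)) \<le> \<delta>"
    proof -
      have "(lam l)\<^sup>2 * (xx l / real m) = \<delta> / (2 * real L) + \<delta> / 4 * (1 / 2) ^ l" for l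
      proof -
        have "(4::real) ^ l = 2 ^ l * 2 ^ l" by (simp flip: power_mult_distrib)
        then show ?thesis unfolding lam2 xx_def X_def using B m L by (simp add: field_simps)
      qed
      then have "(\<Sum>l<L. (lam l)\<^sup>2 * (xx l / real m)) = \<delta> / 2 + \<delta> / 4 * (\<Sum>l<L. (1 / 2) ^ l)"
        using L by (simp add: sum.distrib sum_distrib_left)
      also have "(\<Sum>l<L. (1 / 2) ^ l) \<le> (2::real)" by (simp add: sum_gp_strict)
      finally show ?thesis using \<delta> by simp
    qed
    have "(\<Sum>l<L. (lam l)\<^sup>2 * (expectation (lo l) / 2 - xx l / real m - \<eta>)) \<le> (\<Sum>l<L. (lam l)\<^sup>2 * A (up l))"
      by (intro sum_mono mult_left_mono level) auto
    moreover have "(\<Sum>l<L. (lam l)\<^sup>2 * (expectation (lo l) / 2 - xx l / real m - \<eta>))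
      = (\<Sum>l<L. (lam l)\<^sup>2 * expectation (lo l)) / 2 - (\<Sum>l<L. (lam l)\<^sup>2 * (xx l / real m)) - \<eta> * (\<Sum>l<L. (lam l)\<^sup>2)"
      by (simp add: right_diff_distrib sum_subtractf sum_distrib_left sum_divide_distrib mult.commute)
    moreover have "\<eta> * (\<Sum>l<L. (lam l)\<^sup>2) \<le> \<eta> * (4 / 3 * B\<^sup>2)"
      using geo \<delta> by (intro mult_left_mono) (auto simp: \<eta>_def)
    moreover have "\<eta> * (4 / 3 * B\<^sup>2) = 2 / 3 * \<delta>" using B by (simp add: \<eta>_def)
    ultimately have "expectation (\<lambda>x. (cmod (f x))\<^sup>2) / 8 - 3 * \<delta> \<le> 16 / 3 * A (\<lambda>x. (cmod (f x))\<^sup>2)"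
      using low upp dev \<delta> by linarith
    \<comment> \<open>Multiplication by 3/16 gives the factor 3/128 = (1/8)(3/16), and 9/16 of
      \<open>\<delta>\<close> is at most \<open>\<delta>\<close>.\<close>
    then show "3 / 128 * expectation (\<lambda>x. (cmod (\<Sum>i\<in>I. of_real (p i) * d i x))\<^sup>2) - \<delta>
         \<le> (\<Sum>k=1..m. (cmod (\<Sum>i\<in>I. of_real (p i) * d i (t k)))\<^sup>2) / real m"
      using \<delta> by (simp add: A_def f_def)
  qed
qed

section \<open>Square integrable functions\<close>

lemma borel_measurable_cnj [measurable]: "cnj \<in> borel_measurable borel"
  by (intro borel_measurable_continuous_onI continuous_intros)

lemma LtwoD: "f \<in> Ltwo \<Longrightarrow> f \<in> borel_measurable lborel" "f \<in> Ltwo \<Longrightarrow> f \<in> borel_measurable borel"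
   "f \<in> Ltwo \<Longrightarrow> integrable lborel (\<lambda>x. (cmod (f x))\<^sup>2)"
  by (auto simp: Ltwo_def)

lemma Ltwo_bounded_by:
  assumes "g \<in> borel_measurable borel" "integrable lborel h" "AE x in lborel. (cmod (g x))\<^sup>2 \<le> h x"
  shows "g \<in> Ltwo"
proof -
  have [measurable]: "g \<in> borel_measurable lborel" using assms(1) by simp
  have "integrable lborel (\<lambda>x. (cmod (g x))\<^sup>2)"
  proof (rule Bochner_Integration.integrable_bound[OF assms(2)])
    show "(\<lambda>x. (cmod (g x))\<^sup>2) \<in> borel_measurable lborel" by measurable
    show "AE x in lborel. norm ((cmod (g x))\<^sup>2) \<le> norm (h x)"
      using assms(3) by eventually_elim simp
  qed
  then show ?thesis by (simp add: Ltwo_def)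
qed

lemma Ltwo_zero: "(\<lambda>x. 0) \<in> Ltwo" by (simp add: Ltwo_def)

lemma cmod_add_square_le: "(cmod (a + b))\<^sup>2 \<le> 2 * (cmod a)\<^sup>2 + 2 * (cmod b)\<^sup>2"
proof -
  have "(cmod (a + b))\<^sup>2 \<le> (cmod a + cmod b)\<^sup>2" by (intro power_mono norm_triangle_ineq) auto
  also have "\<dots> \<le> 2 * (cmod a)\<^sup>2 + 2 * (cmod b)\<^sup>2"
    using zero_le_power2[of "cmod a - cmod b"] unfolding power2_diff power2_sum by linarith
  finally show ?thesis .
qed

lemma Ltwo_add: "(\<lambda>x. f x + g x) \<in> Ltwo" if "f \<in> Ltwo" "g \<in> Ltwo"
proof (rule Ltwo_bounded_by)
  note [measurable] = LtwoD(2)[OF that(1)] LtwoD(2)[OF that(2)]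
  show "(\<lambda>x. f x + g x) \<in> borel_measurable borel" by measurable
  show "integrable lborel (\<lambda>x. 2 * (cmod (f x))\<^sup>2 + 2 * (cmod (g x))\<^sup>2)"
    using LtwoD(3)[OF that(1)] LtwoD(3)[OF that(2)] by simp
qed (simp add: cmod_add_square_le)

lemma Ltwo_cmult: "(\<lambda>x. c * f x) \<in> Ltwo" if "f \<in> Ltwo"
proof -
  note [measurable] = LtwoD(1)[OF that]
  have "integrable lborel (\<lambda>x. (cmod c)\<^sup>2 * (cmod (f x))\<^sup>2)" using LtwoD(3)[OF that] by auto
  then show ?thesis by (simp add: Ltwo_def norm_mult power_mult_distrib)
qed

lemma Ltwo_diff: "(\<lambda>x. f x - g x) \<in> Ltwo" if "f \<in> Ltwo" "g \<in> Ltwo"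
  using Ltwo_add[OF that(1) Ltwo_cmult[OF that(2), of "-1"]] by simp

lemma Ltwo_sum: "(\<And>i. i \<in> I \<Longrightarrow> f i \<in> Ltwo) \<Longrightarrow> (\<lambda>x. \<Sum>i\<in>I. f i x) \<in> Ltwo"
  by (induction I rule: infinite_finite_induct) (auto simp: Ltwo_zero intro: Ltwo_add)

lemma Ltwo_lincomb: "(\<And>i. i \<in> I \<Longrightarrow> f i \<in> Ltwo) \<Longrightarrow> (\<lambda>x. \<Sum>i\<in>I. a i * f i x) \<in> Ltwo"
  by (intro Ltwo_sum Ltwo_cmult)

lemma Ltwo_mult_integrable: "integrable lborel (\<lambda>x. f x * cnj (g x))" if "f \<in> Ltwo" "g \<in> Ltwo"
proof (rule Bochner_Integration.integrable_bound)
  note [measurable] = LtwoD(1)[OF that(1)] LtwoD(1)[OF that(2)]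
  show "(\<lambda>x. f x * cnj (g x)) \<in> borel_measurable lborel" by measurable
  show "integrable lborel (\<lambda>x. (cmod (f x))\<^sup>2 + (cmod (g x))\<^sup>2)"
    using LtwoD(3)[OF that(1)] LtwoD(3)[OF that(2)] by simp
  have "a * b \<le> a\<^sup>2 + b\<^sup>2" for a b :: real
    using zero_le_power2[of "a - b"] zero_le_power2[of a] zero_le_power2[of b] unfolding power2_diff by linarith
  then show "AE x in lborel. norm (f x * cnj (g x)) \<le> norm ((cmod (f x))\<^sup>2 + (cmod (g x))\<^sup>2)"
    by (simp add: norm_mult)
qed

lemma Ltwo_norm_nonneg: "0 \<le> Ltwo_norm f"
  by (simp add: Ltwo_norm_def integral_nonneg_AE)

lemma Ltwo_norm_square: "(Ltwo_norm f)\<^sup>2 = (LINT x|lborel. (cmod (f x))\<^sup>2)"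
  by (simp add: Ltwo_norm_def integral_nonneg_AE)

lemma Ltwo_inner_self: "Ltwo_inner f f = of_real ((Ltwo_norm f)\<^sup>2)"
  unfolding Ltwo_norm_square Ltwo_inner_def
  by (subst integral_complex_of_real[symmetric]) (simp add: complex_norm_square del: of_real_power)

lemma Ltwo_inner_commute: "Ltwo_inner g f = cnj (Ltwo_inner f g)"
  unfolding Ltwo_inner_def by (subst Bochner_Integration.integral_cnj[symmetric]) (simp add: mult.commute)

lemma Ltwo_inner_add_left: "Ltwo_inner (\<lambda>x. f x + g x) h = Ltwo_inner f h + Ltwo_inner g h"
  if "f \<in> Ltwo" "g \<in> Ltwo" "h \<in> Ltwo"
  unfolding Ltwo_inner_def using that by (simp add: distrib_right Ltwo_mult_integrable)

lemma Ltwo_inner_diff_left: "Ltwo_inner (\<lambda>x. f x - g x) h = Ltwo_inner f h - Ltwo_inner g h"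
  if "f \<in> Ltwo" "g \<in> Ltwo" "h \<in> Ltwo"
  unfolding Ltwo_inner_def using that by (simp add: left_diff_distrib Ltwo_mult_integrable)

lemma Ltwo_inner_cmult_left: "Ltwo_inner (\<lambda>x. c * f x) h = c * Ltwo_inner f h"
  unfolding Ltwo_inner_def by (simp add: mult.assoc)

lemma Ltwo_inner_lincomb_left:
  assumes "\<And>i. i \<in> I \<Longrightarrow> f i \<in> Ltwo" "h \<in> Ltwo"
  shows "Ltwo_inner (\<lambda>x. \<Sum>i\<in>I. a i * f i x) h = (\<Sum>i\<in>I. a i * Ltwo_inner (f i) h)"
  using assms(1)
proof (induction I rule: infinite_finite_induct)
  case (insert i I)
  then show ?case
    by (simp add: Ltwo_inner_add_left[OF Ltwo_cmult Ltwo_lincomb assms(2)] Ltwo_inner_cmult_left)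
qed (simp_all add: Ltwo_inner_def)

lemma Ltwo_inner_lincomb_right:
  assumes "\<And>i. i \<in> I \<Longrightarrow> f i \<in> Ltwo" "h \<in> Ltwo"
  shows "Ltwo_inner h (\<lambda>x. \<Sum>i\<in>I. a i * f i x) = (\<Sum>i\<in>I. cnj (a i) * Ltwo_inner h (f i))"
proof -
  have "Ltwo_inner h (\<lambda>x. \<Sum>i\<in>I. a i * f i x) = cnj (\<Sum>i\<in>I. a i * Ltwo_inner (f i) h)"
    using assms by (subst Ltwo_inner_commute, subst Ltwo_inner_lincomb_left) auto
  also have "\<dots> = (\<Sum>i\<in>I. cnj (a i) * cnj (Ltwo_inner (f i) h))" by simp
  also have "\<dots> = (\<Sum>i\<in>I. cnj (a i) * Ltwo_inner h (f i))"
    by (intro sum.cong refl arg_cong2[where f="(*)"] Ltwo_inner_commute[symmetric])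
  finally show ?thesis .
qed

lemma Ltwo_norm_eq_0_iff: "Ltwo_norm f = 0 \<longleftrightarrow> (AE x in lborel. f x = 0)" if "f \<in> Ltwo"
  using integral_nonneg_eq_0_iff_AE[OF LtwoD(3)[OF that]]
  by (simp add: Ltwo_norm_def integral_nonneg_AE)

lemma Ltwo_abs_mult_integral_le:
  assumes "f \<in> Ltwo" "g \<in> Ltwo"
  shows "(LINT x|lborel. cmod (f x) * cmod (g x)) \<le> Ltwo_norm f * Ltwo_norm g"
proof -
  let ?a = "Ltwo_norm f" and ?b = "Ltwo_norm g"
  have int: "integrable lborel (\<lambda>x. cmod (f x) * cmod (g x))"
    using integrable_norm[OF Ltwo_mult_integrable[OF assms]] by (simp add: norm_mult)
  note [measurable] = LtwoD(1)[OF assms(1)] LtwoD(1)[OF assms(2)]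
  show ?thesis
  proof (cases "?a = 0 \<or> ?b = 0")
    case True
    then have "AE x in lborel. cmod (f x) * cmod (g x) = 0"
      using Ltwo_norm_eq_0_iff[OF assms(1)] Ltwo_norm_eq_0_iff[OF assms(2)] by fastforce
    then have "(LINT x|lborel. cmod (f x) * cmod (g x)) = 0" by (rule integral_eq_zero_AE)
    then show ?thesis by (simp add: Ltwo_norm_nonneg)
  next
    case False
    then have ab: "0 < ?a" "0 < ?b" using Ltwo_norm_nonneg[of f] Ltwo_norm_nonneg[of g] by auto
    \<comment> \<open>The arithmetic-geometric mean with weights balanced by the two norms, so that
      both terms integrate to half of the product of the norms.\<close>
    have "(LINT x|lborel. cmod (f x) * cmod (g x)) \<le>
      (LINT x|lborel. ?b / (2 * ?a) * (cmod (f x))\<^sup>2 + ?a / (2 * ?b) * (cmod (g x))\<^sup>2)"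
    proof (intro integral_mono_AE int AE_I2)
      show "integrable lborel (\<lambda>x. ?b / (2 * ?a) * (cmod (f x))\<^sup>2 + ?a / (2 * ?b) * (cmod (g x))\<^sup>2)"
        using LtwoD(3)[OF assms(1)] LtwoD(3)[OF assms(2)] by simp
      fix x
      have "0 \<le> (?b * cmod (f x) - ?a * cmod (g x))\<^sup>2" by simp
      then have "2 * (?a * ?b) * (cmod (f x) * cmod (g x)) \<le> ?b\<^sup>2 * (cmod (f x))\<^sup>2 + ?a\<^sup>2 * (cmod (g x))\<^sup>2"
        by (simp add: power2_eq_square algebra_simps)
      also have "\<dots> = 2 * (?a * ?b) * (?b / (2 * ?a) * (cmod (f x))\<^sup>2 + ?a / (2 * ?b) * (cmod (g x))\<^sup>2)"
        using ab by (simp add: field_simps power2_eq_square)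
      finally show "cmod (f x) * cmod (g x) \<le> ?b / (2 * ?a) * (cmod (f x))\<^sup>2 + ?a / (2 * ?b) * (cmod (g x))\<^sup>2"
        using ab by (subst (asm) mult_le_cancel_left_pos) auto
    qed
    also have "\<dots> = ?b / (2 * ?a) * ?a\<^sup>2 + ?a / (2 * ?b) * ?b\<^sup>2"
      unfolding Ltwo_norm_square using LtwoD(3)[OF assms(1)] LtwoD(3)[OF assms(2)]
      by (subst Bochner_Integration.integral_add) simp_all
    also have "\<dots> = ?a * ?b" using ab by (simp add: field_simps power2_eq_square)
    finally show ?thesis .
  qed
qed

lemma Ltwo_Cauchy_Schwarz: "cmod (Ltwo_inner f g) \<le> Ltwo_norm f * Ltwo_norm g" if "f \<in> Ltwo" "g \<in> Ltwo"
proof -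
  have "cmod (Ltwo_inner f g) \<le> (LINT x|lborel. cmod (f x * cnj (g x)))"
    unfolding Ltwo_inner_def by (rule integral_norm_bound)
  also have "\<dots> = (LINT x|lborel. cmod (f x) * cmod (g x))" by (simp add: norm_mult)
  finally show ?thesis using Ltwo_abs_mult_integral_le[OF that] by linarith
qed

lemma Ltwo_norm_add_square:
  assumes "f \<in> Ltwo" "g \<in> Ltwo"
  shows "(Ltwo_norm (\<lambda>x. f x + g x))\<^sup>2 = (Ltwo_norm f)\<^sup>2 + (Ltwo_norm g)\<^sup>2 + 2 * Re (Ltwo_inner f g)"
proof -
  have "complex_of_real ((Ltwo_norm (\<lambda>x. f x + g x))\<^sup>2) = Ltwo_inner (\<lambda>x. f x + g x) (\<lambda>x. f x + g x)"
    by (rule Ltwo_inner_self[symmetric])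
  also have "\<dots> = Ltwo_inner f (\<lambda>x. f x + g x) + Ltwo_inner g (\<lambda>x. f x + g x)"
    by (intro Ltwo_inner_add_left assms Ltwo_add)
  also have "\<dots> = cnj (Ltwo_inner f f + Ltwo_inner g f) + cnj (Ltwo_inner f g + Ltwo_inner g g)"
    by (subst (1 2) Ltwo_inner_commute) (simp add: Ltwo_inner_add_left assms)
  also have "\<dots> = of_real ((Ltwo_norm f)\<^sup>2 + (Ltwo_norm g)\<^sup>2 + 2 * Re (Ltwo_inner f g))"
    unfolding Ltwo_inner_self Ltwo_inner_commute[of g f]
    by (simp add: complex_eq_iff)
  finally show ?thesis unfolding of_real_eq_iff .
qed

lemma Ltwo_norm_cmult: "Ltwo_norm (\<lambda>x. c * f x) = cmod c * Ltwo_norm f"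
  by (simp add: Ltwo_norm_def norm_mult power_mult_distrib real_sqrt_mult)

lemma Ltwo_triangle: "Ltwo_norm (\<lambda>x. f x + g x) \<le> Ltwo_norm f + Ltwo_norm g" if "f \<in> Ltwo" "g \<in> Ltwo"
proof (rule power2_le_imp_le)
  have "Re (Ltwo_inner f g) \<le> Ltwo_norm f * Ltwo_norm g"
    using Ltwo_Cauchy_Schwarz[OF that] complex_Re_le_cmod[of "Ltwo_inner f g"] by linarith
  then show "(Ltwo_norm (\<lambda>x. f x + g x))\<^sup>2 \<le> (Ltwo_norm f + Ltwo_norm g)\<^sup>2"
    unfolding Ltwo_norm_add_square[OF that] by (simp add: power2_eq_square algebra_simps)
qed (simp add: Ltwo_norm_nonneg)

lemma Ltwo_triangle_diff:
  assumes "f \<in> Ltwo" "g \<in> Ltwo" "h \<in> Ltwo"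
  shows "Ltwo_norm (\<lambda>x. f x - h x) \<le> Ltwo_norm (\<lambda>x. f x - g x) + Ltwo_norm (\<lambda>x. g x - h x)"
  using Ltwo_triangle[OF Ltwo_diff[OF assms(1,2)] Ltwo_diff[OF assms(2,3)]] by simp

section \<open>Finite and closed linear spans\<close>

lemma fun_span_Ltwo: "(\<And>i. i \<in> I \<Longrightarrow> e i \<in> Ltwo) \<Longrightarrow> f \<in> fun_span e I \<Longrightarrow> f \<in> Ltwo"
  unfolding fun_span_def by (auto intro!: Ltwo_lincomb)

lemma fun_span_base: "i \<in> I \<Longrightarrow> e i \<in> fun_span e I"
  unfolding fun_span_def by (rule CollectI, intro exI[of _ "{i}"] exI[of _ "\<lambda>_. 1"]) auto

lemma fun_spanI: "finite S \<Longrightarrow> S \<subseteq> I \<Longrightarrow> (\<lambda>x. \<Sum>i\<in>S. a i * e i x) \<in> fun_span e I"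
  unfolding fun_span_def by blast

lemma fun_span_cmult:
  assumes "f \<in> fun_span e I"
  shows "(\<lambda>x. c * f x) \<in> fun_span e I"
proof -
  obtain S a where S: "finite S" "S \<subseteq> I" "f = (\<lambda>x. \<Sum>i\<in>S. a i * e i x)"
    using assms unfolding fun_span_def by blast
  then have "(\<lambda>x. c * f x) = (\<lambda>x. \<Sum>i\<in>S. (c * a i) * e i x)"
    by (simp add: sum_distrib_left mult.assoc)
  then show ?thesis using fun_spanI[OF S(1,2)] by simp
qed

lemma fun_span_add:
  assumes "f \<in> fun_span e I" "g \<in> fun_span e I"
  shows "(\<lambda>x. f x + g x) \<in> fun_span e I"
proof -
  obtain S a T b where S: "finite S" "S \<subseteq> I" "f = (\<lambda>x. \<Sum>i\<in>S. a i * e i x)"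
    and T: "finite T" "T \<subseteq> I" "g = (\<lambda>x. \<Sum>i\<in>T. b i * e i x)"
    using assms unfolding fun_span_def by blast
  define c where "c i = (if i \<in> S then a i else 0) + (if i \<in> T then b i else 0)" for i
  have "f x + g x = (\<Sum>i\<in>S \<union> T. c i * e i x)" for x
  proof -
    have "(\<Sum>i\<in>S \<union> T. c i * e i x) = (\<Sum>i\<in>S \<union> T. (if i \<in> S then a i * e i x else 0)) + (\<Sum>i\<in>S \<union> T. (if i \<in> T then b i * e i x else 0))"
      unfolding sum.distrib[symmetric] by (intro sum.cong) (auto simp: c_def distrib_right)
    also have "\<dots> = f x + g x"
      using S T by (simp add: sum.If_cases Int_absorb1 flip: sum.inter_restrict)
    finally show ?thesis by simp
  qed
  then show ?thesis unfolding fun_span_def using S T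
    by (intro CollectI exI[of _ "S \<union> T"] exI[of _ c]) auto
qed

lemma closed_span_Ltwo: "f \<in> Ltwo_closed_span e I \<Longrightarrow> f \<in> Ltwo"
  by (simp add: Ltwo_closed_span_def)

lemma closed_spanI:
  "f \<in> Ltwo \<Longrightarrow> (\<And>\<delta>. \<delta> > 0 \<Longrightarrow> \<exists>g\<in>fun_span e I. Ltwo_norm (\<lambda>x. f x - g x) < \<delta>) \<Longrightarrow> f \<in> Ltwo_closed_span e I"
  by (simp add: Ltwo_closed_span_def)

lemma closed_spanD:
  "f \<in> Ltwo_closed_span e I \<Longrightarrow> \<delta> > 0 \<Longrightarrow> \<exists>g\<in>fun_span e I. Ltwo_norm (\<lambda>x. f x - g x) < \<delta>"
  by (simp add: Ltwo_closed_span_def)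

context
  fixes e :: "'i \<Rightarrow> 'a::euclidean_space \<Rightarrow> complex" and I :: "'i set"
  assumes e: "\<And>i. i \<in> I \<Longrightarrow> e i \<in> Ltwo"
begin

lemma fun_span_closed_span: "f \<in> fun_span e I \<Longrightarrow> f \<in> Ltwo_closed_span e I"
  by (intro closed_spanI fun_span_Ltwo[OF e] bexI[of _ f]) (auto simp: Ltwo_norm_def)

lemma closed_span_closed:
  assumes "f \<in> Ltwo" "\<And>\<delta>. \<delta> > 0 \<Longrightarrow> \<exists>g\<in>Ltwo_closed_span e I. Ltwo_norm (\<lambda>x. f x - g x) < \<delta>"
  shows "f \<in> Ltwo_closed_span e I"
proof (rule closed_spanI[OF assms(1)])
  fix \<delta> :: real assume "\<delta> > 0"
  then obtain g where g: "g \<in> Ltwo_closed_span e I" "Ltwo_norm (\<lambda>x. f x - g x) < \<delta> / 2"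
    using assms(2)[of "\<delta> / 2"] by auto
  obtain h where h: "h \<in> fun_span e I" "Ltwo_norm (\<lambda>x. g x - h x) < \<delta> / 2"
    using closed_spanD[OF g(1), of "\<delta> / 2"] \<open>\<delta> > 0\<close> by auto
  have "Ltwo_norm (\<lambda>x. f x - h x) < \<delta>"
    using Ltwo_triangle_diff[OF assms(1) closed_span_Ltwo[OF g(1)] fun_span_Ltwo[OF e h(1)]] g h by simp
  then show "\<exists>g\<in>fun_span e I. Ltwo_norm (\<lambda>x. f x - g x) < \<delta>" using h by blast
qed

lemma closed_span_add:
  assumes "f \<in> Ltwo_closed_span e I" "g \<in> Ltwo_closed_span e I"
  shows "(\<lambda>x. f x + g x) \<in> Ltwo_closed_span e I"
proof (rule closed_spanI)
  note L = closed_span_Ltwo[OF assms(1)] closed_span_Ltwo[OF assms(2)]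
  show "(\<lambda>x. f x + g x) \<in> Ltwo" by (intro Ltwo_add L)
  fix \<delta> :: real assume "\<delta> > 0"
  then obtain f' g' where f': "f' \<in> fun_span e I" "Ltwo_norm (\<lambda>x. f x - f' x) < \<delta> / 2"
    and g': "g' \<in> fun_span e I" "Ltwo_norm (\<lambda>x. g x - g' x) < \<delta> / 2"
    using closed_spanD[OF assms(1), of "\<delta>/2"] closed_spanD[OF assms(2), of "\<delta>/2"] by auto
  have "Ltwo_norm (\<lambda>x. (f x - f' x) + (g x - g' x)) \<le> Ltwo_norm (\<lambda>x. f x - f' x) + Ltwo_norm (\<lambda>x. g x - g' x)"
    by (intro Ltwo_triangle Ltwo_diff L fun_span_Ltwo[OF e f'(1)] fun_span_Ltwo[OF e g'(1)])
  then have "Ltwo_norm (\<lambda>x. (f x + g x) - (f' x + g' x)) < \<delta>" using f' g' by (simp add: algebra_simps)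
  then show "\<exists>h\<in>fun_span e I. Ltwo_norm (\<lambda>x. (f x + g x) - h x) < \<delta>"
    by (intro bexI[of _ "\<lambda>x. f' x + g' x"] fun_span_add f'(1) g'(1))
qed

lemma closed_span_cmult:
  assumes "f \<in> Ltwo_closed_span e I"
  shows "(\<lambda>x. c * f x) \<in> Ltwo_closed_span e I"
proof (rule closed_spanI)
  show "(\<lambda>x. c * f x) \<in> Ltwo" by (intro Ltwo_cmult closed_span_Ltwo[OF assms])
  fix \<delta> :: real assume "\<delta> > 0"
  have c1: "cmod c + 1 > 0" by (simp add: add_nonneg_pos)
  with \<open>\<delta> > 0\<close> have "0 < \<delta> / (cmod c + 1)" by simp
  from closed_spanD[OF assms this] obtain f' where f': "f' \<in> fun_span e I" "Ltwo_norm (\<lambda>x. f x - f' x) < \<delta> / (cmod c + 1)"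
    by blast
  have "Ltwo_norm (\<lambda>x. c * f x - c * f' x) = cmod c * Ltwo_norm (\<lambda>x. f x - f' x)"
    by (simp add: Ltwo_norm_cmult flip: right_diff_distrib)
  also have "\<dots> \<le> (cmod c + 1) * Ltwo_norm (\<lambda>x. f x - f' x)" by (intro mult_right_mono Ltwo_norm_nonneg) simp
  also have "\<dots> < \<delta>" using f'(2) c1 by (simp add: field_simps)
  finally show "\<exists>h\<in>fun_span e I. Ltwo_norm (\<lambda>x. c * f x - h x) < \<delta>"
    by (intro bexI[of _ "\<lambda>x. c * f' x"] fun_span_cmult f'(1))
qed

lemma closed_span_diff:
  assumes "f \<in> Ltwo_closed_span e I" "g \<in> Ltwo_closed_span e I"
  shows "(\<lambda>x. f x - g x) \<in> Ltwo_closed_span e I"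
  using closed_span_add[OF assms(1) closed_span_cmult[OF assms(2), of "-1"]] by simp

lemma closed_span_sum:
  assumes "\<And>k. k \<in> K \<Longrightarrow> f k \<in> Ltwo_closed_span e I"
  shows "(\<lambda>x. \<Sum>k\<in>K. f k x) \<in> Ltwo_closed_span e I"
  using assms
proof (induction K rule: infinite_finite_induct)
  have z: "(\<lambda>x. 0) \<in> Ltwo_closed_span e I"
    by (rule fun_span_closed_span) (auto simp: fun_span_def intro!: exI[of _ "{}"])
  { case infinite then show ?case using z by simp }
  { case empty then show ?case using z by simp }
  { case (insert k K) then show ?case by (simp add: closed_span_add) }
qed

lemma closed_span_orthogonal:
  assumes "h \<in> Ltwo" "\<And>i. i \<in> I \<Longrightarrow> Ltwo_inner (e i) h = 0" "f \<in> Ltwo_closed_span e I"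
  shows "Ltwo_inner f h = 0"
proof -
  have "cmod (Ltwo_inner f h) \<le> 0 + \<delta>" if "\<delta> > 0" for \<delta>
  proof -
    have h1: "0 < Ltwo_norm h + 1" using Ltwo_norm_nonneg[of h] by linarith
    have "0 < \<delta> / (Ltwo_norm h + 1)" using that h1 by simp
    from closed_spanD[OF assms(3) this]
    obtain g where g: "g \<in> fun_span e I" "Ltwo_norm (\<lambda>x. f x - g x) < \<delta> / (Ltwo_norm h + 1)" by blast
    obtain S a where S: "finite S" "S \<subseteq> I" "g = (\<lambda>x. \<Sum>i\<in>S. a i * e i x)"
      using g(1) unfolding fun_span_def by blast
    have gL: "g \<in> Ltwo" using fun_span_Ltwo[OF e g(1)] .
    have "Ltwo_inner g h = (\<Sum>i\<in>S. a i * Ltwo_inner (e i) h)"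
      unfolding S(3) using S(2) by (intro Ltwo_inner_lincomb_left e assms(1)) auto
    also have "\<dots> = 0" using S(2) assms(2) by (intro sum.neutral) auto
    finally have "Ltwo_inner f h = Ltwo_inner (\<lambda>x. f x - g x) h"
      using Ltwo_inner_diff_left[OF closed_span_Ltwo[OF assms(3)] gL assms(1)] by simp
    then have "cmod (Ltwo_inner f h) \<le> Ltwo_norm (\<lambda>x. f x - g x) * Ltwo_norm h"
      using Ltwo_Cauchy_Schwarz[OF Ltwo_diff[OF closed_span_Ltwo[OF assms(3)] gL] assms(1)] by simp
    also have "\<dots> \<le> \<delta> / (Ltwo_norm h + 1) * (Ltwo_norm h + 1)"
      using g(2) Ltwo_norm_nonneg[of h] Ltwo_norm_nonneg[of "\<lambda>x. f x - g x"] by (intro mult_mono) auto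
    also have "\<dots> = \<delta>" using h1 by simp
    finally show ?thesis by simp
  qed
  then have "cmod (Ltwo_inner f h) \<le> 0" by (rule field_le_epsilon)
  then show ?thesis by simp
qed

end

lemma closed_span_inner_zero_imp:
  assumes "f \<in> Ltwo" "Ltwo_inner f f = 0"
  shows "AE x in lborel. f x = 0"
proof -
  have "(Ltwo_norm f)\<^sup>2 = 0" using assms(2) unfolding Ltwo_inner_self of_real_eq_0_iff .
  then show ?thesis using Ltwo_norm_eq_0_iff[OF assms(1)] by simp
qed

section \<open>Orthonormal expansions\<close>

lemma orthonormal_sum_square:
  assumes "finite S" "\<And>i. i \<in> S \<Longrightarrow> e i \<in> Ltwo"
    and on: "\<And>i k. i \<in> S \<Longrightarrow> k \<in> S \<Longrightarrow> Ltwo_inner (e i) (e k) = (if i = k then 1 else 0)"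
  shows "(Ltwo_norm (\<lambda>x. \<Sum>i\<in>S. a i * e i x))\<^sup>2 = (\<Sum>i\<in>S. (cmod (a i))\<^sup>2)"
proof -
  have "complex_of_real ((Ltwo_norm (\<lambda>x. \<Sum>i\<in>S. a i * e i x))\<^sup>2) =
     Ltwo_inner (\<lambda>x. \<Sum>i\<in>S. a i * e i x) (\<lambda>x. \<Sum>i\<in>S. a i * e i x)" by (rule Ltwo_inner_self[symmetric])
  also have "\<dots> = (\<Sum>i\<in>S. a i * Ltwo_inner (e i) (\<lambda>x. \<Sum>i\<in>S. a i * e i x))"
    by (intro Ltwo_inner_lincomb_left Ltwo_lincomb assms)
  also have "\<dots> = (\<Sum>i\<in>S. a i * cnj (a i))"
  proof (rule sum.cong[OF refl])
    fix i assume i: "i \<in> S"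
    have "Ltwo_inner (e i) (\<lambda>x. \<Sum>i\<in>S. a i * e i x) = (\<Sum>k\<in>S. cnj (a k) * Ltwo_inner (e i) (e k))"
      by (intro Ltwo_inner_lincomb_right assms i)
    also have "\<dots> = (\<Sum>k\<in>S. if i = k then cnj (a k) else 0)" by (intro sum.cong) (auto simp: on i)
    also have "\<dots> = cnj (a i)" using i assms(1) by simp
    finally show "a i * Ltwo_inner (e i) (\<lambda>x. \<Sum>i\<in>S. a i * e i x) = a i * cnj (a i)" by simp
  qed
  also have "\<dots> = of_real (\<Sum>i\<in>S. (cmod (a i))\<^sup>2)"
    by (simp add: complex_norm_square del: of_real_power)
  finally show ?thesis unfolding of_real_eq_iff .
qed

text \<open>Pythagoras with arbitrary coefficients \<open>a\<close>. With the Fourier coefficients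
  it computes the residual of a projection; with any other coefficients it shows that no combination
  approximates better, so density of the span yields Parseval's identity.\<close>

lemma orthonormal_residual_square:
  assumes "finite S" "\<And>i. i \<in> S \<Longrightarrow> e i \<in> Ltwo" "u \<in> Ltwo"
    and on: "\<And>i k. i \<in> S \<Longrightarrow> k \<in> S \<Longrightarrow> Ltwo_inner (e i) (e k) = (if i = k then 1 else 0)"
  shows "(Ltwo_norm (\<lambda>x. u x - (\<Sum>i\<in>S. a i * e i x)))\<^sup>2 =
    (Ltwo_norm u)\<^sup>2 - (\<Sum>i\<in>S. (cmod (Ltwo_inner u (e i)))\<^sup>2) + (\<Sum>i\<in>S. (cmod (a i - Ltwo_inner u (e i)))\<^sup>2)"
proof -
  let ?g = "\<lambda>x. \<Sum>i\<in>S. a i * e i x"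
  have g: "?g \<in> Ltwo" by (intro Ltwo_lincomb assms)
  define g where "g = ?g"
  have gL: "g \<in> Ltwo" unfolding g_def by (rule g)
  have ig: "Ltwo_inner u g = (\<Sum>i\<in>S. cnj (a i) * Ltwo_inner u (e i))"
    unfolding g_def by (intro Ltwo_inner_lincomb_right assms)
  have ng: "(Ltwo_norm g)\<^sup>2 = (\<Sum>i\<in>S. (cmod (a i))\<^sup>2)"
    unfolding g_def by (intro orthonormal_sum_square assms)
  have "Ltwo_inner (\<lambda>x. -1 * g x) u = -1 * Ltwo_inner g u" by (rule Ltwo_inner_cmult_left)
  then have m: "Ltwo_inner u (\<lambda>x. -1 * g x) = - Ltwo_inner u g"
    unfolding Ltwo_inner_commute[of u] by simp
  have "(Ltwo_norm (\<lambda>x. u x + -1 * g x))\<^sup>2 = (Ltwo_norm u)\<^sup>2 + (Ltwo_norm (\<lambda>x. -1 * g x))\<^sup>2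
     + 2 * Re (Ltwo_inner u (\<lambda>x. -1 * g x))"
    by (intro Ltwo_norm_add_square assms Ltwo_cmult gL)
  also have "Ltwo_norm (\<lambda>x. -1 * g x) = Ltwo_norm g"
    unfolding Ltwo_norm_cmult by simp
  finally have "(Ltwo_norm (\<lambda>x. u x - g x))\<^sup>2 = (Ltwo_norm u)\<^sup>2 + (Ltwo_norm g)\<^sup>2 - 2 * Re (Ltwo_inner u g)"
    unfolding m by simp
  then have 1: "(Ltwo_norm (\<lambda>x. u x - ?g x))\<^sup>2 = (Ltwo_norm u)\<^sup>2 + (\<Sum>i\<in>S. (cmod (a i))\<^sup>2)
      - 2 * (\<Sum>i\<in>S. Re (cnj (a i) * Ltwo_inner u (e i)))"
    unfolding ng ig unfolding g_def Re_sum .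
  have "(cmod (z - w))\<^sup>2 = (cmod z)\<^sup>2 + (cmod w)\<^sup>2 - 2 * Re (cnj z * w)" for z w
    unfolding cmod_power2 by (simp add: power2_eq_square algebra_simps)
  then have "(\<Sum>i\<in>S. (cmod (a i - Ltwo_inner u (e i)))\<^sup>2) = (\<Sum>i\<in>S. (cmod (a i))\<^sup>2)
     + (\<Sum>i\<in>S. (cmod (Ltwo_inner u (e i)))\<^sup>2) - 2 * (\<Sum>i\<in>S. Re (cnj (a i) * Ltwo_inner u (e i)))"
    by (simp add: sum.distrib sum_subtractf sum_distrib_left)
  then show ?thesis using 1 by linarith
qed

text \<open>The locally null sets are glued with a countable subcover, by Lindelof's theorem.\<close>

lemma AE_zero_of_disjoint_ess_support:
  fixes f :: "'a::euclidean_space \<Rightarrow> complex"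
  assumes "ess_support f \<inter> A = {}"
  shows "AE x in lborel. x \<in> A \<longrightarrow> f x = 0"
proof -
  have "\<forall>x\<in>A. \<exists>d>0. AE y in lborel. y \<in> ball x d \<longrightarrow> f y = 0"
  proof
    fix x assume "x \<in> A"
    then have "x \<notin> ess_support f" using assms by auto
    then show "\<exists>d>0. AE y in lborel. y \<in> ball x d \<longrightarrow> f y = 0" by (simp add: ess_support_def)
  qed
  then obtain d where d: "\<And>x. x \<in> A \<Longrightarrow> d x > 0" "\<And>x. x \<in> A \<Longrightarrow> AE y in lborel. y \<in> ball x (d x) \<longrightarrow> f y = 0"
    unfolding bchoice_iff by blast
  obtain F where F: "F \<subseteq> (\<lambda>x. ball x (d x)) ` A" "countable F" "\<Union>F = \<Union>((\<lambda>x. ball x (d x)) ` A)"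
    using Lindelof[of "(\<lambda>x. ball x (d x)) ` A"] by (metis (no_types, lifting) imageE open_ball)
  have "AE y in lborel. \<forall>B\<in>F. y \<in> B \<longrightarrow> f y = 0"
    unfolding AE_ball_countable[OF F(2)]
  proof
    fix B assume "B \<in> F"
    then obtain x where "x \<in> A" "B = ball x (d x)" using F(1) by blast
    then show "AE y in lborel. y \<in> B \<longrightarrow> f y = 0" using d(2) by simp
  qed
  moreover have "A \<subseteq> \<Union>F" unfolding F(3) using d(1) by auto
  ultimately show ?thesis by (elim eventually_mono) blast
qed

lemma AE_zero_outside_ess_support: "AE x in lborel. x \<notin> ess_support f \<longrightarrow> f x = 0"
  using AE_zero_of_disjoint_ess_support[of f "- ess_support f"] by auto

lemma not_in_ess_support:
  assumes "AE x in lborel. x \<in> U \<longrightarrow> f x = 0" "open U" "x \<in> U"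
  shows "x \<notin> ess_support f"
proof -
  obtain d where "d > 0" "ball x d \<subseteq> U" using assms(2,3) openE by blast
  then have "AE y in lborel. y \<in> ball x d \<longrightarrow> f y = 0" using assms(1) by (elim eventually_mono) blast
  then show ?thesis using \<open>d > 0\<close> by (auto simp: ess_support_def)
qed

lemma integrable_tensor_pair:
  fixes f :: "'a::euclidean_space \<Rightarrow> real" and g :: "'b::euclidean_space \<Rightarrow> real"
  assumes f: "integrable lborel f" and g: "integrable lborel g"
  shows "integrable (lborel \<Otimes>\<^sub>M lborel) (\<lambda>(x, y). f x * g y)"
proof -
  have [measurable]: "f \<in> borel_measurable borel" "g \<in> borel_measurable borel" using f g by auto
  show ?thesis
  proof (rule lborel_pair.Fubini_integrable)
    show "(\<lambda>(x, y). f x * g y) \<in> borel_measurable (lborel \<Otimes>\<^sub>M lborel)" by measurable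
    have "integrable lborel (\<lambda>x. norm (f x) * (\<integral>y. norm (g y) \<partial>lborel))"
      using f by (intro integrable_mult_left integrable_norm)
    then show "integrable lborel (\<lambda>x. \<integral>y. norm (case (x, y) of (x, y) \<Rightarrow> f x * g y) \<partial>lborel)"
      by (simp add: abs_mult)
    show "AE x in lborel. integrable lborel (\<lambda>y. case (x, y) of (x, y) \<Rightarrow> f x * g y)"
      using g by auto
  qed
qed

text \<open>A product of two integrable functions as a bound gives integrability on the product
  space; for oscillating integrands, where only the modulus is under control, this is the usable
  form of the hypothesis.\<close>

lemma Fubini_dominated:
  fixes F :: "'a::euclidean_space \<Rightarrow> 'b::euclidean_space \<Rightarrow> complex"
  assumes F: "case_prod F \<in> borel_measurable (lborel \<Otimes>\<^sub>M lborel)"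
    and f: "integrable lborel f" and g: "integrable lborel g"
    and le: "\<And>x y. cmod (F x y) \<le> f x * g y"
  shows "(LINT y|lborel. LINT x|lborel. F x y) = (LINT x|lborel. LINT y|lborel. F x y)"
proof (rule lborel_pair.Fubini_integral)
  show "integrable (lborel \<Otimes>\<^sub>M lborel) (case_prod F)"
  proof (rule Bochner_Integration.integrable_bound[OF integrable_tensor_pair[OF f g] F])
    show "AE x in lborel \<Otimes>\<^sub>M lborel. norm (case_prod F x) \<le> norm (case x of (x, y) \<Rightarrow> f x * g y)"
      by (rule AE_I2) (use le in \<open>auto intro: order_trans[OF _ abs_ge_self]\<close>)
  qed
qed

section \<open>Fourier multipliers with the Bessel symbol\<close>

text \<open>The chart that carries Fubini's theorem from pairs of reals to vectors of length
  two.\<close>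

definition vec2 :: "real \<times> real \<Rightarrow> real ^ 2" where
  "vec2 p = (\<chi> i. if i = 1 then fst p else snd p)"

lemma vec2_nth [simp]: "vec2 p $ 1 = fst p" "vec2 p $ 2 = snd p"
  by (simp_all add: vec2_def)

lemma UNIV_2_eq: "(UNIV :: 2 set) = {1, 2}"
  by (metis (mono_tags, lifting) UNIV_eq_I exhaust_2 insertCI)

lemma measurable_vec2 [measurable]: "vec2 \<in> borel_measurable borel"
proof (rule borel_measurable_continuous_onI)
  have "continuous_on UNIV (\<lambda>p::real \<times> real. if i = 1 then fst p else snd p)" for i :: 2
    by (cases "i = 1") (auto intro!: continuous_intros)
  then show "continuous_on UNIV vec2" unfolding vec2_def by (intro continuous_on_vec_lambda)
qed

lemma Basis_2: "(Basis :: (real ^ 2) set) = {axis 1 1, axis 2 1}"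
  by (auto simp: Basis_vec_def UNIV_2_eq)

lemma prod_Basis_2: "(\<Prod>b\<in>Basis. (x :: real ^ 2) \<bullet> b) = x $ 1 * x $ 2"
proof -
  have "axis 1 1 \<noteq> (axis 2 1 :: real ^ 2)" by (simp add: axis_eq_axis)
  then show ?thesis by (simp add: Basis_2 inner_axis)
qed

text \<open>Lebesgue measure is determined by its values on boxes, and the chart pulls boxes back to
  rectangles.\<close>

lemma lborel_vec2: "(lborel :: (real ^ 2) measure) = distr lborel borel vec2"
proof (rule lborel_eqI)
  fix l u :: "real ^ 2" assume lu: "\<And>b. b \<in> Basis \<Longrightarrow> l \<bullet> b \<le> u \<bullet> b"
  have lu': "l $ 1 \<le> u $ 1" "l $ 2 \<le> u $ 2"
    using lu[of "axis 1 1"] lu[of "axis 2 1"] by (simp_all add: Basis_2 inner_axis)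
  have "emeasure (distr lborel borel vec2) (box l u) = emeasure lborel (vec2 -` box l u \<inter> space lborel)"
    by (rule emeasure_distr) auto
  also have "vec2 -` box l u \<inter> space lborel = {l $ 1<..<u $ 1} \<times> {l $ 2<..<u $ 2}"
    by (auto simp: mem_box_cart forall_2)
  also have "emeasure lborel \<dots> = emeasure (lborel \<Otimes>\<^sub>M lborel) ({l $ 1<..<u $ 1} \<times> {l $ 2<..<u $ 2})"
    by (simp add: lborel_prod)
  also have "\<dots> = emeasure lborel {l $ 1<..<u $ 1} * emeasure lborel {l $ 2<..<u $ 2}"
    by (intro lborel.emeasure_pair_measure_Times) auto
  also have "\<dots> = ennreal (\<Prod>b\<in>Basis. (u - l) \<bullet> b)"
    using lu' by (simp add: prod_Basis_2 ennreal_mult'')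
  finally show "emeasure (distr lborel borel vec2) (box l u) = ennreal (\<Prod>b\<in>Basis. (u - l) \<bullet> b)" .
qed simp

lemma nn_integral_vec2:
  assumes [measurable]: "f \<in> borel_measurable borel"
  shows "(\<integral>\<^sup>+x. f x \<partial>lborel) = (\<integral>\<^sup>+x. \<integral>\<^sup>+y. f (vec2 (x, y)) \<partial>lborel \<partial>lborel)"
proof -
  have "(\<integral>\<^sup>+x. f x \<partial>lborel) = (\<integral>\<^sup>+p. f (vec2 p) \<partial>lborel)"
    by (subst lborel_vec2, subst nn_integral_distr) auto
  also have "\<dots> = (\<integral>\<^sup>+p. f (vec2 p) \<partial>(lborel \<Otimes>\<^sub>M lborel))" by (simp add: lborel_prod)
  also have "\<dots> = (\<integral>\<^sup>+x. \<integral>\<^sup>+y. f (vec2 (x, y)) \<partial>lborel \<partial>lborel)"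
    by (subst lborel.nn_integral_fst) (simp_all add: lborel_prod)
  finally show ?thesis .
qed

lemma nn_integral_tensor2:
  assumes [measurable]: "f \<in> borel_measurable borel" "g \<in> borel_measurable borel"
  shows "(\<integral>\<^sup>+x. f (x $ 1) * g (x $ 2) \<partial>(lborel :: (real ^ 2) measure)) = (\<integral>\<^sup>+x. f x \<partial>lborel) * (\<integral>\<^sup>+x. g x \<partial>lborel)"
  by (subst nn_integral_vec2) (simp_all add: nn_integral_cmult nn_integral_multc)

lemma
  fixes f g :: "real \<Rightarrow> complex"
  assumes "integrable lborel f" "integrable lborel g"
  shows integrable_tensor2: "integrable lborel (\<lambda>x :: real ^ 2. f (x $ 1) * g (x $ 2))"
    and integral_tensor2: "(LINT x|(lborel :: (real ^ 2) measure). f (x $ 1) * g (x $ 2)) = (LINT x|lborel. f x) * (LINT x|lborel. g x)"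
proof -
  have [measurable]: "f \<in> borel_measurable borel" "g \<in> borel_measurable borel" using assms by auto
  have fin: "(\<integral>\<^sup>+x. norm (f x) \<partial>lborel) < \<infinity>" "(\<integral>\<^sup>+x. norm (g x) \<partial>lborel) < \<infinity>"
    using assms by (auto simp: integrable_iff_bounded)
  have "(\<integral>\<^sup>+x. norm (f (x $ 1) * g (x $ 2)) \<partial>(lborel :: (real ^ 2) measure))
      = (\<integral>\<^sup>+x. ennreal (norm (f (x $ 1))) * ennreal (norm (g (x $ 2))) \<partial>(lborel :: (real ^ 2) measure))"
    by (simp add: norm_mult ennreal_mult)
  also have "\<dots> = (\<integral>\<^sup>+x. norm (f x) \<partial>lborel) * (\<integral>\<^sup>+x. norm (g x) \<partial>lborel)"
    by (rule nn_integral_tensor2) auto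
  also have "\<dots> < \<infinity>" using fin by (simp add: ennreal_mult_less_top)
  finally show int: "integrable lborel (\<lambda>x :: real ^ 2. f (x $ 1) * g (x $ 2))"
    by (intro integrableI_bounded) auto
  have i2: "integrable (lborel \<Otimes>\<^sub>M lborel) (\<lambda>p. f (fst p) * g (snd p))"
  proof -
    have "integrable (distr lborel borel vec2) (\<lambda>x. f (x $ 1) * g (x $ 2))"
      using int unfolding lborel_vec2 .
    then show ?thesis by (subst (asm) integrable_distr_eq) (auto simp: lborel_prod)
  qed
  have "(LINT x|(lborel :: (real ^ 2) measure). f (x $ 1) * g (x $ 2)) = (LINT p|lborel. f (fst p) * g (snd p))"
    by (subst lborel_vec2, subst integral_distr) auto
  also have "\<dots> = (LINT p|(lborel \<Otimes>\<^sub>M lborel). f (fst p) * g (snd p))" by (simp add: lborel_prod)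
  also have "\<dots> = (LINT x|lborel. LINT y|lborel. f x * g y)"
    using lborel_pair.integral_fst'[OF i2] by simp
  also have "\<dots> = (LINT x|lborel. f x) * (LINT x|lborel. g x)" by simp
  finally show "(LINT x|(lborel :: (real ^ 2) measure). f (x $ 1) * g (x $ 2)) = (LINT x|lborel. f x) * (LINT x|lborel. g x)" .
qed

lemma nn_integral_scale2:
  assumes [measurable]: "f \<in> borel_measurable borel" and c: "0 < c"
  shows "(\<integral>\<^sup>+x. f (c *\<^sub>R x) \<partial>(lborel :: (real ^ 2) measure)) = ennreal (1 / c\<^sup>2) * (\<integral>\<^sup>+x. f x \<partial>lborel)"
proof -
  have "(\<integral>\<^sup>+x. f x \<partial>lborel) = ennreal (c\<^sup>2) * (\<integral>\<^sup>+x. f (c *\<^sub>R x) \<partial>(lborel :: (real ^ 2) measure))"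
    using c by (subst lborel_affine[where c=c and t=0]) (auto simp: nn_integral_density nn_integral_distr nn_integral_cmult)
  moreover have "ennreal (1 / c\<^sup>2) * ennreal (c\<^sup>2) = 1" using c by (simp flip: ennreal_mult)
  ultimately show ?thesis by (simp flip: mult.assoc)
qed

lemma nn_integral_lborel_translate:
  fixes f :: "'a::euclidean_space \<Rightarrow> ennreal"
  assumes [measurable]: "f \<in> borel_measurable borel"
  shows "(\<integral>\<^sup>+x. f (x - a) \<partial>lborel) = (\<integral>\<^sup>+x. f x \<partial>lborel)"
proof -
  have "(\<integral>\<^sup>+x. f x \<partial>lborel) = (\<integral>\<^sup>+x. f x \<partial>distr lborel borel ((+) (- a)))"
    by (simp add: lborel_distr_plus)
  also have "\<dots> = (\<integral>\<^sup>+x. f (x - a) \<partial>lborel)" by (subst nn_integral_distr) auto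
  finally show ?thesis by simp
qed

section \<open>Plancherel's inequality on a disc\<close>

lemma measurable_cis [measurable]: "cis \<in> borel_measurable borel"
  by (intro borel_measurable_continuous_onI continuous_intros)

lemma measurable_inverse_fourier [measurable]:
  assumes [measurable]: "H \<in> borel_measurable borel"
  shows "inverse_fourier H \<in> borel_measurable borel"
proof -
  have "(\<lambda>x. LINT \<xi>|lborel. cis (2 * pi * (\<xi> \<bullet> x)) * H \<xi>) \<in> borel_measurable lborel"
    by (rule lborel.borel_measurable_lebesgue_integral) measurable
  then show ?thesis unfolding inverse_fourier_def[abs_def] by simp
qed

lemma inverse_fourier_bound: "cmod (inverse_fourier H t) \<le> (LINT \<xi>|lborel. cmod (H \<xi>))"
proof -
  have "cmod (inverse_fourier H t) \<le> (LINT \<xi>|lborel. cmod (cis (2 * pi * (\<xi> \<bullet> t)) * H \<xi>))"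
    unfolding inverse_fourier_def by (rule integral_norm_bound)
  then show ?thesis by (simp add: norm_mult)
qed

text \<open>A substitute for Plancherel's inequality that needs no limit: the weight \<open>\<rho>\<close> has a positive
  integrable Fourier transform, so the weighted square norm is a double integral to which Schur's
  test applies.\<close>

lemma weighted_plancherel:
  fixes H :: "'a::euclidean_space \<Rightarrow> complex"
  assumes H: "integrable lborel H" "H \<in> Ltwo" and \<rho>: "integrable lborel \<rho>" "\<And>t. 0 \<le> \<rho> t"
    and k[measurable]: "k \<in> borel_measurable borel" and kpos: "\<And>v. 0 \<le> k v" and keven: "\<And>v. k (- v) = k v"
    and \<rho>k: "\<And>v. cmod (LINT t|lborel. of_real (\<rho> t) * cis (2 * pi * (v \<bullet> t))) \<le> k v"
    and \<kappa>: "(\<integral>\<^sup>+v. ennreal (k v) \<partial>lborel) \<le> ennreal \<kappa>" "0 \<le> \<kappa>"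
  shows "integrable lborel (\<lambda>t. \<rho> t * (cmod (inverse_fourier H t))\<^sup>2)"
    and "(LINT t|lborel. \<rho> t * (cmod (inverse_fourier H t))\<^sup>2) \<le> \<kappa> * (Ltwo_norm H)\<^sup>2"
proof -
  have [measurable]: "H \<in> borel_measurable borel" "\<rho> \<in> borel_measurable borel" using H \<rho> by auto
  let ?w = "inverse_fourier H"
  define B where "B = (LINT \<xi>|lborel. cmod (H \<xi>))"
  have wB: "cmod (?w t) \<le> B" for t unfolding B_def by (rule inverse_fourier_bound)
  have B0: "0 \<le> B" using wB[of 0] norm_ge_zero order_trans by blast
  have nH: "integrable lborel (\<lambda>\<xi>. cmod (H \<xi>))" using H by simp
  show int: "integrable lborel (\<lambda>t. \<rho> t * (cmod (?w t))\<^sup>2)"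
  proof (rule Bochner_Integration.integrable_bound)
    show "integrable lborel (\<lambda>t. \<rho> t * B\<^sup>2)" using \<rho> by simp
    show "AE t in lborel. norm (\<rho> t * (cmod (?w t))\<^sup>2) \<le> norm (\<rho> t * B\<^sup>2)"
      using \<rho>(2) wB by (intro AE_I2) (auto simp: abs_mult intro!: mult_left_mono power_mono)
  qed measurable
  define R where "R v = (LINT t|lborel. of_real (\<rho> t) * cis (2 * pi * (v \<bullet> t)))" for v
  have inner: "(LINT t|lborel. of_real (\<rho> t) * ?w t * cis (- (2 * pi * (\<xi>' \<bullet> t)))) = (LINT \<xi>|lborel. H \<xi> * R (\<xi> - \<xi>'))" for \<xi>'
  proof -
    have "(LINT t|lborel. of_real (\<rho> t) * ?w t * cis (- (2 * pi * (\<xi>' \<bullet> t))))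
      = (LINT t|lborel. LINT \<xi>|lborel. of_real (\<rho> t) * (cis (2 * pi * (\<xi> \<bullet> t)) * H \<xi>) * cis (- (2 * pi * (\<xi>' \<bullet> t))))"
      unfolding inverse_fourier_def by simp
    also have "\<dots> = (LINT \<xi>|lborel. LINT t|lborel. of_real (\<rho> t) * (cis (2 * pi * (\<xi> \<bullet> t)) * H \<xi>) * cis (- (2 * pi * (\<xi>' \<bullet> t))))"
      by (rule Fubini_dominated[OF _ nH \<rho>(1)]) (use \<rho>(2) in \<open>auto simp: norm_mult\<close>)
    also have "\<dots> = (LINT \<xi>|lborel. LINT t|lborel. H \<xi> * (of_real (\<rho> t) * cis (2 * pi * ((\<xi> - \<xi>') \<bullet> t))))"
    proof -
      have c: "cis (2 * pi * ((\<xi> - \<xi>') \<bullet> t)) = cis (2 * pi * (\<xi> \<bullet> t)) * cis (- (2 * pi * (\<xi>' \<bullet> t)))" for \<xi> t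
        by (simp add: cis_mult inner_diff_left right_diff_distrib)
      show ?thesis unfolding c by (simp add: mult_ac)
    qed
    also have "\<dots> = (LINT \<xi>|lborel. H \<xi> * R (\<xi> - \<xi>'))" by (simp add: R_def)
    finally show ?thesis .
  qed
  have cnjw: "cnj (?w t) = (LINT \<xi>'|lborel. cis (- (2 * pi * (\<xi>' \<bullet> t))) * cnj (H \<xi>'))" for t
    unfolding inverse_fourier_def by (subst Bochner_Integration.integral_cnj[symmetric]) (simp add: cis_cnj)
  have "complex_of_real (LINT t|lborel. \<rho> t * (cmod (?w t))\<^sup>2) = (LINT t|lborel. of_real (\<rho> t) * (?w t * cnj (?w t)))"
    by (subst integral_complex_of_real[symmetric]) (simp add: complex_norm_square del: of_real_power)
  also have "\<dots> = (LINT t|lborel. LINT \<xi>'|lborel. of_real (\<rho> t) * ?w t * (cis (- (2 * pi * (\<xi>' \<bullet> t))) * cnj (H \<xi>')))"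
    unfolding cnjw by (simp add: mult.assoc)
  also have "\<dots> = (LINT \<xi>'|lborel. LINT t|lborel. of_real (\<rho> t) * ?w t * (cis (- (2 * pi * (\<xi>' \<bullet> t))) * cnj (H \<xi>')))"
  proof (rule Fubini_dominated[OF _ nH, where g="\<lambda>t. B * \<rho> t"])
    show "integrable lborel (\<lambda>t. B * \<rho> t)" using \<rho>(1) by simp
    show "cmod (of_real (\<rho> t) * ?w t * (cis (- (2 * pi * (\<xi>' \<bullet> t))) * cnj (H \<xi>'))) \<le> cmod (H \<xi>') * (B * \<rho> t)" for \<xi>' t
    proof -
      have "cmod (?w t) * (\<rho> t * cmod (H \<xi>')) \<le> B * (\<rho> t * cmod (H \<xi>'))"
        using wB \<rho>(2) by (intro mult_right_mono) auto
      then show ?thesis using \<rho>(2)[of t] by (simp add: norm_mult mult_ac)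
    qed
  qed measurable
  also have "\<dots> = (LINT \<xi>'|lborel. cnj (H \<xi>') * (LINT t|lborel. of_real (\<rho> t) * ?w t * cis (- (2 * pi * (\<xi>' \<bullet> t)))))"
    by (simp add: mult_ac flip: Bochner_Integration.integral_mult_right_zero)
  also have "\<dots> = (LINT \<xi>'|lborel. cnj (H \<xi>') * (LINT \<xi>|lborel. H \<xi> * R (\<xi> - \<xi>')))"
    unfolding inner ..
  finally have eq: "complex_of_real (LINT t|lborel. \<rho> t * (cmod (?w t))\<^sup>2)
     = (LINT \<xi>'|lborel. cnj (H \<xi>') * (LINT \<xi>|lborel. H \<xi> * R (\<xi> - \<xi>')))" .
  \<comment> \<open>The Bochner integral of a non-integrable function is 0, so this bound holds for
    every \<open>f\<close>, and nothing about integrability of the double integral has to be known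
    beforehand.\<close>
  have nn_bound: "ennreal (cmod (LINT x|lborel. f x)) \<le> (\<integral>\<^sup>+x. ennreal (cmod (f x)) \<partial>lborel)" for f :: "'a \<Rightarrow> complex"
  proof (cases "integrable lborel f")
    case True
    then show ?thesis using integral_norm_bound_ennreal by blast
  next
    case False
    then show ?thesis by (simp add: not_integrable_integral_eq)
  qed
  have "ennreal (LINT t|lborel. \<rho> t * (cmod (?w t))\<^sup>2) = ennreal (cmod (complex_of_real (LINT t|lborel. \<rho> t * (cmod (?w t))\<^sup>2)))"
    using \<rho>(2) by (simp add: integral_nonneg_AE)
  also have "\<dots> \<le> (\<integral>\<^sup>+\<xi>'. ennreal (cmod (cnj (H \<xi>') * (LINT \<xi>|lborel. H \<xi> * R (\<xi> - \<xi>')))) \<partial>lborel)"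
    unfolding eq by (rule nn_bound)
  \<comment> \<open>The product of the two values of \<open>H\<close> is split by the
    arithmetic-geometric mean; since \<open>k\<close> is even, both halves give the same
    integral.\<close>
  also have "\<dots> \<le> (\<integral>\<^sup>+\<xi>'. \<integral>\<^sup>+\<xi>. ennreal ((cmod (H \<xi>'))\<^sup>2 / 2) * ennreal (k (\<xi> - \<xi>')) + ennreal ((cmod (H \<xi>))\<^sup>2 / 2) * ennreal (k (\<xi> - \<xi>')) \<partial>lborel \<partial>lborel)"
  proof (rule nn_integral_mono)
    fix \<xi>' :: 'a
    have "ennreal (cmod (cnj (H \<xi>') * (LINT \<xi>|lborel. H \<xi> * R (\<xi> - \<xi>'))))
       = ennreal (cmod (LINT \<xi>|lborel. cnj (H \<xi>') * (H \<xi> * R (\<xi> - \<xi>'))))" by simp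
    also have "\<dots> \<le> (\<integral>\<^sup>+\<xi>. ennreal (cmod (cnj (H \<xi>') * (H \<xi> * R (\<xi> - \<xi>')))) \<partial>lborel)" by (rule nn_bound)
    also have "\<dots> \<le> (\<integral>\<^sup>+\<xi>. ennreal ((cmod (H \<xi>'))\<^sup>2 / 2) * ennreal (k (\<xi> - \<xi>')) + ennreal ((cmod (H \<xi>))\<^sup>2 / 2) * ennreal (k (\<xi> - \<xi>')) \<partial>lborel)"
    proof (rule nn_integral_mono)
      fix \<xi> :: 'a
      have "cmod (cnj (H \<xi>') * (H \<xi> * R (\<xi> - \<xi>'))) = (cmod (H \<xi>') * cmod (H \<xi>)) * cmod (R (\<xi> - \<xi>'))"
        by (simp add: norm_mult)
      also have "\<dots> \<le> ((cmod (H \<xi>'))\<^sup>2 / 2 + (cmod (H \<xi>))\<^sup>2 / 2) * k (\<xi> - \<xi>')"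
      proof (intro mult_mono)
        show "cmod (H \<xi>') * cmod (H \<xi>) \<le> (cmod (H \<xi>'))\<^sup>2 / 2 + (cmod (H \<xi>))\<^sup>2 / 2"
          using zero_le_power2[of "cmod (H \<xi>') - cmod (H \<xi>)"] unfolding power2_diff by simp
        show "cmod (R (\<xi> - \<xi>')) \<le> k (\<xi> - \<xi>')" unfolding R_def by (rule \<rho>k)
      qed auto
      finally show "ennreal (cmod (cnj (H \<xi>') * (H \<xi> * R (\<xi> - \<xi>')))) \<le> ennreal ((cmod (H \<xi>'))\<^sup>2 / 2) * ennreal (k (\<xi> - \<xi>')) + ennreal ((cmod (H \<xi>))\<^sup>2 / 2) * ennreal (k (\<xi> - \<xi>'))"
        using kpos by (simp add: distrib_right flip: ennreal_mult ennreal_plus)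
    qed
    finally show "ennreal (cmod (cnj (H \<xi>') * (LINT \<xi>|lborel. H \<xi> * R (\<xi> - \<xi>'))))
      \<le> (\<integral>\<^sup>+\<xi>. ennreal ((cmod (H \<xi>'))\<^sup>2 / 2) * ennreal (k (\<xi> - \<xi>')) + ennreal ((cmod (H \<xi>))\<^sup>2 / 2) * ennreal (k (\<xi> - \<xi>')) \<partial>lborel)" .
  qed
  also have "\<dots> = (\<integral>\<^sup>+\<xi>'. \<integral>\<^sup>+\<xi>. ennreal ((cmod (H \<xi>'))\<^sup>2 / 2) * ennreal (k (\<xi> - \<xi>')) \<partial>lborel \<partial>lborel)
      + (\<integral>\<^sup>+\<xi>'. \<integral>\<^sup>+\<xi>. ennreal ((cmod (H \<xi>))\<^sup>2 / 2) * ennreal (k (\<xi> - \<xi>')) \<partial>lborel \<partial>lborel)"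
    by (subst nn_integral_add[symmetric]) (auto intro!: nn_integral_cong nn_integral_add)
  also have "(\<integral>\<^sup>+\<xi>'. \<integral>\<^sup>+\<xi>. ennreal ((cmod (H \<xi>))\<^sup>2 / 2) * ennreal (k (\<xi> - \<xi>')) \<partial>lborel \<partial>lborel)
      = (\<integral>\<^sup>+\<xi>. \<integral>\<^sup>+\<xi>'. ennreal ((cmod (H \<xi>))\<^sup>2 / 2) * ennreal (k (\<xi> - \<xi>')) \<partial>lborel \<partial>lborel)"
    by (rule lborel_pair.Fubini') measurable
  also have "\<dots> = (\<integral>\<^sup>+\<xi>'. \<integral>\<^sup>+\<xi>. ennreal ((cmod (H \<xi>'))\<^sup>2 / 2) * ennreal (k (\<xi> - \<xi>')) \<partial>lborel \<partial>lborel)"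
  proof -
    have "k (\<xi> - \<xi>') = k (\<xi>' - \<xi>)" for \<xi> \<xi>' using keven[of "\<xi> - \<xi>'"] by simp
    then show ?thesis by (intro nn_integral_cong) simp
  qed
  also have "(\<integral>\<^sup>+\<xi>'. \<integral>\<^sup>+\<xi>. ennreal ((cmod (H \<xi>'))\<^sup>2 / 2) * ennreal (k (\<xi> - \<xi>')) \<partial>lborel \<partial>lborel)
      = (\<integral>\<^sup>+\<xi>'. ennreal ((cmod (H \<xi>'))\<^sup>2 / 2) \<partial>lborel) * (\<integral>\<^sup>+v. ennreal (k v) \<partial>lborel)"
    by (simp add: nn_integral_cmult nn_integral_multc nn_integral_lborel_translate[of "\<lambda>v. ennreal (k v)"])
  also have "(\<integral>\<^sup>+\<xi>'. ennreal ((cmod (H \<xi>'))\<^sup>2 / 2) \<partial>lborel) = ennreal ((Ltwo_norm H)\<^sup>2 / 2)"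
    unfolding Ltwo_norm_square using LtwoD(3)[OF H(2)] by (subst nn_integral_eq_integral) auto
  also have "ennreal ((Ltwo_norm H)\<^sup>2 / 2) * (\<integral>\<^sup>+v. ennreal (k v) \<partial>lborel) + ennreal ((Ltwo_norm H)\<^sup>2 / 2) * (\<integral>\<^sup>+v. ennreal (k v) \<partial>lborel)
     \<le> ennreal ((Ltwo_norm H)\<^sup>2 / 2) * ennreal \<kappa> + ennreal ((Ltwo_norm H)\<^sup>2 / 2) * ennreal \<kappa>"
    by (intro add_mono mult_left_mono \<kappa>) auto
  also have "\<dots> = ennreal (\<kappa> * (Ltwo_norm H)\<^sup>2)" using \<kappa>(2) by (simp flip: ennreal_mult ennreal_plus)
  finally show "(LINT t|lborel. \<rho> t * (cmod (?w t))\<^sup>2) \<le> \<kappa> * (Ltwo_norm H)\<^sup>2"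
    using \<kappa>(2) by (subst (asm) ennreal_le_iff) auto
qed

lemma inner_vec2: "(x :: real ^ 2) \<bullet> y = x $ 1 * y $ 1 + x $ 2 * y $ 2"
  by (simp add: inner_vec_def UNIV_2_eq)

text \<open>The characteristic function of the standard normal law at \<open>2 * pi * N * v\<close>,
  after the substitution t = N x.\<close>

lemma gaussian_fourier:
  assumes "0 < N"
  shows "integrable lborel (\<lambda>t. of_real (std_normal_density (t / N)) * cis (2 * pi * (v * t)))"
    and "(LINT t|lborel. of_real (std_normal_density (t / N)) * cis (2 * pi * (v * t))) = of_real (N * exp (- (2 * pi * N * v)\<^sup>2 / 2))"
proof -
  have i0: "integrable lborel (\<lambda>x. of_real (std_normal_density x) * cis (2 * pi * N * v * x))"
  proof (rule Bochner_Integration.integrable_bound)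
    show "integrable lborel std_normal_density" by simp
    show "AE x in lborel. norm (of_real (std_normal_density x) * cis (2 * pi * N * v * x)) \<le> norm (std_normal_density x)"
      by (simp add: norm_mult)
  qed measurable
  have c: "(LINT x|lborel. of_real (std_normal_density x) * cis (2 * pi * N * v * x)) = of_real (exp (- (2 * pi * N * v)\<^sup>2 / 2))"
  proof -
    have "(LINT x|lborel. of_real (std_normal_density x) * cis (2 * pi * N * v * x)) = char std_normal_distribution (2 * pi * N * v)"
      unfolding char_def by (subst integral_density) (auto simp: cis_conv_exp scaleR_conv_of_real)
    then show ?thesis by (simp add: char_std_normal_distribution)
  qed
  have eq: "of_real (std_normal_density (t / N)) * cis (2 * pi * (v * t))
     = (\<lambda>x. of_real (std_normal_density x) * cis (2 * pi * N * v * x)) (0 + (1 / N) * t)" for t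
    using assms by (simp add: field_simps)
  show "integrable lborel (\<lambda>t. of_real (std_normal_density (t / N)) * cis (2 * pi * (v * t)))"
    unfolding eq by (rule lborel_integrable_real_affine[OF i0]) (use assms in simp)
  have "(LINT x|lborel. of_real (std_normal_density x) * cis (2 * pi * N * v * x))
     = \<bar>1 / N\<bar> *\<^sub>R (LINT t|lborel. of_real (std_normal_density (t / N)) * cis (2 * pi * (v * t)))"
    unfolding eq by (rule lborel_integral_real_affine) (use assms in simp)
  then show "(LINT t|lborel. of_real (std_normal_density (t / N)) * cis (2 * pi * (v * t))) = of_real (N * exp (- (2 * pi * N * v)\<^sup>2 / 2))"
    unfolding c using assms by (simp add: scaleR_conv_of_real field_simps)
qed

text \<open>The mass does not depend on \<open>N\<close>; this is what makes the constant of
  \<open>plancherel_disc\<close> uniform in the radius.\<close>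

lemma nn_integral_gaussian:
  assumes "0 < N"
  shows "(\<integral>\<^sup>+v. ennreal (N * exp (- (2 * pi * N * v)\<^sup>2 / 2)) \<partial>lborel) = ennreal (1 / sqrt (2 * pi))"
proof -
  have "(\<integral>\<^sup>+x. ennreal (std_normal_density x) \<partial>lborel) = 1"
    by (subst nn_integral_eq_integral) auto
  also have "(\<integral>\<^sup>+x. ennreal (std_normal_density x) \<partial>lborel) = ennreal \<bar>2 * pi * N\<bar> * (\<integral>\<^sup>+v. ennreal (std_normal_density (0 + (2 * pi * N) * v)) \<partial>lborel)"
    by (rule nn_integral_real_affine) (use assms in auto)
  finally have 1: "ennreal (2 * pi * N) * (\<integral>\<^sup>+v. ennreal (std_normal_density (2 * pi * N * v)) \<partial>lborel) = 1"
    using assms by simp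
  have "N * exp (- (2 * pi * N * v)\<^sup>2 / 2) = (1 / sqrt (2 * pi)) * (2 * pi * N) * std_normal_density (2 * pi * N * v)" for v
  proof -
    have "sqrt (2 * pi) * sqrt (2 * pi) = 2 * pi" by simp
    then show ?thesis unfolding std_normal_density_def by (simp add: field_simps)
  qed
  then have "(\<integral>\<^sup>+v. ennreal (N * exp (- (2 * pi * N * v)\<^sup>2 / 2)) \<partial>lborel)
     = (\<integral>\<^sup>+v. ennreal (1 / sqrt (2 * pi)) * (ennreal (2 * pi * N) * ennreal (std_normal_density (2 * pi * N * v))) \<partial>lborel)"
    using assms by (simp add: mult.assoc flip: ennreal_mult)
  also have "\<dots> = ennreal (1 / sqrt (2 * pi)) * (ennreal (2 * pi * N) * (\<integral>\<^sup>+v. ennreal (std_normal_density (2 * pi * N * v)) \<partial>lborel))"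
    by (simp add: nn_integral_cmult)
  finally show ?thesis unfolding 1 by simp
qed

text \<open>A Gaussian of width \<open>N\<close> is at least \<open>exp (- 1) / (2 * pi)\<close> on
  the disc of radius \<open>N\<close>, while its Fourier transform has mass
  \<open>1 / (2 * pi)\<close>. The quotient is the constant e, the same for all radii.\<close>

lemma plancherel_disc:
  fixes H :: "real ^ 2 \<Rightarrow> complex"
  assumes H: "integrable lborel H" "H \<in> Ltwo" and N: "0 < N"
  shows "(LINT t|lborel. indicator (cball 0 N) t * (cmod (inverse_fourier H t))\<^sup>2) \<le> exp 1 * (Ltwo_norm H)\<^sup>2"
proof -
  define n where "n t = std_normal_density (t / N)" for t
  define \<rho> where "\<rho> t = n (t $ 1) * n (t $ 2)" for t :: "real ^ 2"
  define k1 where "k1 v = N * exp (- (2 * pi * N * v)\<^sup>2 / 2)" for v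
  define k where "k v = k1 (v $ 1) * k1 (v $ 2)" for v :: "real ^ 2"
  have [measurable]: "n \<in> borel_measurable borel" "k1 \<in> borel_measurable borel"
    unfolding n_def k1_def by measurable
  have n0: "0 \<le> n t" "0 \<le> k1 t" for t using N by (auto simp: n_def k1_def)
  have ni: "integrable lborel (\<lambda>t. complex_of_real (n t))"
    using gaussian_fourier(1)[OF N, of 0] by (simp add: n_def)
  have \<rho>i: "integrable lborel \<rho>"
    using integrable_norm[OF integrable_tensor2[OF ni ni]] n0 by (simp add: \<rho>_def[abs_def] norm_mult)
  have eq: "of_real (\<rho> t) * cis (2 * pi * (v \<bullet> t)) = (of_real (n (t $ 1)) * cis (2 * pi * (v $ 1 * t $ 1))) * (of_real (n (t $ 2)) * cis (2 * pi * (v $ 2 * t $ 2)))" for t v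
    by (simp add: \<rho>_def inner_vec2 distrib_left mult_ac flip: cis_mult)
  have R: "(LINT t|lborel. of_real (\<rho> t) * cis (2 * pi * (v \<bullet> t))) = of_real (k v)" for v
    unfolding eq n_def by (subst integral_tensor2[OF gaussian_fourier(1)[OF N] gaussian_fourier(1)[OF N]])
      (simp add: gaussian_fourier(2)[OF N] k_def k1_def)
  have "(\<integral>\<^sup>+v. ennreal (k v) \<partial>lborel) = (\<integral>\<^sup>+v. ennreal (k1 (v $ 1)) * ennreal (k1 (v $ 2)) \<partial>(lborel :: (real ^ 2) measure))"
    unfolding k_def using n0 by (simp add: ennreal_mult)
  also have "\<dots> = ennreal (1 / sqrt (2 * pi)) * ennreal (1 / sqrt (2 * pi))"
  proof -
    have "(\<integral>\<^sup>+v. ennreal (k1 v) \<partial>lborel) = ennreal (1 / sqrt (2 * pi))"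
      unfolding k1_def by (rule nn_integral_gaussian[OF N])
    then show ?thesis by (subst nn_integral_tensor2) simp_all
  qed
  also have "\<dots> = ennreal (1 / (2 * pi))" by (simp flip: ennreal_mult)
  finally have kk: "(\<integral>\<^sup>+v. ennreal (k v) \<partial>lborel) \<le> ennreal (1 / (2 * pi))" by simp
  have kmeas: "k \<in> borel_measurable borel" unfolding k_def[abs_def] by measurable
  have k0: "0 \<le> k v" "0 \<le> \<rho> v" for v using n0 by (simp_all add: k_def \<rho>_def)
  have keven: "k (- v) = k v" for v by (simp add: k_def k1_def)
  have Rk: "cmod (LINT t|lborel. of_real (\<rho> t) * cis (2 * pi * (v \<bullet> t))) \<le> k v" for v
    unfolding R using k0(1)[of v] by (simp only: norm_of_real abs_of_nonneg)
  note wp = weighted_plancherel[OF H \<rho>i k0(2) kmeas k0(1) keven Rk kk]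
  have ge: "indicator (cball 0 N) t \<le> 2 * pi * exp 1 * \<rho> t" for t
  proof (cases "t \<in> cball 0 N")
    case True
    have h: "exp (- 1 / 2) / sqrt (2 * pi) \<le> n (t $ i)" for i
    proof -
      have "\<bar>t $ i\<bar> \<le> N" using component_le_norm_cart[of t i] True by simp
      then have "(t $ i / N)\<^sup>2 \<le> 1" using N by (simp add: power_divide abs_le_square_iff[symmetric] divide_le_eq_1)
      then show ?thesis unfolding n_def std_normal_density_def by (simp add: divide_right_mono)
    qed
    have "(exp (- 1 / 2) / sqrt (2 * pi)) * (exp (- 1 / 2) / sqrt (2 * pi)) \<le> \<rho> t"
      unfolding \<rho>_def by (intro mult_mono h n0) auto
    also have "(exp (- 1 / 2) / sqrt (2 * pi)) * (exp (- 1 / 2) / sqrt (2 * pi)) = exp (- 1) / (2 * pi)"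
      by (simp flip: exp_add)
    finally have "2 * pi * exp 1 * (exp (- 1) / (2 * pi)) \<le> 2 * pi * exp 1 * \<rho> t" by (intro mult_left_mono) auto
    moreover have "2 * pi * exp 1 * (exp (- 1) / (2 * pi)) = (1 :: real)" by (simp add: exp_minus)
    ultimately have "1 \<le> 2 * pi * exp 1 * \<rho> t" by (simp only:)
    then show ?thesis using True by simp
  next
    case False
    then show ?thesis using n0 by (simp add: \<rho>_def)
  qed
  note [measurable] = LtwoD(2)[OF H(2)]
  have [measurable]: "\<rho> \<in> borel_measurable borel" using \<rho>i by auto
  have i2: "integrable lborel (\<lambda>t. 2 * pi * exp 1 * (\<rho> t * (cmod (inverse_fourier H t))\<^sup>2))" using wp(1) by simp
  have le: "indicator (cball 0 N) t * (cmod (inverse_fourier H t))\<^sup>2 \<le> 2 * pi * exp 1 * (\<rho> t * (cmod (inverse_fourier H t))\<^sup>2)" for t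
    using mult_right_mono[OF ge[of t], of "(cmod (inverse_fourier H t))\<^sup>2"] by (simp add: mult.assoc)
  have "(LINT t|lborel. indicator (cball 0 N) t * (cmod (inverse_fourier H t))\<^sup>2) \<le> (LINT t|lborel. 2 * pi * exp 1 * (\<rho> t * (cmod (inverse_fourier H t))\<^sup>2))"
    by (rule integral_mono'[OF i2 le]) (use k0 in \<open>auto intro!: mult_nonneg_nonneg\<close>)
  also have "\<dots> = 2 * pi * exp 1 * (LINT t|lborel. \<rho> t * (cmod (inverse_fourier H t))\<^sup>2)" by simp
  also have "\<dots> \<le> 2 * pi * exp 1 * (1 / (2 * pi) * (Ltwo_norm H)\<^sup>2)" by (intro mult_left_mono wp(2)) auto
  finally show ?thesis by simp
qed

section \<open>Trigonometric polynomials against the Bessel symbol\<close>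

lemma integral_cis_period:
  fixes k :: int and T :: nat
  assumes "k \<noteq> 0"
  shows "(LINT x|lborel. indicator {- real T..real T} x *\<^sub>R cis (2 * pi * (of_int k * x))) = 0"
proof -
  define F where "F x = cis (2 * pi * (of_int k * x)) / (\<i> * of_real (2 * pi * of_int k))" for x :: real
  have nz: "\<i> * of_real (2 * pi * of_int k) \<noteq> 0" using assms by auto
  have "(LINT x|lborel. indicator {- real T..real T} x *\<^sub>R cis (2 * pi * (of_int k * x))) = F (real T) - F (- real T)"
  proof (rule integral_FTC_Icc)
    show "- real T \<le> real T" by simp
    fix x :: real
    have "((\<lambda>x. cis (2 * pi * (of_int k * x))) has_vector_derivative (2 * pi * of_int k) *\<^sub>R (\<i> * cis (2 * pi * (of_int k * x)))) (at x within {- real T..real T})"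
    proof -
      have "((\<lambda>x. exp (\<i> * of_real (2 * pi * of_int k) * of_real x)) has_vector_derivative (\<i> * of_real (2 * pi * of_int k) * exp (\<i> * of_real (2 * pi * of_int k) * of_real x))) (at x within {- real T..real T})"
        by (rule has_vector_derivative_at_within) (auto intro!: derivative_eq_intros has_vector_derivative_real_field simp: mult_ac)
      then show ?thesis unfolding cis_conv_exp by (simp add: scaleR_conv_of_real mult_ac)
    qed
    from has_vector_derivative_divide[OF this, of "\<i> * of_real (2 * pi * of_int k)"]
    show "(F has_vector_derivative cis (2 * pi * (of_int k * x))) (at x within {- real T..real T})"
      unfolding F_def using nz by (simp add: scaleR_conv_of_real field_simps)
    show "continuous_on {- real T..real T} (\<lambda>x. cis (2 * pi * (of_int k * x)))" by (intro continuous_intros)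
  qed
  moreover have "F (real T) = F (- real T)"
  proof -
    have "cis (2 * pi * (of_int k * real T)) = cis (2 * pi * of_int (k * int T))" by simp
    also have "\<dots> = 1" by (rule cis_multiple_2pi) auto
    finally have a: "cis (2 * pi * (of_int k * real T)) = 1" .
    have "cis (2 * pi * (of_int k * - real T)) = cis (2 * pi * of_int (- k * int T))" by simp
    also have "\<dots> = 1" by (rule cis_multiple_2pi) auto
    finally have b: "cis (2 * pi * (of_int k * - real T)) = 1" .
    show ?thesis unfolding F_def a b ..
  qed
  ultimately show ?thesis by simp
qed

text \<open>The interval consists of \<open>2 * T\<close> full periods, so the exponentials divided
  by \<open>sqrt (2 * real T)\<close> are orthonormal on it. The statement uses
  \<open>ennreal\<close> because it is iterated inside a second integral.\<close>

lemma trig_poly_interval: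
  fixes a :: "int \<Rightarrow> complex" and T :: nat
  assumes F: "finite F" and T: "0 < T"
  shows "(\<integral>\<^sup>+x. indicator {- real T..real T} x * ennreal ((cmod (\<Sum>n\<in>F. a n * cis (2 * pi * (of_int n * x))))\<^sup>2) \<partial>lborel)
     = ennreal (2 * real T * (\<Sum>n\<in>F. (cmod (a n))\<^sup>2))"
proof -
  define e where "e n x = indicator {- real T..real T} x *\<^sub>R cis (2 * pi * (of_int n * x)) / of_real (sqrt (2 * real T))" for n :: int and x :: real
  have sq: "sqrt (2 * real T) \<noteq> 0" using T by simp
  have em[measurable]: "e n \<in> borel_measurable borel" for n unfolding e_def by measurable
  have eL: "e n \<in> Ltwo" for n
  proof (rule Ltwo_bounded_by)
    show "integrable lborel (\<lambda>x. indicator {- real T..real T} x * (1 / (2 * real T)) :: real)"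
      by (intro integrable_mult_left integrable_real_indicator) auto
    show "AE x in lborel. (cmod (e n x))\<^sup>2 \<le> indicator {- real T..real T} x * (1 / (2 * real T))"
      by (rule AE_I2) (auto simp: e_def norm_divide power_divide indicator_def)
  qed measurable
  have on: "Ltwo_inner (e n) (e k) = (if n = k then 1 else 0)" for n k
  proof -
    have "e n x * cnj (e k x) = (indicator {- real T..real T} x *\<^sub>R cis (2 * pi * (of_int (n - k) * x))) / of_real (2 * real T)" for x
    proof -
      have "cis (2 * pi * (of_int (n - k) * x)) = cis (2 * pi * (of_int n * x)) * cnj (cis (2 * pi * (of_int k * x)))"
        by (simp add: cis_cnj cis_mult left_diff_distrib right_diff_distrib)
      moreover have "complex_of_real (sqrt (2 * real T)) * complex_of_real (sqrt (2 * real T)) = of_real (2 * real T)"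
        by (simp only: of_real_mult[symmetric]) simp
      ultimately show ?thesis by (auto simp: e_def indicator_def divide_simps mult_ac)
    qed
    then have "Ltwo_inner (e n) (e k) = (LINT x|lborel. indicator {- real T..real T} x *\<^sub>R cis (2 * pi * (of_int (n - k) * x))) / of_real (2 * real T)"
      unfolding Ltwo_inner_def by simp
    moreover have "(LINT x|lborel. indicator {- real T..real T} x *\<^sub>R (1::complex)) = of_real (2 * real T)"
      using T by (subst integral_scaleR_left) (auto simp: scaleR_conv_of_real)
    ultimately show ?thesis using integral_cis_period[of "n - k" T] T by auto
  qed
  have "(\<Sum>n\<in>F. (of_real (sqrt (2 * real T)) * a n) * e n x) = indicator {- real T..real T} x *\<^sub>R (\<Sum>n\<in>F. a n * cis (2 * pi * (of_int n * x)))" for x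
    unfolding scaleR_sum_right using sq by (intro sum.cong) (auto simp: e_def indicator_def)
  moreover have "(Ltwo_norm (\<lambda>x. \<Sum>n\<in>F. (of_real (sqrt (2 * real T)) * a n) * e n x))\<^sup>2 = (\<Sum>n\<in>F. (cmod (of_real (sqrt (2 * real T)) * a n))\<^sup>2)"
    by (rule orthonormal_sum_square[OF F eL on])
  ultimately have n: "(Ltwo_norm (\<lambda>x. indicator {- real T..real T} x *\<^sub>R (\<Sum>n\<in>F. a n * cis (2 * pi * (of_int n * x)))))\<^sup>2 = 2 * real T * (\<Sum>n\<in>F. (cmod (a n))\<^sup>2)"
    by (simp add: norm_mult power_mult_distrib sum_distrib_left)
  have L: "(\<lambda>x. indicator {- real T..real T} x *\<^sub>R (\<Sum>n\<in>F. a n * cis (2 * pi * (of_int n * x)))) \<in> Ltwo"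
    using Ltwo_lincomb[of F e "\<lambda>n. of_real (sqrt (2 * real T)) * a n"] eL
    unfolding \<open>\<And>x. (\<Sum>n\<in>F. (of_real (sqrt (2 * real T)) * a n) * e n x) = _\<close> by simp
  have "(\<integral>\<^sup>+x. indicator {- real T..real T} x * ennreal ((cmod (\<Sum>n\<in>F. a n * cis (2 * pi * (of_int n * x))))\<^sup>2) \<partial>lborel)
     = (\<integral>\<^sup>+x. ennreal ((cmod (indicator {- real T..real T} x *\<^sub>R (\<Sum>n\<in>F. a n * cis (2 * pi * (of_int n * x)))))\<^sup>2) \<partial>lborel)"
    by (intro nn_integral_cong) (auto simp: indicator_def)
  also have "\<dots> = ennreal (2 * real T * (\<Sum>n\<in>F. (cmod (a n))\<^sup>2))"
    unfolding n[symmetric] Ltwo_norm_square using LtwoD(3)[OF L] by (subst nn_integral_eq_integral) auto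
  finally show ?thesis .
qed

text \<open>The factor that the integer translations contribute to the Fourier transform of a
  combination of atoms of one scale and one type; hence the minus sign.\<close>

definition trig_poly2 :: "(int \<times> int) set \<Rightarrow> (int \<times> int \<Rightarrow> complex) \<Rightarrow> real ^ 2 \<Rightarrow> complex" where
  "trig_poly2 F a \<eta> = (\<Sum>n\<in>F. a n * cis (- (2 * pi * (of_int (fst n) * \<eta> $ 1 + of_int (snd n) * \<eta> $ 2))))"

lemma measurable_trig_poly2 [measurable]: "trig_poly2 F a \<in> borel_measurable borel"
  unfolding trig_poly2_def by measurable

text \<open>Parseval's identity in one variable after the other. To separate the variables, the
  frequencies are negated and the coefficients are extended by zero to a rectangle
  \<open>A \<times> B\<close> of frequencies.\<close>

lemma trig_poly_square:
  fixes a :: "int \<times> int \<Rightarrow> complex" and T :: nat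
  assumes F: "finite F" and T: "0 < T"
  shows "(\<integral>\<^sup>+\<eta>. indicator {\<eta>. \<bar>\<eta> $ 1\<bar> \<le> real T \<and> \<bar>\<eta> $ 2\<bar> \<le> real T} \<eta> * ennreal ((cmod (trig_poly2 F a \<eta>))\<^sup>2) \<partial>lborel)
     = ennreal (4 * (real T)\<^sup>2 * (\<Sum>n\<in>F. (cmod (a n))\<^sup>2))"
proof -
  define A where "A = uminus ` fst ` F"
  define B where "B = uminus ` snd ` F"
  define c where "c k l = (if (- k, - l) \<in> F then a (- k, - l) else 0)" for k l
  have fin: "finite A" "finite B" using F by (auto simp: A_def B_def)
  let ?neg = "\<lambda>(k, l). (- k, - l) :: int \<times> int"
  have inj: "inj_on ?neg F" by (auto simp: inj_on_def)
  have sub: "?neg ` F \<subseteq> A \<times> B" by (auto simp: A_def B_def image_iff) (metis fst_conv, metis snd_conv)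
  have reidx: "(\<Sum>k\<in>A. \<Sum>l\<in>B. g k l) = (\<Sum>n\<in>F. g (- fst n) (- snd n))"
    if "\<And>k l. (- k, - l) \<notin> F \<Longrightarrow> g k l = 0" for g :: "int \<Rightarrow> int \<Rightarrow> 'z::comm_monoid_add"
  proof -
    have "(\<Sum>k\<in>A. \<Sum>l\<in>B. g k l) = (\<Sum>p\<in>A \<times> B. g (fst p) (snd p))" by (simp add: sum.cartesian_product case_prod_unfold)
    also have "\<dots> = (\<Sum>p\<in>?neg ` F. g (fst p) (snd p))"
    proof (rule sum.mono_neutral_right[OF _ sub])
      show "\<forall>i\<in>A \<times> B - ?neg ` F. g (fst i) (snd i) = 0"
      proof
        fix i assume i: "i \<in> A \<times> B - ?neg ` F"
        have "(- fst i, - snd i) \<notin> F"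
        proof
          assume "(- fst i, - snd i) \<in> F"
          then have "?neg (- fst i, - snd i) \<in> ?neg ` F" by (rule imageI)
          then show False using i by simp
        qed
        then show "g (fst i) (snd i) = 0" by (rule that)
      qed
    qed (use fin in auto)
    also have "\<dots> = (\<Sum>n\<in>F. g (- fst n) (- snd n))"
      by (subst sum.reindex[OF inj]) (simp add: case_prod_unfold)
    finally show ?thesis .
  qed
  have tp: "trig_poly2 F a (vec2 (x, y)) = (\<Sum>l\<in>B. (\<Sum>k\<in>A. c k l * cis (2 * pi * (of_int k * x))) * cis (2 * pi * (of_int l * y)))" for x y
  proof -
    have "(\<Sum>l\<in>B. (\<Sum>k\<in>A. c k l * cis (2 * pi * (of_int k * x))) * cis (2 * pi * (of_int l * y)))
       = (\<Sum>k\<in>A. \<Sum>l\<in>B. c k l * cis (2 * pi * (of_int k * x)) * cis (2 * pi * (of_int l * y)))"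
      unfolding sum_distrib_right by (rule sum.swap)
    also have "\<dots> = (\<Sum>n\<in>F. c (- fst n) (- snd n) * cis (2 * pi * (of_int (- fst n) * x)) * cis (2 * pi * (of_int (- snd n) * y)))"
      by (rule reidx) (simp add: c_def)
    also have "\<dots> = trig_poly2 F a (vec2 (x, y))"
      unfolding trig_poly2_def by (intro sum.cong refl) (simp add: c_def mult.assoc cis_mult algebra_simps)
    finally show ?thesis by simp
  qed
  have "(\<integral>\<^sup>+\<eta>. indicator {\<eta>. \<bar>\<eta> $ 1\<bar> \<le> real T \<and> \<bar>\<eta> $ 2\<bar> \<le> real T} \<eta> * ennreal ((cmod (trig_poly2 F a \<eta>))\<^sup>2) \<partial>lborel)
     = (\<integral>\<^sup>+x. \<integral>\<^sup>+y. indicator {\<eta>. \<bar>\<eta> $ 1\<bar> \<le> real T \<and> \<bar>\<eta> $ 2\<bar> \<le> real T} (vec2 (x, y)) * ennreal ((cmod (trig_poly2 F a (vec2 (x, y))))\<^sup>2) \<partial>lborel \<partial>lborel)"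
    by (rule nn_integral_vec2) measurable
  also have "\<dots> = (\<integral>\<^sup>+x. indicator {- real T..real T} x * (\<integral>\<^sup>+y. indicator {- real T..real T} y * ennreal ((cmod (trig_poly2 F a (vec2 (x, y))))\<^sup>2) \<partial>lborel) \<partial>lborel)"
  proof (rule nn_integral_cong)
    fix x :: real
    have [measurable]: "(\<lambda>y. trig_poly2 F a (vec2 (x, y))) \<in> borel_measurable borel" unfolding tp by measurable
    have "(\<integral>\<^sup>+y. indicator {\<eta>. \<bar>\<eta> $ 1\<bar> \<le> real T \<and> \<bar>\<eta> $ 2\<bar> \<le> real T} (vec2 (x, y)) * ennreal ((cmod (trig_poly2 F a (vec2 (x, y))))\<^sup>2) \<partial>lborel)
      = (\<integral>\<^sup>+y. indicator {- real T..real T} x * (indicator {- real T..real T} y * ennreal ((cmod (trig_poly2 F a (vec2 (x, y))))\<^sup>2)) \<partial>lborel)"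
      by (intro nn_integral_cong) (auto simp: indicator_def abs_le_iff)
    also have "\<dots> = indicator {- real T..real T} x * (\<integral>\<^sup>+y. indicator {- real T..real T} y * ennreal ((cmod (trig_poly2 F a (vec2 (x, y))))\<^sup>2) \<partial>lborel)"
      by (rule nn_integral_cmult) measurable
    finally show "(\<integral>\<^sup>+y. indicator {\<eta>. \<bar>\<eta> $ 1\<bar> \<le> real T \<and> \<bar>\<eta> $ 2\<bar> \<le> real T} (vec2 (x, y)) * ennreal ((cmod (trig_poly2 F a (vec2 (x, y))))\<^sup>2) \<partial>lborel) = \<dots>" .
  qed
  also have "\<dots> = (\<integral>\<^sup>+x. (\<Sum>l\<in>B. ennreal (2 * real T) * (indicator {- real T..real T} x * ennreal ((cmod (\<Sum>k\<in>A. c k l * cis (2 * pi * (of_int k * x))))\<^sup>2))) \<partial>lborel)"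
    unfolding tp trig_poly_interval[OF fin(2) T]
    by (intro nn_integral_cong) (simp add: ennreal_mult sum_nonneg sum_ennreal[symmetric] sum_distrib_left mult_ac del: sum_ennreal)
  also have "\<dots> = (\<Sum>l\<in>B. ennreal (2 * real T) * (\<integral>\<^sup>+x. indicator {- real T..real T} x * ennreal ((cmod (\<Sum>k\<in>A. c k l * cis (2 * pi * (of_int k * x))))\<^sup>2) \<partial>lborel))"
    by (simp add: nn_integral_sum nn_integral_cmult)
  also have "\<dots> = (\<Sum>l\<in>B. ennreal (2 * real T * (2 * real T * (\<Sum>k\<in>A. (cmod (c k l))\<^sup>2))))"
    unfolding trig_poly_interval[OF fin(1) T]
    by (intro sum.cong refl ennreal_mult[symmetric]) (auto intro!: mult_nonneg_nonneg sum_nonneg)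
  also have "\<dots> = ennreal (4 * (real T)\<^sup>2 * (\<Sum>l\<in>B. \<Sum>k\<in>A. (cmod (c k l))\<^sup>2))"
  proof -
    have "(\<Sum>l\<in>B. 2 * real T * (2 * real T * (\<Sum>k\<in>A. (cmod (c k l))\<^sup>2))) = 4 * (real T)\<^sup>2 * (\<Sum>l\<in>B. \<Sum>k\<in>A. (cmod (c k l))\<^sup>2)"
      unfolding sum_distrib_left[of _ _ B] by (intro sum.cong) (simp_all add: power2_eq_square)
    moreover have "(\<Sum>l\<in>B. ennreal (2 * real T * (2 * real T * (\<Sum>k\<in>A. (cmod (c k l))\<^sup>2)))) = ennreal (\<Sum>l\<in>B. 2 * real T * (2 * real T * (\<Sum>k\<in>A. (cmod (c k l))\<^sup>2)))"
      by (rule sum_ennreal) (auto intro!: mult_nonneg_nonneg sum_nonneg)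
    ultimately show ?thesis by (simp only:)
  qed
  also have "(\<Sum>l\<in>B. \<Sum>k\<in>A. (cmod (c k l))\<^sup>2) = (\<Sum>k\<in>A. \<Sum>l\<in>B. (cmod (c k l))\<^sup>2)" by (rule sum.swap)
  also have "\<dots> = (\<Sum>n\<in>F. (cmod (c (- fst n) (- snd n)))\<^sup>2)" by (rule reidx) (simp add: c_def)
  also have "\<dots> = (\<Sum>n\<in>F. (cmod (a n))\<^sup>2)" by (intro sum.cong) (auto simp: c_def)
  finally show ?thesis .
qed

definition bessel_symbol :: "real \<Rightarrow> 'a::euclidean_space \<Rightarrow> real" where
  "bessel_symbol b \<xi> = (1 + (norm \<xi>)\<^sup>2) powr (- b / 2)"

lemma measurable_bessel_symbol [measurable]: "bessel_symbol b \<in> borel_measurable borel"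
  unfolding bessel_symbol_def[abs_def] by measurable

lemma bessel_symbol_pos: "0 < bessel_symbol b \<xi>"
proof -
  have "0 < 1 + (norm \<xi>)\<^sup>2" by (simp add: add_pos_nonneg)
  then show ?thesis by (simp add: bessel_symbol_def)
qed

lemma bessel_symbol_le_1: "0 \<le> b \<Longrightarrow> bessel_symbol b \<xi> \<le> 1"
  unfolding bessel_symbol_def using powr_mono2'[of "- (b / 2)" 1 "1 + (norm \<xi>)\<^sup>2"] by simp

lemma bessel_symbol_le_powr: "bessel_symbol b \<xi> \<le> R powr (- b)" if "0 < R" "R \<le> norm \<xi>" "0 \<le> b"
proof -
  have "R\<^sup>2 \<le> (norm \<xi>)\<^sup>2" using that by (intro power_mono) auto
  then have "R\<^sup>2 \<le> 1 + (norm \<xi>)\<^sup>2" by simp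
  then have "bessel_symbol b \<xi> \<le> (R\<^sup>2) powr (- (b / 2))"
    unfolding bessel_symbol_def using that powr_mono2'[of "- (b / 2)" "R\<^sup>2" "1 + (norm \<xi>)\<^sup>2"] by simp
  also have "\<dots> = R powr (- b)" using that by (simp add: powr_powr flip: powr_numeral)
  finally show ?thesis .
qed

text \<open>The sum of the geometric series that arises in \<open>bessel_symbol_trig_poly\<close>;
  its ratio \<open>2 powr (2 - b)\<close> is below 1 because 2 < b.\<close>

definition bessel_const :: "real \<Rightarrow> real" where
  "bessel_const b = 4 * 2 powr b / (1 - 2 powr (2 - b))"

lemma bessel_const_pos: "2 < b \<Longrightarrow> 0 < bessel_const b"
  using powr_less_cancel_iff[of 2 "2 - b" 0] by (simp add: bessel_const_def)

text \<open>The plane is exhausted by dyadic squares. On the square \<open>Q i\<close>, outside the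
  preceding one, the symbol is at most of order 2^(-b i), whereas the squared polynomial integrates
  to 4^(i + 1) times the sum of squared coefficients: 2 < b makes the decay win.\<close>

lemma bessel_symbol_trig_poly:
  assumes b: "2 < b" and F: "finite F"
  shows "(\<integral>\<^sup>+\<eta>. ennreal (bessel_symbol b \<eta>) * ennreal ((cmod (trig_poly2 F a \<eta>))\<^sup>2) \<partial>lborel)
     \<le> ennreal (bessel_const b * (\<Sum>n\<in>F. (cmod (a n))\<^sup>2))"
proof -
  define S where "S = (\<Sum>n\<in>F. (cmod (a n))\<^sup>2)"
  define Q where "Q i = {\<eta> :: real ^ 2. \<bar>\<eta> $ 1\<bar> \<le> real (2 ^ i) \<and> \<bar>\<eta> $ 2\<bar> \<le> real (2 ^ i)}" for i :: nat
  define c where "c i = 2 powr b * 2 powr (- b * real i)" for i :: nat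
  have [measurable]: "Q i \<in> sets borel" for i unfolding Q_def by measurable
  have S0: "0 \<le> S" by (simp add: S_def sum_nonneg)
  have pt: "ennreal (bessel_symbol b \<eta>) \<le> (\<Sum>i. ennreal (c i) * indicator (Q i) \<eta>)" for \<eta>
  proof -
    have ex: "\<exists>i. \<eta> \<in> Q i"
    proof -
      obtain i :: nat where i: "norm \<eta> < 2 ^ i" using real_arch_pow[of 2 "norm \<eta>"] by auto
      then have "\<eta> \<in> Q i" unfolding Q_def using component_le_norm_cart[of \<eta>] by (auto intro: order_trans less_imp_le)
      then show ?thesis ..
    qed
    \<comment> \<open>Minimality puts the point outside \<open>Q k\<close> with
      \<open>i = Suc k\<close>, so its norm is at least \<open>2 ^ k\<close>; the extra factor
      \<open>2 powr b\<close> in \<open>c\<close> compensates the shift from \<open>i\<close> to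
      \<open>k\<close>.\<close>
    define i where "i = (LEAST i. \<eta> \<in> Q i)"
    have iQ: "\<eta> \<in> Q i" unfolding i_def using ex by (rule LeastI_ex)
    have "bessel_symbol b \<eta> \<le> c i"
    proof (cases i)
      case 0
      have "1 \<le> 2 powr b" using b by (simp add: ge_one_powr_ge_zero)
      then show ?thesis using 0 bessel_symbol_le_1[of b \<eta>] b by (simp add: c_def)
    next
      case (Suc k)
      then have "\<eta> \<notin> Q k" unfolding i_def by (metis lessI not_less_Least)
      then have "2 ^ k \<le> norm \<eta>"
        unfolding Q_def using component_le_norm_cart[of \<eta> 1] component_le_norm_cart[of \<eta> 2] by auto
      then have "bessel_symbol b \<eta> \<le> (2 ^ k) powr (- b)" using b by (intro bessel_symbol_le_powr) auto
      also have "\<dots> = c i"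
        unfolding c_def Suc by (simp add: powr_powr algebra_simps flip: powr_realpow powr_add)
      finally show ?thesis .
    qed
    then have "ennreal (bessel_symbol b \<eta>) \<le> (\<Sum>i\<in>{i}. ennreal (c i) * indicator (Q i) \<eta>)"
      using iQ by (simp add: ennreal_leI)
    also have "\<dots> \<le> (\<Sum>i. ennreal (c i) * indicator (Q i) \<eta>)"
      by (intro sum_le_suminf summableI) auto
    finally show ?thesis .
  qed
  define q where "q = 2 powr (2 - b)"
  have q: "0 \<le> q" "q < 1" using b powr_less_cancel_iff[of 2 "2 - b" 0] by (auto simp: q_def)
  have "(\<integral>\<^sup>+\<eta>. ennreal (bessel_symbol b \<eta>) * ennreal ((cmod (trig_poly2 F a \<eta>))\<^sup>2) \<partial>lborel)
    \<le> (\<integral>\<^sup>+\<eta>. (\<Sum>i. ennreal (c i) * (indicator (Q i) \<eta> * ennreal ((cmod (trig_poly2 F a \<eta>))\<^sup>2))) \<partial>lborel)"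
  proof (rule nn_integral_mono)
    fix \<eta> :: "real ^ 2"
    have "ennreal (bessel_symbol b \<eta>) * ennreal ((cmod (trig_poly2 F a \<eta>))\<^sup>2)
      \<le> (\<Sum>i. ennreal (c i) * indicator (Q i) \<eta>) * ennreal ((cmod (trig_poly2 F a \<eta>))\<^sup>2)"
      by (intro mult_right_mono pt) auto
    also have "\<dots> = (\<Sum>i. ennreal (c i) * (indicator (Q i) \<eta> * ennreal ((cmod (trig_poly2 F a \<eta>))\<^sup>2)))"
      by (simp add: ennreal_suminf_multc[symmetric] mult.assoc)
    finally show "ennreal (bessel_symbol b \<eta>) * ennreal ((cmod (trig_poly2 F a \<eta>))\<^sup>2)
      \<le> (\<Sum>i. ennreal (c i) * (indicator (Q i) \<eta> * ennreal ((cmod (trig_poly2 F a \<eta>))\<^sup>2)))" .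
  qed
  also have "\<dots> = (\<Sum>i. \<integral>\<^sup>+\<eta>. ennreal (c i) * (indicator (Q i) \<eta> * ennreal ((cmod (trig_poly2 F a \<eta>))\<^sup>2)) \<partial>lborel)"
    by (rule nn_integral_suminf) measurable
  also have "\<dots> = (\<Sum>i. ennreal (c i) * ennreal (4 * (real (2 ^ i))\<^sup>2 * S))"
  proof (rule suminf_cong)
    fix i
    have "(\<integral>\<^sup>+\<eta>. ennreal (c i) * (indicator (Q i) \<eta> * ennreal ((cmod (trig_poly2 F a \<eta>))\<^sup>2)) \<partial>lborel)
      = ennreal (c i) * (\<integral>\<^sup>+\<eta>. indicator (Q i) \<eta> * ennreal ((cmod (trig_poly2 F a \<eta>))\<^sup>2) \<partial>lborel)"
      by (rule nn_integral_cmult) measurable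
    also have "\<dots> = ennreal (c i) * ennreal (4 * (real (2 ^ i))\<^sup>2 * S)"
      unfolding Q_def S_def by (subst trig_poly_square[OF F]) auto
    finally show "(\<integral>\<^sup>+\<eta>. ennreal (c i) * (indicator (Q i) \<eta> * ennreal ((cmod (trig_poly2 F a \<eta>))\<^sup>2)) \<partial>lborel)
      = ennreal (c i) * ennreal (4 * (real (2 ^ i))\<^sup>2 * S)" .
  qed
  also have "\<dots> = (\<Sum>i. ennreal (4 * 2 powr b * S * q ^ i))"
  proof (rule suminf_cong)
    fix i
    have "c i * (4 * (real (2 ^ i))\<^sup>2 * S) = 4 * 2 powr b * S * q ^ i"
    proof -
      have "2 powr (- b * real i) * (real (2 ^ i))\<^sup>2 = q ^ i"
      proof -
        have "q ^ i = q powr real i" by (simp add: q_def powr_realpow)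
        also have "\<dots> = 2 powr (- b * real i) * (2 powr real i * 2 powr real i)"
          unfolding q_def powr_powr powr_add[symmetric] by (simp add: algebra_simps)
        finally show ?thesis by (simp add: powr_realpow power2_eq_square)
      qed
      then show ?thesis by (simp add: c_def mult_ac)
    qed
    moreover have "ennreal (c i) * ennreal (4 * (real (2 ^ i))\<^sup>2 * S) = ennreal (c i * (4 * (real (2 ^ i))\<^sup>2 * S))"
      using S0 by (intro ennreal_mult[symmetric]) (auto simp: c_def)
    ultimately show "ennreal (c i) * ennreal (4 * (real (2 ^ i))\<^sup>2 * S) = ennreal (4 * 2 powr b * S * q ^ i)"
      by (simp only:)
  qed
  also have "\<dots> = ennreal (\<Sum>i. 4 * 2 powr b * S * q ^ i)"
    using q S0 by (intro suminf_ennreal2 summable_mult summable_geometric) auto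
  also have "(\<Sum>i. 4 * 2 powr b * S * q ^ i) = bessel_const b * S"
    using q by (subst suminf_mult) (auto intro: summable_geometric simp: suminf_geometric bessel_const_def q_def)
  finally show ?thesis by (simp add: S_def)
qed

lemma integrable_bessel_symbol:
  assumes "2 < b"
  shows "integrable lborel (bessel_symbol b :: real ^ 2 \<Rightarrow> real)"
    and "(\<integral>\<^sup>+\<eta>. ennreal (bessel_symbol b (\<eta> :: real ^ 2)) \<partial>lborel) \<le> ennreal (bessel_const b)"
proof -
  \<comment> \<open>The constant polynomial 1 reduces the integral of the symbol itself to the
    preceding estimate.\<close>
  have "trig_poly2 {(0,0)} (\<lambda>_. 1) \<eta> = 1" for \<eta> by (simp add: trig_poly2_def)
  then show le: "(\<integral>\<^sup>+\<eta>. ennreal (bessel_symbol b (\<eta> :: real ^ 2)) \<partial>lborel) \<le> ennreal (bessel_const b)"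
    using bessel_symbol_trig_poly[OF assms, of "{(0,0)}" "\<lambda>_. 1"] by simp
  show "integrable lborel (bessel_symbol b :: real ^ 2 \<Rightarrow> real)"
  proof (rule integrableI_bounded)
    have "(\<integral>\<^sup>+\<eta>. ennreal (norm (bessel_symbol b (\<eta> :: real ^ 2))) \<partial>lborel) \<le> ennreal (bessel_const b)"
      using le by (simp add: less_imp_le[OF bessel_symbol_pos])
    then show "(\<integral>\<^sup>+\<eta>. ennreal (norm (bessel_symbol b (\<eta> :: real ^ 2))) \<partial>lborel) < \<infinity>"
      by (rule le_less_trans) auto
  qed measurable
qed

text \<open>The pointwise bound uses Cauchy-Schwarz against the integrable symbol, the mean-square bound
  uses the Plancherel substitute.\<close>

lemma multiplier_estimates:
  assumes b: "2 < b" and F: "finite F" and s: "0 < s" and A: "0 \<le> A"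
    and Hm[measurable]: "H \<in> borel_measurable borel"
    and H: "\<And>\<xi>. cmod (H \<xi>) \<le> A * (bessel_symbol b (s *\<^sub>R \<xi>) * cmod (trig_poly2 F a (s *\<^sub>R \<xi>)))"
  defines "S \<equiv> (\<Sum>n\<in>F. (cmod (a n))\<^sup>2)"
  shows "integrable lborel H"
    and "(cmod (inverse_fourier H t))\<^sup>2 \<le> (bessel_const b)\<^sup>2 * A\<^sup>2 / s ^ 4 * S"
    and "0 < N \<Longrightarrow> (LINT t|lborel. indicator (cball 0 N) t * (cmod (inverse_fourier H t))\<^sup>2) \<le> exp 1 * bessel_const b * A\<^sup>2 / s\<^sup>2 * S"
proof -
  let ?m = "trig_poly2 F a" and ?g = "bessel_symbol b :: real ^ 2 \<Rightarrow> real" and ?C = "bessel_const b"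
  have C: "0 < ?C" by (rule bessel_const_pos[OF b])
  have S0: "0 \<le> S" by (simp add: S_def sum_nonneg)
  note tp = bessel_symbol_trig_poly[OF b F, of a, folded S_def]
  have g0: "0 \<le> ?g x" "?g x \<le> 1" for x using bessel_symbol_pos[of b x] bessel_symbol_le_1[of b x] b by auto
  \<comment> \<open>Cauchy-Schwarz as an arithmetic-geometric mean with weight sqrt S. This form
    stays inside \<open>ennreal\<close> and presupposes no integrability, but it divides by sqrt S;
    hence the separate case S = 0.\<close>
  have gm: "(\<integral>\<^sup>+\<eta>. ennreal (?g \<eta> * cmod (?m \<eta>)) \<partial>lborel) \<le> ennreal (?C * sqrt S)"
  proof (cases "S = 0")
    case True
    then have "a n = 0" if "n \<in> F" for n using F that unfolding S_def by (simp add: sum_nonneg_eq_0_iff)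
    then have "?m \<eta> = 0" for \<eta> by (simp add: trig_poly2_def)
    then show ?thesis by simp
  next
    case False
    then have sp: "0 < sqrt S" using S0 by simp
    have "(\<integral>\<^sup>+\<eta>. ennreal (?g \<eta> * cmod (?m \<eta>)) \<partial>lborel)
      \<le> (\<integral>\<^sup>+\<eta>. ennreal (sqrt S / 2) * ennreal (?g \<eta>) + ennreal (1 / (2 * sqrt S)) * (ennreal (?g \<eta>) * ennreal ((cmod (?m \<eta>))\<^sup>2)) \<partial>lborel)"
    proof (rule nn_integral_mono)
      fix \<eta>
      have "0 \<le> (sqrt S - cmod (?m \<eta>))\<^sup>2" by simp
      then have "2 * sqrt S * cmod (?m \<eta>) \<le> (sqrt S)\<^sup>2 + (cmod (?m \<eta>))\<^sup>2" unfolding power2_diff by simp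
      then have "cmod (?m \<eta>) \<le> sqrt S / 2 + 1 / (2 * sqrt S) * (cmod (?m \<eta>))\<^sup>2"
        using sp by (simp add: field_simps power2_eq_square)
      from mult_left_mono[OF this g0(1)[of \<eta>]]
      have "?g \<eta> * cmod (?m \<eta>) \<le> sqrt S / 2 * ?g \<eta> + 1 / (2 * sqrt S) * (?g \<eta> * (cmod (?m \<eta>))\<^sup>2)"
        by (simp add: algebra_simps)
      then have "ennreal (?g \<eta> * cmod (?m \<eta>)) \<le> ennreal (sqrt S / 2 * ?g \<eta> + 1 / (2 * sqrt S) * (?g \<eta> * (cmod (?m \<eta>))\<^sup>2))"
        by (rule ennreal_leI)
      also have "\<dots> = ennreal (sqrt S / 2 * ?g \<eta>) + ennreal (1 / (2 * sqrt S) * (?g \<eta> * (cmod (?m \<eta>))\<^sup>2))"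
        using sp g0 by (intro ennreal_plus) auto
      also have "\<dots> = ennreal (sqrt S / 2) * ennreal (?g \<eta>) + ennreal (1 / (2 * sqrt S)) * (ennreal (?g \<eta>) * ennreal ((cmod (?m \<eta>))\<^sup>2))"
        using sp g0 by (simp only: ennreal_mult'' ennreal_mult' zero_le_power2 mult_nonneg_nonneg)
      finally show "ennreal (?g \<eta> * cmod (?m \<eta>)) \<le> ennreal (sqrt S / 2) * ennreal (?g \<eta>) + ennreal (1 / (2 * sqrt S)) * (ennreal (?g \<eta>) * ennreal ((cmod (?m \<eta>))\<^sup>2))" .
    qed
    also have "\<dots> = ennreal (sqrt S / 2) * (\<integral>\<^sup>+\<eta>. ennreal (?g \<eta>) \<partial>lborel) + ennreal (1 / (2 * sqrt S)) * (\<integral>\<^sup>+\<eta>. ennreal (?g \<eta>) * ennreal ((cmod (?m \<eta>))\<^sup>2) \<partial>lborel)"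
      by (simp add: nn_integral_add nn_integral_cmult)
    also have "\<dots> \<le> ennreal (sqrt S / 2) * ennreal ?C + ennreal (1 / (2 * sqrt S)) * ennreal (?C * S)"
      by (intro add_mono mult_left_mono integrable_bessel_symbol(2)[OF b] tp) auto
    also have "\<dots> = ennreal (sqrt S / 2 * ?C + 1 / (2 * sqrt S) * (?C * S))"
      using sp C S0 by (simp flip: ennreal_mult ennreal_plus)
    also have "1 / (2 * sqrt S) * (?C * S) = ?C * sqrt S / 2"
      using sp S0 by (simp add: field_simps)
    finally show ?thesis by (simp add: mult_ac)
  qed
  have H1: "(\<integral>\<^sup>+\<xi>. ennreal (cmod (H \<xi>)) \<partial>lborel) \<le> ennreal (?C * A / s\<^sup>2 * sqrt S)"
  proof -
    have "(\<integral>\<^sup>+\<xi>. ennreal (cmod (H \<xi>)) \<partial>lborel) \<le> (\<integral>\<^sup>+\<xi>. ennreal A * ennreal (?g (s *\<^sub>R \<xi>) * cmod (?m (s *\<^sub>R \<xi>))) \<partial>lborel)"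
      using A g0 H by (intro nn_integral_mono) (simp add: ennreal_leI flip: ennreal_mult)
    also have "\<dots> = ennreal A * (\<integral>\<^sup>+\<xi>. ennreal (?g (s *\<^sub>R \<xi>) * cmod (?m (s *\<^sub>R \<xi>))) \<partial>lborel)"
      by (rule nn_integral_cmult) measurable
    also have "(\<integral>\<^sup>+\<xi>. ennreal (?g (s *\<^sub>R \<xi>) * cmod (?m (s *\<^sub>R \<xi>))) \<partial>lborel) = ennreal (1 / s\<^sup>2) * (\<integral>\<^sup>+\<eta>. ennreal (?g \<eta> * cmod (?m \<eta>)) \<partial>lborel)"
      by (rule nn_integral_scale2[OF _ s]) measurable
    also have "ennreal A * \<dots> \<le> ennreal A * (ennreal (1 / s\<^sup>2) * ennreal (?C * sqrt S))"
      by (intro mult_left_mono gm) auto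
    also have "\<dots> = ennreal (?C * A / s\<^sup>2 * sqrt S)" using A C S0 s by (simp flip: ennreal_mult add: mult_ac)
    finally show ?thesis .
  qed
  show Hi: "integrable lborel H"
    by (rule integrableI_bounded) (use H1 in \<open>auto intro: le_less_trans\<close>)
  have H1': "(LINT \<xi>|lborel. cmod (H \<xi>)) \<le> ?C * A / s\<^sup>2 * sqrt S"
  proof -
    have "ennreal (LINT \<xi>|lborel. cmod (H \<xi>)) = (\<integral>\<^sup>+\<xi>. ennreal (cmod (H \<xi>)) \<partial>lborel)"
      using Hi by (intro nn_integral_eq_integral[symmetric]) auto
    then show ?thesis using H1 A C S0 s by (metis ennreal_le_iff mult_nonneg_nonneg divide_nonneg_nonneg less_imp_le real_sqrt_ge_zero zero_le_power2)
  qed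
  have "cmod (inverse_fourier H t) \<le> ?C * A / s\<^sup>2 * sqrt S"
    using inverse_fourier_bound[of H t] H1' by linarith
  then have "(cmod (inverse_fourier H t))\<^sup>2 \<le> (?C * A / s\<^sup>2 * sqrt S)\<^sup>2" by (intro power_mono) auto
  also have "\<dots> = ?C\<^sup>2 * A\<^sup>2 / s ^ 4 * S" using S0 by (simp add: power_mult_distrib power_divide flip: power_mult)
  finally show "(cmod (inverse_fourier H t))\<^sup>2 \<le> ?C\<^sup>2 * A\<^sup>2 / s ^ 4 * S" .
  have H2: "(\<integral>\<^sup>+\<xi>. ennreal ((cmod (H \<xi>))\<^sup>2) \<partial>lborel) \<le> ennreal (?C * A\<^sup>2 / s\<^sup>2 * S)"
  proof -
    have "(\<integral>\<^sup>+\<xi>. ennreal ((cmod (H \<xi>))\<^sup>2) \<partial>lborel) \<le> (\<integral>\<^sup>+\<xi>. ennreal (A\<^sup>2) * (ennreal (?g (s *\<^sub>R \<xi>)) * ennreal ((cmod (?m (s *\<^sub>R \<xi>)))\<^sup>2)) \<partial>lborel)"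
    proof (rule nn_integral_mono)
      fix \<xi> :: "real ^ 2"
      let ?x = "s *\<^sub>R \<xi>"
      have "(cmod (H \<xi>))\<^sup>2 \<le> (A * (?g ?x * cmod (?m ?x)))\<^sup>2" by (intro power_mono H) auto
      also have "\<dots> = A\<^sup>2 * (?g ?x * (?g ?x * (cmod (?m ?x))\<^sup>2))" by (simp add: power2_eq_square)
      \<comment> \<open>One of the two factors of the symbol is bounded by 1, so that the same
        estimate on polynomials serves the mean square as well.\<close>
      also have "\<dots> \<le> A\<^sup>2 * (1 * (?g ?x * (cmod (?m ?x))\<^sup>2))" using g0 by (intro mult_left_mono mult_right_mono) auto
      finally have "(cmod (H \<xi>))\<^sup>2 \<le> A\<^sup>2 * (?g ?x * (cmod (?m ?x))\<^sup>2)" by simp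
      then show "ennreal ((cmod (H \<xi>))\<^sup>2) \<le> ennreal (A\<^sup>2) * (ennreal (?g ?x) * ennreal ((cmod (?m ?x))\<^sup>2))"
        using g0 by (simp add: ennreal_leI flip: ennreal_mult)
    qed
    also have "\<dots> = ennreal (A\<^sup>2) * (\<integral>\<^sup>+\<xi>. ennreal (?g (s *\<^sub>R \<xi>)) * ennreal ((cmod (?m (s *\<^sub>R \<xi>)))\<^sup>2) \<partial>lborel)"
      by (rule nn_integral_cmult) measurable
    also have "(\<integral>\<^sup>+\<xi>. ennreal (?g (s *\<^sub>R \<xi>)) * ennreal ((cmod (?m (s *\<^sub>R \<xi>)))\<^sup>2) \<partial>lborel)
       = ennreal (1 / s\<^sup>2) * (\<integral>\<^sup>+\<eta>. ennreal (?g \<eta>) * ennreal ((cmod (?m \<eta>))\<^sup>2) \<partial>lborel)"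
      by (rule nn_integral_scale2[OF _ s]) measurable
    also have "ennreal (A\<^sup>2) * \<dots> \<le> ennreal (A\<^sup>2) * (ennreal (1 / s\<^sup>2) * ennreal (?C * S))"
      by (intro mult_left_mono tp) auto
    also have "\<dots> = ennreal (?C * A\<^sup>2 / s\<^sup>2 * S)" using C S0 s by (simp flip: ennreal_mult add: mult_ac)
    finally show ?thesis .
  qed
  have iH2: "integrable lborel (\<lambda>\<xi>. (cmod (H \<xi>))\<^sup>2)"
    by (rule integrableI_bounded) (use H2 in \<open>auto intro: le_less_trans\<close>)
  then have HL: "H \<in> Ltwo" by (simp add: Ltwo_def)
  have n2: "(Ltwo_norm H)\<^sup>2 \<le> ?C * A\<^sup>2 / s\<^sup>2 * S"
  proof -
    have "ennreal ((Ltwo_norm H)\<^sup>2) = (\<integral>\<^sup>+\<xi>. ennreal ((cmod (H \<xi>))\<^sup>2) \<partial>lborel)"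
      unfolding Ltwo_norm_square using iH2 by (intro nn_integral_eq_integral[symmetric]) auto
    then show ?thesis using H2 C S0 s by (metis ennreal_le_iff mult_nonneg_nonneg divide_nonneg_nonneg less_imp_le zero_le_power2)
  qed
  assume "0 < N"
  then have "(LINT t|lborel. indicator (cball 0 N) t * (cmod (inverse_fourier H t))\<^sup>2) \<le> exp 1 * (Ltwo_norm H)\<^sup>2"
    by (rule plancherel_disc[OF Hi HL])
  also have "\<dots> \<le> exp 1 * (?C * A\<^sup>2 / s\<^sup>2 * S)" by (intro mult_left_mono n2) auto
  finally show "(LINT t|lborel. indicator (cball 0 N) t * (cmod (inverse_fourier H t))\<^sup>2) \<le> exp 1 * ?C * A\<^sup>2 / s\<^sup>2 * S"
    by (simp add: mult.assoc)
qed

section \<open>Fourier transforms of the atoms\<close>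

definition fourier :: "('a::euclidean_space \<Rightarrow> complex) \<Rightarrow> 'a \<Rightarrow> complex" where
  "fourier f \<xi> = (LINT x|lborel. f x * cis (- (2 * pi * (\<xi> \<bullet> x))))"

lemma measurable_fourier [measurable]:
  assumes [measurable]: "f \<in> borel_measurable borel"
  shows "fourier f \<in> borel_measurable borel"
proof -
  have "(\<lambda>\<xi>. LINT x|lborel. f x * cis (- (2 * pi * (\<xi> \<bullet> x)))) \<in> borel_measurable lborel"
    by (rule lborel.borel_measurable_lebesgue_integral) measurable
  then show ?thesis unfolding fourier_def[abs_def] by simp
qed

lemma fourier_integrable: "integrable lborel (\<lambda>x. f x * cis (- (2 * pi * (\<xi> \<bullet> x))))" if "integrable lborel f"
proof (rule Bochner_Integration.integrable_bound[OF that])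
  have [measurable]: "f \<in> borel_measurable borel" using that by auto
  show "(\<lambda>x. f x * cis (- (2 * pi * (\<xi> \<bullet> x)))) \<in> borel_measurable lborel" by measurable
qed (simp add: norm_mult)

lemma fourier_bound: "cmod (fourier f \<xi>) \<le> (LINT x|lborel. cmod (f x))"
proof -
  have "cmod (fourier f \<xi>) \<le> (LINT x|lborel. cmod (f x * cis (- (2 * pi * (\<xi> \<bullet> x)))))"
    unfolding fourier_def by (rule integral_norm_bound)
  then show ?thesis by (simp add: norm_mult)
qed

lemma fourier_lincomb:
  assumes "\<And>i. i \<in> I \<Longrightarrow> integrable lborel (f i)"
  shows "fourier (\<lambda>x. \<Sum>i\<in>I. a i * f i x) \<xi> = (\<Sum>i\<in>I. a i * fourier (f i) \<xi>)"
proof -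
  have "fourier (\<lambda>x. \<Sum>i\<in>I. a i * f i x) \<xi> = (LINT x|lborel. (\<Sum>i\<in>I. a i * (f i x * cis (- (2 * pi * (\<xi> \<bullet> x))))))"
    unfolding fourier_def by (simp add: sum_distrib_right mult.assoc)
  also have "\<dots> = (\<Sum>i\<in>I. LINT x|lborel. a i * (f i x * cis (- (2 * pi * (\<xi> \<bullet> x)))))"
    using fourier_integrable[OF assms] by (intro Bochner_Integration.integral_sum) auto
  finally show ?thesis by (simp add: fourier_def)
qed

lemma bessel_kernel_eq: "bessel_kernel b x = (LINT \<xi>|lborel. cis (2 * pi * (\<xi> \<bullet> x)) * of_real (bessel_symbol b \<xi>))"
  by (simp add: bessel_kernel_def inverse_fourier_def bessel_symbol_def)

lemma bessel_kernel_bound: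
  assumes "2 < b"
  shows "cmod (bessel_kernel b x) \<le> bessel_const b"
proof -
  have "cmod (bessel_kernel b x) \<le> (LINT \<xi>|lborel. cmod (cis (2 * pi * (\<xi> \<bullet> x)) * of_real (bessel_symbol b \<xi>)))"
    unfolding bessel_kernel_eq by (rule integral_norm_bound)
  also have "\<dots> = (LINT \<xi>|lborel. bessel_symbol b (\<xi> :: real ^ 2))"
    by (simp add: norm_mult less_imp_le[OF bessel_symbol_pos])
  also have "\<dots> \<le> bessel_const b"
  proof -
    have "ennreal (LINT \<xi>|lborel. bessel_symbol b (\<xi> :: real ^ 2)) = (\<integral>\<^sup>+\<xi>. ennreal (bessel_symbol b (\<xi> :: real ^ 2)) \<partial>lborel)"
      using integrable_bessel_symbol(1)[OF assms] less_imp_le[OF bessel_symbol_pos]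
      by (intro nn_integral_eq_integral[symmetric]) auto
    then show ?thesis using integrable_bessel_symbol(2)[OF assms] bessel_const_pos[OF assms] by (metis ennreal_le_iff less_imp_le)
  qed
  finally show ?thesis .
qed

lemma measurable_bessel_kernel [measurable]: "bessel_kernel b \<in> borel_measurable borel"
  unfolding bessel_kernel_def bessel_symbol_def[symmetric] by measurable

lemma bessel_conv_fourier:
  assumes b: "2 < b" and f: "integrable lborel f"
  shows "bessel_conv b f t = inverse_fourier (\<lambda>\<xi>. of_real (bessel_symbol b \<xi>) * fourier f \<xi>) t"
proof -
  have [measurable]: "f \<in> borel_measurable borel" using f by auto
  have nf: "integrable lborel (\<lambda>x. cmod (f x))" using f by simp
  have "bessel_conv b f t = (LINT y|lborel. LINT \<xi>|lborel. cis (2 * pi * (\<xi> \<bullet> (t - y))) * of_real (bessel_symbol b \<xi>) * f y)"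
    unfolding bessel_conv_def bessel_kernel_eq by simp
  also have "\<dots> = (LINT \<xi>|lborel. LINT y|lborel. cis (2 * pi * (\<xi> \<bullet> (t - y))) * of_real (bessel_symbol b \<xi>) * f y)"
    by (rule Fubini_dominated[OF _ integrable_bessel_symbol(1)[OF b] nf])
      (auto simp: norm_mult abs_of_pos[OF bessel_symbol_pos])
  also have "\<dots> = (LINT \<xi>|lborel. LINT y|lborel. cis (2 * pi * (\<xi> \<bullet> t)) * of_real (bessel_symbol b \<xi>) * (f y * cis (- (2 * pi * (\<xi> \<bullet> y)))))"
  proof -
    have c: "cis (2 * pi * (\<xi> \<bullet> (t - y))) = cis (2 * pi * (\<xi> \<bullet> t)) * cis (- (2 * pi * (\<xi> \<bullet> y)))" for \<xi> y :: "real ^ 2"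
      by (simp add: cis_mult inner_diff_right right_diff_distrib)
    show ?thesis unfolding c by (simp only: mult_ac)
  qed
  also have "\<dots> = inverse_fourier (\<lambda>\<xi>. of_real (bessel_symbol b \<xi>) * fourier f \<xi>) t"
    unfolding inverse_fourier_def fourier_def by (simp add: mult.assoc)
  finally show ?thesis .
qed

lemma fourier_dilation:
  fixes \<theta> :: "real \<Rightarrow> complex" and n :: int
  assumes \<theta>: "integrable lborel \<theta>" and j: "0 < c"
  shows "integrable lborel (\<lambda>y. \<theta> (c * y - of_int n))"
    and "(LINT y|lborel. \<theta> (c * y - of_int n) * cis (- (2 * pi * (\<xi> * y)))) = of_real (1 / c) * cis (- (2 * pi * (of_int n * (\<xi> / c)))) * fourier \<theta> (\<xi> / c)"
proof -
  have [measurable]: "\<theta> \<in> borel_measurable borel" using \<theta> by auto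
  show "integrable lborel (\<lambda>y. \<theta> (c * y - of_int n))"
    using lborel_integrable_real_affine[OF \<theta>, of c "- of_int n"] j by simp
  have "(LINT y|lborel. \<theta> (c * y - of_int n) * cis (- (2 * pi * (\<xi> * y))))
     = \<bar>1 / c\<bar> *\<^sub>R (LINT x|lborel. \<theta> (c * (of_int n / c + 1 / c * x) - of_int n) * cis (- (2 * pi * (\<xi> * (of_int n / c + 1 / c * x)))))"
    by (rule lborel_integral_real_affine) (use j in simp)
  also have "(LINT x|lborel. \<theta> (c * (of_int n / c + 1 / c * x) - of_int n) * cis (- (2 * pi * (\<xi> * (of_int n / c + 1 / c * x)))))
     = (LINT x|lborel. cis (- (2 * pi * (of_int n * (\<xi> / c)))) * (\<theta> x * cis (- (2 * pi * (\<xi> / c * x)))))"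
  proof -
    have "\<theta> (c * (of_int n / c + 1 / c * x) - of_int n) = \<theta> x" for x using j by (simp add: field_simps)
    moreover have "cis (- (2 * pi * (\<xi> * (of_int n / c + 1 / c * x)))) = cis (- (2 * pi * (of_int n * (\<xi> / c)))) * cis (- (2 * pi * (\<xi> / c * x)))" for x
      unfolding cis_mult by (simp add: algebra_simps)
    ultimately show ?thesis by (simp add: mult_ac)
  qed
  also have "\<dots> = cis (- (2 * pi * (of_int n * (\<xi> / c)))) * fourier \<theta> (\<xi> / c)" by (simp add: fourier_def)
  finally show "(LINT y|lborel. \<theta> (c * y - of_int n) * cis (- (2 * pi * (\<xi> * y)))) = of_real (1 / c) * cis (- (2 * pi * (of_int n * (\<xi> / c)))) * fourier \<theta> (\<xi> / c)"
    using j by (simp add: scaleR_conv_of_real mult.assoc)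
qed

abbreviation gen :: "(real \<Rightarrow> complex) \<Rightarrow> (real \<Rightarrow> complex) \<Rightarrow> bool \<Rightarrow> real \<Rightarrow> complex" where
  "gen \<psi> \<phi> e \<equiv> (if e then \<phi> else \<psi>)"

lemma watom_eq: "watom \<psi> \<phi> (j, n, e) x =
     2 ^ j * gen \<psi> \<phi> (fst e) (2 ^ j * x $ 1 - of_int (fst n)) * gen \<psi> \<phi> (snd e) (2 ^ j * x $ 2 - of_int (snd n))"
  by (cases n; cases e) simp

lemma
  assumes "integrable lborel \<psi>" "integrable lborel \<phi>"
  shows integrable_watom: "integrable lborel (watom \<psi> \<phi> (j, n, e))"
    and fourier_watom: "fourier (watom \<psi> \<phi> (j, n, e)) \<xi> = of_real (1 / 2 ^ j) *
      cis (- (2 * pi * (of_int (fst n) * ((1 / 2 ^ j) *\<^sub>R \<xi>) $ 1 + of_int (snd n) * ((1 / 2 ^ j) *\<^sub>R \<xi>) $ 2))) *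
      (fourier (gen \<psi> \<phi> (fst e)) (\<xi> $ 1 / 2 ^ j) * fourier (gen \<psi> \<phi> (snd e)) (\<xi> $ 2 / 2 ^ j))"
proof -
  have g: "integrable lborel (gen \<psi> \<phi> e)" for e using assms by simp
  have c: "0 < (2 :: real) ^ j" by simp
  let ?f1 = "\<lambda>y. gen \<psi> \<phi> (fst e) (2 ^ j * y - of_int (fst n))" and ?f2 = "\<lambda>y. gen \<psi> \<phi> (snd e) (2 ^ j * y - of_int (snd n))"
  note i = fourier_dilation(1)[OF g c]
  have eq: "watom \<psi> \<phi> (j, n, e) = (\<lambda>x. 2 ^ j * (?f1 (x $ 1) * ?f2 (x $ 2)))" by (auto simp: watom_eq mult.assoc)
  show "integrable lborel (watom \<psi> \<phi> (j, n, e))"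
    unfolding eq by (intro integrable_mult_right integrable_tensor2 i)
  have i': "integrable lborel (\<lambda>y. gen \<psi> \<phi> e (2 ^ j * y - of_int n) * cis (- (2 * pi * (\<xi> * y))))" for e n \<xi>
    using fourier_integrable[OF i[of e n], of \<xi>] by simp
  have "fourier (watom \<psi> \<phi> (j, n, e)) \<xi> = 2 ^ j * (LINT x|(lborel :: (real ^ 2) measure). (?f1 (x $ 1) * cis (- (2 * pi * (\<xi> $ 1 * x $ 1)))) * (?f2 (x $ 2) * cis (- (2 * pi * (\<xi> $ 2 * x $ 2)))))"
  proof -
    have "cis (- (2 * pi * (\<xi> \<bullet> x))) = cis (- (2 * pi * (\<xi> $ 1 * x $ 1))) * cis (- (2 * pi * (\<xi> $ 2 * x $ 2)))" for x
      unfolding cis_mult inner_vec2 by (simp add: algebra_simps)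
    then show ?thesis unfolding fourier_def eq by (simp add: mult_ac)
  qed
  also have "\<dots> = 2 ^ j * ((LINT x|lborel. ?f1 x * cis (- (2 * pi * (\<xi> $ 1 * x)))) * (LINT x|lborel. ?f2 x * cis (- (2 * pi * (\<xi> $ 2 * x)))))"
    by (subst integral_tensor2[OF i' i']) simp
  also have "\<dots> = of_real (1 / 2 ^ j) *
      (cis (- (2 * pi * (of_int (fst n) * (\<xi> $ 1 / 2 ^ j)))) * cis (- (2 * pi * (of_int (snd n) * (\<xi> $ 2 / 2 ^ j))))) *
      (fourier (gen \<psi> \<phi> (fst e)) (\<xi> $ 1 / 2 ^ j) * fourier (gen \<psi> \<phi> (snd e)) (\<xi> $ 2 / 2 ^ j))"
    unfolding fourier_dilation(2)[OF g c] by simp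
  also have "cis (- (2 * pi * (of_int (fst n) * (\<xi> $ 1 / 2 ^ j)))) * cis (- (2 * pi * (of_int (snd n) * (\<xi> $ 2 / 2 ^ j))))
     = cis (- (2 * pi * (of_int (fst n) * ((1 / 2 ^ j) *\<^sub>R \<xi>) $ 1 + of_int (snd n) * ((1 / 2 ^ j) *\<^sub>R \<xi>) $ 2)))"
    unfolding cis_mult by (simp add: algebra_simps)
  finally show "fourier (watom \<psi> \<phi> (j, n, e)) \<xi> = of_real (1 / 2 ^ j) *
      cis (- (2 * pi * (of_int (fst n) * ((1 / 2 ^ j) *\<^sub>R \<xi>) $ 1 + of_int (snd n) * ((1 / 2 ^ j) *\<^sub>R \<xi>) $ 2))) *
      (fourier (gen \<psi> \<phi> (fst e)) (\<xi> $ 1 / 2 ^ j) * fourier (gen \<psi> \<phi> (snd e)) (\<xi> $ 2 / 2 ^ j))" .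
qed

section \<open>Forward images of a single scale\<close>

text \<open>The source of the gain \<open>s powr b\<close>. The symbol at \<eta> / s is at most
  \<open>s powr b * norm \<eta> powr (- b)\<close>, which is harmless for large \<eta>; near the
  origin its blow-up is cancelled by the decay of \<open>z\<close>, the trace of the vanishing
  moments. For s = 1 no gain is claimed, which admits products of scaling functions.\<close>

lemma bessel_symbol_dilation:
  fixes \<eta> :: "'a::euclidean_space"
  assumes b: "0 < b" and s: "0 < s" "s \<le> 1" and K: "0 \<le> K" and z: "z \<le> K" "s = 1 \<or> z \<le> K * norm \<eta> powr b"
  shows "bessel_symbol b ((1 / s) *\<^sub>R \<eta>) * z \<le> K * 2 powr (b / 2) * s powr b * bessel_symbol b \<eta>"
proof (cases "s = 1")
  case True
  have "1 \<le> 2 powr (b / 2)" using b by (simp add: ge_one_powr_ge_zero)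
  then have "z * 1 \<le> K * 2 powr (b / 2)" using z K by (intro mult_mono) auto
  then show ?thesis using True mult_right_mono[of z "K * 2 powr (b / 2)" "bessel_symbol b \<eta>"] bessel_symbol_pos[of b \<eta>]
    by (simp add: mult_ac)
next
  case False
  then have z2: "z \<le> K * norm \<eta> powr b" using z by simp
  show ?thesis
  proof (cases "\<eta> = 0")
    case True
    then have "z \<le> 0" using z2 b by simp
    then have "bessel_symbol b ((1 / s) *\<^sub>R \<eta>) * z \<le> 0" using bessel_symbol_pos[of b "(1 / s) *\<^sub>R \<eta>"] by (simp add: mult_nonneg_nonpos)
    also have "0 \<le> K * 2 powr (b / 2) * s powr b * bessel_symbol b \<eta>"
      using K bessel_symbol_pos[of b \<eta>] by (intro mult_nonneg_nonneg) auto
    finally show ?thesis .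
  next
    case nz: False
    have zz: "norm \<eta> powr (- b) * z \<le> K * 2 powr (b / 2) * bessel_symbol b \<eta>"
    proof -
      \<comment> \<open>The factor \<open>2 powr (b / 2)\<close> replaces 1 + |\<eta>|^2 by its
        half, which is at most |\<eta>|^2 when |\<eta>| is at least 1 and at most 1
        otherwise.\<close>
      have two: "2 powr (b / 2) * bessel_symbol b \<eta> = ((1 + (norm \<eta>)\<^sup>2) / 2) powr (- (b / 2))"
        unfolding bessel_symbol_def by (simp add: powr_divide powr_minus field_simps add_nonneg_nonneg)
      show ?thesis
      proof (cases "1 \<le> norm \<eta>")
        case True
        have "norm \<eta> powr (- b) = ((norm \<eta>)\<^sup>2) powr (- (b / 2))"
          using nz by (simp add: powr_powr flip: powr_numeral)
        also have "\<dots> \<le> ((1 + (norm \<eta>)\<^sup>2) / 2) powr (- (b / 2))"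
          using True b by (intro powr_mono2') (auto simp: add_pos_nonneg)
        finally have "norm \<eta> powr (- b) * z \<le> ((1 + (norm \<eta>)\<^sup>2) / 2) powr (- (b / 2)) * K"
          using z K by (intro order_trans[OF mult_left_mono[OF z(1)] mult_right_mono]) auto
        then show ?thesis unfolding two[symmetric] by (simp add: mult_ac)
      next
        case False
        have "norm \<eta> powr (- b) * z \<le> norm \<eta> powr (- b) * (K * norm \<eta> powr b)" by (intro mult_left_mono z2) auto
        also have "\<dots> = K * 1" using nz by (simp add: powr_minus field_simps)
        also have "\<dots> \<le> K * ((1 + (norm \<eta>)\<^sup>2) / 2) powr (- (b / 2))"
        proof (intro mult_left_mono K)
          have "(norm \<eta>)\<^sup>2 \<le> 1" using False by (simp add: power_le_one)
          then have "1 powr (- (b / 2)) \<le> ((1 + (norm \<eta>)\<^sup>2) / 2) powr (- (b / 2))"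
            using b by (intro powr_mono2') (auto simp: add_pos_nonneg)
          then show "1 \<le> ((1 + (norm \<eta>)\<^sup>2) / 2) powr (- (b / 2))" by simp
        qed
        finally show ?thesis unfolding two[symmetric] by (simp add: mult_ac)
      qed
    qed
    have "bessel_symbol b ((1 / s) *\<^sub>R \<eta>) \<le> (norm \<eta> / s) powr (- b)"
      using nz s b by (intro bessel_symbol_le_powr) auto
    also have "\<dots> = s powr b * norm \<eta> powr (- b)" using nz s by (simp add: powr_divide powr_minus field_simps)
    finally have le: "bessel_symbol b ((1 / s) *\<^sub>R \<eta>) \<le> s powr b * norm \<eta> powr (- b)" .
    show ?thesis
    proof (cases "0 \<le> z")
      case True
      have "bessel_symbol b ((1 / s) *\<^sub>R \<eta>) * z \<le> s powr b * norm \<eta> powr (- b) * z" by (intro mult_right_mono le True)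
      also have "\<dots> \<le> s powr b * (K * 2 powr (b / 2) * bessel_symbol b \<eta>)"
        unfolding mult.assoc[of "s powr b"] by (intro mult_left_mono zz) auto
      finally show ?thesis by (simp add: mult_ac)
    next
      case False
      then have "bessel_symbol b ((1 / s) *\<^sub>R \<eta>) * z \<le> 0" using bessel_symbol_pos[of b "(1 / s) *\<^sub>R \<eta>"] by (simp add: mult_nonneg_nonpos)
      also have "0 \<le> K * 2 powr (b / 2) * s powr b * bessel_symbol b \<eta>"
        using K bessel_symbol_pos[of b \<eta>] by (intro mult_nonneg_nonneg) auto
      finally show ?thesis .
    qed
  qed
qed

text \<open>Atoms of one scale and type differ only by translation, so the Fourier transform of a
  combination is a trigonometric polynomial at \<open>s *\<^sub>R \<xi>\<close> times one fixed
  product of generators. With A of order 2^(-(b + 1) j), the quotients by s^4 and by s^2 in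
  \<open>multiplier_estimates\<close> give the two exponents.\<close>

theorem bessel_conv_single_scale:
  fixes a :: "int \<times> int \<Rightarrow> complex"
  assumes b: "2 < b" and int: "integrable lborel \<psi>" "integrable lborel \<phi>"
    and K: "0 \<le> K" "\<And>\<eta>. cmod (fourier \<psi> \<eta>) \<le> K" "\<And>\<eta>. cmod (fourier \<phi> \<eta>) \<le> K" "\<And>\<eta>. cmod (fourier \<phi> \<eta>) \<le> K * \<bar>\<eta>\<bar> powr b"
    and F: "finite F" and e: "e = (False, False) \<Longrightarrow> j = 0"
  defines "w \<equiv> bessel_conv b (\<lambda>x. \<Sum>n\<in>F. a n * watom \<psi> \<phi> (j, n, e) x)"
    and "S \<equiv> (\<Sum>n\<in>F. (cmod (a n))\<^sup>2)" and "R \<equiv> (bessel_const b + exp 1) * bessel_const b * (K\<^sup>2 * 2 powr (b / 2))\<^sup>2"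
  shows "(cmod (w t))\<^sup>2 \<le> R * 2 powr (2 * (1 - b) * real j) * S"
    and "0 < N \<Longrightarrow> (LINT t|lborel. indicator (cball 0 N) t * (cmod (w t))\<^sup>2) \<le> R * 2 powr (- 2 * b * real j) * S"
proof -
  define s :: real where "s = 1 / 2 ^ j"
  have s: "0 < s" "s \<le> 1" by (auto simp: s_def)
  have s2: "s = 2 powr (- real j)" by (simp add: s_def powr_minus powr_realpow field_simps)
  \<comment> \<open>One factor \<open>s\<close> is the normalisation of the Fourier transform of an
    atom, \<open>s powr b\<close> is the gain from \<open>bessel_symbol_dilation\<close>, and the
    square of \<open>K\<close> comes from the two generators.\<close>
  define A where "A = K\<^sup>2 * 2 powr (b / 2) * (s powr b * s)"
  have A: "0 \<le> A" using s by (simp add: A_def)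
  define \<Theta> where "\<Theta> \<xi> = fourier (gen \<psi> \<phi> (fst e)) (\<xi> $ 1 / 2 ^ j) * fourier (gen \<psi> \<phi> (snd e)) (\<xi> $ 2 / 2 ^ j)" for \<xi> :: "real ^ 2"
  define H where "H \<xi> = of_real (bessel_symbol b \<xi>) * (of_real s * trig_poly2 F a (s *\<^sub>R \<xi>) * \<Theta> \<xi>)" for \<xi>
  have [measurable]: "\<psi> \<in> borel_measurable borel" "\<phi> \<in> borel_measurable borel" using int by auto
  have [measurable]: "gen \<psi> \<phi> e \<in> borel_measurable borel" for e by (cases e) auto
  have [measurable]: "\<Theta> \<in> borel_measurable borel" unfolding \<Theta>_def by measurable
  have [measurable]: "H \<in> borel_measurable borel" unfolding H_def by measurable
  have C: "0 < bessel_const b" by (rule bessel_const_pos[OF b])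
  have S0: "0 \<le> S" by (simp add: S_def sum_nonneg)
  have wH: "w t = inverse_fourier H t" for t
  proof -
    have "fourier (\<lambda>x. \<Sum>n\<in>F. a n * watom \<psi> \<phi> (j, n, e) x) \<xi> = of_real s * trig_poly2 F a (s *\<^sub>R \<xi>) * \<Theta> \<xi>" for \<xi>
      unfolding fourier_lincomb[OF integrable_watom[OF int]] fourier_watom[OF int] trig_poly2_def \<Theta>_def s_def
      by (simp add: sum_distrib_left sum_distrib_right mult_ac)
    then show ?thesis unfolding w_def H_def
      by (subst bessel_conv_fourier[OF b]) (auto intro!: Bochner_Integration.integrable_sum integrable_mult_right integrable_watom[OF int])
  qed
  have gK: "cmod (fourier (gen \<psi> \<phi> e) \<eta>) \<le> K" for e \<eta> using K by simp
  have bnd: "cmod (H \<xi>) \<le> A * (bessel_symbol b (s *\<^sub>R \<xi>) * cmod (trig_poly2 F a (s *\<^sub>R \<xi>)))" for \<xi>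
  proof -
    define \<eta> where "\<eta> = s *\<^sub>R \<xi>"
    have x1: "\<xi> $ i / 2 ^ j = \<eta> $ i" for i by (simp add: \<eta>_def s_def)
    have \<xi>\<eta>: "\<xi> = (1 / s) *\<^sub>R \<eta>" using s by (simp add: \<eta>_def)
    have z1: "cmod (\<Theta> \<xi>) \<le> K\<^sup>2"
      unfolding \<Theta>_def norm_mult power2_eq_square by (intro mult_mono gK K) auto
    \<comment> \<open>Away from scale 0 at least one of the two generators is the wavelet, and its
      decay at the origin is enough for the product.\<close>
    have z2: "s = 1 \<or> cmod (\<Theta> \<xi>) \<le> K\<^sup>2 * norm \<eta> powr b"
    proof (cases "e = (False, False)")
      case True
      then show ?thesis using e by (simp add: s_def)
    next
      case False
      have comp: "\<bar>\<eta> $ i\<bar> powr b \<le> norm \<eta> powr b" for i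
        using component_le_norm_cart[of \<eta> i] b by (intro powr_mono2) auto
      have "fst e \<or> snd e" using False by (cases e) auto
      then have "cmod (\<Theta> \<xi>) \<le> K * (K * norm \<eta> powr b)"
      proof
        assume "fst e"
        then have "cmod (fourier (gen \<psi> \<phi> (fst e)) (\<eta> $ 1)) \<le> K * norm \<eta> powr b"
          using K(4)[of "\<eta> $ 1"] mult_left_mono[OF comp K(1), of 1] by simp
        then have "cmod (\<Theta> \<xi>) \<le> (K * norm \<eta> powr b) * K"
          unfolding \<Theta>_def norm_mult x1 using K(1) by (intro mult_mono gK) auto
        then show ?thesis by (simp add: mult_ac)
      next
        assume "snd e"
        then have "cmod (fourier (gen \<psi> \<phi> (snd e)) (\<eta> $ 2)) \<le> K * norm \<eta> powr b"
          using K(4)[of "\<eta> $ 2"] mult_left_mono[OF comp K(1), of 2] by simp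
        then show ?thesis
          unfolding \<Theta>_def norm_mult x1 using K(1) by (intro mult_mono gK) auto
      qed
      then show ?thesis by (simp add: power2_eq_square mult_ac)
    qed
    have "cmod (H \<xi>) = s * cmod (trig_poly2 F a \<eta>) * (bessel_symbol b \<xi> * cmod (\<Theta> \<xi>))"
      using s less_imp_le[OF bessel_symbol_pos[of b \<xi>]] by (simp add: H_def norm_mult \<eta>_def mult_ac)
    also have "\<dots> \<le> s * cmod (trig_poly2 F a \<eta>) * (K\<^sup>2 * 2 powr (b / 2) * s powr b * bessel_symbol b \<eta>)"
      unfolding \<xi>\<eta> using b s z1 z2 by (intro mult_left_mono bessel_symbol_dilation) (auto simp: \<xi>\<eta>[symmetric])
    also have "\<dots> = A * (bessel_symbol b \<eta> * cmod (trig_poly2 F a \<eta>))" by (simp add: A_def mult_ac)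
    finally show ?thesis by (simp add: \<eta>_def)
  qed
  note est = multiplier_estimates[OF b F s(1) A \<open>H \<in> borel_measurable borel\<close> bnd, folded S_def]
  let ?k = "(K\<^sup>2 * 2 powr (b / 2))\<^sup>2"
  have A2: "A\<^sup>2 = ?k * 2 powr (- 2 * (b + 1) * real j)"
  proof -
    have "s powr b * s = 2 powr (- (b + 1) * real j)" unfolding s2 powr_powr by (simp add: algebra_simps flip: powr_add)
    then show ?thesis unfolding A_def power_mult_distrib[of _ "s powr b * s"] by (simp add: power2_eq_square mult_ac flip: powr_add)
  qed
  have R1: "(bessel_const b)\<^sup>2 * ?k \<le> R" "exp 1 * bessel_const b * ?k \<le> R"
  proof -
    have "bessel_const b * bessel_const b * ?k \<le> R"
      unfolding R_def using C by (intro mult_right_mono) auto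
    then show "(bessel_const b)\<^sup>2 * ?k \<le> R" by (simp only: power2_eq_square)
    show "exp 1 * bessel_const b * ?k \<le> R"
      unfolding R_def using C by (intro mult_right_mono) auto
  qed
  have eq4: "A\<^sup>2 / s ^ 4 = ?k * 2 powr (2 * (1 - b) * real j)"
  proof -
    have "s ^ 4 = 2 powr (- 4 * real j)" unfolding s2 by (simp add: powr_powr mult.commute flip: powr_realpow)
    moreover have "- 2 * (b + 1) * real j - - 4 * real j = 2 * (1 - b) * real j" by (simp add: algebra_simps)
    ultimately show ?thesis unfolding A2 by (simp only: times_divide_eq_right[symmetric] powr_diff[symmetric])
  qed
  have "(cmod (w t))\<^sup>2 \<le> (bessel_const b)\<^sup>2 * (A\<^sup>2 / s ^ 4) * S" unfolding wH using est(2) by simp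
  also have "\<dots> = ((bessel_const b)\<^sup>2 * ?k) * (2 powr (2 * (1 - b) * real j) * S)" unfolding eq4 by (simp only: mult_ac)
  also have "\<dots> \<le> R * (2 powr (2 * (1 - b) * real j) * S)" using S0 by (intro mult_right_mono R1) auto
  finally show "(cmod (w t))\<^sup>2 \<le> R * 2 powr (2 * (1 - b) * real j) * S" by (simp add: mult.assoc)
  assume N: "0 < N"
  have eq2: "A\<^sup>2 / s\<^sup>2 = ?k * 2 powr (- 2 * b * real j)"
  proof -
    have "s\<^sup>2 = 2 powr (- 2 * real j)" unfolding s2 by (simp add: powr_powr mult.commute flip: powr_realpow)
    moreover have "- 2 * (b + 1) * real j - - 2 * real j = - 2 * b * real j" by (simp add: algebra_simps)
    ultimately show ?thesis unfolding A2 by (simp only: times_divide_eq_right[symmetric] powr_diff[symmetric])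
  qed
  have "(LINT t|lborel. indicator (cball 0 N) t * (cmod (w t))\<^sup>2) \<le> exp 1 * bessel_const b * (A\<^sup>2 / s\<^sup>2) * S"
    unfolding wH using est(3)[OF N] by simp
  also have "\<dots> = (exp 1 * bessel_const b * ?k) * (2 powr (- 2 * b * real j) * S)" unfolding eq2 by (simp only: mult_ac)
  also have "\<dots> \<le> R * (2 powr (- 2 * b * real j) * S)" using S0 by (intro mult_right_mono R1) auto
  finally show "(LINT t|lborel. indicator (cball 0 N) t * (cmod (w t))\<^sup>2) \<le> R * 2 powr (- 2 * b * real j) * S" by (simp add: mult.assoc)
qed

section \<open>Taylor expansion and dyadic points\<close>

text \<open>For complex values the Lagrange form of the remainder fails. The remainder of order p +
  1 has as derivative the remainder of order p of the shifted family, and the mean value inequality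
  integrates the bound; the factorial is given away.\<close>

lemma taylor_remainder_bound:
  fixes D :: "nat \<Rightarrow> real \<Rightarrow> complex"
  assumes der: "\<And>k x. k < p \<Longrightarrow> (D k has_vector_derivative D (Suc k) x) (at x)"
    and bd: "\<And>x. cmod (D p x) \<le> K"
  shows "cmod (D 0 (a + h) - (\<Sum>i<p. D i a * of_real (h ^ i / fact i))) \<le> K * \<bar>h\<bar> ^ p"
  using der bd
proof (induction p arbitrary: D h)
  case 0
  then show ?case by simp
next
  case (Suc p)
  define r where "r h = D 0 (a + h) - (\<Sum>i<Suc p. D i a * of_real (h ^ i / fact i))" for h
  define r' where "r' h = D 1 (a + h) - (\<Sum>i<p. D (Suc i) a * of_real (h ^ i / fact i))" for h
  have K: "0 \<le> K" using Suc.prems(2)[of 0] norm_ge_zero order_trans by blast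
  have r'_le: "cmod (r' h) \<le> K * \<bar>h\<bar> ^ p" for h
    using Suc.IH[of "\<lambda>k. D (Suc k)" h] Suc.prems unfolding r'_def by simp
  have deriv: "(r has_vector_derivative r' h) (at h)" for h
  proof -
    have "((\<lambda>h. D 0 (a + h)) has_vector_derivative D 1 (a + h)) (at h)"
    proof -
      have "(D 0 has_vector_derivative D (Suc 0) (a + h)) (at (a + h))" using Suc.prems(1)[of 0 "a + h"] by simp
      then have "(D 0 \<circ> (\<lambda>h. a + h) has_vector_derivative (1 *\<^sub>R D (Suc 0) (a + h))) (at h)"
        by (intro vector_diff_chain_at) (auto intro!: derivative_eq_intros)
      then show ?thesis by (simp add: o_def)
    qed
    moreover have "((\<lambda>h. \<Sum>i<Suc p. D i a * of_real (h ^ i / fact i)) has_vector_derivative (\<Sum>i<p. D (Suc i) a * of_real (h ^ i / fact i))) (at h)"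
    proof -
      have trm: "((\<lambda>h. D i a * of_real (h ^ i / fact i)) has_vector_derivative D i a * of_real (real i * h ^ (i - 1) / fact i)) (at h)" for i
        by (intro has_vector_derivative_mult_right has_vector_derivative_of_real)
           (auto intro!: derivative_eq_intros simp: has_real_derivative_iff_has_vector_derivative[symmetric])
      have "((\<lambda>h. \<Sum>i<Suc p. D i a * of_real (h ^ i / fact i)) has_vector_derivative (\<Sum>i<Suc p. D i a * of_real (real i * h ^ (i - 1) / fact i))) (at h)"
        by (intro has_vector_derivative_sum trm)
      also have "(\<Sum>i<Suc p. D i a * of_real (real i * h ^ (i - 1) / fact i)) = (\<Sum>i<p. D (Suc i) a * of_real (h ^ i / fact i))"
      proof -
        have "real (Suc i) * h ^ (Suc i - 1) / fact (Suc i) = h ^ i / fact i" for i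
          unfolding fact_Suc of_nat_mult diff_Suc_1 by (rule mult_divide_mult_cancel_left) simp
        then show ?thesis by (subst sum.lessThan_Suc_shift) (simp del: fact_Suc of_nat_Suc of_real_divide)
      qed
      finally show ?thesis .
    qed
    ultimately show ?thesis unfolding r_def r'_def by (rule has_vector_derivative_diff)
  qed
  have r0: "r 0 = 0"
    unfolding r_def by (subst sum.lessThan_Suc_shift) simp
  have "norm (r h - r 0) \<le> (K * \<bar>h\<bar> ^ p) * norm (h - 0)"
  proof (rule differentiable_bound[where S="cball 0 \<bar>h\<bar>" and f'="\<lambda>x y. y *\<^sub>R r' x"])
    fix x :: real assume x: "x \<in> cball 0 \<bar>h\<bar>"
    show "(r has_derivative (\<lambda>y. y *\<^sub>R r' x)) (at x within cball 0 \<bar>h\<bar>)"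
      using deriv[of x] unfolding has_vector_derivative_def by (rule has_derivative_at_withinI)
    have "onorm (\<lambda>y. y *\<^sub>R r' x) \<le> cmod (r' x)"
      by (rule onorm_le) (simp add: mult.commute)
    also have "\<dots> \<le> K * \<bar>x\<bar> ^ p" by (rule r'_le)
    also have "\<dots> \<le> K * \<bar>h\<bar> ^ p" using x K by (intro mult_left_mono power_mono) auto
    finally show "onorm (\<lambda>y. y *\<^sub>R r' x) \<le> K * \<bar>h\<bar> ^ p" .
  qed auto
  then show ?case unfolding r0 by (simp add: r_def mult_ac)
qed

lemma dyadic_approximation: "(\<lambda>J. of_int \<lfloor>2 ^ J * x\<rfloor> / 2 ^ J) \<longlonglongrightarrow> (x :: real)"
proof (rule metric_LIMSEQ_I)
  fix e :: real assume "e > 0"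
  then obtain N where N: "(1 / 2) ^ N < e" using real_arch_pow_inv[of e "1/2"] by auto
  show "\<exists>N. \<forall>J\<ge>N. dist (of_int \<lfloor>2 ^ J * x\<rfloor> / 2 ^ J) x < e"
  proof (intro exI allI impI)
    fix J assume "N \<le> J"
    have "\<bar>of_int \<lfloor>2 ^ J * x\<rfloor> - 2 ^ J * x\<bar> \<le> 1" by linarith
    then have "\<bar>of_int \<lfloor>2 ^ J * x\<rfloor> - 2 ^ J * x\<bar> / 2 ^ J \<le> 1 / 2 ^ J" by (intro divide_right_mono) auto
    moreover have "\<bar>of_int \<lfloor>2 ^ J * x\<rfloor> - 2 ^ J * x\<bar> / 2 ^ J = \<bar>of_int \<lfloor>2 ^ J * x\<rfloor> / 2 ^ J - x\<bar>"
    proof -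
      have "\<bar>of_int \<lfloor>2 ^ J * x\<rfloor> - 2 ^ J * x\<bar> / 2 ^ J = \<bar>(of_int \<lfloor>2 ^ J * x\<rfloor> - 2 ^ J * x) / 2 ^ J\<bar>" by (simp only: abs_divide) simp
      also have "(of_int \<lfloor>2 ^ J * x\<rfloor> - 2 ^ J * x) / 2 ^ J = of_int \<lfloor>2 ^ J * x\<rfloor> / 2 ^ J - x" by (simp add: diff_divide_distrib)
      finally show ?thesis .
    qed
    moreover have "1 / 2 ^ J \<le> ((1 / 2) ^ N :: real)" using \<open>N \<le> J\<close> by (simp add: power_one_over power_decreasing[of N J "1/2 :: real"] flip: power_one_over)
    ultimately show "dist (of_int \<lfloor>2 ^ J * x\<rfloor> / 2 ^ J) x < e" using N by (simp add: dist_real_def)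
  qed
qed

lemma Ltwo_dilation:
  fixes f :: "real \<Rightarrow> complex"
  assumes "f \<in> Ltwo" "0 < c"
  shows "(\<lambda>x. f (c * x)) \<in> Ltwo" and "Ltwo_norm (\<lambda>x. f (c * x)) = Ltwo_norm f / sqrt c"
proof -
  note [measurable] = LtwoD(2)[OF assms(1)]
  have "integrable lborel (\<lambda>x. (cmod (f (0 + c * x)))\<^sup>2)"
    by (rule lborel_integrable_real_affine[OF LtwoD(3)[OF assms(1)]]) (use assms in auto)
  then show "(\<lambda>x. f (c * x)) \<in> Ltwo" by (simp add: Ltwo_def)
  have "(LINT x|lborel. (cmod (f x))\<^sup>2) = \<bar>c\<bar> *\<^sub>R (LINT x|lborel. (cmod (f (0 + c * x)))\<^sup>2)"
    by (rule lborel_integral_real_affine) (use assms in auto)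
  then have "(LINT x|lborel. (cmod (f (c * x)))\<^sup>2) = (LINT x|lborel. (cmod (f x))\<^sup>2) / c"
    using assms by simp
  then show "Ltwo_norm (\<lambda>x. f (c * x)) = Ltwo_norm f / sqrt c" by (simp add: Ltwo_norm_def real_sqrt_divide)
qed

lemma Ltwo_inner_dilation:
  fixes f g :: "real \<Rightarrow> complex"
  assumes "0 < c"
  shows "Ltwo_inner (\<lambda>x. f (c * x)) (\<lambda>x. g (c * x)) = Ltwo_inner f g / of_real c"
proof -
  have "(LINT x|lborel. f x * cnj (g x)) = \<bar>c\<bar> *\<^sub>R (LINT x|lborel. f (0 + c * x) * cnj (g (0 + c * x)))"
    by (rule lborel_integral_real_affine) (use assms in auto)
  then show ?thesis using assms by (simp add: Ltwo_inner_def scaleR_conv_of_real)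
qed

lemma Ltwo_translate:
  assumes "f \<in> Ltwo"
  shows "translate f n \<in> Ltwo"
proof -
  note [measurable] = LtwoD(2)[OF assms(1)]
  have "integrable lborel (\<lambda>x. (cmod (f (- of_int n + 1 * x)))\<^sup>2)"
    by (rule lborel_integrable_real_affine[OF LtwoD(3)[OF assms(1)]]) auto
  then show ?thesis by (simp add: Ltwo_def translate_def[abs_def])
qed

section \<open>Vanishing moments and the tensor wavelet basis\<close>

locale compact_wavelet =
  fixes V :: "int \<Rightarrow> (real \<Rightarrow> complex) set" and \<psi> \<phi> :: "real \<Rightarrow> complex" and \<rho> :: nat
  assumes mra: "regular_mra \<rho> V" and scaling: "scaling_function V \<psi>" and wavelet: "mra_wavelet V \<phi>"
    and compact: "compact (ess_support \<psi>)" "compact (ess_support \<phi>)"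
begin

lemma V_closed_subspace: "Ltwo_closed_subspace (V j)"
  and V_increasing: "V j \<subseteq> V (j + 1)"
  and V_dense: "f \<in> Ltwo \<Longrightarrow> \<delta> > 0 \<Longrightarrow> \<exists>j. \<exists>g\<in>V j. Ltwo_norm (\<lambda>x. f x - g x) < \<delta>"
  and V_dilation: "f \<in> V j \<longleftrightarrow> (\<lambda>x. f (2 * x)) \<in> V (j + 1)"
  using mra unfolding regular_mra_def mra_ladder_def by blast+

lemma V_Ltwo: "f \<in> V j \<Longrightarrow> f \<in> Ltwo"
  and V_add: "f \<in> V j \<Longrightarrow> g \<in> V j \<Longrightarrow> (\<lambda>x. f x + g x) \<in> V j"
  and V_cmult: "f \<in> V j \<Longrightarrow> (\<lambda>x. c * f x) \<in> V j"
  and V_zero: "(\<lambda>x. 0) \<in> V j"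
  using V_closed_subspace[of j] unfolding Ltwo_closed_subspace_def by blast+

lemma V_sum: "(\<And>i. i \<in> I \<Longrightarrow> f i \<in> V j) \<Longrightarrow> (\<lambda>x. \<Sum>i\<in>I. f i x) \<in> V j"
  by (induction I rule: infinite_finite_induct) (auto simp: V_zero intro: V_add)

lemma V_mono: "i \<le> j \<Longrightarrow> V i \<subseteq> V j"
proof -
  have "V i \<subseteq> V (i + int n)" for n
  proof (induction n)
    case (Suc n)
    then show ?case using V_increasing[of "i + int n"] by (auto simp: add_ac)
  qed simp
  then show "i \<le> j \<Longrightarrow> V i \<subseteq> V j" using zle_iff_zadd by auto
qed

lemma V_dilation_pow: "f \<in> V i \<longleftrightarrow> (\<lambda>x. f (2 ^ n * x)) \<in> V (i + int n)"
proof (induction n)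
  case (Suc n)
  have "f \<in> V i \<longleftrightarrow> (\<lambda>x. f (2 ^ n * (2 * x))) \<in> V (i + int n + 1)"
    unfolding Suc by (rule V_dilation)
  then show ?case by (simp add: mult_ac add_ac)
qed simp

lemma psi_V: "translate \<psi> n \<in> V 0"
  and psi_orthonormal: "Ltwo_inner (translate \<psi> n) (translate \<psi> k) = (if n = k then 1 else 0)"
  and psi_span: "Ltwo_closed_span (translate \<psi>) UNIV = V 0"
  using scaling unfolding scaling_function_def orthonormal_basis_of_def by auto

lemma phi_V: "translate \<phi> n \<in> V 1"
  and phi_orthogonal: "g \<in> V 0 \<Longrightarrow> Ltwo_inner (translate \<phi> n) g = 0"
  and phi_orthonormal: "Ltwo_inner (translate \<phi> n) (translate \<phi> k) = (if n = k then 1 else 0)"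
  and phi_span: "Ltwo_closed_span (translate \<phi>) UNIV = {f \<in> V 1. \<forall>g\<in>V 0. Ltwo_inner f g = 0}"
  using wavelet unfolding mra_wavelet_def orthonormal_basis_of_def by auto

lemma psi_Ltwo: "\<psi> \<in> Ltwo" and phi_Ltwo: "\<phi> \<in> Ltwo"
  using V_Ltwo[OF psi_V[of 0]] V_Ltwo[OF phi_V[of 0]] by (simp_all add: translate_def[abs_def])

lemma support_radius: "\<exists>R\<ge>1. (AE x in lborel. R < \<bar>x\<bar> \<longrightarrow> \<psi> x = 0) \<and> (AE x in lborel. R < \<bar>x\<bar> \<longrightarrow> \<phi> x = 0)"
proof -
  obtain R1 where R1: "\<forall>x\<in>ess_support \<psi>. norm x \<le> R1" using compact_imp_bounded[OF compact(1)] unfolding bounded_iff by blast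
  obtain R2 where R2: "\<forall>x\<in>ess_support \<phi>. norm x \<le> R2" using compact_imp_bounded[OF compact(2)] unfolding bounded_iff by blast
  let ?R = "max 1 (max R1 R2)"
  have "AE x in lborel. ?R < \<bar>x\<bar> \<longrightarrow> \<psi> x = 0"
    using AE_zero_outside_ess_support[of \<psi>] by eventually_elim (use R1 in force)
  moreover have "AE x in lborel. ?R < \<bar>x\<bar> \<longrightarrow> \<phi> x = 0"
    using AE_zero_outside_ess_support[of \<phi>] by eventually_elim (use R2 in force)
  ultimately show ?thesis by (intro exI[of _ ?R]) auto
qed

definition rad :: real where
  "rad = (SOME R. R \<ge> 1 \<and> (AE x in lborel. R < \<bar>x\<bar> \<longrightarrow> \<psi> x = 0) \<and> (AE x in lborel. R < \<bar>x\<bar> \<longrightarrow> \<phi> x = 0))"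

lemma rad: "1 \<le> rad" "AE x in lborel. rad < \<bar>x\<bar> \<longrightarrow> \<psi> x = 0" "AE x in lborel. rad < \<bar>x\<bar> \<longrightarrow> \<phi> x = 0"
  using someI_ex[OF support_radius] unfolding rad_def by blast+

lemma gen_Ltwo: "gen \<psi> \<phi> e \<in> Ltwo" using psi_Ltwo phi_Ltwo by simp

lemma gen_rad: "AE x in lborel. rad < \<bar>x\<bar> \<longrightarrow> gen \<psi> \<phi> e x = 0" using rad by simp

section \<open>Moments of the wavelet\<close>

text \<open>The weight is cut off to \<open>{- rad..rad}\<close>, where it is bounded and hence
  square integrable; outside, the generator vanishes almost everywhere. This gives all moments
  although the generators are only known to lie in \<open>Ltwo\<close>.\<close>

lemma weighted_integrable:
  fixes p :: "real \<Rightarrow> real"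
  assumes p: "continuous_on UNIV p"
  shows "integrable lborel (\<lambda>x. of_real (p x) * gen \<psi> \<phi> e x)"
proof -
  have [measurable]: "p \<in> borel_measurable borel" using p by (rule borel_measurable_continuous_onI)
  note [measurable] = LtwoD(2)[OF gen_Ltwo]
  define q where "q x = complex_of_real (indicator {- rad..rad} x * p x)" for x
  have "compact (p ` {- rad..rad})"
    by (intro compact_continuous_image continuous_on_subset[OF p]) auto
  then obtain B where B: "\<And>x. x \<in> {- rad..rad} \<Longrightarrow> \<bar>p x\<bar> \<le> B"
    unfolding bounded_iff[THEN iffD1, OF compact_imp_bounded, rule_format] using compact_imp_bounded bounded_iff by (metis image_eqI real_norm_def)
  have "q \<in> Ltwo"
  proof (rule Ltwo_bounded_by)
    show "integrable lborel (\<lambda>x. indicator {- rad..rad} x * B\<^sup>2)"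
      by (intro integrable_mult_left integrable_real_indicator) (auto simp: emeasure_lborel_Icc_eq)
    show "AE x in lborel. (cmod (q x))\<^sup>2 \<le> indicator {- rad..rad} x * B\<^sup>2"
    proof (rule AE_I2)
      fix x show "(cmod (q x))\<^sup>2 \<le> indicator {- rad..rad} x * B\<^sup>2"
        using power_mono[OF B[of x], of 2] by (cases "x \<in> {- rad..rad}") (auto simp: q_def)
    qed
    show "q \<in> borel_measurable borel" unfolding q_def by measurable
  qed
  from Ltwo_mult_integrable[OF gen_Ltwo this, of e]
  have i: "integrable lborel (\<lambda>x. gen \<psi> \<phi> e x * cnj (q x))" .
  have m1: "(\<lambda>x. of_real (p x) * gen \<psi> \<phi> e x) \<in> borel_measurable lborel" by measurable
  have ae: "AE x in lborel. gen \<psi> \<phi> e x * cnj (q x) = of_real (p x) * gen \<psi> \<phi> e x"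
    using gen_rad[of e] by eventually_elim (auto simp: q_def indicator_def)
  show ?thesis using i by (rule Bochner_Integration.integrable_cong_AE_imp[OF _ m1]) (use ae in \<open>auto elim: eventually_mono\<close>)
qed

lemma gen_integrable: "integrable lborel (gen \<psi> \<phi> e)"
  using weighted_integrable[of "\<lambda>_. 1" e] by simp

lemma moment_integrable: "integrable lborel (\<lambda>x. of_real (x ^ k) * \<phi> x)"
  using weighted_integrable[of "\<lambda>x. x ^ k" True] by (simp add: continuous_intros del: of_real_power)

lemma abs_moment_integrable: "integrable lborel (\<lambda>x. cmod (\<phi> x) * \<bar>x\<bar> ^ k)"
proof -
  have "integrable lborel (\<lambda>x. of_real (\<bar>x\<bar> ^ k) * \<phi> x)"
    using weighted_integrable[of "\<lambda>x. \<bar>x\<bar> ^ k" True] by (simp add: continuous_intros del: of_real_power)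
  from integrable_norm[OF this] show ?thesis by (simp add: norm_mult norm_power mult.commute)
qed

definition moment :: "nat \<Rightarrow> complex" where
  "moment k = (LINT x|lborel. of_real (x ^ k) * \<phi> x)"

text \<open>The wavelet is orthogonal to all functions \<open>g(2\<^sup>-\<^sup>J(x + k))\<close>, since these lie in \<open>V (-J) \<subseteq> V 0\<close>.
  Comparing with the Taylor expansion of \<open>g\<close> at a dyadic point as \<open>J\<close> grows, the first nonzero
  moment would force a derivative of \<open>g\<close> to vanish at all dyadic points.\<close>

lemma vanishing_moments: "k < \<rho> \<Longrightarrow> moment k = 0"
proof (induction k rule: less_induct)
  case (less l)
  obtain g where g: "riesz_basis_of (translate g) UNIV (V 0)" and rd: "rapidly_decreasing_C \<rho> g"
    using mra unfolding regular_mra_def by blast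
  obtain D :: "nat \<Rightarrow> real \<Rightarrow> complex" where D: "D 0 = g \<and>
        (\<forall>k<\<rho>. \<forall>x. (D k has_vector_derivative D (Suc k) x) (at x)) \<and>
        (\<forall>k\<le>\<rho>. continuous_on UNIV (D k)) \<and>
        (\<forall>k\<le>\<rho>. \<forall>p::nat. \<exists>K. \<forall>x. (1 + \<bar>x\<bar>) ^ p * cmod (D k x) \<le> K)"
    using rd unfolding rapidly_decreasing_C_def by (elim exE) (rule that)
  have D0: "D 0 = g" using D by (elim conjE)
  have der: "\<And>k x. k < \<rho> \<Longrightarrow> (D k has_vector_derivative D (Suc k) x) (at x)" using D by simp
  have cont: "\<And>k. k \<le> \<rho> \<Longrightarrow> continuous_on UNIV (D k)" using D by simp
  have dec: "\<And>k p. k \<le> \<rho> \<Longrightarrow> \<exists>K. \<forall>x. (1 + \<bar>x\<bar>) ^ p * cmod (D k x) \<le> K" using D by simp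
  have gV: "g \<in> V 0" using g unfolding riesz_basis_of_def by (auto simp: translate_def[abs_def] dest: spec[of _ 0])
  have gm[measurable]: "g \<in> borel_measurable borel" using V_Ltwo[OF gV] by (rule LtwoD)
  have pm[measurable]: "\<phi> \<in> borel_measurable borel" using phi_Ltwo by (rule LtwoD)
  have orth: "(LINT y|lborel. \<phi> y * cnj (g (of_int k / 2 ^ J + y / 2 ^ J))) = 0" for k J
  proof -
    have "(\<lambda>x. (\<lambda>y. g (y / 2 ^ J)) (2 ^ J * x)) = g" by (simp add: fun_eq_iff)
    then have "(\<lambda>y. g (y / 2 ^ J)) \<in> V (- int J)"
      using V_dilation_pow[of "\<lambda>y. g (y / 2 ^ J)" "- int J" J] gV by simp
    then have "(\<lambda>y. g (y / 2 ^ J)) \<in> V 0" using V_mono[of "- int J" 0] by auto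
    then have "0 = Ltwo_inner (translate \<phi> k) (\<lambda>y. g (y / 2 ^ J))" by (simp add: phi_orthogonal)
    also have "\<dots> = (LINT x|lborel. \<phi> (x - of_int k) * cnj (g (x / 2 ^ J)))"
      by (simp add: Ltwo_inner_def translate_def)
    also have "\<dots> = \<bar>1\<bar> *\<^sub>R (LINT y|lborel. \<phi> (of_int k + 1 * y - of_int k) * cnj (g ((of_int k + 1 * y) / 2 ^ J)))"
      by (rule lborel_integral_real_affine) simp
    finally show ?thesis by (simp add: add_divide_distrib)
  qed
  obtain K where K: "\<And>x. cmod (D (Suc l) x) \<le> K"
    using dec[of "Suc l" 0] less.prems by auto
  have DM: "D l a * cnj (moment l) = 0" if a: "a = of_int k0 / 2 ^ J0" for a k0 J0
  proof -
    define Mabs where "Mabs = (LINT x|lborel. cmod (\<phi> x) * \<bar>x\<bar> ^ Suc l)"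
    have le: "cmod (D l a * cnj (moment l)) \<le> fact l * K * Mabs * (1 / 2) ^ J" if J: "J0 \<le> J" for J
    proof -
      define h where "h = 1 / (2::real) ^ J"
      have h: "0 < h" by (simp add: h_def)
      \<comment> \<open>The dyadic point is rewritten with the finer denominator
        \<open>2 ^ J\<close>, so that \<open>orth\<close> applies at every \<open>J\<close> from
        \<open>J0\<close> on while \<open>a\<close> stays fixed.\<close>
      have aJ: "a = of_int (k0 * 2 ^ (J - J0)) / 2 ^ J"
      proof -
        have "(2::real) ^ J = 2 ^ J0 * 2 ^ (J - J0)" using J by (simp flip: power_add)
        then show ?thesis unfolding a by simp
      qed
      \<comment> \<open>Expansion to degree \<open>l\<close>: the lower moments vanish by induction,
        so only the term with \<open>h ^ l\<close> survives, and the remainder of order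
        \<open>h ^ Suc l\<close> divided by it tends to 0.\<close>
      define T where "T y = (\<Sum>i<Suc l. D i a * of_real ((h * y) ^ i / fact i))" for y
      define E where "E y = g (a + h * y) - T y" for y
      have Ele: "cmod (E y) \<le> K * \<bar>h * y\<bar> ^ Suc l" for y
        unfolding E_def T_def D0[symmetric] by (rule taylor_remainder_bound) (use der less.prems K in auto)
      have [measurable]: "T \<in> borel_measurable borel" unfolding T_def by measurable
      have [measurable]: "E \<in> borel_measurable borel" unfolding E_def by measurable
      have iT: "(\<lambda>y. \<phi> y * cnj (T y)) = (\<lambda>y. \<Sum>i<Suc l. cnj (D i a) * of_real (h ^ i / fact i) * (of_real (y ^ i) * \<phi> y))"
        unfolding T_def cnj_sum sum_distrib_left by (intro ext sum.cong refl) (simp add: power_mult_distrib mult_ac)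
      have intT: "integrable lborel (\<lambda>y. \<phi> y * cnj (T y))"
        unfolding iT by (intro Bochner_Integration.integrable_sum integrable_mult_right moment_integrable)
      have intE: "integrable lborel (\<lambda>y. \<phi> y * cnj (E y))"
      proof (rule Bochner_Integration.integrable_bound)
        show "integrable lborel (\<lambda>y. K * h ^ Suc l * (cmod (\<phi> y) * \<bar>y\<bar> ^ Suc l))"
          by (intro integrable_mult_right abs_moment_integrable)
        show "AE y in lborel. norm (\<phi> y * cnj (E y)) \<le> norm (K * h ^ Suc l * (cmod (\<phi> y) * \<bar>y\<bar> ^ Suc l))"
        proof (rule AE_I2)
          fix y
          have "norm (\<phi> y * cnj (E y)) \<le> cmod (\<phi> y) * (K * \<bar>h * y\<bar> ^ Suc l)"
            unfolding norm_mult complex_mod_cnj by (intro mult_left_mono Ele) auto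
          also have "\<dots> = K * h ^ Suc l * (cmod (\<phi> y) * \<bar>y\<bar> ^ Suc l)"
            using h by (simp add: abs_mult power_mult_distrib mult_ac)
          finally show "norm (\<phi> y * cnj (E y)) \<le> norm (K * h ^ Suc l * (cmod (\<phi> y) * \<bar>y\<bar> ^ Suc l))" by (rule order_trans) simp
        qed
      qed measurable
      have "0 = (LINT y|lborel. \<phi> y * cnj (g (a + h * y)))"
        using orth[of "k0 * 2 ^ (J - J0)" J] unfolding aJ h_def by simp
      also have "\<dots> = (LINT y|lborel. \<phi> y * cnj (T y) + \<phi> y * cnj (E y))"
        by (simp add: E_def distrib_left[symmetric] flip: complex_cnj_add)
      also have "\<dots> = (LINT y|lborel. \<phi> y * cnj (T y)) + (LINT y|lborel. \<phi> y * cnj (E y))"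
        by (rule Bochner_Integration.integral_add[OF intT intE])
      also have "(LINT y|lborel. \<phi> y * cnj (T y)) = (\<Sum>i<Suc l. cnj (D i a) * of_real (h ^ i / fact i) * moment i)"
        unfolding iT moment_def by (subst Bochner_Integration.integral_sum) (auto intro!: integrable_mult_right moment_integrable simp del: of_real_power)
      also have "\<dots> = cnj (D l a) * of_real (h ^ l / fact l) * moment l"
        using less.IH less.prems by simp
      finally have eq: "cnj (D l a) * of_real (h ^ l / fact l) * moment l = - (LINT y|lborel. \<phi> y * cnj (E y))"
        by (simp add: eq_neg_iff_add_eq_0)
      have "cmod (D l a) * (h ^ l / fact l) * cmod (moment l) = cmod (LINT y|lborel. \<phi> y * cnj (E y))"
        using arg_cong[OF eq, of cmod] h by (simp add: norm_mult norm_divide norm_power)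
      also have "\<dots> \<le> (LINT y|lborel. norm (\<phi> y * cnj (E y)))" by (rule integral_norm_bound)
      also have "\<dots> \<le> (LINT y|lborel. K * h ^ Suc l * (cmod (\<phi> y) * \<bar>y\<bar> ^ Suc l))"
      proof (intro integral_mono_AE AE_I2 integrable_norm intE integrable_mult_right abs_moment_integrable)
        fix y
        have "norm (\<phi> y * cnj (E y)) \<le> cmod (\<phi> y) * (K * \<bar>h * y\<bar> ^ Suc l)"
          unfolding norm_mult complex_mod_cnj by (intro mult_left_mono Ele) auto
        also have "\<dots> = K * h ^ Suc l * (cmod (\<phi> y) * \<bar>y\<bar> ^ Suc l)"
          using h by (simp add: abs_mult power_mult_distrib mult_ac)
        finally show "norm (\<phi> y * cnj (E y)) \<le> K * h ^ Suc l * (cmod (\<phi> y) * \<bar>y\<bar> ^ Suc l)" .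
      qed
      also have "\<dots> = K * h ^ Suc l * Mabs" by (simp add: Mabs_def)
      finally have "(h ^ l / fact l) * (cmod (D l a) * cmod (moment l)) \<le> (h ^ l / fact l) * (fact l * K * Mabs * h)"
        by (simp add: mult_ac)
      then have "cmod (D l a) * cmod (moment l) \<le> fact l * K * Mabs * h"
        using h by (subst (asm) mult_le_cancel_left_pos) auto
      then show ?thesis by (simp add: norm_mult h_def power_one_over)
    qed
    have "(\<lambda>J. fact l * K * Mabs * (1 / 2) ^ J) \<longlonglongrightarrow> fact l * K * Mabs * 0"
      by (intro tendsto_mult_left LIMSEQ_realpow_zero) auto
    moreover have "eventually (\<lambda>J. cmod (D l a * cnj (moment l)) \<le> fact l * K * Mabs * (1 / 2) ^ J) sequentially"
      using le eventually_sequentially by blast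
    ultimately have "cmod (D l a * cnj (moment l)) \<le> fact l * K * Mabs * 0"
      by (intro tendsto_le[OF sequentially_bot _ tendsto_const]) auto
    then show ?thesis by simp
  qed
  show ?case
  proof (rule ccontr)
    assume nz: "moment l \<noteq> 0"
    have Dl: "D l x = 0" for x
    proof -
      have "(\<lambda>J. D l (of_int \<lfloor>2 ^ J * x\<rfloor> / 2 ^ J)) \<longlonglongrightarrow> D l x"
        using cont[of l] less.prems dyadic_approximation[of x]
        by (intro isCont_tendsto_compose[of x "D l"]) (auto simp: continuous_on_eq_continuous_at)
      moreover have "D l (of_int \<lfloor>2 ^ J * x\<rfloor> / 2 ^ J) = 0" for J
        using DM[OF refl, of "\<lfloor>2 ^ J * x\<rfloor>" J] nz by simp
      ultimately have "(\<lambda>J::nat. 0) \<longlonglongrightarrow> D l x" by simp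
      then show ?thesis using LIMSEQ_unique tendsto_const by blast
    qed
    \<comment> \<open>Downward integration: a derivative whose own derivative vanishes is constant,
      and decay at infinity makes the constant 0. At the end \<open>g\<close> itself is 0, against
      the lower Riesz bound.\<close>
    have "i \<le> l \<Longrightarrow> \<forall>x. D (l - i) x = 0" for i
    proof (induction i)
      case 0
      then show ?case using Dl by simp
    next
      case (Suc i)
      define k where "k = l - Suc i"
      have k: "k < \<rho>" "Suc k = l - i" using Suc.prems less.prems by (auto simp: k_def)
      have "\<forall>x. (D k has_vector_derivative 0) (at x)"
        using der[OF k(1)] Suc.IH Suc.prems unfolding k(2) by simp
      then obtain c where "\<And>x. x \<in> UNIV \<Longrightarrow> D k x = c"
        using has_vector_derivative_zero_constant[of UNIV "D k"] by auto
      then have c: "\<And>x. D k x = c" by simp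
      obtain M where M: "\<And>x. (1 + \<bar>x\<bar>) ^ 1 * cmod (D k x) \<le> M" using dec[of k 1] k(1) by auto
      have "c = 0"
      proof (rule ccontr)
        assume "c \<noteq> 0"
        then have "0 < cmod c" by simp
        have "(1 + \<bar>M / cmod c\<bar>) * cmod c \<le> M" using M[of "M / cmod c"] c by simp
        moreover have "(1 + \<bar>M / cmod c\<bar>) * cmod c = cmod c + \<bar>M\<bar>" using \<open>0 < cmod c\<close> by (simp add: field_simps abs_divide)
        ultimately show False using \<open>0 < cmod c\<close> by linarith
      qed
      then show ?case using c by (simp add: k_def)
    qed
    from this[of l] have "g x = 0" for x using D0 by simp
    moreover have "\<exists>A>0. \<exists>B>0. \<forall>F a. finite F \<and> F \<subseteq> (UNIV :: int set) \<longrightarrow>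
        A * (\<Sum>i\<in>F. (cmod (a i))\<^sup>2) \<le> (Ltwo_norm (\<lambda>x. \<Sum>i\<in>F. a i * translate g i x))\<^sup>2 \<and>
        (Ltwo_norm (\<lambda>x. \<Sum>i\<in>F. a i * translate g i x))\<^sup>2 \<le> B * (\<Sum>i\<in>F. (cmod (a i))\<^sup>2)"
      using g unfolding riesz_basis_of_def by (elim conjE)
    then obtain A B where A: "A > 0" and AB: "\<forall>F a. finite F \<and> F \<subseteq> (UNIV :: int set) \<longrightarrow>
        A * (\<Sum>i\<in>F. (cmod (a i))\<^sup>2) \<le> (Ltwo_norm (\<lambda>x. \<Sum>i\<in>F. a i * translate g i x))\<^sup>2 \<and>
        (Ltwo_norm (\<lambda>x. \<Sum>i\<in>F. a i * translate g i x))\<^sup>2 \<le> B * (\<Sum>i\<in>F. (cmod (a i))\<^sup>2)"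
      by (elim exE conjE) (rule that; assumption)
    from AB[rule_format, of "{0}" "\<lambda>_. 1"] have "A \<le> (Ltwo_norm (\<lambda>x. translate g 0 x))\<^sup>2" by simp
    ultimately have "A \<le> 0" by (simp add: translate_def Ltwo_norm_def)
    with A show False by simp
  qed
qed

text \<open>The vanishing moments remove the Taylor polynomial of the exponential, which leaves
  decay of order |\<eta>|^\<rho> at the origin. As b < \<rho>, this is stronger than |\<eta>|^b for
  |\<eta>| at most 1; for larger |\<eta>| the L1 bound suffices.\<close>

lemma fourier_decay:
  assumes b: "0 < b" "b < real \<rho>"
  shows "\<exists>K\<ge>0. (\<forall>\<eta>. cmod (fourier \<psi> \<eta>) \<le> K) \<and> (\<forall>\<eta>. cmod (fourier \<phi> \<eta>) \<le> K) \<and> (\<forall>\<eta>. cmod (fourier \<phi> \<eta>) \<le> K * \<bar>\<eta>\<bar> powr b)"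
proof -
  define n where "n = \<rho> - 1"
  have \<rho>: "\<rho> = Suc n" using b by (simp add: n_def)
  define K1 where "K1 = (LINT x|lborel. cmod (\<psi> x)) + (LINT x|lborel. cmod (\<phi> x))"
  define K2 where "K2 = (2 * pi) ^ \<rho> * (LINT x|lborel. cmod (\<phi> x) * \<bar>x\<bar> ^ \<rho>)"
  have pos: "0 \<le> (LINT x|lborel. cmod (\<psi> x))" "0 \<le> (LINT x|lborel. cmod (\<phi> x))" "0 \<le> K2"
    by (auto intro!: mult_nonneg_nonneg integral_nonneg_AE simp: K2_def)
  have k\<psi>: "cmod (fourier \<psi> \<eta>) \<le> K1" for \<eta> using fourier_bound[of \<psi> \<eta>] pos unfolding K1_def by linarith
  have k\<phi>: "cmod (fourier \<phi> \<eta>) \<le> K1" for \<eta> using fourier_bound[of \<phi> \<eta>] pos unfolding K1_def by linarith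
  have kr: "cmod (fourier \<phi> \<eta>) \<le> K2 * \<bar>\<eta>\<bar> ^ \<rho>" for \<eta>
  proof -
    \<comment> \<open>The Taylor polynomial of degree \<rho> - 1, so that all moments involved have
      order below \<rho>.\<close>
    define P where "P x = (\<Sum>k\<le>n. (\<i> * of_real (- (2 * pi * (\<eta> * x)))) ^ k / fact k)" for x :: real
    have Pint: "integrable lborel (\<lambda>x. \<phi> x * P x)" and P0: "(LINT x|lborel. \<phi> x * P x) = 0"
    proof -
      have eq: "(\<lambda>x. \<phi> x * P x) = (\<lambda>x. \<Sum>k\<le>n. (\<i> * of_real (- (2 * pi * \<eta>))) ^ k / fact k * (of_real (x ^ k) * \<phi> x))"
        unfolding P_def by (auto simp: fun_eq_iff sum_distrib_left power_mult_distrib mult_ac intro!: sum.cong)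
          (simp add: power_mult_distrib[symmetric] mult_ac)
      show "integrable lborel (\<lambda>x. \<phi> x * P x)"
        unfolding eq by (intro Bochner_Integration.integrable_sum integrable_mult_right moment_integrable)
      show "(LINT x|lborel. \<phi> x * P x) = 0"
        unfolding eq
        by (subst Bochner_Integration.integral_sum)
          (auto intro!: integrable_mult_right moment_integrable sum.neutral simp: moment_def[symmetric] vanishing_moments \<rho> simp del: of_real_power)
    qed
    have fint: "integrable lborel (\<lambda>x. \<phi> x * cis (- (2 * pi * (\<eta> * x))))"
      using fourier_integrable[OF gen_integrable[of True], of \<eta>] by simp
    have "fourier \<phi> \<eta> = (LINT x|lborel. \<phi> x * (cis (- (2 * pi * (\<eta> * x))) - P x))"
      unfolding right_diff_distrib by (subst Bochner_Integration.integral_diff[OF fint Pint]) (simp add: P0 fourier_def)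
    also have "cmod \<dots> \<le> (LINT x|lborel. cmod (\<phi> x * (cis (- (2 * pi * (\<eta> * x))) - P x)))" by (rule integral_norm_bound)
    also have "\<dots> \<le> (LINT x|lborel. (2 * pi) ^ \<rho> * \<bar>\<eta>\<bar> ^ \<rho> * (cmod (\<phi> x) * \<bar>x\<bar> ^ \<rho>))"
    proof (intro integral_mono_AE AE_I2 integrable_norm integrable_mult_right abs_moment_integrable)
      show "integrable lborel (\<lambda>x. \<phi> x * (cis (- (2 * pi * (\<eta> * x))) - P x))"
        unfolding right_diff_distrib by (intro Bochner_Integration.integrable_diff fint Pint)
      fix x
      have "cmod (cis (- (2 * pi * (\<eta> * x))) - P x) \<le> \<bar>- (2 * pi * (\<eta> * x))\<bar> ^ Suc n / fact (Suc n)"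
        using iexp_approx1[of "- (2 * pi * (\<eta> * x))" n] unfolding P_def cis_conv_exp by simp
      also have "\<dots> \<le> \<bar>- (2 * pi * (\<eta> * x))\<bar> ^ Suc n / 1"
        by (intro divide_left_mono fact_ge_1) auto
      finally have "cmod (\<phi> x) * cmod (cis (- (2 * pi * (\<eta> * x))) - P x) \<le> cmod (\<phi> x) * \<bar>- (2 * pi * (\<eta> * x))\<bar> ^ Suc n"
        by (intro mult_left_mono) auto
      then show "norm (\<phi> x * (cis (- (2 * pi * (\<eta> * x))) - P x)) \<le> (2 * pi) ^ \<rho> * \<bar>\<eta>\<bar> ^ \<rho> * (cmod (\<phi> x) * \<bar>x\<bar> ^ \<rho>)"
        unfolding \<rho> norm_mult by (simp add: abs_mult power_mult_distrib mult_ac)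
    qed
    also have "\<dots> = K2 * \<bar>\<eta>\<bar> ^ \<rho>" by (simp add: K2_def)
    finally show ?thesis .
  qed
  have "cmod (fourier \<phi> \<eta>) \<le> (K1 + K2) * \<bar>\<eta>\<bar> powr b" for \<eta>
  proof (cases "\<bar>\<eta>\<bar> \<le> 1")
    case True
    have "\<bar>\<eta>\<bar> ^ \<rho> \<le> \<bar>\<eta>\<bar> powr b"
    proof (cases "\<eta> = 0")
      case False
      then show ?thesis using True b powr_mono'[of b "real \<rho>" "\<bar>\<eta>\<bar>"] by (simp add: powr_realpow)
    qed (simp add: \<rho>)
    then have "K2 * \<bar>\<eta>\<bar> ^ \<rho> \<le> K2 * \<bar>\<eta>\<bar> powr b" using pos by (intro mult_left_mono) auto
    moreover have "0 \<le> K1 * \<bar>\<eta>\<bar> powr b" using pos by (simp add: K1_def)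
    ultimately show ?thesis using kr[of \<eta>] by (simp add: distrib_right)
  next
    case False
    then have "1 \<le> \<bar>\<eta>\<bar> powr b" using b by (intro ge_one_powr_ge_zero) auto
    then have "K1 * 1 \<le> K1 * \<bar>\<eta>\<bar> powr b" using pos by (intro mult_left_mono) (auto simp: K1_def)
    moreover have "0 \<le> K2 * \<bar>\<eta>\<bar> powr b" using pos by simp
    ultimately show ?thesis using k\<phi>[of \<eta>] by (simp add: distrib_right)
  qed
  moreover have "cmod (fourier \<psi> \<eta>) \<le> K1 + K2" "cmod (fourier \<phi> \<eta>) \<le> K1 + K2" for \<eta>
    using k\<psi>[of \<eta>] k\<phi>[of \<eta>] pos(3) by linarith+
  moreover have "0 \<le> K1 + K2" using pos unfolding K1_def by linarith
  ultimately show ?thesis by blast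
qed

end

section \<open>Tensor products and closed spans\<close>

definition tens :: "(real \<Rightarrow> complex) \<Rightarrow> (real \<Rightarrow> complex) \<Rightarrow> real ^ 2 \<Rightarrow> complex" where
  "tens f g x = f (x $ 1) * g (x $ 2)"

lemma tens_Ltwo: "tens f g \<in> Ltwo" if "f \<in> Ltwo" "g \<in> Ltwo"
proof -
  note [measurable] = LtwoD(2)[OF that(1)] LtwoD(2)[OF that(2)]
  have i: "integrable lborel (\<lambda>x. complex_of_real ((cmod (f x))\<^sup>2))" "integrable lborel (\<lambda>x. complex_of_real ((cmod (g x))\<^sup>2))"
    using LtwoD(3)[OF that(1)] LtwoD(3)[OF that(2)] by (simp_all del: of_real_power)
  have "integrable lborel (\<lambda>x :: real ^ 2. complex_of_real ((cmod (f (x $ 1)))\<^sup>2) * complex_of_real ((cmod (g (x $ 2)))\<^sup>2))"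
    by (rule integrable_tensor2[OF i])
  then have "integrable lborel (\<lambda>x :: real ^ 2. (cmod (f (x $ 1)))\<^sup>2 * (cmod (g (x $ 2)))\<^sup>2)"
    unfolding of_real_mult[symmetric] complex_of_real_integrable_eq .
  then show ?thesis by (simp add: Ltwo_def tens_def[abs_def] norm_mult power_mult_distrib)
qed

lemma tens_inner: "Ltwo_inner (tens f g) (tens h k) = Ltwo_inner f h * Ltwo_inner g k"
  if "f \<in> Ltwo" "g \<in> Ltwo" "h \<in> Ltwo" "k \<in> Ltwo"
  using integral_tensor2[OF Ltwo_mult_integrable[OF that(1,3)] Ltwo_mult_integrable[OF that(2,4)]]
  by (simp add: Ltwo_inner_def tens_def mult_ac)

lemma tens_norm: "Ltwo_norm (tens f g) = Ltwo_norm f * Ltwo_norm g" if "f \<in> Ltwo" "g \<in> Ltwo"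
proof -
  have "complex_of_real ((Ltwo_norm (tens f g))\<^sup>2) = of_real ((Ltwo_norm f * Ltwo_norm g)\<^sup>2)"
    unfolding Ltwo_inner_self[symmetric] tens_inner[OF that that] unfolding Ltwo_inner_self
    by (simp add: power_mult_distrib)
  then have "(Ltwo_norm (tens f g))\<^sup>2 = (Ltwo_norm f * Ltwo_norm g)\<^sup>2" unfolding of_real_eq_iff .
  then show ?thesis by (simp add: power2_eq_iff_nonneg Ltwo_norm_nonneg)
qed

text \<open>Tensoring with a fixed factor is bounded, so membership in a closed span passes from the
  generators to their closed span. The norm is increased by 1 to have a positive divisor also when
  \<open>g\<close> is null.\<close>

lemma tens_closed_span_left:
  fixes w :: "'i \<Rightarrow> real ^ 2 \<Rightarrow> complex"
  assumes w: "\<And>i. i \<in> I \<Longrightarrow> w i \<in> Ltwo" and e: "\<And>k. k \<in> K \<Longrightarrow> e k \<in> Ltwo"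
    and f: "f \<in> Ltwo_closed_span e K" and g: "g \<in> Ltwo"
    and base: "\<And>k. k \<in> K \<Longrightarrow> tens (e k) g \<in> Ltwo_closed_span w I"
  shows "tens f g \<in> Ltwo_closed_span w I"
proof (rule closed_span_closed[OF w])
  note fL = closed_span_Ltwo[OF f]
  show "tens f g \<in> Ltwo" by (intro tens_Ltwo fL g)
  fix \<delta> :: real assume "\<delta> > 0"
  have g1: "0 < Ltwo_norm g + 1" using Ltwo_norm_nonneg[of g] by linarith
  then have "0 < \<delta> / (Ltwo_norm g + 1)" using \<open>\<delta> > 0\<close> by simp
  from closed_spanD[OF f this] obtain f' where f': "f' \<in> fun_span e K" "Ltwo_norm (\<lambda>x. f x - f' x) < \<delta> / (Ltwo_norm g + 1)"
    by blast
  obtain S a where S: "finite S" "S \<subseteq> K" "f' = (\<lambda>x. \<Sum>k\<in>S. a k * e k x)"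
    using f'(1) unfolding fun_span_def by blast
  have "tens f' g = (\<lambda>x. \<Sum>k\<in>S. a k * tens (e k) g x)"
    unfolding S(3) tens_def by (simp add: fun_eq_iff sum_distrib_right mult.assoc)
  also have "\<dots> \<in> Ltwo_closed_span w I"
    using S(2) by (intro closed_span_sum[OF w] closed_span_cmult[OF w] base) auto
  finally have 1: "tens f' g \<in> Ltwo_closed_span w I" .
  have "Ltwo_norm (\<lambda>x. tens f g x - tens f' g x) = Ltwo_norm (tens (\<lambda>x. f x - f' x) g)"
    by (simp add: tens_def[abs_def] left_diff_distrib)
  also have "\<dots> = Ltwo_norm (\<lambda>x. f x - f' x) * Ltwo_norm g"
    by (intro tens_norm Ltwo_diff fL fun_span_Ltwo[OF e f'(1)] g)
  also have "\<dots> \<le> Ltwo_norm (\<lambda>x. f x - f' x) * (Ltwo_norm g + 1)"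
    by (intro mult_left_mono Ltwo_norm_nonneg) simp
  also have "\<dots> < \<delta>" using f'(2) g1 by (simp add: field_simps)
  finally show "\<exists>h\<in>Ltwo_closed_span w I. Ltwo_norm (\<lambda>x. tens f g x - h x) < \<delta>" using 1 by blast
qed

lemma tens_closed_span_right:
  fixes w :: "'i \<Rightarrow> real ^ 2 \<Rightarrow> complex"
  assumes w: "\<And>i. i \<in> I \<Longrightarrow> w i \<in> Ltwo" and e: "\<And>k. k \<in> K \<Longrightarrow> e k \<in> Ltwo"
    and f: "f \<in> Ltwo_closed_span e K" and g: "g \<in> Ltwo"
    and base: "\<And>k. k \<in> K \<Longrightarrow> tens g (e k) \<in> Ltwo_closed_span w I"
  shows "tens g f \<in> Ltwo_closed_span w I"
proof (rule closed_span_closed[OF w])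
  note fL = closed_span_Ltwo[OF f]
  show "tens g f \<in> Ltwo" by (intro tens_Ltwo fL g)
  fix \<delta> :: real assume "\<delta> > 0"
  have g1: "0 < Ltwo_norm g + 1" using Ltwo_norm_nonneg[of g] by linarith
  then have "0 < \<delta> / (Ltwo_norm g + 1)" using \<open>\<delta> > 0\<close> by simp
  from closed_spanD[OF f this] obtain f' where f': "f' \<in> fun_span e K" "Ltwo_norm (\<lambda>x. f x - f' x) < \<delta> / (Ltwo_norm g + 1)"
    by blast
  obtain S a where S: "finite S" "S \<subseteq> K" "f' = (\<lambda>x. \<Sum>k\<in>S. a k * e k x)"
    using f'(1) unfolding fun_span_def by blast
  have "tens g f' = (\<lambda>x. \<Sum>k\<in>S. a k * tens g (e k) x)"
    unfolding S(3) tens_def by (simp add: fun_eq_iff sum_distrib_left mult_ac)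
  also have "\<dots> \<in> Ltwo_closed_span w I"
    using S(2) by (intro closed_span_sum[OF w] closed_span_cmult[OF w] base) auto
  finally have 1: "tens g f' \<in> Ltwo_closed_span w I" .
  have "Ltwo_norm (\<lambda>x. tens g f x - tens g f' x) = Ltwo_norm (tens g (\<lambda>x. f x - f' x))"
    by (simp add: tens_def[abs_def] right_diff_distrib)
  also have "\<dots> = Ltwo_norm g * Ltwo_norm (\<lambda>x. f x - f' x)"
    by (intro tens_norm Ltwo_diff fL fun_span_Ltwo[OF e f'(1)] g)
  also have "\<dots> \<le> (Ltwo_norm g + 1) * Ltwo_norm (\<lambda>x. f x - f' x)"
    by (intro mult_right_mono Ltwo_norm_nonneg) simp
  also have "\<dots> < \<delta>" using f'(2) g1 by (simp add: field_simps)
  finally show "\<exists>h\<in>Ltwo_closed_span w I. Ltwo_norm (\<lambda>x. tens g f x - h x) < \<delta>" using 1 by blast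
qed

lemma closed_span_dilation:
  fixes e :: "'i \<Rightarrow> real \<Rightarrow> complex"
  assumes e: "\<And>i. i \<in> I \<Longrightarrow> e i \<in> Ltwo" and f: "f \<in> Ltwo_closed_span e I" and c: "0 < c"
  shows "(\<lambda>x. f (c * x)) \<in> Ltwo_closed_span (\<lambda>i x. e i (c * x)) I"
proof (rule closed_spanI)
  note fL = closed_span_Ltwo[OF f]
  show "(\<lambda>x. f (c * x)) \<in> Ltwo" by (rule Ltwo_dilation[OF fL c])
  fix \<delta> :: real assume "\<delta> > 0"
  then have "0 < \<delta> * sqrt c" using c by simp
  from closed_spanD[OF f this] obtain f' where f': "f' \<in> fun_span e I" "Ltwo_norm (\<lambda>x. f x - f' x) < \<delta> * sqrt c" by blast
  have "Ltwo_norm (\<lambda>x. f (c * x) - f' (c * x)) = Ltwo_norm (\<lambda>x. f x - f' x) / sqrt c"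
    by (rule Ltwo_dilation(2)[OF Ltwo_diff[OF fL fun_span_Ltwo[OF e f'(1)]] c])
  also have "\<dots> < \<delta>" using f'(2) c by (simp add: field_simps)
  finally have "Ltwo_norm (\<lambda>x. f (c * x) - f' (c * x)) < \<delta>" .
  moreover have "(\<lambda>x. f' (c * x)) \<in> fun_span (\<lambda>i x. e i (c * x)) I"
    using f'(1) unfolding fun_span_def by auto
  ultimately show "\<exists>g\<in>fun_span (\<lambda>i x. e i (c * x)) I. Ltwo_norm (\<lambda>x. f (c * x) - g x) < \<delta>"
    by (intro bexI[of _ "\<lambda>x. f' (c * x)"])
qed

lemma closed_span_mono_image:
  assumes "f \<in> Ltwo_closed_span e I" "\<And>i. i \<in> I \<Longrightarrow> e i = e' (t i) \<and> t i \<in> I'"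
    and e': "\<And>i. i \<in> I' \<Longrightarrow> e' i \<in> Ltwo"
  shows "f \<in> Ltwo_closed_span e' I'"
proof (rule closed_span_closed[OF e'])
  show "f \<in> Ltwo" using assms(1) by (rule closed_span_Ltwo)
  fix \<delta> :: real assume "\<delta> > 0"
  from closed_spanD[OF assms(1) this] obtain g where g: "g \<in> fun_span e I" "Ltwo_norm (\<lambda>x. f x - g x) < \<delta>" by blast
  obtain S a where S: "finite S" "S \<subseteq> I" "g = (\<lambda>x. \<Sum>k\<in>S. a k * e k x)"
    using g(1) unfolding fun_span_def by blast
  have "g \<in> Ltwo_closed_span e' I'"
    unfolding S(3)
  proof (intro closed_span_sum[OF e'] closed_span_cmult[OF e'])
    fix k assume "k \<in> S"
    then have "e k = e' (t k)" "t k \<in> I'" using S(2) assms(2) by auto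
    then show "e k \<in> Ltwo_closed_span e' I'" using fun_span_closed_span[OF e' fun_span_base] by simp
  qed
  then show "\<exists>g\<in>Ltwo_closed_span e' I'. Ltwo_norm (\<lambda>x. f x - g x) < \<delta>" using g(2) by blast
qed

context compact_wavelet
begin

section \<open>Orthonormality of the tensor atoms\<close>

text \<open>The one-dimensional normalisation 2^(j/2) is left out; the two missing factors together
  are the \<open>2 ^ j\<close> of \<open>watom_tens\<close>.\<close>

definition atom1 :: "bool \<Rightarrow> nat \<Rightarrow> int \<Rightarrow> real \<Rightarrow> complex" where
  "atom1 e j n x = gen \<psi> \<phi> e (2 ^ j * x - of_int n)"

lemma atom1_translate: "atom1 e j n = (\<lambda>x. translate (gen \<psi> \<phi> e) n (2 ^ j * x))"
  by (simp add: atom1_def translate_def fun_eq_iff)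

lemma atom1_Ltwo: "atom1 e j n \<in> Ltwo"
  unfolding atom1_translate by (intro Ltwo_dilation Ltwo_translate gen_Ltwo) simp

lemma atom1_V: "atom1 False j n \<in> V (int j)" "atom1 e j n \<in> V (int j + 1)"
proof -
  show 1: "atom1 False j n \<in> V (int j)"
    using V_dilation_pow[of "translate \<psi> n" 0 j] psi_V unfolding atom1_translate by simp
  have "atom1 True j n \<in> V (int j + 1)"
    using V_dilation_pow[of "translate \<phi> n" 1 j] phi_V unfolding atom1_translate by (simp add: add.commute)
  then show "atom1 e j n \<in> V (int j + 1)" using 1 V_increasing[of "int j"] by (cases e) auto
qed

lemma atom1_inner_same: "Ltwo_inner (atom1 e j n) (atom1 e' j k) = (if e = e' \<and> n = k then 1 else 0) / 2 ^ j"
proof -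
  have "Ltwo_inner (translate (gen \<psi> \<phi> e) n) (translate (gen \<psi> \<phi> e') k) = (if e = e' \<and> n = k then 1 else 0)"
  proof (cases e; cases e')
    assume "\<not> e" "e'"
    then show ?thesis using phi_orthogonal[OF psi_V, of k n] Ltwo_inner_commute[of "translate \<psi> n" "translate \<phi> k"] by simp
  qed (simp_all add: psi_orthonormal phi_orthonormal phi_orthogonal[OF psi_V])
  then show ?thesis
    unfolding atom1_translate by (subst Ltwo_inner_dilation) auto
qed

lemma atom1_inner_V: "Ltwo_inner (atom1 True j n) f = 0" if "f \<in> V (int j)"
proof -
  define h where "h x = f (x / 2 ^ j)" for x
  have fh: "f = (\<lambda>x. h (2 ^ j * x))" by (simp add: h_def fun_eq_iff)
  have "h \<in> V 0" using V_dilation_pow[of h 0 j] that fh by simp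
  then have "Ltwo_inner (translate \<phi> n) h = 0" by (rule phi_orthogonal)
  then show ?thesis unfolding atom1_translate fh by (subst Ltwo_inner_dilation) auto
qed

lemma atom1_inner_scales: "Ltwo_inner (atom1 True j' k) (atom1 e j n) = 0" if "j < j'"
proof (rule atom1_inner_V)
  have "V (int j + 1) \<subseteq> V (int j')" using that by (intro V_mono) simp
  then show "atom1 e j n \<in> V (int j')" using atom1_V(2) by blast
qed

lemma watom_tens: "watom \<psi> \<phi> (j, n, e) = (\<lambda>x. 2 ^ j * tens (atom1 (fst e) j (fst n)) (atom1 (snd e) j (snd n)) x)"
  by (simp add: fun_eq_iff watom_eq tens_def atom1_def mult.assoc)

lemma watom_Ltwo: "watom \<psi> \<phi> i \<in> Ltwo"
proof -
  obtain j n e where "i = (j, n, e)" by (cases i) auto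
  then show ?thesis by (simp add: watom_tens) (intro Ltwo_cmult tens_Ltwo atom1_Ltwo)
qed

lemma watom_inner_tens: "Ltwo_inner (watom \<psi> \<phi> (j, n, e)) (watom \<psi> \<phi> (j', n', e')) =
   2 ^ j * 2 ^ j' * (Ltwo_inner (atom1 (fst e) j (fst n)) (atom1 (fst e') j' (fst n')) * Ltwo_inner (atom1 (snd e) j (snd n)) (atom1 (snd e') j' (snd n')))"
  using Ltwo_inner_cmult_left[of "2 ^ j" "tens (atom1 (fst e) j (fst n)) (atom1 (snd e) j (snd n))" "\<lambda>x. 2 ^ j' * tens (atom1 (fst e') j' (fst n')) (atom1 (snd e') j' (snd n')) x"]
    Ltwo_inner_cmult_left[of "2 ^ j'" "tens (atom1 (fst e') j' (fst n')) (atom1 (snd e') j' (snd n'))" "tens (atom1 (fst e) j (fst n)) (atom1 (snd e) j (snd n))"]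
  unfolding watom_tens tens_inner[OF atom1_Ltwo atom1_Ltwo atom1_Ltwo atom1_Ltwo, symmetric]
  by (simp add: Ltwo_inner_commute[of "tens (atom1 (fst e) j (fst n)) (atom1 (snd e) j (snd n))" "\<lambda>x. 2 ^ j' * tens (atom1 (fst e') j' (fst n')) (atom1 (snd e') j' (snd n')) x"]
     Ltwo_inner_commute[of "tens (atom1 (fst e') j' (fst n')) (atom1 (snd e') j' (snd n'))" "tens (atom1 (fst e) j (fst n)) (atom1 (snd e) j (snd n))"])

text \<open>Indices of the basis of the whole plane. Completeness is proved for this family first,
  and the support condition of \<open>dict_index\<close> comes in only for functions on the
  disc.\<close>

definition all_index :: "windex set" where
  "all_index = {(j, n, e). e = (False, False) \<longrightarrow> j = 0}"

lemma dict_index_subset: "dict_index \<psi> \<phi> \<subseteq> all_index"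
  by (auto simp: dict_index_def all_index_def)

text \<open>The finer atom has a wavelet factor in at least one variable, because the pure scaling
  type occurs at scale 0 only; this factor is orthogonal to every one-dimensional atom of a coarser
  scale.\<close>

lemma watom_inner_lt:
  assumes "(j', n', e') \<in> all_index" "j < j'"
  shows "Ltwo_inner (watom \<psi> \<phi> (j', n', e')) (watom \<psi> \<phi> (j, n, e)) = 0"
proof -
  have "fst e' \<or> snd e'" using assms by (cases e') (auto simp: all_index_def)
  then have "Ltwo_inner (atom1 (fst e') j' (fst n')) (atom1 (fst e) j (fst n)) = 0 \<or> Ltwo_inner (atom1 (snd e') j' (snd n')) (atom1 (snd e) j (snd n)) = 0"
    using atom1_inner_scales[OF assms(2)] by auto
  then show ?thesis unfolding watom_inner_tens by auto
qed

lemma watom_orthonormal: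
  assumes "i \<in> all_index" "k \<in> all_index"
  shows "Ltwo_inner (watom \<psi> \<phi> i) (watom \<psi> \<phi> k) = (if i = k then 1 else 0)"
proof -
  obtain j n e where i: "i = (j, n, e)" by (cases i) auto
  obtain j' n' e' where k: "k = (j', n', e')" by (cases k) auto
  consider "j = j'" | "j' < j" | "j < j'" by linarith
  then show ?thesis
  proof cases
    case 1
    then show ?thesis unfolding i k watom_inner_tens by (auto simp: atom1_inner_same prod_eq_iff)
  next
    case 2
    then show ?thesis unfolding i k using watom_inner_lt assms(1) i by auto
  next
    case 3
    then have "Ltwo_inner (watom \<psi> \<phi> k) (watom \<psi> \<phi> i) = 0" unfolding i k using watom_inner_lt assms(2) k by auto
    then show ?thesis unfolding Ltwo_inner_commute[of "watom \<psi> \<phi> i" "watom \<psi> \<phi> k"] using 3 i k by auto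
  qed
qed

text \<open>Since the functions \<open>\<psi>(2x - n)\<close> and \<open>\<psi>(x - k)\<close> have compact support, the
  projection of the former onto \<open>V 0\<close> is a finite sum, and the remainder lies in the wavelet space.\<close>

lemma psi_refine: "atom1 False 1 n \<in> Ltwo_closed_span (\<lambda>(e, k). atom1 e 0 k) UNIV"
proof -
  let ?u = "atom1 False 1 n"
  \<comment> \<open>Outside this range the supports cannot meet: |2x - n| and |x - k| at most
    \<open>rad\<close> would give |k| at most (\<open>rad\<close> + |n|)/2 +
    \<open>rad\<close>.\<close>
  define K where "K = {k :: int. \<bar>of_int k\<bar> \<le> 2 * rad + \<bar>of_int n\<bar>}"
  have "K \<subseteq> {- \<lceil>2 * rad + \<bar>of_int n\<bar>\<rceil> .. \<lceil>2 * rad + \<bar>of_int n\<bar>\<rceil>}" unfolding K_def by (auto simp: abs_le_iff; linarith)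
  then have K: "finite K" by (rule finite_subset) simp
  have uL: "?u \<in> Ltwo" by (rule atom1_Ltwo)
  have uV: "?u \<in> V 1" using atom1_V(1)[of 1 n] by simp
  have a0: "atom1 e 0 k = translate (gen \<psi> \<phi> e) k" for e k by (simp add: atom1_def translate_def fun_eq_iff)
  have pm: "Measurable.pred borel (\<lambda>x. rad < \<bar>x\<bar> \<longrightarrow> \<psi> x = 0)"
  proof -
    note [measurable] = LtwoD(2)[OF psi_Ltwo]
    show ?thesis by measurable
  qed
  have out: "Ltwo_inner ?u (translate \<psi> k) = 0" if k: "k \<notin> K" for k
  proof -
    have "AE x in lborel. rad < \<bar>2 * x - of_int n\<bar> \<longrightarrow> \<psi> (2 * x - of_int n) = 0"
      using AE_borel_affine[OF _ pm rad(2), of 2 "- of_int n"] by simp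
    moreover have "AE x in lborel. rad < \<bar>x - of_int k\<bar> \<longrightarrow> \<psi> (x - of_int k) = 0"
      using AE_borel_affine[OF _ pm rad(2), of 1 "- of_int k"] by simp
    ultimately have "AE x in lborel. ?u x * cnj (translate \<psi> k x) = 0"
    proof eventually_elim
      case (elim x)
      have "rad < \<bar>2 * x - of_int n\<bar> \<or> rad < \<bar>x - of_int k\<bar>"
      proof (rule ccontr)
        assume "\<not> (rad < \<bar>2 * x - of_int n\<bar> \<or> rad < \<bar>x - of_int k\<bar>)"
        then have "\<bar>of_int k\<bar> \<le> 2 * rad + \<bar>of_int n\<bar>" using rad(1) by linarith
        then show False using k by (simp add: K_def)
      qed
      then show ?case using elim by (auto simp: atom1_def translate_def)
    qed
    then show ?thesis unfolding Ltwo_inner_def by (rule integral_eq_zero_AE)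
  qed
  define P where "P = (\<lambda>x. \<Sum>k\<in>K. Ltwo_inner ?u (translate \<psi> k) * translate \<psi> k x)"
  have PV: "P \<in> V 0" unfolding P_def by (intro V_sum V_cmult psi_V)
  have PL: "P \<in> Ltwo" using PV by (rule V_Ltwo)
  define r where "r = (\<lambda>x. ?u x - P x)"
  have rL: "r \<in> Ltwo" unfolding r_def by (intro Ltwo_diff uL PL)
  have rV: "r \<in> V 1"
    using V_add[OF uV V_cmult[of P 1 "-1"]] PV V_increasing[of 0] by (auto simp: r_def)
  have tL: "translate \<psi> k \<in> Ltwo" for k by (rule V_Ltwo[OF psi_V])
  have r_orth: "Ltwo_inner (translate \<psi> k) r = 0" for k
  proof -
    have "Ltwo_inner r (translate \<psi> k) = Ltwo_inner ?u (translate \<psi> k) - Ltwo_inner P (translate \<psi> k)"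
      unfolding r_def by (intro Ltwo_inner_diff_left uL PL tL)
    also have "Ltwo_inner P (translate \<psi> k) = (\<Sum>l\<in>K. Ltwo_inner ?u (translate \<psi> l) * Ltwo_inner (translate \<psi> l) (translate \<psi> k))"
      unfolding P_def by (intro Ltwo_inner_lincomb_left tL)
    also have "\<dots> = (\<Sum>l\<in>K. if l = k then Ltwo_inner ?u (translate \<psi> k) else 0)"
      by (intro sum.cong) (auto simp: psi_orthonormal)
    also have "\<dots> = Ltwo_inner ?u (translate \<psi> k)" using K out by auto
    finally have "Ltwo_inner r (translate \<psi> k) = 0" by simp
    then show ?thesis using Ltwo_inner_commute[of "translate \<psi> k" r] by simp
  qed
  have "Ltwo_inner r g = 0" if "g \<in> V 0" for g
  proof -
    have "Ltwo_inner g r = 0"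
      using that unfolding psi_span[symmetric] by (intro closed_span_orthogonal[OF tL rL r_orth])
    then show ?thesis using Ltwo_inner_commute[of r g] by simp
  qed
  then have r_span: "r \<in> Ltwo_closed_span (translate \<phi>) UNIV" unfolding phi_span using rV by blast
  let ?e = "\<lambda>(e, k). atom1 e 0 k"
  have eL: "?e i \<in> Ltwo" for i by (cases i) (simp add: atom1_Ltwo)
  have "r \<in> Ltwo_closed_span ?e UNIV"
  proof (rule closed_span_mono_image[OF r_span, where t="\<lambda>k. (True, k)"])
    show "translate \<phi> k = ?e (True, k) \<and> (True, k) \<in> UNIV" for k by (simp add: a0)
    show "?e i \<in> Ltwo" for i by (rule eL)
  qed
  moreover have "P \<in> Ltwo_closed_span ?e UNIV"
    unfolding P_def
  proof (intro closed_span_sum[OF eL] closed_span_cmult[OF eL])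
    fix k
    have "?e (False, k) \<in> Ltwo_closed_span ?e UNIV" by (intro fun_span_closed_span[OF eL] fun_span_base) simp
    then show "translate \<psi> k \<in> Ltwo_closed_span ?e UNIV" by (simp add: a0)
  qed
  ultimately have "(\<lambda>x. r x + P x) \<in> Ltwo_closed_span ?e UNIV" by (intro closed_span_add[OF eL])
  then show ?thesis by (simp add: r_def)
qed

lemma atom1_refine: "atom1 False (Suc j) n \<in> Ltwo_closed_span (\<lambda>(e, k). atom1 e j k) UNIV"
proof -
  let ?e = "\<lambda>i. case i of (e, k) \<Rightarrow> atom1 e 0 k"
  have eL: "?e i \<in> Ltwo" for i by (cases i) (simp add: atom1_Ltwo)
  have "(\<lambda>x. atom1 False 1 n (2 ^ j * x)) \<in> Ltwo_closed_span (\<lambda>i x. ?e i (2 ^ j * x)) UNIV"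
    by (rule closed_span_dilation[OF eL psi_refine]) simp
  moreover have "(\<lambda>x. atom1 False 1 n (2 ^ j * x)) = atom1 False (Suc j) n" by (simp add: atom1_def fun_eq_iff mult.assoc)
  moreover have "(\<lambda>i x. ?e i (2 ^ j * x)) = (\<lambda>(e, k). atom1 e j k)" by (auto simp: atom1_def fun_eq_iff)
  ultimately show ?thesis by simp
qed

section \<open>Completeness for functions on the disc\<close>

abbreviation wspan :: "(real ^ 2 \<Rightarrow> complex) set" where
  "wspan \<equiv> Ltwo_closed_span (watom \<psi> \<phi>) all_index"

lemma tens_atom1_wspan:
  assumes "(j, (n1, n2), (e1, e2)) \<in> all_index"
  shows "tens (atom1 e1 j n1) (atom1 e2 j n2) \<in> wspan"
proof -
  have "watom \<psi> \<phi> (j, (n1, n2), (e1, e2)) \<in> wspan"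
    by (intro fun_span_closed_span[OF watom_Ltwo] fun_span_base assms)
  from closed_span_cmult[OF watom_Ltwo this, of "1 / 2 ^ j"]
  show ?thesis unfolding watom_tens by simp
qed

text \<open>Refining both factors by one level produces four kinds of products of scale
  \<open>j\<close>. Three contain a wavelet and are multiples of atoms; the fourth is the induction
  hypothesis.\<close>

lemma tens_scaling_wspan: "tens (atom1 False j n1) (atom1 False j n2) \<in> wspan"
proof (induction j arbitrary: n1 n2)
  case 0
  show ?case by (rule tens_atom1_wspan) (simp add: all_index_def)
next
  case (Suc j)
  let ?e = "\<lambda>i. case i of (e, k) \<Rightarrow> atom1 e j k"
  have eL: "?e i \<in> Ltwo" for i by (cases i) (simp add: atom1_Ltwo)
  have base: "tens (atom1 e1 j k1) (atom1 e2 j k2) \<in> wspan" for e1 e2 k1 k2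
  proof (cases "(e1, e2) = (False, False)")
    case True
    then show ?thesis using Suc by simp
  next
    case False
    then show ?thesis by (intro tens_atom1_wspan) (auto simp: all_index_def)
  qed
  show ?case
  proof (rule tens_closed_span_left[OF watom_Ltwo eL atom1_refine atom1_Ltwo])
    fix i :: "bool \<times> int"
    show "tens (?e i) (atom1 False (Suc j) n2) \<in> wspan"
    proof (rule tens_closed_span_right[OF watom_Ltwo eL atom1_refine eL])
      fix k :: "bool \<times> int"
      show "tens (?e i) (?e k) \<in> wspan" by (cases i; cases k) (simp add: base)
    qed
  qed
qed

lemma V_span: "f \<in> V (int j) \<Longrightarrow> f \<in> Ltwo_closed_span (atom1 False j) UNIV"
proof -
  assume f: "f \<in> V (int j)"
  define h where "h x = f (x / 2 ^ j)" for x
  have fh: "f = (\<lambda>x. h (2 ^ j * x))" by (simp add: h_def fun_eq_iff)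
  have "h \<in> V 0" using V_dilation_pow[of h 0 j] f fh by simp
  then have "h \<in> Ltwo_closed_span (translate \<psi>) UNIV" unfolding psi_span .
  from closed_span_dilation[OF V_Ltwo[OF psi_V] this, of "2 ^ j"]
  show ?thesis unfolding fh[symmetric] by (simp add: atom1_translate[abs_def])
qed

lemma tens_V_wspan: "f \<in> V (int j) \<Longrightarrow> g \<in> V (int j) \<Longrightarrow> tens f g \<in> wspan"
  by (rule tens_closed_span_left[OF watom_Ltwo atom1_Ltwo V_span V_Ltwo])
     (auto intro: tens_closed_span_right[OF watom_Ltwo atom1_Ltwo V_span atom1_Ltwo] tens_scaling_wspan)

lemma tens_wspan: "tens f g \<in> wspan" if f: "f \<in> Ltwo" and g: "g \<in> Ltwo"
proof -
  have 1: "tens f g' \<in> wspan" if g': "g' \<in> V j" for g' j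
  proof (rule closed_span_closed[OF watom_Ltwo])
    have g'L: "g' \<in> Ltwo" using g' by (rule V_Ltwo)
    show "tens f g' \<in> Ltwo" by (intro tens_Ltwo f g'L)
    fix \<delta> :: real assume "\<delta> > 0"
    have p: "0 < Ltwo_norm g' + 1" using Ltwo_norm_nonneg[of g'] by linarith
    then have "0 < \<delta> / (Ltwo_norm g' + 1)" using \<open>\<delta> > 0\<close> by simp
    from V_dense[OF f this] obtain i f' where f': "f' \<in> V i" "Ltwo_norm (\<lambda>x. f x - f' x) < \<delta> / (Ltwo_norm g' + 1)" by blast
    have f'L: "f' \<in> Ltwo" using f'(1) by (rule V_Ltwo)
    \<comment> \<open>The spaces of the ladder that approximate the two factors may have different
      or negative levels; both lie in the one of the nonnegative level \<open>J\<close>, for which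
      \<open>tens_V_wspan\<close> is available.\<close>
    define J where "J = nat (max i j)"
    have "V i \<subseteq> V (int J)" "V j \<subseteq> V (int J)"
    proof -
      have "i \<le> int J" "j \<le> int J" unfolding J_def by linarith+
      then show "V i \<subseteq> V (int J)" "V j \<subseteq> V (int J)" by (simp_all add: V_mono)
    qed
    then have "tens f' g' \<in> wspan" using f'(1) g' by (intro tens_V_wspan[of _ J]) auto
    moreover have "Ltwo_norm (\<lambda>x. tens f g' x - tens f' g' x) < \<delta>"
    proof -
      have "Ltwo_norm (\<lambda>x. tens f g' x - tens f' g' x) = Ltwo_norm (tens (\<lambda>x. f x - f' x) g')"
        by (simp add: tens_def[abs_def] left_diff_distrib)
      also have "\<dots> = Ltwo_norm (\<lambda>x. f x - f' x) * Ltwo_norm g'" by (intro tens_norm Ltwo_diff f f'L g'L)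
      also have "\<dots> \<le> Ltwo_norm (\<lambda>x. f x - f' x) * (Ltwo_norm g' + 1)" by (intro mult_left_mono Ltwo_norm_nonneg) simp
      also have "\<dots> < \<delta>" using f'(2) p by (simp add: field_simps)
      finally show ?thesis .
    qed
    ultimately show "\<exists>h\<in>wspan. Ltwo_norm (\<lambda>x. tens f g' x - h x) < \<delta>" by blast
  qed
  show ?thesis
  proof (rule closed_span_closed[OF watom_Ltwo])
    show "tens f g \<in> Ltwo" by (intro tens_Ltwo f g)
    fix \<delta> :: real assume "\<delta> > 0"
    have p: "0 < Ltwo_norm f + 1" using Ltwo_norm_nonneg[of f] by linarith
    then have "0 < \<delta> / (Ltwo_norm f + 1)" using \<open>\<delta> > 0\<close> by simp
    from V_dense[OF g this] obtain i g' where g': "g' \<in> V i" "Ltwo_norm (\<lambda>x. g x - g' x) < \<delta> / (Ltwo_norm f + 1)" by blast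
    have g'L: "g' \<in> Ltwo" using g'(1) by (rule V_Ltwo)
    have "Ltwo_norm (\<lambda>x. tens f g x - tens f g' x) = Ltwo_norm (tens f (\<lambda>x. g x - g' x))"
      by (simp add: tens_def[abs_def] right_diff_distrib)
    also have "\<dots> = Ltwo_norm f * Ltwo_norm (\<lambda>x. g x - g' x)" by (intro tens_norm Ltwo_diff f g g'L)
    also have "\<dots> \<le> (Ltwo_norm f + 1) * Ltwo_norm (\<lambda>x. g x - g' x)" by (intro mult_right_mono Ltwo_norm_nonneg) simp
    also have "\<dots> < \<delta>" using g'(2) p by (simp add: field_simps)
    finally show "\<exists>h\<in>wspan. Ltwo_norm (\<lambda>x. tens f g x - h x) < \<delta>" using 1[OF g'(1)] by blast
  qed
qed

lemma Ltwo_limit_wspan: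
  assumes F: "\<And>n::nat. F n \<in> wspan" and u: "u \<in> borel_measurable borel" and h: "integrable lborel h"
    and lim: "\<And>x. (\<lambda>n. F n x) \<longlonglongrightarrow> u x" and bd: "\<And>n x. (cmod (F n x - u x))\<^sup>2 \<le> h x" and uL: "u \<in> Ltwo"
  shows "u \<in> wspan"
proof (rule closed_span_closed[OF watom_Ltwo uL])
  note [measurable] = u LtwoD(2)[OF closed_span_Ltwo[OF F]]
  have "(\<lambda>n. LINT x|lborel. (cmod (F n x - u x))\<^sup>2) \<longlonglongrightarrow> (LINT x|(lborel :: (real ^ 2) measure). (0::real))"
  proof (rule integral_dominated_convergence)
    show "AE x in lborel. (\<lambda>n. (cmod (F n x - u x))\<^sup>2) \<longlonglongrightarrow> 0"
    proof (rule AE_I2)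
      fix x
      have "(\<lambda>n. (cmod (F n x - u x))\<^sup>2) \<longlonglongrightarrow> (cmod (u x - u x))\<^sup>2" by (intro tendsto_intros lim)
      then show "(\<lambda>n. (cmod (F n x - u x))\<^sup>2) \<longlonglongrightarrow> 0" by simp
    qed
    show "\<And>n. AE x in lborel. norm ((cmod (F n x - u x))\<^sup>2) \<le> h x" using bd by simp
    show "integrable lborel h" by (rule h)
  qed measurable
  then have lim2: "(\<lambda>n. LINT x|lborel. (cmod (F n x - u x))\<^sup>2) \<longlonglongrightarrow> 0" by simp
  fix \<delta> :: real assume "\<delta> > 0"
  then have "0 < \<delta>\<^sup>2" by simp
  then obtain n where "(LINT x|lborel. (cmod (F n x - u x))\<^sup>2) < \<delta>\<^sup>2"
    using order_tendstoD(2)[OF lim2] unfolding eventually_sequentially by blast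
  then have "(Ltwo_norm (\<lambda>x. u x - F n x))\<^sup>2 < \<delta>\<^sup>2"
    unfolding Ltwo_norm_square by (simp add: norm_minus_commute)
  then have "Ltwo_norm (\<lambda>x. u x - F n x) < \<delta>" using \<open>\<delta> > 0\<close> by (simp add: power_less_imp_less_base)
  then show "\<exists>g\<in>wspan. Ltwo_norm (\<lambda>x. u x - g x) < \<delta>" by (intro bexI[of _ "F n"] F)
qed

lemma indicator_Ltwo:
  fixes A :: "'a::euclidean_space set"
  assumes "A \<in> sets borel" "emeasure lborel A < \<infinity>"
  shows "(\<lambda>x. indicator A x :: complex) \<in> Ltwo"
proof -
  have "integrable lborel (indicator A :: 'a \<Rightarrow> real)" using assms by (intro integrable_real_indicator) auto
  moreover have "(\<lambda>x. (cmod (indicator A x))\<^sup>2) = (indicator A :: 'a \<Rightarrow> real)" by (auto simp: indicator_def fun_eq_iff)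
  ultimately show ?thesis using assms by (simp add: Ltwo_def)
qed

text \<open>A box of finite measure around the unit disc. Cutting with it keeps complements square
  integrable, which the induction over Borel sets requires.\<close>

definition square :: "(real ^ 2) set" where
  "square = box (vec2 (-2, -2)) (vec2 (2, 2))"

lemma square_sets [measurable]: "square \<in> sets borel" by (simp add: square_def)

lemma emeasure_square: "emeasure lborel (A \<inter> square) < \<infinity>"
  using emeasure_mono[of "A \<inter> square" square lborel] emeasure_lborel_box_finite[of "vec2 (-2, -2)" "vec2 (2, 2)"]
  by (auto simp: square_def intro: le_less_trans)

lemma box_Int_box_ex: "\<exists>p q. box l u \<inter> box l' u' = box p (q :: 'a::euclidean_space)"
  by (intro exI) (rule box_Int_box)

lemma indicator_box_wspan: "(\<lambda>x. indicator (box l u) x) \<in> wspan"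
proof -
  have "(\<lambda>x. indicator (box l u) x :: complex) = tens (indicator {l $ 1<..<u $ 1}) (indicator {l $ 2<..<u $ 2})"
    by (auto simp: fun_eq_iff tens_def indicator_def mem_box_cart forall_2)
  moreover have "(indicator {a<..<b} :: real \<Rightarrow> complex) \<in> Ltwo" for a b :: real
  proof -
    have "emeasure lborel {a<..<b} < \<infinity>" by (cases "a \<le> b") auto
    then show ?thesis using indicator_Ltwo[of "{a<..<b}"] by simp
  qed
  ultimately show ?thesis using tens_wspan by simp
qed

text \<open>Indicators of boxes are tensors, boxes are stable under intersection and generate the
  Borel sets, and the closed span is closed under relative complements and disjoint countable
  unions.\<close>

lemma indicator_wspan:
  assumes "A \<in> sets borel"
  shows "(\<lambda>x. indicator (A \<inter> square) x) \<in> wspan"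
proof -
  let ?G = "range (\<lambda>(a, b). box a b :: (real ^ 2) set)"
  have A: "A \<in> sigma_sets UNIV ?G" using assms unfolding borel_eq_box by (simp add: sets_measure_of)
  have IS: "Int_stable ?G"
  proof (rule Int_stableI)
    fix a b assume "a \<in> ?G" "b \<in> ?G"
    then obtain l u l' u' where "a = box l u" "b = box l' u'" by auto
    then obtain l'' u'' where "a \<inter> b = box l'' u''" using box_Int_box_ex[of l u l' u'] by auto
    then show "a \<inter> b \<in> ?G" by (auto intro!: image_eqI[of _ _ "(l'', u'')"])
  qed
  have S: "(\<lambda>x. indicator square x) \<in> wspan" unfolding square_def by (rule indicator_box_wspan)
  show ?thesis
  proof (rule sigma_sets_induct_disjoint[OF IS _ A])
    show "?G \<subseteq> Pow UNIV" by simp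
  next
    fix B assume "B \<in> ?G"
    then obtain l u where "B = box l u" by auto
    then obtain l' u' where "B \<inter> square = box l' u'" unfolding square_def using box_Int_box_ex[of l u] by blast
    then show "(\<lambda>x. indicator (B \<inter> square) x) \<in> wspan" using indicator_box_wspan by simp
  next
    show "(\<lambda>x. indicator ({} \<inter> square) x) \<in> wspan"
      using closed_span_cmult[OF watom_Ltwo S, of 0] by simp
  next
    fix B assume "(\<lambda>x. indicator (B \<inter> square) x) \<in> wspan"
    from closed_span_diff[OF watom_Ltwo S this]
    have "(\<lambda>x. indicator square x - indicator (B \<inter> square) x) \<in> wspan" .
    also have "(\<lambda>x. indicator square x - indicator (B \<inter> square) x :: complex) = (\<lambda>x. indicator ((UNIV - B) \<inter> square) x)"
      by (auto simp: fun_eq_iff indicator_def)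
    finally show "(\<lambda>x. indicator ((UNIV - B) \<inter> square) x) \<in> wspan" .
  next
    fix B :: "nat \<Rightarrow> (real ^ 2) set"
    assume disj: "disjoint_family B" and B: "range B \<subseteq> sigma_sets UNIV ?G" and IH: "\<And>i. (\<lambda>x. indicator (B i \<inter> square) x) \<in> wspan"
    have Bm: "B i \<in> sets borel" for i using B unfolding borel_eq_box by (auto simp: sets_measure_of)
    have Um[measurable]: "(\<Union>i. B i) \<inter> square \<in> sets borel" using Bm by auto
    define F where "F n x = (\<Sum>i<n. indicator (B i \<inter> square) x :: complex)" for n and x :: "real ^ 2"
    have F_eq: "F n x = indicator ((\<Union>i<n. B i) \<inter> square) x" for n x
    proof (cases "x \<in> square")
      case True
      have "indicator (\<Union>i<n. B i) x = (\<Sum>i<n. indicator (B i) x :: complex)"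
        using disj by (intro indicator_UN_disjoint) (auto intro: disjoint_family_on_mono)
      moreover have "F n x = (\<Sum>i<n. indicator (B i) x)" unfolding F_def using True by (intro sum.cong) (auto simp: indicator_def)
      ultimately show ?thesis using True by (auto simp: indicator_def)
    next
      case False
      then show ?thesis by (simp add: F_def)
    qed
    show "(\<lambda>x. indicator ((\<Union>i. B i) \<inter> square) x) \<in> wspan"
    proof (rule Ltwo_limit_wspan[where F=F and h="indicator square"])
      show "F n \<in> wspan" for n unfolding F_def by (intro closed_span_sum[OF watom_Ltwo] IH)
      show "(\<lambda>x. indicator ((\<Union>i. B i) \<inter> square) x :: complex) \<in> borel_measurable borel" by measurable
      show "integrable lborel (indicator square :: real ^ 2 \<Rightarrow> real)"
        using emeasure_square[of UNIV] by (intro integrable_real_indicator) auto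
      show "(\<lambda>x. indicator ((\<Union>i. B i) \<inter> square) x :: complex) \<in> Ltwo" by (intro indicator_Ltwo Um emeasure_square)
      fix x
      show "(\<lambda>n. F n x) \<longlonglongrightarrow> indicator ((\<Union>i. B i) \<inter> square) x"
      proof (rule tendsto_eventually)
        show "\<forall>\<^sub>F n in sequentially. F n x = indicator ((\<Union>i. B i) \<inter> square) x"
        proof (cases "x \<in> (\<Union>i. B i)")
          case True
          then obtain i where "x \<in> B i" by blast
          then have "F n x = indicator ((\<Union>i. B i) \<inter> square) x" if "Suc i \<le> n" for n
            unfolding F_eq using that by (auto simp: indicator_def)
          then show ?thesis unfolding eventually_sequentially by blast
        next
          case False
          then show ?thesis unfolding F_eq by (intro always_eventually) (auto simp: indicator_def)
        qed
      qed
      show "(cmod (F n x - indicator ((\<Union>i. B i) \<inter> square) x))\<^sup>2 \<le> indicator square x" for n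
        unfolding F_eq by (auto simp: indicator_def)
    qed
  qed
qed

text \<open>The approximating simple functions satisfy |F n x| at most 2 |u x|. This bound makes
  them vanish wherever \<open>u\<close> does, so that their level sets may be cut with
  \<open>square\<close>, and it dominates the squared error by (1 + 2)^2 = 9 times |u x|^2.\<close>

lemma Ltwo_disc_wspan:
  assumes "u \<in> Ltwo_disc"
  shows "u \<in> wspan"
proof -
  have uL: "u \<in> Ltwo" and u0: "\<And>x. x \<notin> ball 0 1 \<Longrightarrow> u x = 0" using assms by (auto simp: Ltwo_disc_def)
  note um[measurable] = LtwoD(2)[OF uL]
  have ball_sq: "ball 0 1 \<subseteq> square"
  proof
    fix x :: "real ^ 2" assume "x \<in> ball 0 1"
    then have "\<bar>x $ i\<bar> < 1" for i using component_le_norm_cart[of x i] by simp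
    then have "\<bar>x $ 1\<bar> < 1" "\<bar>x $ 2\<bar> < 1" by auto
    then show "x \<in> square" by (auto simp: square_def mem_box_cart forall_2)
  qed
  obtain F where F: "\<And>n. simple_function borel (F n)" "\<And>x. (\<lambda>n. F n x) \<longlonglongrightarrow> u x"
    "\<And>n x. dist (F n x) 0 \<le> 2 * dist (u x) 0"
    using borel_measurable_implies_sequence_metric[OF um, of 0] by auto
  have Fb: "cmod (F n x) \<le> 2 * cmod (u x)" for n x using F(3)[of n x] by simp
  show ?thesis
  proof (rule Ltwo_limit_wspan[where F=F and h="\<lambda>x. 9 * (cmod (u x))\<^sup>2"])
    show "F n \<in> wspan" for n
    proof -
      have fin: "finite (range (F n))" using simple_functionD(1)[OF F(1)[of n]] by simp
      have "F n x = (\<Sum>y\<in>range (F n). y * indicator (F n -` {y} \<inter> square) x)" for x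
      proof -
        have "(\<Sum>y\<in>range (F n). y * indicator (F n -` {y} \<inter> square) x) = (\<Sum>y\<in>range (F n). if y = F n x then y * indicator square x else 0)"
          by (intro sum.cong) (auto simp: indicator_def)
        also have "\<dots> = F n x * indicator square x" using fin by simp
        also have "\<dots> = F n x"
        proof (cases "x \<in> square")
          case False
          then have "x \<notin> ball 0 1" using ball_sq by blast
          then have "u x = 0" by (rule u0)
          then show ?thesis using Fb[of n x] by simp
        qed simp
        finally show ?thesis by simp
      qed
      then have "F n = (\<lambda>x. \<Sum>y\<in>range (F n). y * indicator (F n -` {y} \<inter> square) x)" by (rule ext)
      also have "\<dots> \<in> wspan"
      proof (intro closed_span_sum[OF watom_Ltwo] closed_span_cmult[OF watom_Ltwo] indicator_wspan)
        fix y show "F n -` {y} \<in> sets borel" using simple_functionD(2)[OF F(1)[of n], of "{y}"] by simp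
      qed
      finally show ?thesis .
    qed
    show "integrable lborel (\<lambda>x. 9 * (cmod (u x))\<^sup>2)" using LtwoD(3)[OF uL] by simp
    show "(cmod (F n x - u x))\<^sup>2 \<le> 9 * (cmod (u x))\<^sup>2" for n x
    proof -
      have "cmod (F n x - u x) \<le> 3 * cmod (u x)" using norm_triangle_ineq4[of "F n x" "u x"] Fb[of n x] by linarith
      then have "(cmod (F n x - u x))\<^sup>2 \<le> (3 * cmod (u x))\<^sup>2" by (intro power_mono) auto
      then show ?thesis by (simp add: power_mult_distrib)
    qed
  qed (use um uL F(2) in auto)
qed

lemma inner_disc_outside:
  assumes u: "u \<in> Ltwo_disc" and i: "i \<in> all_index" "i \<notin> dict_index \<psi> \<phi>"
  shows "Ltwo_inner u (watom \<psi> \<phi> i) = 0"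
proof -
  obtain j n e where ie: "i = (j, n, e)" by (cases i) auto
  have "ess_support (watom \<psi> \<phi> i) \<inter> ball 0 1 = {}"
    using i unfolding ie dict_index_def all_index_def by auto
  then have "AE x in lborel. x \<in> ball 0 1 \<longrightarrow> watom \<psi> \<phi> i x = 0" by (rule AE_zero_of_disjoint_ess_support)
  then have "AE x in lborel. u x * cnj (watom \<psi> \<phi> i x) = 0"
    using u unfolding Ltwo_disc_def by (auto elim!: eventually_mono)
  then show ?thesis unfolding Ltwo_inner_def by (rule integral_eq_zero_AE)
qed

text \<open>The basis of the plane gives a finite set of indices with small residual; those outside
  the dictionary contribute nothing, since their atoms vanish almost everywhere on the disc.\<close>

lemma disc_parseval:
  assumes u: "u \<in> Ltwo_disc" and \<delta>: "\<delta> > 0"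
  shows "\<exists>S. finite S \<and> S \<subseteq> dict_index \<psi> \<phi> \<and> (Ltwo_norm u)\<^sup>2 - (\<Sum>i\<in>S. (cmod (Ltwo_inner u (watom \<psi> \<phi> i)))\<^sup>2) < \<delta>"
proof -
  have uL: "u \<in> Ltwo" using u by (simp add: Ltwo_disc_def)
  have "0 < sqrt \<delta>" using \<delta> by simp
  from closed_spanD[OF Ltwo_disc_wspan[OF u] this] obtain g where g: "g \<in> fun_span (watom \<psi> \<phi>) all_index" "Ltwo_norm (\<lambda>x. u x - g x) < sqrt \<delta>"
    by blast
  obtain S a where S: "finite S" "S \<subseteq> all_index" "g = (\<lambda>x. \<Sum>i\<in>S. a i * watom \<psi> \<phi> i x)"
    using g(1) unfolding fun_span_def by blast
  have "(Ltwo_norm u)\<^sup>2 - (\<Sum>i\<in>S. (cmod (Ltwo_inner u (watom \<psi> \<phi> i)))\<^sup>2) \<le> (Ltwo_norm (\<lambda>x. u x - g x))\<^sup>2"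
  proof -
    have on: "Ltwo_inner (watom \<psi> \<phi> i) (watom \<psi> \<phi> k) = (if i = k then 1 else 0)" if "i \<in> S" "k \<in> S" for i k
      using that S(2) by (intro watom_orthonormal) (rule subsetD, assumption+)+
    have "0 \<le> (\<Sum>i\<in>S. (cmod (a i - Ltwo_inner u (watom \<psi> \<phi> i)))\<^sup>2)" by (intro sum_nonneg) simp
    moreover have "(Ltwo_norm (\<lambda>x. u x - (\<Sum>i\<in>S. a i * watom \<psi> \<phi> i x)))\<^sup>2 =
      (Ltwo_norm u)\<^sup>2 - (\<Sum>i\<in>S. (cmod (Ltwo_inner u (watom \<psi> \<phi> i)))\<^sup>2) + (\<Sum>i\<in>S. (cmod (a i - Ltwo_inner u (watom \<psi> \<phi> i)))\<^sup>2)"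
      by (rule orthonormal_residual_square[OF S(1) watom_Ltwo uL on])
    ultimately show ?thesis unfolding S(3) by linarith
  qed
  also have "\<dots> < (sqrt \<delta>)\<^sup>2" using g(2) by (intro power_strict_mono Ltwo_norm_nonneg) auto
  finally have "(Ltwo_norm u)\<^sup>2 - (\<Sum>i\<in>S. (cmod (Ltwo_inner u (watom \<psi> \<phi> i)))\<^sup>2) < \<delta>" using \<delta> by simp
  moreover have "(\<Sum>i\<in>S. (cmod (Ltwo_inner u (watom \<psi> \<phi> i)))\<^sup>2) = (\<Sum>i\<in>S \<inter> dict_index \<psi> \<phi>. (cmod (Ltwo_inner u (watom \<psi> \<phi> i)))\<^sup>2)"
  proof (rule sum.mono_neutral_right)
    show "\<forall>i\<in>S - S \<inter> dict_index \<psi> \<phi>. (cmod (Ltwo_inner u (watom \<psi> \<phi> i)))\<^sup>2 = 0"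
    proof
      fix i assume "i \<in> S - S \<inter> dict_index \<psi> \<phi>"
      then have "i \<in> all_index" "i \<notin> dict_index \<psi> \<phi>" using S(2) by blast+
      from inner_disc_outside[OF u this] show "(cmod (Ltwo_inner u (watom \<psi> \<phi> i)))\<^sup>2 = 0" by simp
    qed
  qed (use S(1) in blast)+
  ultimately show ?thesis using S(1) by (intro exI[of _ "S \<inter> dict_index \<psi> \<phi>"]) auto
qed

end

lemma AE_vec_nth:
  assumes "AE x in lborel. P x" and [measurable]: "Measurable.pred borel P"
  shows "AE x in (lborel :: (real ^ 2) measure). P (x $ i)"
proof -
  have "emeasure lborel {x. \<not> P x} = 0" using assms by (subst (asm) AE_iff_measurable[OF _ refl]) auto
  then have z: "(\<integral>\<^sup>+x. indicator {x. \<not> P x} x \<partial>lborel) = 0" by simp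
  have "(\<integral>\<^sup>+x. indicator {x. \<not> P x} (x $ i) \<partial>(lborel :: (real ^ 2) measure)) = 0"
  proof (cases "i = 1")
    case True
    then show ?thesis using nn_integral_tensor2[of "indicator {x. \<not> P x}" "\<lambda>_. 1"] z by simp
  next
    case False
    then have "i = 2" using exhaust_2 by blast
    then show ?thesis using nn_integral_tensor2[of "\<lambda>_. 1" "indicator {x. \<not> P x}"] z by simp
  qed
  then have "AE x in (lborel :: (real ^ 2) measure). indicator {x. \<not> P x} (x $ i) = (0 :: ennreal)"
    by (subst (asm) nn_integral_0_iff_AE) auto
  then show ?thesis by eventually_elim (auto simp: indicator_def split: if_splits)
qed

section \<open>Summation over scales\<close>

lemma sum_weighted_Cauchy_Schwarz:
  fixes z :: "'p \<Rightarrow> complex"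
  assumes "\<And>p. p \<in> I \<Longrightarrow> 0 < q p"
  shows "(cmod (\<Sum>p\<in>I. z p))\<^sup>2 \<le> (\<Sum>p\<in>I. q p) * (\<Sum>p\<in>I. (cmod (z p))\<^sup>2 / q p)"
proof -
  have "cmod (\<Sum>p\<in>I. z p) \<le> (\<Sum>p\<in>I. cmod (z p))" by (rule norm_sum)
  also have "\<dots> = (\<Sum>p\<in>I. sqrt (q p) * (cmod (z p) / sqrt (q p)))"
    using assms by (intro sum.cong refl) (simp add: less_imp_neq[THEN not_sym])
  finally have "(cmod (\<Sum>p\<in>I. z p))\<^sup>2 \<le> (\<Sum>p\<in>I. sqrt (q p) * (cmod (z p) / sqrt (q p)))\<^sup>2" by (intro power_mono) auto
  also have "\<dots> \<le> (\<Sum>p\<in>I. (sqrt (q p))\<^sup>2) * (\<Sum>p\<in>I. (cmod (z p) / sqrt (q p))\<^sup>2)" by (rule Cauchy_Schwarz_ineq_sum)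
  also have "\<dots> = (\<Sum>p\<in>I. q p) * (\<Sum>p\<in>I. (cmod (z p))\<^sup>2 / q p)"
    using assms by (intro arg_cong2[where f="(*)"] sum.cong refl) (auto simp: power_divide less_imp_le)
  finally show ?thesis .
qed

text \<open>Since \<open>2 powr (- \<alpha>)\<close> is at most 1/2, each term is at most the drop
  from its predecessor to itself, and the sum telescopes with constant 1.\<close>

lemma sum_powr_tail:
  fixes \<alpha> :: real
  assumes "1 \<le> \<alpha>"
  shows "(\<Sum>j\<in>{j0<..J}. 2 powr (- \<alpha> * real j)) \<le> 2 powr (- \<alpha> * real j0)"
proof (cases "j0 \<le> J")
  case True
  have "(\<Sum>j\<in>{j0<..J}. 2 powr (- \<alpha> * real j)) \<le> 2 powr (- \<alpha> * real j0) - 2 powr (- \<alpha> * real J)"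
    using True
  proof (induction J rule: dec_induct)
    case (step n)
    have "2 powr (- \<alpha> * real (Suc n)) = 2 powr (- \<alpha>) * 2 powr (- \<alpha> * real n)" by (simp add: algebra_simps flip: powr_add)
    also have "2 powr (- \<alpha>) * 2 powr (- \<alpha> * real n) \<le> (1 / 2) * 2 powr (- \<alpha> * real n)"
      using assms powr_mono[of "- \<alpha>" "- 1" 2] by (intro mult_right_mono) (auto simp: powr_minus)
    finally have "2 * 2 powr (- \<alpha> * real (Suc n)) \<le> 2 powr (- \<alpha> * real n)" by simp
    moreover have "{j0<..Suc n} = insert (Suc n) {j0<..n}" using step by auto
    ultimately show ?case using step by simp
  qed simp
  then show ?thesis using powr_ge_zero[of 2 "- \<alpha> * real J"] by linarith
qed simp

section \<open>The forward operator on the dictionary\<close>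

locale wavelet_recovery = compact_wavelet +
  fixes b :: real
  assumes b: "2 < b" "b < real \<rho>"
begin

abbreviation "U \<equiv> bessel_conv b"
abbreviation "watm \<equiv> watom \<psi> \<phi>"
abbreviation "\<Gamma> \<equiv> dict_index \<psi> \<phi>"
abbreviation "\<Lambda> \<equiv> dict_index_le \<psi> \<phi>"

lemma watm_integrable: "integrable lborel (watm i)"
proof -
  obtain j n e where "i = (j, n, e)" by (cases i) auto
  then show ?thesis using integrable_watom[of \<psi> \<phi> j n e] gen_integrable[of False] gen_integrable[of True] by simp
qed

lemma U_integrable: "integrable lborel (\<lambda>y. bessel_kernel b (x - y) * f y)" if "integrable lborel f"
proof (rule Bochner_Integration.integrable_bound)
  have [measurable]: "f \<in> borel_measurable borel" using that by auto
  show "integrable lborel (\<lambda>y. bessel_const b * cmod (f y))" using that by simp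
  show "AE y in lborel. norm (bessel_kernel b (x - y) * f y) \<le> norm (bessel_const b * cmod (f y))"
    using bessel_kernel_bound[OF b(1)] bessel_const_pos[OF b(1)] by (intro AE_I2) (simp add: norm_mult mult_right_mono)
  show "(\<lambda>y. bessel_kernel b (x - y) * f y) \<in> borel_measurable lborel" by measurable
qed

lemma U_lincomb:
  assumes "\<And>i. i \<in> I \<Longrightarrow> integrable lborel (f i)"
  shows "U (\<lambda>x. \<Sum>i\<in>I. a i * f i x) t = (\<Sum>i\<in>I. a i * U (f i) t)"
proof -
  have "U (\<lambda>x. \<Sum>i\<in>I. a i * f i x) t = (LINT y|lborel. (\<Sum>i\<in>I. a i * (bessel_kernel b (t - y) * f i y)))"
    unfolding bessel_conv_def by (simp add: sum_distrib_left mult_ac)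
  also have "\<dots> = (\<Sum>i\<in>I. a i * U (f i) t)"
    unfolding bessel_conv_def by (subst Bochner_Integration.integral_sum) (auto intro!: U_integrable assms)
  finally show ?thesis .
qed

lemma U_measurable: "integrable lborel f \<Longrightarrow> U f \<in> borel_measurable borel"
proof -
  assume "integrable lborel f"
  then have [measurable]: "f \<in> borel_measurable borel" by auto
  have "(\<lambda>x. LINT y|lborel. bessel_kernel b (x - y) * f y) \<in> borel_measurable lborel"
    by (rule lborel.borel_measurable_lebesgue_integral) measurable
  then show ?thesis unfolding bessel_conv_def[abs_def] by simp
qed

lemma U_bound: "cmod (U f t) \<le> bessel_const b * (LINT y|lborel. cmod (f y))" if "integrable lborel f"
proof -
  have "cmod (U f t) \<le> (LINT y|lborel. cmod (bessel_kernel b (t - y) * f y))"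
    unfolding bessel_conv_def by (rule integral_norm_bound)
  also have "\<dots> \<le> (LINT y|lborel. bessel_const b * cmod (f y))"
  proof (rule integral_mono_AE)
    show "integrable lborel (\<lambda>y. cmod (bessel_kernel b (t - y) * f y))" using U_integrable[OF that] by (rule integrable_norm)
    show "integrable lborel (\<lambda>y. bessel_const b * cmod (f y))" using that by simp
    show "AE y in lborel. cmod (bessel_kernel b (t - y) * f y) \<le> bessel_const b * cmod (f y)"
      using bessel_kernel_bound[OF b(1)] by (intro AE_I2) (simp add: norm_mult mult_right_mono)
  qed
  finally show ?thesis by simp
qed

lemma scale_bound_ex: "\<exists>R\<ge>1. \<forall>j e F a. finite F \<longrightarrow> (e = (False, False) \<longrightarrow> j = 0) \<longrightarrow>
   (\<forall>t. (cmod (U (\<lambda>x. \<Sum>n\<in>F. a n * watm (j, n, e) x) t))\<^sup>2 \<le> R * 2 powr (2 * (1 - b) * real j) * (\<Sum>n\<in>F. (cmod (a n))\<^sup>2)) \<and>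
   (\<forall>N>0. (LINT t|lborel. indicator (cball 0 N) t * (cmod (U (\<lambda>x. \<Sum>n\<in>F. a n * watm (j, n, e) x) t))\<^sup>2)
      \<le> R * 2 powr (- 2 * b * real j) * (\<Sum>n\<in>F. (cmod (a n))\<^sup>2))"
proof -
  obtain K where K: "0 \<le> K" "\<And>\<eta>. cmod (fourier \<psi> \<eta>) \<le> K" "\<And>\<eta>. cmod (fourier \<phi> \<eta>) \<le> K" "\<And>\<eta>. cmod (fourier \<phi> \<eta>) \<le> K * \<bar>\<eta>\<bar> powr b"
    using fourier_decay[of b] b by auto
  have int: "integrable lborel \<psi>" "integrable lborel \<phi>" using gen_integrable[of False] gen_integrable[of True] by auto
  define R where "R = (bessel_const b + exp 1) * bessel_const b * (K\<^sup>2 * 2 powr (b / 2))\<^sup>2"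
  have R: "R \<le> max 1 R" by simp
  note est = bessel_conv_single_scale[OF b(1) int K, folded R_def]
  show ?thesis
  proof (intro exI[of _ "max 1 R"] conjI allI impI)
    fix j :: nat and e and F :: "(int \<times> int) set" and a t assume F: "finite F" and e: "e = (False, False) \<longrightarrow> j = 0"
    have est1: "(cmod (U (\<lambda>x. \<Sum>n\<in>F. a n * watm (j, n, e) x) t))\<^sup>2 \<le> R * 2 powr (2 * (1 - b) * real j) * (\<Sum>n\<in>F. (cmod (a n))\<^sup>2)" for t
      by (rule est(1)[OF F]) (use e in simp)
    have est2: "(LINT t|lborel. indicator (cball 0 N) t * (cmod (U (\<lambda>x. \<Sum>n\<in>F. a n * watm (j, n, e) x) t))\<^sup>2) \<le> R * 2 powr (- 2 * b * real j) * (\<Sum>n\<in>F. (cmod (a n))\<^sup>2)"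
      if "0 < N" for N
      by (rule est(2)[OF F _ that]) (use e in simp)
    have le: "R * 2 powr x * (\<Sum>n\<in>F. (cmod (a n))\<^sup>2) \<le> max 1 R * 2 powr x * (\<Sum>n\<in>F. (cmod (a n))\<^sup>2)" for x
      by (intro mult_right_mono R sum_nonneg) auto
    show "(cmod (U (\<lambda>x. \<Sum>n\<in>F. a n * watm (j, n, e) x) t))\<^sup>2 \<le> max 1 R * 2 powr (2 * (1 - b) * real j) * (\<Sum>n\<in>F. (cmod (a n))\<^sup>2)"
      by (rule order_trans[OF est1 le])
    fix N :: real assume N: "N > 0"
    show "(LINT t|lborel. indicator (cball 0 N) t * (cmod (U (\<lambda>x. \<Sum>n\<in>F. a n * watm (j, n, e) x) t))\<^sup>2) \<le> max 1 R * 2 powr (- 2 * b * real j) * (\<Sum>n\<in>F. (cmod (a n))\<^sup>2)"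
      by (rule order_trans[OF est2[OF N] le])
  qed simp
qed

text \<open>Fixed inside the locale, hence dependent only on \<open>b\<close> and the dictionary.
  All later constants are built from it, which gives the uniformity that the final statement
  requires.\<close>

definition scale_const :: real where
  "scale_const = (SOME R. 1 \<le> R \<and> (\<forall>j e F a. finite F \<longrightarrow> (e = (False, False) \<longrightarrow> j = 0) \<longrightarrow>
   (\<forall>t. (cmod (U (\<lambda>x. \<Sum>n\<in>F. a n * watm (j, n, e) x) t))\<^sup>2 \<le> R * 2 powr (2 * (1 - b) * real j) * (\<Sum>n\<in>F. (cmod (a n))\<^sup>2)) \<and>
   (\<forall>N>0. (LINT t|lborel. indicator (cball 0 N) t * (cmod (U (\<lambda>x. \<Sum>n\<in>F. a n * watm (j, n, e) x) t))\<^sup>2)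
      \<le> R * 2 powr (- 2 * b * real j) * (\<Sum>n\<in>F. (cmod (a n))\<^sup>2))))"

lemma scale_const: "1 \<le> scale_const"
  and scale_bound_sup: "finite F \<Longrightarrow> (e = (False, False) \<Longrightarrow> j = 0) \<Longrightarrow>
   (cmod (U (\<lambda>x. \<Sum>n\<in>F. a n * watm (j, n, e) x) t))\<^sup>2 \<le> scale_const * 2 powr (2 * (1 - b) * real j) * (\<Sum>n\<in>F. (cmod (a n))\<^sup>2)"
  and scale_bound_Ltwo: "finite F \<Longrightarrow> (e = (False, False) \<Longrightarrow> j = 0) \<Longrightarrow> 0 < N \<Longrightarrow>
   (LINT t|lborel. indicator (cball 0 N) t * (cmod (U (\<lambda>x. \<Sum>n\<in>F. a n * watm (j, n, e) x) t))\<^sup>2)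
      \<le> scale_const * 2 powr (- 2 * b * real j) * (\<Sum>n\<in>F. (cmod (a n))\<^sup>2)"
  using someI_ex[OF scale_bound_ex, folded scale_const_def] by blast+

lemma U_watm_bound:
  assumes "i \<in> all_index"
  shows "cmod (U (watm i) t) \<le> sqrt scale_const * 2 powr ((1 - b) * real (scale i))"
proof -
  obtain j n e where i: "i = (j, n, e)" by (cases i) auto
  have "(cmod (U (watm i) t))\<^sup>2 \<le> scale_const * 2 powr (2 * (1 - b) * real j)"
    using scale_bound_sup[of "{n}" e j "\<lambda>_. 1" t] assms by (simp add: i all_index_def)
  also have "\<dots> = (sqrt scale_const * 2 powr ((1 - b) * real j))\<^sup>2"
  proof -
    have "(2 powr ((1 - b) * real j))\<^sup>2 = 2 powr (2 * (1 - b) * real j)"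
      unfolding power2_eq_square powr_add[symmetric] by (simp add: algebra_simps)
    then show ?thesis using scale_const by (simp add: power_mult_distrib)
  qed
  finally have "cmod (U (watm i) t) \<le> sqrt scale_const * 2 powr ((1 - b) * real j)"
    by (rule power2_le_imp_le) (use scale_const in simp)
  moreover have "scale i = j" by (simp add: i scale_def)
  ultimately show ?thesis by simp
qed

section \<open>Supports and size of the dictionary\<close>

lemma gen_pred: "Measurable.pred borel (\<lambda>x. rad < \<bar>x\<bar> \<longrightarrow> gen \<psi> \<phi> e x = 0)"
proof -
  note [measurable] = LtwoD(2)[OF gen_Ltwo]
  show ?thesis by measurable
qed

lemma watm_support:
  "AE x in lborel. rad < \<bar>2 ^ j * x $ 1 - of_int (fst n)\<bar> \<or> rad < \<bar>2 ^ j * x $ 2 - of_int (snd n)\<bar> \<longrightarrow> watm (j, n, e) x = 0"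
proof -
  have 1: "AE x in lborel. rad < \<bar>2 ^ j * x - of_int k\<bar> \<longrightarrow> gen \<psi> \<phi> d (2 ^ j * x - of_int k) = 0" for k d
    using AE_borel_affine[OF _ gen_pred gen_rad, of "2 ^ j" "- of_int k" d] by simp
  have m: "Measurable.pred borel (\<lambda>x. rad < \<bar>2 ^ j * x - of_int k\<bar> \<longrightarrow> gen \<psi> \<phi> d (2 ^ j * x - of_int k) = 0)" for k :: int and d
  proof -
    note [measurable] = LtwoD(2)[OF gen_Ltwo]
    show ?thesis by measurable
  qed
  show ?thesis
    using AE_vec_nth[OF 1[of "fst n" "fst e"] m, of 1] AE_vec_nth[OF 1[of "snd n" "snd e"] m, of 2]
    by eventually_elim (auto simp: watom_eq)
qed

text \<open>For a larger translation the atom vanishes almost everywhere on the open disc, and then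
  no point of the disc belongs to its support.\<close>

lemma dict_translation_bound:
  assumes "(j, n, e) \<in> \<Gamma>"
  shows "\<bar>of_int (fst n)\<bar> \<le> 2 ^ j + rad" "\<bar>of_int (snd n)\<bar> \<le> 2 ^ j + rad"
proof -
  obtain x where x: "x \<in> ess_support (watm (j, n, e))" "x \<in> ball 0 1"
    using assms unfolding dict_index_def by auto
  have no: "\<not> (AE x in lborel. x \<in> ball 0 1 \<longrightarrow> watm (j, n, e) x = 0)"
    using not_in_ess_support[of "ball 0 1" "watm (j, n, e)" x] x by auto
  have comp: "\<bar>2 ^ j * y $ i\<bar> \<le> 2 ^ j" if "y \<in> ball 0 1" for y :: "real ^ 2" and i
  proof -
    have "\<bar>y $ i\<bar> \<le> 1" using component_le_norm_cart[of y i] that by simp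
    then show ?thesis by (simp add: abs_mult mult_left_le)
  qed
  show "\<bar>of_int (fst n)\<bar> \<le> 2 ^ j + rad"
  proof (rule ccontr)
    assume h: "\<not> \<bar>of_int (fst n)\<bar> \<le> 2 ^ j + rad"
    have "AE x in lborel. x \<in> ball 0 1 \<longrightarrow> watm (j, n, e) x = 0"
      using watm_support[of j n e]
    proof eventually_elim
      case (elim y)
      show ?case
      proof
        assume "y \<in> ball 0 1"
        then have "rad < \<bar>2 ^ j * y $ 1 - of_int (fst n)\<bar>" using comp[of y 1] h by linarith
        then show "watm (j, n, e) y = 0" using elim by blast
      qed
    qed
    then show False using no by blast
  qed
  show "\<bar>of_int (snd n)\<bar> \<le> 2 ^ j + rad"
  proof (rule ccontr)
    assume h: "\<not> \<bar>of_int (snd n)\<bar> \<le> 2 ^ j + rad"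
    have "AE x in lborel. x \<in> ball 0 1 \<longrightarrow> watm (j, n, e) x = 0"
      using watm_support[of j n e]
    proof eventually_elim
      case (elim y)
      show ?case
      proof
        assume "y \<in> ball 0 1"
        then have "rad < \<bar>2 ^ j * y $ 2 - of_int (snd n)\<bar>" using comp[of y 2] h by linarith
        then show "watm (j, n, e) y = 0" using elim by blast
      qed
    qed
    then show False using no by blast
  qed
qed

text \<open>A square that contains the supports at all scales up to null sets: beyond it, |2^j y|
  exceeds 2^j + 2 \<open>rad\<close>, while translations are at most 2^j + \<open>rad\<close>. On
  such a bounded set \<open>Ltwo\<close> embeds into L1, where \<open>U\<close> is easy to
  handle.\<close>

definition frame :: "(real ^ 2) set" where
  "frame = {x. \<bar>x $ 1\<bar> \<le> 2 * rad + 1 \<and> \<bar>x $ 2\<bar> \<le> 2 * rad + 1}"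

lemma frame_sets [measurable]: "frame \<in> sets borel"
  unfolding frame_def by measurable

lemma frame_finite: "emeasure lborel frame < \<infinity>"
proof -
  let ?r = "2 * rad + 1"
  have "frame \<subseteq> cbox (vec2 (- ?r, - ?r)) (vec2 (?r, ?r))"
    by (auto simp: frame_def mem_box_cart forall_2 abs_le_iff)
  then have "emeasure lborel frame \<le> emeasure lborel (cbox (vec2 (- ?r, - ?r)) (vec2 (?r, ?r)))"
    by (intro emeasure_mono) auto
  also have "\<dots> < \<infinity>" by (rule emeasure_lborel_cbox_finite)
  finally show ?thesis .
qed

lemma watm_frame: "i \<in> \<Gamma> \<Longrightarrow> AE x in lborel. x \<notin> frame \<longrightarrow> watm i x = 0"
proof -
  assume "i \<in> \<Gamma>"
  obtain j n e where i: "i = (j, n, e)" by (cases i) auto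
  note bnd = dict_translation_bound[OF \<open>i \<in> \<Gamma>\<close>[unfolded i]]
  have far: "rad < \<bar>2 ^ j * y - of_int k\<bar>" if "2 * rad + 1 < \<bar>y\<bar>" "\<bar>of_int k\<bar> \<le> 2 ^ j + rad" for y :: real and k :: int
  proof -
    have "1 \<le> (2::real) ^ j" by simp
    have "2 ^ j * (2 * rad + 1) < 2 ^ j * \<bar>y\<bar>" using that(1) by (intro mult_strict_left_mono) auto
    moreover have "1 * (2 * rad) \<le> 2 ^ j * (2 * rad)" using rad(1) \<open>1 \<le> (2::real) ^ j\<close> by (intro mult_right_mono) auto
    ultimately have "2 * rad + 2 ^ j < \<bar>2 ^ j * y\<bar>" by (simp add: abs_mult distrib_left)
    then show ?thesis using that(2) by linarith
  qed
  show "AE x in lborel. x \<notin> frame \<longrightarrow> watm i x = 0"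
    unfolding i using watm_support[of j n e]
  proof eventually_elim
    case (elim y)
    show ?case
    proof
      assume "y \<notin> frame"
      then have "2 * rad + 1 < \<bar>y $ 1\<bar> \<or> 2 * rad + 1 < \<bar>y $ 2\<bar>" by (auto simp: frame_def)
      then have "rad < \<bar>2 ^ j * y $ 1 - of_int (fst n)\<bar> \<or> rad < \<bar>2 ^ j * y $ 2 - of_int (snd n)\<bar>"
        using far bnd by blast
      then show "watm (j, n, e) y = 0" using elim by blast
    qed
  qed
qed

lemma disc_frame: "u \<in> Ltwo_disc \<Longrightarrow> x \<notin> frame \<Longrightarrow> u x = 0"
proof -
  assume u: "u \<in> Ltwo_disc" and x: "x \<notin> frame"
  have "x \<notin> ball 0 1"
  proof
    assume "x \<in> ball 0 1"
    then have a: "\<bar>x $ i\<bar> \<le> 1" for i using component_le_norm_cart[of x i] by simp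
    have "\<bar>x $ i\<bar> \<le> 2 * rad + 1" for i using a[of i] rad(1) by linarith
    then show False using x by (simp add: frame_def)
  qed
  then show "u x = 0" using u by (simp add: Ltwo_disc_def)
qed

definition count_const :: real where "count_const = 4 * (2 * rad + 5)\<^sup>2"

text \<open>Four types, J + 1 scales and of order 4^J translations each. The crude J + 1 at most 2^J
  is harmless because only the logarithm of the count enters the sample size.\<close>

lemma
  shows finite_dict_le: "finite (\<Lambda> J)"
    and card_dict_le: "real (card (\<Lambda> J)) \<le> count_const * 8 ^ J"
proof -
  define B where "B = \<lceil>2 ^ J + rad\<rceil>"
  let ?T = "{..J} \<times> ({- B..B} \<times> {- B..B}) \<times> (UNIV :: (bool \<times> bool) set)"
  have sub: "\<Lambda> J \<subseteq> ?T"
  proof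
    fix i assume i: "i \<in> \<Lambda> J"
    obtain j n e where ie: "i = (j, n, e)" by (cases i) auto
    have j: "j \<le> J" "(j, n, e) \<in> \<Gamma>" using i by (auto simp: dict_index_le_def ie scale_def)
    have "(2::real) ^ j \<le> 2 ^ J" using j(1) by (intro power_increasing) auto
    then have "\<bar>fst n\<bar> \<le> B" "\<bar>snd n\<bar> \<le> B"
      using dict_translation_bound[OF j(2)] unfolding B_def by linarith+
    then show "i \<in> ?T" using j(1) by (cases n) (auto simp: ie abs_le_iff)
  qed
  have finT: "finite ?T" by simp
  show "finite (\<Lambda> J)" using sub finT by (rule finite_subset)
  have "0 \<le> 2 ^ J + rad" using rad(1) by (intro add_nonneg_nonneg) auto
  then have B0: "0 \<le> B" unfolding B_def by linarith
  have "card (\<Lambda> J) \<le> card ?T" using sub finT by (intro card_mono)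
  also have "card ?T = (J + 1) * (nat (2 * B + 1) * nat (2 * B + 1)) * 4"
    by (simp add: card_cartesian_product card_UNIV_bool algebra_simps flip: UNIV_Times_UNIV)
  finally have "real (card (\<Lambda> J)) \<le> real ((J + 1) * (nat (2 * B + 1) * nat (2 * B + 1)) * 4)" by linarith
  also have "\<dots> = real (J + 1) * (of_int (2 * B + 1) * of_int (2 * B + 1)) * 4" using B0 by (simp add: algebra_simps)
  also have "\<dots> \<le> 2 ^ J * (((2 * rad + 5) * 2 ^ J) * ((2 * rad + 5) * 2 ^ J)) * 4"
  proof -
    have p: "1 \<le> (2::real) ^ J" by simp
    have "of_int B \<le> 2 ^ J + rad + 1" unfolding B_def by linarith
    then have "of_int (2 * B + 1) \<le> 2 * 2 ^ J + (2 * rad + 3) * 1" by simp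
    also have "\<dots> \<le> 2 * 2 ^ J + (2 * rad + 3) * 2 ^ J" using rad(1) p by (intro add_left_mono mult_left_mono) auto
    finally have 1: "of_int (2 * B + 1) \<le> (2 * rad + 5) * 2 ^ J" by (simp add: algebra_simps)
    have "J + 1 \<le> 2 ^ J" using Suc_leI[OF less_exp[of J]] by simp
    then have 2: "real (J + 1) \<le> 2 ^ J" by (metis of_nat_le_iff of_nat_numeral of_nat_power)
    show ?thesis using 1 2 B0 by (intro mult_right_mono mult_mono) auto
  qed
  also have "\<dots> = count_const * (2 ^ J * (2 ^ J * 2 ^ J))" by (simp add: count_const_def power2_eq_square)
  also have "(2::real) ^ J * (2 ^ J * 2 ^ J) = 8 ^ J" by (simp flip: power_mult_distrib)
  finally show "real (card (\<Lambda> J)) \<le> count_const * 8 ^ J" .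
qed

lemma count_const_ge: "1 \<le> count_const"
proof -
  have "1\<^sup>2 \<le> (2 * rad + 5)\<^sup>2" using rad(1) by (intro power_mono) auto
  then show ?thesis unfolding count_const_def by simp
qed

end

lemma emeasure_cball_less_top: "emeasure lborel (cball (x :: 'a::euclidean_space) N) < top"
  using emeasure_bounded_finite[of "cball x N"] by simp

context wavelet_recovery
begin

text \<open>Together with \<open>U_bound\<close> this makes \<open>U\<close> continuous from
  \<open>Ltwo\<close> on the frame to the sup norm, so convergence of expansions in
  \<open>Ltwo\<close> becomes pointwise convergence of their images.\<close>

lemma Ltwo_frame_integrable:
  assumes f: "f \<in> Ltwo" and out: "AE x in lborel. x \<notin> frame \<longrightarrow> f x = 0"
  shows "integrable lborel f"
    and "(LINT x|lborel. cmod (f x)) \<le> Ltwo_norm (\<lambda>x. indicator frame x :: complex) * Ltwo_norm f"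
proof -
  note [measurable] = LtwoD(1)[OF f]
  have iL: "(\<lambda>x. indicator frame x :: complex) \<in> Ltwo" by (rule indicator_Ltwo[OF frame_sets frame_finite])
  have i: "integrable lborel (\<lambda>x. f x * cnj (indicator frame x))" by (rule Ltwo_mult_integrable[OF f iL])
  have ae: "AE x in lborel. f x * cnj (indicator frame x) = f x"
    using out by eventually_elim (auto simp: indicator_def)
  show fi: "integrable lborel f"
    by (rule Bochner_Integration.integrable_cong_AE_imp[OF i]) (use ae in \<open>auto elim: eventually_mono\<close>)
  have "(LINT x|lborel. cmod (f x)) = (LINT x|lborel. cmod (indicator frame x :: complex) * cmod (f x))"
  proof (rule integral_cong_AE)
    show "AE x in lborel. cmod (f x) = cmod (indicator frame x :: complex) * cmod (f x)"
      using out by eventually_elim (auto simp: indicator_def)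
  qed measurable
  also have "\<dots> \<le> Ltwo_norm (\<lambda>x. indicator frame x :: complex) * Ltwo_norm f"
    by (rule Ltwo_abs_mult_integral_le[OF iL f])
  finally show "(LINT x|lborel. cmod (f x)) \<le> Ltwo_norm (\<lambda>x. indicator frame x :: complex) * Ltwo_norm f" .
qed

lemma dict_le_subset: "\<Lambda> J \<subseteq> \<Gamma>" "\<Gamma> \<subseteq> all_index" "\<Lambda> J \<subseteq> all_index"
  using dict_index_subset by (auto simp: dict_index_le_def)

lemma dict_le_mono: "I \<le> J \<Longrightarrow> \<Lambda> I \<subseteq> \<Lambda> J"
  by (auto simp: dict_index_le_def)

lemma watm_on: "S \<subseteq> all_index \<Longrightarrow> i \<in> S \<Longrightarrow> k \<in> S \<Longrightarrow> Ltwo_inner (watm i) (watm k) = (if i = k then 1 else 0)"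
  by (rule watom_orthonormal) (erule subsetD, assumption)+

section \<open>Truncated expansions and their residual\<close>

text \<open>The orthogonal projection of \<open>u\<close> onto the atoms up to scale
  \<open>J\<close>, kept as an explicit finite sum so that it has point values.\<close>

definition trunc :: "(real ^ 2 \<Rightarrow> complex) \<Rightarrow> nat \<Rightarrow> real ^ 2 \<Rightarrow> complex" where
  "trunc u J x = (\<Sum>i\<in>\<Lambda> J. analysis_op \<psi> \<phi> u i * watm i x)"

lemma trunc_Ltwo: "trunc u J \<in> Ltwo"
  unfolding trunc_def[abs_def] by (intro Ltwo_lincomb watom_Ltwo)

lemma analysis_dict: "i \<in> \<Gamma> \<Longrightarrow> analysis_op \<psi> \<phi> u i = Ltwo_inner u (watm i)"
  by (simp add: analysis_op_def)

lemma trunc_residual: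
  assumes "u \<in> Ltwo"
  shows "(Ltwo_norm (\<lambda>x. u x - trunc u J x))\<^sup>2 = (Ltwo_norm u)\<^sup>2 - (\<Sum>i\<in>\<Lambda> J. (cmod (analysis_op \<psi> \<phi> u i))\<^sup>2)"
proof -
  have a: "analysis_op \<psi> \<phi> u i = Ltwo_inner u (watm i)" if "i \<in> \<Lambda> J" for i
    using that dict_le_subset(1)[of J] by (intro analysis_dict) (rule subsetD)
  have "(Ltwo_norm (\<lambda>x. u x - (\<Sum>i\<in>\<Lambda> J. analysis_op \<psi> \<phi> u i * watm i x)))\<^sup>2 =
    (Ltwo_norm u)\<^sup>2 - (\<Sum>i\<in>\<Lambda> J. (cmod (Ltwo_inner u (watm i)))\<^sup>2) + (\<Sum>i\<in>\<Lambda> J. (cmod (analysis_op \<psi> \<phi> u i - Ltwo_inner u (watm i)))\<^sup>2)"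
    by (rule orthonormal_residual_square[OF finite_dict_le watom_Ltwo assms watm_on[OF dict_le_subset(3)]])
  moreover have "(\<Sum>i\<in>\<Lambda> J. (cmod (analysis_op \<psi> \<phi> u i - Ltwo_inner u (watm i)))\<^sup>2) = 0"
    by (intro sum.neutral ballI) (simp add: a)
  moreover have "(\<Sum>i\<in>\<Lambda> J. (cmod (Ltwo_inner u (watm i)))\<^sup>2) = (\<Sum>i\<in>\<Lambda> J. (cmod (analysis_op \<psi> \<phi> u i))\<^sup>2)"
    by (intro sum.cong refl) (simp add: a)
  ultimately show ?thesis unfolding trunc_def by linarith
qed

lemma bessel_inequality:
  assumes u: "u \<in> Ltwo" and S: "finite S" "S \<subseteq> \<Gamma>"
  shows "(\<Sum>i\<in>S. (cmod (analysis_op \<psi> \<phi> u i))\<^sup>2) \<le> (Ltwo_norm u)\<^sup>2"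
proof -
  define J where "J = (if S = {} then 0 else Max (scale ` S))"
  have sub: "S \<subseteq> \<Lambda> J"
  proof
    fix i assume "i \<in> S"
    then have "scale i \<le> J" using S(1) by (auto simp: J_def)
    then show "i \<in> \<Lambda> J" using \<open>i \<in> S\<close> S(2) by (auto simp: dict_index_le_def)
  qed
  have "(\<Sum>i\<in>S. (cmod (analysis_op \<psi> \<phi> u i))\<^sup>2) \<le> (\<Sum>i\<in>\<Lambda> J. (cmod (analysis_op \<psi> \<phi> u i))\<^sup>2)"
    by (intro sum_mono2 finite_dict_le sub) simp
  moreover have "0 \<le> (Ltwo_norm (\<lambda>x. u x - trunc u J x))\<^sup>2" by simp
  ultimately show ?thesis unfolding trunc_residual[OF u] by linarith
qed

lemma trunc_tendsto:
  assumes "u \<in> Ltwo_disc"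
  shows "(\<lambda>J. Ltwo_norm (\<lambda>x. u x - trunc u J x)) \<longlonglongrightarrow> 0"
proof (rule LIMSEQ_I)
  fix e :: real assume "0 < e"
  have uL: "u \<in> Ltwo" using assms by (simp add: Ltwo_disc_def)
  obtain S where S: "finite S" "S \<subseteq> \<Gamma>" "(Ltwo_norm u)\<^sup>2 - (\<Sum>i\<in>S. (cmod (Ltwo_inner u (watm i)))\<^sup>2) < e\<^sup>2"
    using disc_parseval[OF assms, of "e\<^sup>2"] \<open>0 < e\<close> by auto
  define J0 where "J0 = (if S = {} then 0 else Max (scale ` S))"
  show "\<exists>no. \<forall>J\<ge>no. norm (Ltwo_norm (\<lambda>x. u x - trunc u J x) - 0) < e"
  proof (intro exI allI impI)
    fix J assume J: "J0 \<le> J"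
    have sub: "S \<subseteq> \<Lambda> J"
    proof
      fix i assume "i \<in> S"
      then have "scale i \<le> J0" using S(1) by (auto simp: J0_def)
      then show "i \<in> \<Lambda> J" using \<open>i \<in> S\<close> S(2) J by (auto simp: dict_index_le_def)
    qed
    have "(\<Sum>i\<in>S. (cmod (Ltwo_inner u (watm i)))\<^sup>2) = (\<Sum>i\<in>S. (cmod (analysis_op \<psi> \<phi> u i))\<^sup>2)"
      using S(2) by (intro sum.cong refl) (simp add: analysis_dict subsetD)
    also have "\<dots> \<le> (\<Sum>i\<in>\<Lambda> J. (cmod (analysis_op \<psi> \<phi> u i))\<^sup>2)"
      by (intro sum_mono2 finite_dict_le sub) simp
    finally have "(Ltwo_norm (\<lambda>x. u x - trunc u J x))\<^sup>2 < e\<^sup>2"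
      using S(3) unfolding trunc_residual[OF uL] by linarith
    then have "Ltwo_norm (\<lambda>x. u x - trunc u J x) < e" using \<open>0 < e\<close> by (simp add: power_less_imp_less_base)
    then show "norm (Ltwo_norm (\<lambda>x. u x - trunc u J x) - 0) < e" by (simp add: Ltwo_norm_nonneg)
  qed
qed

lemma trunc_frame: "AE x in lborel. x \<notin> frame \<longrightarrow> trunc u J x = 0"
proof -
  have "AE x in lborel. \<forall>i\<in>\<Lambda> J. x \<notin> frame \<longrightarrow> watm i x = 0"
    using dict_le_subset(1)[of J] by (intro AE_finite_allI finite_dict_le watm_frame) (rule subsetD)
  then show ?thesis by eventually_elim (auto simp: trunc_def intro!: sum.neutral)
qed

lemma trunc_integrable: "integrable lborel (trunc u J)"
  by (rule Ltwo_frame_integrable(1)[OF trunc_Ltwo trunc_frame])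

lemma disc_integrable: "integrable lborel u" if "u \<in> Ltwo_disc"
  using that disc_frame[OF that] by (intro Ltwo_frame_integrable(1)) (auto simp: Ltwo_disc_def)

lemma tail_coefficients:
  assumes u: "u \<in> Ltwo" and r: "ell2_norm \<Gamma> (proj_le_perp \<psi> \<phi> j0 (analysis_op \<psi> \<phi> u)) \<le> r" "0 \<le> r"
    and S: "finite S" "S \<subseteq> \<Gamma> - \<Lambda> j0"
  shows "(\<Sum>i\<in>S. (cmod (analysis_op \<psi> \<phi> u i))\<^sup>2) \<le> r\<^sup>2"
proof -
  let ?c = "\<lambda>i. (cmod (proj_le_perp \<psi> \<phi> j0 (analysis_op \<psi> \<phi> u) i))\<^sup>2"
  have le: "?c i \<le> (cmod (analysis_op \<psi> \<phi> u i))\<^sup>2" for i by (simp add: proj_le_perp_def proj_le_def)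
  have bnd: "sum ?c F \<le> (Ltwo_norm u)\<^sup>2" if "finite F" "F \<subseteq> \<Gamma>" for F
    using sum_mono[of F ?c, OF le] bessel_inequality[OF u that] by (rule order_trans)
  \<comment> \<open>The sum \<open>infsum\<close> of a non-summable family is 0, so a bound on
    \<open>ell2_norm\<close> says nothing before summability is known; it follows from Bessel's
    inequality.\<close>
  have sm: "?c summable_on \<Gamma>"
    by (rule nonneg_bdd_above_summable_on) (auto intro!: bdd_aboveI[of _ "(Ltwo_norm u)\<^sup>2"] bnd)
  have "(\<Sum>i\<in>S. (cmod (analysis_op \<psi> \<phi> u i))\<^sup>2) = sum ?c S"
    using S(2) by (intro sum.cong refl) (auto simp: proj_le_perp_def proj_le_def)
  also have "\<dots> \<le> (\<Sum>\<^sub>\<infinity>i\<in>\<Gamma>. ?c i)"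
    using S by (intro finite_sum_le_infsum sm) auto
  also have "\<dots> = (ell2_norm \<Gamma> (proj_le_perp \<psi> \<phi> j0 (analysis_op \<psi> \<phi> u)))\<^sup>2"
    unfolding ell2_norm_def by (simp add: infsum_nonneg)
  also have "\<dots> \<le> r\<^sup>2" using r by (intro power_mono) (auto simp: ell2_norm_def infsum_nonneg)
  finally show ?thesis .
qed

text \<open>Parseval's identity for functions on the disc: the residual at \<open>j0\<close> is the
  residual at \<open>J\<close> plus coefficients between the two scales, and the former tends to
  0.\<close>

lemma residual_le:
  assumes u: "u \<in> Ltwo_disc" and r: "ell2_norm \<Gamma> (proj_le_perp \<psi> \<phi> j0 (analysis_op \<psi> \<phi> u)) \<le> r" "0 \<le> r"
  shows "Ltwo_norm (\<lambda>x. u x - trunc u j0 x) \<le> r"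
proof -
  have uL: "u \<in> Ltwo" using u by (simp add: Ltwo_disc_def)
  have le: "(Ltwo_norm (\<lambda>x. u x - trunc u j0 x))\<^sup>2 \<le> (Ltwo_norm (\<lambda>x. u x - trunc u J x))\<^sup>2 + r\<^sup>2" if "j0 \<le> J" for J
  proof -
    have "(\<Sum>i\<in>\<Lambda> J. (cmod (analysis_op \<psi> \<phi> u i))\<^sup>2) = (\<Sum>i\<in>\<Lambda> j0. (cmod (analysis_op \<psi> \<phi> u i))\<^sup>2) + (\<Sum>i\<in>\<Lambda> J - \<Lambda> j0. (cmod (analysis_op \<psi> \<phi> u i))\<^sup>2)"
      by (subst sum.subset_diff[OF dict_le_mono[OF that] finite_dict_le]) simp
    moreover have "(\<Sum>i\<in>\<Lambda> J - \<Lambda> j0. (cmod (analysis_op \<psi> \<phi> u i))\<^sup>2) \<le> r\<^sup>2"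
      using dict_le_subset(1)[of J] finite_dict_le by (intro tail_coefficients[OF uL r]) auto
    ultimately show ?thesis unfolding trunc_residual[OF uL] by linarith
  qed
  have "(\<lambda>J. (Ltwo_norm (\<lambda>x. u x - trunc u J x))\<^sup>2 + r\<^sup>2) \<longlonglongrightarrow> 0\<^sup>2 + r\<^sup>2"
    by (intro tendsto_intros trunc_tendsto u)
  then have "(Ltwo_norm (\<lambda>x. u x - trunc u j0 x))\<^sup>2 \<le> 0\<^sup>2 + r\<^sup>2"
    using le by (intro LIMSEQ_le_const[of _ _ "(Ltwo_norm (\<lambda>x. u x - trunc u j0 x))\<^sup>2"]) auto
  then have "(Ltwo_norm (\<lambda>x. u x - trunc u j0 x))\<^sup>2 \<le> r\<^sup>2" by simp
  then show ?thesis using r(2) by (rule power2_le_imp_le)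
qed

section \<open>Forward image of the truncation error\<close>

definition tail :: "(real ^ 2 \<Rightarrow> complex) \<Rightarrow> nat \<Rightarrow> nat \<Rightarrow> real ^ 2 \<Rightarrow> complex" where
  "tail u j0 J t = U (trunc u J) t - U (trunc u j0) t"

lemma U_trunc: "U (trunc u J) t = (\<Sum>i\<in>\<Lambda> J. analysis_op \<psi> \<phi> u i * U (watm i) t)"
  unfolding trunc_def[abs_def] by (rule U_lincomb[OF watm_integrable])

text \<open>The coefficients are grouped by scale and type, since the estimates on \<open>U\<close>
  hold for combinations inside one such block.\<close>

lemma tail_blocks:
  assumes "j0 \<le> J"
  shows "tail u j0 J t = (\<Sum>p\<in>{j0<..J} \<times> UNIV. U (\<lambda>x. \<Sum>n\<in>{n. (fst p, n, snd p) \<in> \<Gamma>}. analysis_op \<psi> \<phi> u (fst p, n, snd p) * watm (fst p, n, snd p) x) t)"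
    and "(\<Sum>i\<in>\<Lambda> J - \<Lambda> j0. (cmod (analysis_op \<psi> \<phi> u i))\<^sup>2) =
      (\<Sum>p\<in>{j0<..J} \<times> UNIV. \<Sum>n\<in>{n. (fst p, n, snd p) \<in> \<Gamma>}. (cmod (analysis_op \<psi> \<phi> u (fst p, n, snd p)))\<^sup>2)"
    and "finite {n. (j, n, e) \<in> \<Gamma>}"
proof -
  show fin: "finite {n. (j, n, e) \<in> \<Gamma>}" for j e
  proof -
    have "(\<lambda>n. (j, n, e)) ` {n. (j, n, e) \<in> \<Gamma>} \<subseteq> \<Lambda> j" by (auto simp: dict_index_le_def scale_def)
    then have "finite ((\<lambda>n. (j, n, e)) ` {n. (j, n, e) \<in> \<Gamma>})" using finite_dict_le by (rule finite_subset)
    then show ?thesis by (rule finite_imageD) (auto simp: inj_on_def)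
  qed
  have re: "(\<Sum>i\<in>\<Lambda> J - \<Lambda> j0. g i) = (\<Sum>p\<in>{j0<..J} \<times> UNIV. \<Sum>n\<in>{n. (fst p, n, snd p) \<in> \<Gamma>}. g (fst p, n, snd p))" for g :: "windex \<Rightarrow> 'z::comm_monoid_add"
  proof -
    have "(\<Sum>p\<in>{j0<..J} \<times> UNIV. \<Sum>n\<in>{n. (fst p, n, snd p) \<in> \<Gamma>}. g (fst p, n, snd p)) =
      (\<Sum>q\<in>Sigma ({j0<..J} \<times> UNIV) (\<lambda>p. {n. (fst p, n, snd p) \<in> \<Gamma>}). g (fst (fst q), snd q, snd (fst q)))"
      using fin by (subst sum.Sigma) (auto simp: case_prod_unfold)
    also have "\<dots> = (\<Sum>i\<in>\<Lambda> J - \<Lambda> j0. g i)"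
      by (rule sum.reindex_bij_witness[where i="\<lambda>i. ((fst i, snd (snd i)), fst (snd i))" and j="\<lambda>q. (fst (fst q), snd q, snd (fst q))"])
         (auto simp: dict_index_le_def scale_def)
    finally show ?thesis by simp
  qed
  have "tail u j0 J t = (\<Sum>i\<in>\<Lambda> J - \<Lambda> j0. analysis_op \<psi> \<phi> u i * U (watm i) t)"
    unfolding tail_def U_trunc by (subst sum.subset_diff[OF dict_le_mono[OF assms] finite_dict_le]) simp
  also have "\<dots> = (\<Sum>p\<in>{j0<..J} \<times> UNIV. \<Sum>n\<in>{n. (fst p, n, snd p) \<in> \<Gamma>}. analysis_op \<psi> \<phi> u (fst p, n, snd p) * U (watm (fst p, n, snd p)) t)"
    by (rule re)
  also have "\<dots> = (\<Sum>p\<in>{j0<..J} \<times> UNIV. U (\<lambda>x. \<Sum>n\<in>{n. (fst p, n, snd p) \<in> \<Gamma>}. analysis_op \<psi> \<phi> u (fst p, n, snd p) * watm (fst p, n, snd p) x) t)"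
    by (intro sum.cong refl U_lincomb[symmetric] watm_integrable)
  finally show "tail u j0 J t = (\<Sum>p\<in>{j0<..J} \<times> UNIV. U (\<lambda>x. \<Sum>n\<in>{n. (fst p, n, snd p) \<in> \<Gamma>}. analysis_op \<psi> \<phi> u (fst p, n, snd p) * watm (fst p, n, snd p) x) t)" .
  show "(\<Sum>i\<in>\<Lambda> J - \<Lambda> j0. (cmod (analysis_op \<psi> \<phi> u i))\<^sup>2) =
      (\<Sum>p\<in>{j0<..J} \<times> UNIV. \<Sum>n\<in>{n. (fst p, n, snd p) \<in> \<Gamma>}. (cmod (analysis_op \<psi> \<phi> u (fst p, n, snd p)))\<^sup>2)"
    by (rule re)
qed

lemma sum_type_powr:
  "1 \<le> \<alpha> \<Longrightarrow> (\<Sum>p\<in>{j0<..J} \<times> (UNIV :: (bool \<times> bool) set). 2 powr (- \<alpha> * real (fst p))) \<le> 4 * 2 powr (- \<alpha> * real j0)"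
proof -
  assume \<alpha>: "1 \<le> \<alpha>"
  have "(\<Sum>p\<in>{j0<..J} \<times> (UNIV :: (bool \<times> bool) set). 2 powr (- \<alpha> * real (fst p))) = (\<Sum>j\<in>{j0<..J}. \<Sum>e\<in>(UNIV :: (bool \<times> bool) set). 2 powr (- \<alpha> * real j))"
    by (subst sum.cartesian_product) (simp add: case_prod_unfold)
  also have "\<dots> = 4 * (\<Sum>j\<in>{j0<..J}. 2 powr (- \<alpha> * real j))"
    by (simp add: sum_distrib_left card_cartesian_product flip: UNIV_Times_UNIV)
  also have "\<dots> \<le> 4 * 2 powr (- \<alpha> * real j0)" by (intro mult_left_mono sum_powr_tail \<alpha>) simp
  finally show ?thesis .
qed

text \<open>Images of different scales need not be orthogonal, so the blocks are combined by
  Cauchy-Schwarz with weights 2^(-\<alpha> j), where \<alpha> is b - 1 for the sup bound and b for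
  the mean square. Half of the decay 2^(-2 \<alpha> j) pays for the weights, the other half is
  evaluated at \<open>j0\<close>.\<close>

lemma tail_finite_bounds:
  assumes uL: "u \<in> Ltwo" and r: "ell2_norm \<Gamma> (proj_le_perp \<psi> \<phi> j0 (analysis_op \<psi> \<phi> u)) \<le> r" "0 \<le> r"
    and J: "j0 \<le> J"
  shows "(cmod (tail u j0 J t))\<^sup>2 \<le> 4 * scale_const * 2 powr (- 2 * (b - 1) * real j0) * r\<^sup>2"
    and "0 < N \<Longrightarrow> (LINT t|lborel. indicator (cball 0 N) t * (cmod (tail u j0 J t))\<^sup>2) \<le> 4 * scale_const * 2 powr (- 2 * b * real j0) * r\<^sup>2"
proof -
  let ?P = "{j0<..J} \<times> (UNIV :: (bool \<times> bool) set)"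
  let ?F = "\<lambda>p. {n. (fst p, n, snd p) \<in> \<Gamma>}"
  define z where "z p = U (\<lambda>x. \<Sum>n\<in>?F p. analysis_op \<psi> \<phi> u (fst p, n, snd p) * watm (fst p, n, snd p) x)" for p :: "nat \<times> bool \<times> bool"
  define S where "S p = (\<Sum>n\<in>?F p. (cmod (analysis_op \<psi> \<phi> u (fst p, n, snd p)))\<^sup>2)" for p :: "nat \<times> bool \<times> bool"
  note R1 = scale_const
  have tz: "tail u j0 J t = (\<Sum>p\<in>?P. z p t)" for t unfolding z_def by (rule tail_blocks(1)[OF J])
  have S0: "0 \<le> S p" for p unfolding S_def by (intro sum_nonneg) simp
  have Sr: "(\<Sum>p\<in>?P. S p) \<le> r\<^sup>2"
    unfolding S_def tail_blocks(2)[OF J, symmetric]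
    using dict_le_subset(1)[of J] finite_dict_le by (intro tail_coefficients[OF uL r]) auto
  have fin: "finite (?F p)" for p :: "nat \<times> bool \<times> bool" by (rule tail_blocks(3)[OF J])
  have zb: "(cmod (z p t))\<^sup>2 \<le> scale_const * 2 powr (2 * (1 - b) * real (fst p)) * S p"
    and zi: "0 < N \<Longrightarrow> (LINT t|lborel. indicator (cball 0 N) t * (cmod (z p t))\<^sup>2) \<le> scale_const * 2 powr (- 2 * b * real (fst p)) * S p" for p t N
  proof -
    have "(cmod (z p t))\<^sup>2 \<le> scale_const * 2 powr (2 * (1 - b) * real (fst p)) * S p \<and>
      (0 < N \<longrightarrow> (LINT t|lborel. indicator (cball 0 N) t * (cmod (z p t))\<^sup>2) \<le> scale_const * 2 powr (- 2 * b * real (fst p)) * S p)"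
    proof (cases "snd p = (False, False) \<longrightarrow> fst p = 0")
      case True
      then show ?thesis unfolding z_def S_def using scale_bound_sup[OF fin] scale_bound_Ltwo[OF fin] by simp
    next
      \<comment> \<open>A pure scaling type above scale 0 is no dictionary index, so this block is
        empty.\<close>
      case False
      then have e: "?F p = {}" by (auto simp: dict_index_def)
      show ?thesis unfolding z_def S_def e by (simp add: bessel_conv_def)
    qed
    then show "(cmod (z p t))\<^sup>2 \<le> scale_const * 2 powr (2 * (1 - b) * real (fst p)) * S p"
      "0 < N \<Longrightarrow> (LINT t|lborel. indicator (cball 0 N) t * (cmod (z p t))\<^sup>2) \<le> scale_const * 2 powr (- 2 * b * real (fst p)) * S p" by blast+
  qed
  have CS: "(cmod (tail u j0 J t))\<^sup>2 \<le> 4 * 2 powr (- \<alpha> * real j0) * (\<Sum>p\<in>?P. (cmod (z p t))\<^sup>2 * 2 powr (\<alpha> * real (fst p)))" if "1 \<le> \<alpha>" for \<alpha> t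
  proof -
    have "(cmod (tail u j0 J t))\<^sup>2 \<le> (\<Sum>p\<in>?P. 2 powr (- \<alpha> * real (fst p))) * (\<Sum>p\<in>?P. (cmod (z p t))\<^sup>2 / 2 powr (- \<alpha> * real (fst p)))"
      unfolding tz by (rule sum_weighted_Cauchy_Schwarz) simp
    also have "\<dots> \<le> 4 * 2 powr (- \<alpha> * real j0) * (\<Sum>p\<in>?P. (cmod (z p t))\<^sup>2 / 2 powr (- \<alpha> * real (fst p)))"
      by (intro mult_right_mono sum_type_powr that sum_nonneg) auto
    finally show ?thesis by (simp add: powr_minus divide_inverse)
  qed
  have dec: "2 powr (- \<alpha> * real (fst p)) \<le> 2 powr (- \<alpha> * real j0)" if "p \<in> ?P" "0 \<le> \<alpha>" for p \<alpha>
    using that by (intro powr_mono) (auto intro!: mult_left_mono)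
  have agg: "(\<Sum>p\<in>?P. scale_const * 2 powr (- 2 * \<alpha> * real (fst p)) * S p * 2 powr (\<alpha> * real (fst p))) \<le> scale_const * 2 powr (- \<alpha> * real j0) * r\<^sup>2"
    if "0 \<le> \<alpha>" for \<alpha>
  proof -
    have "(\<Sum>p\<in>?P. scale_const * 2 powr (- 2 * \<alpha> * real (fst p)) * S p * 2 powr (\<alpha> * real (fst p))) = (\<Sum>p\<in>?P. scale_const * S p * 2 powr (- \<alpha> * real (fst p)))"
    proof (intro sum.cong refl)
      fix p :: "nat \<times> bool \<times> bool"
      have "2 powr (- 2 * \<alpha> * real (fst p)) * 2 powr (\<alpha> * real (fst p)) = 2 powr (- \<alpha> * real (fst p))"
        unfolding powr_add[symmetric] by (simp add: algebra_simps)
      then show "scale_const * 2 powr (- 2 * \<alpha> * real (fst p)) * S p * 2 powr (\<alpha> * real (fst p)) = scale_const * S p * 2 powr (- \<alpha> * real (fst p))"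
        by (simp only: mult_ac)
    qed
    also have "\<dots> \<le> (\<Sum>p\<in>?P. scale_const * S p * 2 powr (- \<alpha> * real j0))"
      using S0 R1 dec that by (intro sum_mono mult_left_mono) auto
    also have "\<dots> = scale_const * 2 powr (- \<alpha> * real j0) * (\<Sum>p\<in>?P. S p)"
      unfolding sum_distrib_left by (intro sum.cong refl) (simp only: mult_ac)
    also have "\<dots> \<le> scale_const * 2 powr (- \<alpha> * real j0) * r\<^sup>2" using R1 by (intro mult_left_mono Sr) auto
    finally show ?thesis .
  qed
  have sq: "4 * 2 powr (- \<alpha> * real j0) * (scale_const * 2 powr (- \<alpha> * real j0) * r\<^sup>2) = 4 * scale_const * 2 powr (- 2 * \<alpha> * real j0) * r\<^sup>2" for \<alpha>
  proof -
    have "2 powr (- 2 * \<alpha> * real j0) = 2 powr (- \<alpha> * real j0) * 2 powr (- \<alpha> * real j0)"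
      unfolding powr_add[symmetric] by (simp add: algebra_simps)
    then show ?thesis by (simp only: mult_ac)
  qed
  have "(cmod (tail u j0 J t))\<^sup>2 \<le> 4 * 2 powr (- (b - 1) * real j0) * (\<Sum>p\<in>?P. (cmod (z p t))\<^sup>2 * 2 powr ((b - 1) * real (fst p)))"
    using b by (intro CS) simp
  also have "\<dots> \<le> 4 * 2 powr (- (b - 1) * real j0) * (\<Sum>p\<in>?P. scale_const * 2 powr (- 2 * (b - 1) * real (fst p)) * S p * 2 powr ((b - 1) * real (fst p)))"
  proof (intro mult_left_mono sum_mono mult_right_mono)
    fix p show "(cmod (z p t))\<^sup>2 \<le> scale_const * 2 powr (- 2 * (b - 1) * real (fst p)) * S p"
      using zb[of p t] by (simp add: algebra_simps)
  qed auto
  also have "\<dots> \<le> 4 * 2 powr (- (b - 1) * real j0) * (scale_const * 2 powr (- (b - 1) * real j0) * r\<^sup>2)"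
    using b by (intro mult_left_mono agg) auto
  finally show "(cmod (tail u j0 J t))\<^sup>2 \<le> 4 * scale_const * 2 powr (- 2 * (b - 1) * real j0) * r\<^sup>2" unfolding sq .
  assume N: "0 < N"
  have zm[measurable]: "z p \<in> borel_measurable borel" for p
    unfolding z_def by (intro U_measurable Bochner_Integration.integrable_sum integrable_mult_right watm_integrable)
  have [measurable]: "cball 0 N \<in> sets (borel :: (real ^ 2) measure)" by simp
  have zint: "integrable lborel (\<lambda>t. indicator (cball 0 N) t * (cmod (z p t))\<^sup>2)" for p
  proof (rule Bochner_Integration.integrable_bound)
    show "integrable lborel (\<lambda>t. indicator (cball 0 N) t * (scale_const * 2 powr (2 * (1 - b) * real (fst p)) * S p) :: real)"
      by (intro integrable_mult_left integrable_real_indicator) (auto simp: emeasure_cball_less_top)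
    show "AE t in lborel. norm (indicator (cball 0 N) t * (cmod (z p t))\<^sup>2) \<le> norm (indicator (cball 0 N) t * (scale_const * 2 powr (2 * (1 - b) * real (fst p)) * S p))"
      using zb[of p] by (intro AE_I2) (auto simp: indicator_def intro: order_trans[OF _ abs_ge_self])
  qed measurable
  have tm: "tail u j0 J \<in> borel_measurable borel"
    unfolding tail_def[abs_def] by (intro borel_measurable_diff U_measurable trunc_integrable)
  have rint: "integrable lborel (\<lambda>t. 4 * 2 powr (- b * real j0) * (\<Sum>p\<in>?P. (indicator (cball 0 N) t * (cmod (z p t))\<^sup>2) * 2 powr (b * real (fst p))))"
    by (intro integrable_mult_right Bochner_Integration.integrable_sum integrable_mult_left zint)
  have "(LINT t|lborel. indicator (cball 0 N) t * (cmod (tail u j0 J t))\<^sup>2)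
     \<le> (LINT t|lborel. 4 * 2 powr (- b * real j0) * (\<Sum>p\<in>?P. (indicator (cball 0 N) t * (cmod (z p t))\<^sup>2) * 2 powr (b * real (fst p))))"
  proof (rule integral_mono'[OF rint])
    fix t
    show "indicator (cball 0 N) t * (cmod (tail u j0 J t))\<^sup>2 \<le> 4 * 2 powr (- b * real j0) * (\<Sum>p\<in>?P. (indicator (cball 0 N) t * (cmod (z p t))\<^sup>2) * 2 powr (b * real (fst p)))"
      using CS[of b t] b by (cases "t \<in> cball 0 N") auto
    show "0 \<le> 4 * 2 powr (- b * real j0) * (\<Sum>p\<in>?P. (indicator (cball 0 N) t * (cmod (z p t))\<^sup>2) * 2 powr (b * real (fst p)))"
      by (intro mult_nonneg_nonneg sum_nonneg) auto
  qed
  also have "\<dots> = 4 * 2 powr (- b * real j0) * (\<Sum>p\<in>?P. (LINT t|lborel. indicator (cball 0 N) t * (cmod (z p t))\<^sup>2) * 2 powr (b * real (fst p)))"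
  proof -
    have "(LINT t|lborel. (\<Sum>p\<in>?P. (indicator (cball 0 N) t * (cmod (z p t))\<^sup>2) * 2 powr (b * real (fst p))))
      = (\<Sum>p\<in>?P. LINT t|lborel. (indicator (cball 0 N) t * (cmod (z p t))\<^sup>2) * 2 powr (b * real (fst p)))"
      by (intro Bochner_Integration.integral_sum integrable_mult_left zint)
    then show ?thesis by simp
  qed
  also have "\<dots> \<le> 4 * 2 powr (- b * real j0) * (\<Sum>p\<in>?P. scale_const * 2 powr (- 2 * b * real (fst p)) * S p * 2 powr (b * real (fst p)))"
    by (intro mult_left_mono sum_mono mult_right_mono zi N) auto
  also have "\<dots> \<le> 4 * 2 powr (- b * real j0) * (scale_const * 2 powr (- b * real j0) * r\<^sup>2)"
    using b by (intro mult_left_mono agg) auto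
  finally show "(LINT t|lborel. indicator (cball 0 N) t * (cmod (tail u j0 J t))\<^sup>2) \<le> 4 * scale_const * 2 powr (- 2 * b * real j0) * r\<^sup>2"
    unfolding sq .
qed

text \<open>The bounds for finite tails do not depend on \<open>J\<close>, and the tails converge
  pointwise. The sup bound passes to the limit directly, and it also dominates the integrands on the
  disc.\<close>

theorem tail_bounds:
  assumes u: "u \<in> Ltwo_disc" and r: "ell2_norm \<Gamma> (proj_le_perp \<psi> \<phi> j0 (analysis_op \<psi> \<phi> u)) \<le> r" "0 \<le> r"
  defines "w \<equiv> \<lambda>t. U u t - U (trunc u j0) t"
  shows "(cmod (w t))\<^sup>2 \<le> 4 * scale_const * 2 powr (- 2 * (b - 1) * real j0) * r\<^sup>2"
    and "0 < N \<Longrightarrow> (LINT t|lborel. indicator (cball 0 N) t * (cmod (w t))\<^sup>2) \<le> 4 * scale_const * 2 powr (- 2 * b * real j0) * r\<^sup>2"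
    and "w \<in> borel_measurable borel"
proof -
  have uL: "u \<in> Ltwo" using u by (simp add: Ltwo_disc_def)
  note ui = disc_integrable[OF u]
  let ?q = "Ltwo_norm (\<lambda>x. indicator frame x :: complex)"
  show wm[measurable]: "w \<in> borel_measurable borel"
    unfolding w_def by (intro borel_measurable_diff U_measurable ui trunc_integrable)
  have conv: "(\<lambda>J. tail u j0 J t) \<longlonglongrightarrow> w t" for t
  proof -
    have le: "cmod (U u t - U (trunc u J) t) \<le> bessel_const b * (?q * Ltwo_norm (\<lambda>x. u x - trunc u J x))" for J
    proof -
      have dL: "(\<lambda>x. u x - trunc u J x) \<in> Ltwo" by (intro Ltwo_diff uL trunc_Ltwo)
      have ae: "AE x in lborel. x \<notin> frame \<longrightarrow> u x - trunc u J x = 0"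
        using trunc_frame[of u J] by eventually_elim (simp add: disc_frame[OF u])
      note di = Ltwo_frame_integrable[OF dL ae]
      have "U u t - U (trunc u J) t = U (\<lambda>x. u x - trunc u J x) t"
        unfolding bessel_conv_def right_diff_distrib
        by (rule Bochner_Integration.integral_diff[symmetric]) (intro U_integrable ui trunc_integrable)+
      also have "cmod \<dots> \<le> bessel_const b * (LINT y|lborel. cmod (u y - trunc u J y))" by (rule U_bound[OF di(1)])
      also have "\<dots> \<le> bessel_const b * (?q * Ltwo_norm (\<lambda>x. u x - trunc u J x))"
        using bessel_const_pos[OF b(1)] by (intro mult_left_mono di(2)) simp
      finally show ?thesis .
    qed
    have "(\<lambda>J. bessel_const b * (?q * Ltwo_norm (\<lambda>x. u x - trunc u J x))) \<longlonglongrightarrow> bessel_const b * (?q * 0)"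
      by (intro tendsto_intros trunc_tendsto u)
    then have lim0: "(\<lambda>J. bessel_const b * (?q * Ltwo_norm (\<lambda>x. u x - trunc u J x))) \<longlonglongrightarrow> 0" by simp
    have "(\<lambda>J. U u t - U (trunc u J) t) \<longlonglongrightarrow> 0"
      by (rule tendsto_norm_zero_cancel, rule real_tendsto_sandwich[OF _ _ tendsto_const lim0])
         (use le in \<open>auto intro!: always_eventually\<close>)
    then have "(\<lambda>J. (U u t - U (trunc u j0) t) - (U u t - U (trunc u J) t)) \<longlonglongrightarrow> (U u t - U (trunc u j0) t) - 0"
      by (intro tendsto_intros)
    then show ?thesis by (simp add: w_def tail_def[abs_def])
  qed
  note fb = tail_finite_bounds[OF uL r]
  show bd: "(cmod (w t))\<^sup>2 \<le> 4 * scale_const * 2 powr (- 2 * (b - 1) * real j0) * r\<^sup>2" for t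
  proof (rule LIMSEQ_le_const2)
    show "(\<lambda>J. (cmod (tail u j0 J t))\<^sup>2) \<longlonglongrightarrow> (cmod (w t))\<^sup>2" by (intro tendsto_intros conv)
    show "\<exists>M. \<forall>J\<ge>M. (cmod (tail u j0 J t))\<^sup>2 \<le> 4 * scale_const * 2 powr (- 2 * (b - 1) * real j0) * r\<^sup>2"
      using fb(1) by blast
  qed
  assume N: "0 < N"
  let ?K = "4 * scale_const * 2 powr (- 2 * (b - 1) * real j0) * r\<^sup>2"
  have [measurable]: "cball 0 N \<in> sets (borel :: (real ^ 2) measure)" by simp
  have tm[measurable]: "tail u j0 J \<in> borel_measurable borel" for J
    unfolding tail_def[abs_def] by (intro borel_measurable_diff U_measurable trunc_integrable)
  \<comment> \<open>The shift by \<open>j0\<close> is there because the uniform bounds hold from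
    \<open>j0\<close> on only.\<close>
  have "(\<lambda>J. LINT t|lborel. indicator (cball 0 N) t * (cmod (tail u j0 (j0 + J) t))\<^sup>2) \<longlonglongrightarrow> (LINT t|lborel. indicator (cball 0 N) t * (cmod (w t))\<^sup>2)"
  proof (rule integral_dominated_convergence)
    show "integrable lborel (\<lambda>t :: real ^ 2. indicator (cball 0 N) t * ?K)"
      by (intro integrable_mult_left integrable_real_indicator) (auto simp: emeasure_cball_less_top)
    show "AE t in lborel. (\<lambda>J. indicator (cball 0 N) t * (cmod (tail u j0 (j0 + J) t))\<^sup>2) \<longlonglongrightarrow> indicator (cball 0 N) t * (cmod (w t))\<^sup>2"
    proof (rule AE_I2)
      fix t
      have "(\<lambda>J. tail u j0 (J + j0) t) \<longlonglongrightarrow> w t" using conv[of t] by (rule LIMSEQ_ignore_initial_segment)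
      then show "(\<lambda>J. indicator (cball 0 N) t * (cmod (tail u j0 (j0 + J) t))\<^sup>2) \<longlonglongrightarrow> indicator (cball 0 N) t * (cmod (w t))\<^sup>2"
        by (intro tendsto_intros) (simp add: add.commute)
    qed
    show "AE t in lborel. norm (indicator (cball 0 N) t * (cmod (tail u j0 (j0 + J) t))\<^sup>2) \<le> indicator (cball 0 N) t * ?K" for J
      using fb(1)[of "j0 + J"] by (intro AE_I2) (auto simp: indicator_def)
  qed measurable
  then show "(LINT t|lborel. indicator (cball 0 N) t * (cmod (w t))\<^sup>2) \<le> 4 * scale_const * 2 powr (- 2 * b * real j0) * r\<^sup>2"
    by (rule LIMSEQ_le_const2) (use fb(2)[OF _ N] in auto)
qed

section \<open>The lower bound from the constants \<open>c\<close> and \<open>C\<close>\<close>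

text \<open>The choice in \<open>synthesis_op\<close> yields some representative. It and the finite
  sum have the same inner products with all of \<open>dict_space\<close>, in particular with their
  difference, which therefore vanishes almost everywhere.\<close>

lemma synthesis_AE:
  assumes x0: "\<forall>i. i \<notin> \<Lambda> J \<longrightarrow> x i = 0"
  shows "AE y in lborel. synthesis_op \<psi> \<phi> x y = (\<Sum>i\<in>\<Lambda> J. x i * watm i y)"
    and "synthesis_op \<psi> \<phi> x \<in> Ltwo"
proof -
  note x = x0[rule_format]
  define u0 where "u0 y = (\<Sum>i\<in>\<Lambda> J. x i * watm i y)" for y
  have wL: "\<And>i. i \<in> \<Gamma> \<Longrightarrow> watm i \<in> Ltwo" by (rule watom_Ltwo)
  let ?P = "\<lambda>u. u \<in> dict_space \<psi> \<phi> \<and> (\<forall>v\<in>dict_space \<psi> \<phi>. Ltwo_inner u v = ell2_inner \<Gamma> x (analysis_op \<psi> \<phi> v))"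
  have u0S: "u0 \<in> dict_space \<psi> \<phi>"
    unfolding u0_def[abs_def] dict_space_def
    by (intro fun_span_closed_span[OF wL] fun_spanI finite_dict_le dict_le_subset)
  have eq: "Ltwo_inner u0 v = ell2_inner \<Gamma> x (analysis_op \<psi> \<phi> v)" if "v \<in> dict_space \<psi> \<phi>" for v
  proof -
    have vL: "v \<in> Ltwo" using that unfolding dict_space_def by (rule closed_span_Ltwo)
    have "Ltwo_inner u0 v = (\<Sum>i\<in>\<Lambda> J. x i * Ltwo_inner (watm i) v)"
      unfolding u0_def[abs_def] by (intro Ltwo_inner_lincomb_left watom_Ltwo vL)
    also have "\<dots> = (\<Sum>i\<in>\<Lambda> J. x i * cnj (analysis_op \<psi> \<phi> v i))"
    proof (intro sum.cong refl)
      fix i assume "i \<in> \<Lambda> J"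
      then have "i \<in> \<Gamma>" using dict_le_subset(1) by blast
      then show "x i * Ltwo_inner (watm i) v = x i * cnj (analysis_op \<psi> \<phi> v i)"
        using Ltwo_inner_commute[of "watm i" v] by (simp add: analysis_dict)
    qed
    also have "\<dots> = (\<Sum>\<^sub>\<infinity>i\<in>\<Lambda> J. x i * cnj (analysis_op \<psi> \<phi> v i))" by (simp add: finite_dict_le)
    also have "\<dots> = ell2_inner \<Gamma> x (analysis_op \<psi> \<phi> v)"
      unfolding ell2_inner_def using dict_le_subset(1)[of J] x by (intro infsum_cong_neutral) auto
    finally show ?thesis .
  qed
  have "?P (synthesis_op \<psi> \<phi> x)" unfolding synthesis_op_def by (rule someI[of ?P u0]) (use u0S eq in blast)
  then have s: "synthesis_op \<psi> \<phi> x \<in> dict_space \<psi> \<phi>" "\<And>v. v \<in> dict_space \<psi> \<phi> \<Longrightarrow> Ltwo_inner (synthesis_op \<psi> \<phi> x) v = Ltwo_inner u0 v"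
    using eq by auto
  show sL: "synthesis_op \<psi> \<phi> x \<in> Ltwo" using s(1) unfolding dict_space_def by (rule closed_span_Ltwo)
  have u0L: "u0 \<in> Ltwo" using u0S unfolding dict_space_def by (rule closed_span_Ltwo)
  define d where "d y = synthesis_op \<psi> \<phi> x y - u0 y" for y
  have dS: "d \<in> dict_space \<psi> \<phi>"
    unfolding d_def[abs_def] using s(1) u0S unfolding dict_space_def by (intro closed_span_diff[OF wL])
  have dL: "d \<in> Ltwo" unfolding d_def[abs_def] by (intro Ltwo_diff sL u0L)
  have "Ltwo_inner d d = 0"
    using Ltwo_inner_diff_left[OF sL u0L dL] s(2)[OF dS] by (simp add: d_def[abs_def])
  from closed_span_inner_zero_imp[OF dL this]
  show "AE y in lborel. synthesis_op \<psi> \<phi> x y = (\<Sum>i\<in>\<Lambda> J. x i * watm i y)"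
    by eventually_elim (simp add: d_def u0_def)
qed

lemma U_synthesis:
  assumes x: "\<forall>i. i \<notin> \<Lambda> J \<longrightarrow> x i = 0"
  shows "U (synthesis_op \<psi> \<phi> x) t = (\<Sum>i\<in>\<Lambda> J. x i * U (watm i) t)"
proof -
  note [measurable] = LtwoD(2)[OF synthesis_AE(2)[OF x]] LtwoD(2)[OF watom_Ltwo]
  have "U (synthesis_op \<psi> \<phi> x) t = U (\<lambda>y. \<Sum>i\<in>\<Lambda> J. x i * watm i y) t"
    unfolding bessel_conv_def
  proof (rule integral_cong_AE)
    show "AE y in lborel. bessel_kernel b (t - y) * synthesis_op \<psi> \<phi> x y = bessel_kernel b (t - y) * (\<Sum>i\<in>\<Lambda> J. x i * watm i y)"
      using synthesis_AE(1)[OF x] by eventually_elim simp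
  qed measurable
  then show ?thesis by (simp add: U_lincomb[OF watm_integrable])
qed

text \<open>The energy on the plane is at least \<open>c\<close> times the weighted sum, and
  balancing allows at most \<open>c / 2 * 2 powr (- 2 * b * real j0)\<close> times the unweighted
  sum outside the disc. Up to scale \<open>j0\<close> every weight is at least that power, so at
  least half of the lower bound stays inside.\<close>

theorem forward_lower_bound:
  assumes c: "0 < c" "lower_bound_const \<psi> \<phi> b c" and C: "balancing_const \<psi> \<phi> b c C" and j0: "1 \<le> j0"
    and x0: "\<forall>i. i \<notin> \<Lambda> j0 \<longrightarrow> x i = 0"
  defines "N \<equiv> real_of_int \<lceil>C * real j0\<rceil>" and "w \<equiv> \<lambda>t. \<Sum>i\<in>\<Lambda> j0. x i * U (watm i) t"
  shows "c / 2 * (\<Sum>i\<in>\<Lambda> j0. 2 powr (- 2 * b * real (scale i)) * (cmod (x i))\<^sup>2)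
      \<le> (LINT t|lborel. indicator (cball 0 N) t * (cmod (w t))\<^sup>2)"
proof -
  note x = x0[rule_format]
  let ?X = "\<Sum>i\<in>\<Lambda> j0. 2 powr (- 2 * b * real (scale i)) * (cmod (x i))\<^sup>2"
  let ?Y = "\<Sum>i\<in>\<Lambda> j0. (cmod (x i))\<^sup>2"
  have wU: "U (synthesis_op \<psi> \<phi> x) = w" unfolding w_def by (rule ext, rule U_synthesis[OF x0])
  have wm[measurable]: "w \<in> borel_measurable borel"
    unfolding w_def by (intro borel_measurable_sum borel_measurable_times borel_measurable_const U_measurable watm_integrable)
  have inf: "(\<Sum>\<^sub>\<infinity>i\<in>\<Gamma>. g i * (cmod (x i))\<^sup>2) = (\<Sum>i\<in>\<Lambda> j0. g i * (cmod (x i))\<^sup>2)" for g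
  proof -
    have "(\<Sum>\<^sub>\<infinity>i\<in>\<Gamma>. g i * (cmod (x i))\<^sup>2) = (\<Sum>\<^sub>\<infinity>i\<in>\<Lambda> j0. g i * (cmod (x i))\<^sup>2)"
      using dict_le_subset(1)[of j0] x by (intro infsum_cong_neutral) auto
    then show ?thesis by (simp add: finite_dict_le)
  qed
  have "(\<lambda>i. (cmod (x i))\<^sup>2) summable_on \<Gamma>"
  proof -
    have "(\<lambda>i. (cmod (x i))\<^sup>2) summable_on \<Lambda> j0" by (simp add: finite_dict_le)
    moreover have "(\<lambda>i. (cmod (x i))\<^sup>2) summable_on \<Gamma> \<longleftrightarrow> (\<lambda>i. (cmod (x i))\<^sup>2) summable_on \<Lambda> j0"
      by (rule summable_on_cong_neutral) (use dict_le_subset(1)[of j0] x in auto)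
    ultimately show ?thesis by simp
  qed
  moreover have "x i = 0" if "i \<notin> \<Gamma>" for i
    using that dict_le_subset(1)[of j0] by (intro x) blast
  ultimately have xl: "x \<in> ell2 \<Gamma>" unfolding ell2_def by simp
  have lb: "c * ?X \<le> (Ltwo_norm w)\<^sup>2"
  proof -
    have "c * (\<Sum>\<^sub>\<infinity>i\<in>\<Gamma>. 2 powr (- 2 * b * real (scale i)) * (cmod (x i))\<^sup>2) \<le> (Ltwo_norm (U (synthesis_op \<psi> \<phi> x)))\<^sup>2"
      using c(2) xl unfolding lower_bound_const_def by (rule bspec)
    then show ?thesis unfolding wU inf .
  qed
  have X0: "0 \<le> ?X" by (intro sum_nonneg) auto
  show ?thesis
  proof (cases "integrable lborel (\<lambda>t. (cmod (w t))\<^sup>2)")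
    \<comment> \<open>\<open>Ltwo_norm\<close> is 0 by convention here, and the lower bound on it
      forces the left-hand side to be at most 0.\<close>
    case False
    then have "(Ltwo_norm w)\<^sup>2 = 0" unfolding Ltwo_norm_square by (simp add: not_integrable_integral_eq)
    then have "c * ?X \<le> 0" using lb by simp
    then have "c / 2 * ?X \<le> 0" by simp
    also have "0 \<le> (LINT t|lborel. indicator (cball 0 N) t * (cmod (w t))\<^sup>2)" by (intro integral_nonneg_AE) simp
    finally show ?thesis .
  next
    case True
    define E where "E = {t :: real ^ 2. N < norm t}"
    have [measurable]: "cball 0 N \<in> sets (borel :: (real ^ 2) measure)" by simp
    have [measurable]: "E \<in> sets borel" unfolding E_def by measurable
    have i1: "integrable lborel (\<lambda>t. indicator (cball 0 N) t * (cmod (w t))\<^sup>2)"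
      by (rule Bochner_Integration.integrable_bound[OF True]) (auto simp: indicator_def)
    have i2: "integrable lborel (\<lambda>t. indicator E t * (cmod (w t))\<^sup>2)"
      by (rule Bochner_Integration.integrable_bound[OF True]) (auto simp: indicator_def)
    have split: "(Ltwo_norm w)\<^sup>2 = (LINT t|lborel. indicator (cball 0 N) t * (cmod (w t))\<^sup>2) + (LINT t|lborel. indicator E t * (cmod (w t))\<^sup>2)"
    proof -
      have "(cmod (w t))\<^sup>2 = indicator (cball 0 N) t * (cmod (w t))\<^sup>2 + indicator E t * (cmod (w t))\<^sup>2" for t
        by (auto simp: indicator_def E_def)
      then have "(LINT t|lborel. (cmod (w t))\<^sup>2) = (LINT t|lborel. indicator (cball 0 N) t * (cmod (w t))\<^sup>2 + indicator E t * (cmod (w t))\<^sup>2)"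
        by (intro Bochner_Integration.integral_cong refl)
      then show ?thesis unfolding Ltwo_norm_square by (simp only: Bochner_Integration.integral_add[OF i1 i2])
    qed
    have out: "(LINT t|lborel. indicator E t * (cmod (w t))\<^sup>2) \<le> c / 2 * 2 powr (- 2 * b * real j0) * ?Y"
    proof (cases "?Y = 0")
      case True
      then have "x i = 0" if "i \<in> \<Lambda> j0" for i using that finite_dict_le by (simp add: sum_nonneg_eq_0_iff)
      then have "w t = 0" for t by (simp add: w_def)
      then show ?thesis using True by simp
    next
      case False
      then have Y: "0 < ?Y" by (metis sum_nonneg zero_le_power2 less_eq_real_def)
      \<comment> \<open>Normalisation: the operator norm is a supremum over the unit ball, so
        \<open>x\<close> is scaled to norm 1.\<close>
      define a where "a = 1 / sqrt ?Y"
      have a: "0 < a" "a\<^sup>2 * ?Y = 1" using Y by (auto simp: a_def power_divide)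
      define x' where "x' i = of_real a * x i" for i
      have x'0: "\<forall>i. i \<notin> \<Lambda> j0 \<longrightarrow> x' i = 0" using x by (simp add: x'_def)
      have n1: "(\<Sum>i\<in>\<Lambda> j0. (cmod (x' i))\<^sup>2) = 1"
        using a by (simp add: x'_def norm_mult power_mult_distrib flip: sum_distrib_left)
      have x'l: "x' \<in> {x \<in> ell2 (\<Lambda> j0). ell2_norm (\<Lambda> j0) x \<le> 1}"
        using x'0 n1 by (auto simp: ell2_def ell2_norm_def finite_dict_le)
      have U': "U (synthesis_op \<psi> \<phi> x') t = of_real a * w t" for t
        unfolding U_synthesis[OF x'0] w_def by (simp add: x'_def sum_distrib_left mult_ac)
      let ?T = "\<lambda>x t. indicator E t * U (synthesis_op \<psi> \<phi> x) t"
      have "ennreal (Ltwo_norm (?T x')) \<le> opnorm_ell2_Ltwo (\<Lambda> j0) ?T"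
        unfolding opnorm_ell2_Ltwo_def by (rule SUP_upper[OF x'l])
      then have "(ennreal (Ltwo_norm (?T x')))\<^sup>2 \<le> (opnorm_ell2_Ltwo (\<Lambda> j0) ?T)\<^sup>2" by (intro power_mono) auto
      also have "\<dots> \<le> ennreal (c / 2 * 2 powr (- 2 * b * real j0))"
        using C j0 unfolding balancing_const_def E_def N_def by blast
      finally have "ennreal ((Ltwo_norm (?T x'))\<^sup>2) \<le> ennreal (c / 2 * 2 powr (- 2 * b * real j0))"
        by (simp add: ennreal_power Ltwo_norm_nonneg)
      then have "(Ltwo_norm (?T x'))\<^sup>2 \<le> c / 2 * 2 powr (- 2 * b * real j0)"
        using c(1) by (subst (asm) ennreal_le_iff) auto
      also have "(Ltwo_norm (?T x'))\<^sup>2 = a\<^sup>2 * (LINT t|lborel. indicator E t * (cmod (w t))\<^sup>2)"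
      proof -
        have "(cmod (indicator E t * (of_real a * w t)))\<^sup>2 = a\<^sup>2 * (indicator E t * (cmod (w t))\<^sup>2)" for t
          by (auto simp: indicator_def norm_mult power_mult_distrib)
        then show ?thesis unfolding Ltwo_norm_square U' by simp
      qed
      finally have "a\<^sup>2 * (LINT t|lborel. indicator E t * (cmod (w t))\<^sup>2) * ?Y \<le> c / 2 * 2 powr (- 2 * b * real j0) * ?Y"
        using Y by (intro mult_right_mono) auto
      moreover have "a\<^sup>2 * (LINT t|lborel. indicator E t * (cmod (w t))\<^sup>2) * ?Y = (a\<^sup>2 * ?Y) * (LINT t|lborel. indicator E t * (cmod (w t))\<^sup>2)"
        by (simp only: mult_ac)
      ultimately show ?thesis unfolding a(2) by simp
    qed
    have "2 powr (- 2 * b * real j0) * ?Y \<le> ?X"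
      unfolding sum_distrib_left
    proof (intro sum_mono mult_right_mono powr_mono)
      fix i assume "i \<in> \<Lambda> j0"
      then have "real (scale i) \<le> real j0" by (simp add: dict_index_le_def)
      then show "- 2 * b * real j0 \<le> - 2 * b * real (scale i)" using b by simp
    qed auto
    then have "c / 2 * (2 powr (- 2 * b * real j0) * ?Y) \<le> c / 2 * ?X" using c by (intro mult_left_mono) auto
    moreover have "c / 2 * 2 powr (- 2 * b * real j0) * ?Y = c / 2 * (2 powr (- 2 * b * real j0) * ?Y)" by (rule mult.assoc)
    moreover have "c * ?X = c / 2 * ?X + c / 2 * ?X" by simp
    ultimately show ?thesis using lb split out by linarith
  qed
qed

end

section \<open>Sampling and recovery\<close>

lemma integral_uniform_measure:
  fixes g :: "'a::euclidean_space \<Rightarrow> real"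
  assumes A: "A \<in> sets borel" "emeasure lborel A < \<infinity>" "0 < measure lborel A" and [measurable]: "g \<in> borel_measurable borel"
  shows "(LINT x|uniform_measure lborel A. g x) = (LINT x|lborel. indicator A x * g x) / measure lborel A"
proof -
  note [measurable] = A(1)
  have "indicator A x / emeasure lborel A = ennreal (indicator A x / measure lborel A)" for x
  proof -
    have "emeasure lborel A = ennreal (measure lborel A)" using A(2) by (intro emeasure_eq_ennreal_measure) auto
    then show ?thesis using A(3) by (auto simp: indicator_def divide_ennreal simp flip: ennreal_1)
  qed
  then have "uniform_measure lborel A = density lborel (\<lambda>x. ennreal (indicator A x / measure lborel A))"
    unfolding uniform_measure_def by simp
  then have "(LINT x|uniform_measure lborel A. g x) = (LINT x|lborel. (indicator A x / measure lborel A) *\<^sub>R g x)"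
    using A(3) by (simp add: integral_density)
  then show ?thesis by simp
qed

section \<open>The cone of errors of an l1 minimiser\<close>

lemma l1_cone:
  fixes x y z :: "'i \<Rightarrow> complex"
  assumes A: "finite A" and opt: "(\<Sum>i\<in>A. cmod (z i)) \<le> (\<Sum>i\<in>A. cmod (x i))"
    and y: "{i. y i \<noteq> 0} \<subseteq> A" "card {i. y i \<noteq> 0} \<le> s"
  shows "(\<Sum>i\<in>A. cmod (z i - x i)) \<le> 2 * sqrt (real s) * sqrt (\<Sum>i\<in>A. (cmod (z i - x i))\<^sup>2) + 2 * (\<Sum>i\<in>A. cmod (x i - y i))"
proof -
  define S where "S = {i. y i \<noteq> 0}"
  have S: "S \<subseteq> A" "finite S" "card S \<le> s" using y A by (auto simp: S_def intro: finite_subset)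
  have split: "(\<Sum>i\<in>A. f i) = (\<Sum>i\<in>A - S. f i) + (\<Sum>i\<in>S. f i)" for f :: "'i \<Rightarrow> real"
    by (rule sum.subset_diff[OF S(1) A])
  have 1: "(\<Sum>i\<in>S. cmod (x i)) \<le> (\<Sum>i\<in>S. cmod (z i)) + (\<Sum>i\<in>S. cmod (z i - x i))"
  proof -
    have "cmod (x i) \<le> cmod (z i) + cmod (z i - x i)" for i using norm_triangle_ineq4[of "z i" "z i - x i"] by simp
    then show ?thesis unfolding sum.distrib[symmetric] by (intro sum_mono)
  qed
  have 2: "(\<Sum>i\<in>A - S. cmod (z i - x i)) \<le> (\<Sum>i\<in>A - S. cmod (z i)) + (\<Sum>i\<in>A - S. cmod (x i))"
    unfolding sum.distrib[symmetric] by (intro sum_mono norm_triangle_ineq4)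
  have 3: "(\<Sum>i\<in>A - S. cmod (x i)) \<le> (\<Sum>i\<in>A. cmod (x i - y i))"
  proof -
    have "(\<Sum>i\<in>A - S. cmod (x i)) = (\<Sum>i\<in>A - S. cmod (x i - y i))" by (intro sum.cong) (auto simp: S_def)
    also have "\<dots> \<le> (\<Sum>i\<in>A. cmod (x i - y i))" using A by (intro sum_mono2) auto
    finally show ?thesis .
  qed
  have 4: "(\<Sum>i\<in>S. cmod (z i - x i)) \<le> sqrt (real s) * sqrt (\<Sum>i\<in>A. (cmod (z i - x i))\<^sup>2)"
  proof -
    have "(\<Sum>i\<in>S. 1 * cmod (z i - x i))\<^sup>2 \<le> (\<Sum>i\<in>S. 1\<^sup>2) * (\<Sum>i\<in>S. (cmod (z i - x i))\<^sup>2)"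
      by (rule Cauchy_Schwarz_ineq_sum)
    also have "\<dots> \<le> real s * (\<Sum>i\<in>A. (cmod (z i - x i))\<^sup>2)"
      using S A by (intro mult_mono sum_mono2 sum_nonneg) auto
    finally have "(\<Sum>i\<in>S. cmod (z i - x i)) \<le> sqrt (real s * (\<Sum>i\<in>A. (cmod (z i - x i))\<^sup>2))"
      by (intro real_le_rsqrt) simp
    then show ?thesis by (simp add: real_sqrt_mult)
  qed
  have o: "(\<Sum>i\<in>A - S. cmod (z i)) + (\<Sum>i\<in>S. cmod (z i)) \<le> (\<Sum>i\<in>A - S. cmod (x i)) + (\<Sum>i\<in>S. cmod (x i))"
    using opt unfolding split .
  have "(\<Sum>i\<in>A - S. cmod (z i - x i)) + (\<Sum>i\<in>S. cmod (z i - x i)) \<le> 2 * (\<Sum>i\<in>S. cmod (z i - x i)) + 2 * (\<Sum>i\<in>A - S. cmod (x i))"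
    using 1 2 o by linarith
  also have "\<dots> \<le> 2 * (sqrt (real s) * sqrt (\<Sum>i\<in>A. (cmod (z i - x i))\<^sup>2)) + 2 * (\<Sum>i\<in>A. cmod (x i - y i))"
    using 3 4 by (intro add_mono mult_left_mono) auto
  finally show ?thesis unfolding split[of "\<lambda>i. cmod (z i - x i)", symmetric] by (simp only: mult.assoc)
qed

lemma ell1_norm_finite: "finite A \<Longrightarrow> ell1_norm A x = (\<Sum>i\<in>A. cmod (x i))"
  by (simp add: ell1_norm_def)

text \<open>The infimum is taken in the inequality of \<open>l1_cone\<close>, so that no best
  approximation has to exist.\<close>

lemma l1_cone_best_approx:
  fixes x z :: "'i \<Rightarrow> complex"
  assumes A: "finite A" and opt: "(\<Sum>i\<in>A. cmod (z i)) \<le> (\<Sum>i\<in>A. cmod (x i))"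
  shows "(\<Sum>i\<in>A. cmod (z i - x i)) \<le> 2 * sqrt (real s) * sqrt (\<Sum>i\<in>A. (cmod (z i - x i))\<^sup>2) + 2 * best_approx1 A s x"
    and "0 \<le> best_approx1 A s x"
proof -
  let ?D = "{ell1_norm A (\<lambda>i. x i - y i) | y. {i. y i \<noteq> 0} \<subseteq> A \<and> finite {i. y i \<noteq> 0} \<and> card {i. y i \<noteq> 0} \<le> s}"
  let ?l = "((\<Sum>i\<in>A. cmod (z i - x i)) - 2 * sqrt (real s) * sqrt (\<Sum>i\<in>A. (cmod (z i - x i))\<^sup>2)) / 2"
  have ne: "?D \<noteq> {}"
  proof -
    have "ell1_norm A (\<lambda>i. x i - (\<lambda>_. 0) i) \<in> ?D" by (rule CollectI, rule exI[of _ "\<lambda>_. 0"]) simp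
    then show ?thesis by blast
  qed
  have "?l \<le> Inf ?D"
  proof (rule cInf_greatest[OF ne])
    fix d assume "d \<in> ?D"
    then obtain y where y: "{i. y i \<noteq> 0} \<subseteq> A" "card {i. y i \<noteq> 0} \<le> s" "d = ell1_norm A (\<lambda>i. x i - y i)" by blast
    show "?l \<le> d" unfolding y(3) ell1_norm_finite[OF A] using l1_cone[OF A opt y(1,2)] by simp
  qed
  then show "(\<Sum>i\<in>A. cmod (z i - x i)) \<le> 2 * sqrt (real s) * sqrt (\<Sum>i\<in>A. (cmod (z i - x i))\<^sup>2) + 2 * best_approx1 A s x"
    unfolding best_approx1_def by simp
  show "0 \<le> best_approx1 A s x"
    unfolding best_approx1_def
    by (rule cInf_greatest[OF ne]) (auto simp: ell1_norm_finite[OF A] intro: sum_nonneg)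
qed

section \<open>Choice of the sample size\<close>

lemma ln_ge_one: "8 \<le> \<tau> \<Longrightarrow> 1 \<le> ln (\<tau> :: real)"
proof -
  assume \<tau>: "8 \<le> \<tau>"
  then have "exp 1 \<le> \<tau>" using exp_le by linarith
  then show "1 \<le> ln \<tau>" using \<tau> by (simp add: ln_ge_iff)
qed

lemma ln_8_le: "ln 8 \<le> (3 :: real)"
proof -
  have "2 \<le> exp (1 :: real)" using exp_ge_add_one_self[of 1] by simp
  then have "2 ^ 3 \<le> exp (1 :: real) ^ 3" by (intro power_mono) auto
  then have "8 \<le> exp (3 :: real)" by (simp flip: exp_of_nat_mult)
  then show ?thesis by (subst ln_le_cancel_iff[symmetric, of 8 "exp 3", simplified, symmetric]) auto
qed

text \<open>Here \<open>q\<close> stands for the ratio of squared sup bound and tolerance,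
  \<open>n\<close> for the number of dictionary elements and \<open>y\<close> for
  \<open>ln (1 / \<gamma>)\<close>. The logarithm of \<open>16 * G * \<tau>\<close> is at most
  \<open>A * ln \<tau>\<close> and that of \<open>n\<close> at most \<open>H * j0\<close>. The
  constant 4100 is 2 * 2050, from L at most twice \<open>\<Lambda>'\<close>; 12 is 4 * 3, from 2 + y
  at most three times the maximum.\<close>

lemma sampling_parameters:
  fixes G Q \<tau> q n m y :: real and j0 :: nat
  assumes G: "1 \<le> G" and Q: "1 \<le> Q" and \<tau>: "8 \<le> \<tau>" and j0: "1 \<le> j0" and n: "1 \<le> n" "n \<le> 5 * Q * 8 ^ j0"
    and q: "0 < q" "q \<le> G * \<tau>" and y: "0 \<le> y"
  defines "A \<equiv> 1 + ln (16 * G)" and "H \<equiv> ln (5 * Q) + 3"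
  defines "\<Lambda>' \<equiv> A * ln \<tau>"
  defines "L \<equiv> nat \<lceil>\<Lambda>'\<rceil>"
  assumes m: "G * (4100 * A\<^sup>2 * H + 12) * \<tau> * max (real j0 * (ln \<tau>) ^ 3) y \<le> m"
  shows "0 < L" "q \<le> 4 ^ L" "ln (16 * q) \<le> \<Lambda>'" "1 \<le> \<Lambda>'" "2050 * real L * \<Lambda>' * ln n \<le> m / q" "4 * (2 + y) \<le> m / q"
proof -
  have l1: "1 \<le> ln \<tau>" by (rule ln_ge_one[OF \<tau>])
  have A1: "1 \<le> A" using G by (simp add: A_def)
  have H0: "0 \<le> H" using Q by (simp add: H_def)
  have "1 * 1 \<le> A * ln \<tau>" using A1 l1 by (intro mult_mono) auto
  then show \<Lambda>1: "1 \<le> \<Lambda>'" by (simp add: \<Lambda>'_def)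
  then show "0 < L" unfolding L_def by linarith
  have lnG: "ln (16 * (G * \<tau>)) \<le> \<Lambda>'"
  proof -
    have "ln (16 * (G * \<tau>)) = ln (16 * G) + ln \<tau>" unfolding mult.assoc[symmetric] using G \<tau> by (intro ln_mult_pos) auto
    also have "\<dots> \<le> ln (16 * G) * ln \<tau> + ln \<tau>" using G l1 by (intro add_right_mono) simp
    also have "\<dots> = \<Lambda>'" by (simp add: \<Lambda>'_def A_def distrib_right)
    finally show ?thesis .
  qed
  have "ln (16 * q) \<le> ln (16 * (G * \<tau>))" using q by (intro ln_mono) auto
  then show "ln (16 * q) \<le> \<Lambda>'" using lnG by linarith
  have L1: "\<Lambda>' \<le> real L" "real L \<le> 2 * \<Lambda>'" using \<Lambda>1 unfolding L_def by linarith+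
  have "q \<le> 16 * (G * \<tau>)" using q G \<tau> by linarith
  also have "\<dots> = exp (ln (16 * (G * \<tau>)))" using G \<tau> by simp
  also have "\<dots> \<le> exp (real L)" using lnG L1 by simp
  also have "\<dots> = exp 1 ^ L" by (simp flip: exp_of_nat_mult)
  also have "\<dots> \<le> 4 ^ L" using exp_le by (intro power_mono) auto
  finally show "q \<le> 4 ^ L" .
  define M where "M = max (real j0 * (ln \<tau>) ^ 3) y"
  have "1 * 1 \<le> real j0 * (ln \<tau>) ^ 3" using j0 l1 by (intro mult_mono) auto
  then have M: "1 \<le> M" "y \<le> M" "real j0 * (ln \<tau>) ^ 3 \<le> M" by (auto simp: M_def)
  have X: "(4100 * A\<^sup>2 * H + 12) * M \<le> m / q"
  proof -
    have "(4100 * A\<^sup>2 * H + 12) * M * q \<le> (4100 * A\<^sup>2 * H + 12) * M * (G * \<tau>)"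
      using q M H0 by (intro mult_left_mono) auto
    also have "\<dots> = G * (4100 * A\<^sup>2 * H + 12) * \<tau> * M" by (simp only: mult_ac)
    also have "\<dots> \<le> m" using m unfolding M_def .
    finally show ?thesis using q by (simp add: pos_le_divide_eq)
  qed
  have "4 * (2 + y) \<le> 12 * M" using M by simp
  also have "\<dots> \<le> (4100 * A\<^sup>2 * H + 12) * M" using H0 M by (intro mult_right_mono) auto
  finally show "4 * (2 + y) \<le> m / q" using X by linarith
  have lnn: "ln n \<le> H * real j0"
  proof -
    have "ln n \<le> ln (5 * Q * 8 ^ j0)" using n by (intro ln_mono) auto
    also have "\<dots> = ln (5 * Q) + real j0 * ln 8" using Q by (subst ln_mult_pos) (auto simp: ln_realpow)
    also have "\<dots> \<le> ln (5 * Q) * real j0 + real j0 * 3"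
      using j0 Q ln_8_le by (intro add_mono mult_left_mono) (auto simp: mult_le_cancel_left1)
    also have "\<dots> = H * real j0" by (simp add: H_def algebra_simps)
    finally show ?thesis .
  qed
  have "2050 * real L * \<Lambda>' * ln n \<le> 2050 * (2 * \<Lambda>') * \<Lambda>' * (H * real j0)"
    using L1 \<Lambda>1 lnn n by (intro mult_mono) auto
  also have "\<dots> = 4100 * A\<^sup>2 * H * (real j0 * (ln \<tau>)\<^sup>2)" by (simp add: \<Lambda>'_def power2_eq_square)
  also have "\<dots> \<le> 4100 * A\<^sup>2 * H * (real j0 * (ln \<tau>) ^ 3)"
    using l1 H0 by (intro mult_left_mono power_increasing) auto
  also have "\<dots> \<le> 4100 * A\<^sup>2 * H * M" using M H0 by (intro mult_left_mono) auto
  also have "\<dots> \<le> (4100 * A\<^sup>2 * H + 12) * M" using M by (simp add: distrib_right)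
  finally show "2050 * real L * \<Lambda>' * ln n \<le> m / q" using X by linarith
qed

text \<open>The nonnegative coefficients of \<open>z\<close> along the four powers of the imaginary
  unit. They turn the complex l1 ball into a convex hull, at the cost of the factor sqrt 2.\<close>

definition quarter_part :: "nat \<Rightarrow> complex \<Rightarrow> real" where
  "quarter_part k z = max 0 (Re (cnj (\<i> ^ k) * z))"

lemma quarter_part_sum:
  "(\<Sum>k<4. of_real (quarter_part k z) * \<i> ^ k) = z"
  "(\<Sum>k<4. quarter_part k z) \<le> sqrt 2 * cmod z"
proof -
  have four: "{..<4::nat} = {0, 1, 2, 3}" by auto
  have i3: "\<i> ^ 3 = - \<i>" by (simp add: power3_eq_cube)
  show "(\<Sum>k<4. of_real (quarter_part k z) * \<i> ^ k) = z"
    unfolding four by (auto simp: quarter_part_def i3 max_def complex_eq_iff)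
  have "(\<Sum>k<4. quarter_part k z) = \<bar>Re z\<bar> + \<bar>Im z\<bar>"
    unfolding four by (auto simp: quarter_part_def i3 max_def)
  also have "\<dots> \<le> sqrt 2 * cmod z"
  proof -
    have "(\<bar>Re z\<bar> + \<bar>Im z\<bar>)\<^sup>2 \<le> 2 * (\<bar>Re z\<bar>\<^sup>2 + \<bar>Im z\<bar>\<^sup>2)"
      using zero_le_power2[of "\<bar>Re z\<bar> - \<bar>Im z\<bar>"] unfolding power2_eq_square by (simp add: algebra_simps)
    also have "\<dots> = (sqrt 2 * cmod z)\<^sup>2" by (simp add: power_mult_distrib cmod_power2)
    finally show ?thesis by (rule power2_le_imp_le) simp
  qed
  finally show "(\<Sum>k<4. quarter_part k z) \<le> sqrt 2 * cmod z" .
qed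

definition sample_count :: "real \<Rightarrow> nat \<Rightarrow> real \<Rightarrow> real \<Rightarrow> real" where
  "sample_count C0 j0 \<tau> \<gamma> = C0 * \<tau> * max (real j0 * (ln \<tau>) ^ 3) (ln (1 / \<gamma>))"

context wavelet_recovery
begin

section \<open>The empirical lower bound for the forward map\<close>

abbreviation "disc_vol \<equiv> unit_ball_vol 2"

lemma disc_measure:
  assumes "0 < N"
  shows "measure lborel (cball (0 :: real ^ 2) N) = disc_vol * N\<^sup>2"
    and "prob_space (uniform_measure lborel (cball (0 :: real ^ 2) N))"
proof -
  show m: "measure lborel (cball (0 :: real ^ 2) N) = disc_vol * N\<^sup>2"
    using content_cball[of N "0 :: real ^ 2"] assms by simp
  have "0 < disc_vol * N\<^sup>2" using assms by simp
  then have "emeasure lborel (cball (0 :: real ^ 2) N) \<noteq> 0" using m by (metis measure_def enn2real_0 less_irrefl)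
  moreover have "emeasure lborel (cball (0 :: real ^ 2) N) \<noteq> \<infinity>" using emeasure_cball_less_top[of "0 :: real ^ 2" N] by simp
  ultimately show "prob_space (uniform_measure lborel (cball (0 :: real ^ 2) N))" by (rule prob_space_uniform_measure)
qed

lemma disc_expectation:
  fixes g :: "real ^ 2 \<Rightarrow> real"
  assumes "0 < N" "g \<in> borel_measurable borel"
  shows "(LINT t|uniform_measure lborel (cball 0 N). g t) = (LINT t|lborel. indicator (cball 0 N) t * g t) / (disc_vol * N\<^sup>2)"
  using integral_uniform_measure[of "cball 0 N" g] assms emeasure_cball_less_top[of "0 :: real ^ 2" N]
  by (simp add: disc_measure(1))

definition weight :: "windex \<Rightarrow> real" where "weight i = 2 powr (b * real (scale i))"

lemma weight_pos: "0 < weight i" by (simp add: weight_def)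

text \<open>The weight cancels exactly the decay 2^(-b j) of the bound on \<open>U\<close>; what
  remains is the growth 2^j of the sup norm.\<close>

lemma weighted_atom_bound: "i \<in> \<Lambda> j0 \<Longrightarrow> weight i * cmod (U (watm i) t) \<le> sqrt scale_const * 2 ^ j0"
proof -
  assume i: "i \<in> \<Lambda> j0"
  have sc: "scale i \<le> j0" using i by (simp add: dict_index_le_def)
  have "weight i * cmod (U (watm i) t) \<le> weight i * (sqrt scale_const * 2 powr ((1 - b) * real (scale i)))"
    using i dict_le_subset(3)[of j0] weight_pos[of i] by (intro mult_left_mono U_watm_bound) auto
  also have "\<dots> = sqrt scale_const * (2 powr (b * real (scale i)) * 2 powr ((1 - b) * real (scale i)))"
    by (simp add: weight_def)
  also have "2 powr (b * real (scale i)) * 2 powr ((1 - b) * real (scale i)) = 2 ^ scale i"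
    unfolding powr_add[symmetric] by (simp add: algebra_simps powr_realpow)
  also have "sqrt scale_const * 2 ^ scale i \<le> sqrt scale_const * 2 ^ j0"
    using scale_const sc by (intro mult_left_mono power_increasing) auto
  finally show "weight i * cmod (U (watm i) t) \<le> sqrt scale_const * 2 ^ j0" .
qed

definition forward :: "nat \<Rightarrow> (windex \<Rightarrow> complex) \<Rightarrow> real ^ 2 \<Rightarrow> complex" where
  "forward j0 z t = (\<Sum>i\<in>\<Lambda> j0. of_real (weight i) * z i * U (watm i) t)"

lemma forward_measurable: "forward j0 z \<in> borel_measurable borel"
  unfolding forward_def[abs_def]
  by (intro borel_measurable_sum borel_measurable_times borel_measurable_const U_measurable watm_integrable)

text \<open>By homogeneity \<open>z\<close> is scaled to l1 norm sqrt s, where it lies in the convex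
  hull to which \<open>sampling_lower_bound\<close> applies. The first constant is 3/128 times
  \<open>c / 2\<close> over the area of the disc. The constant \<open>\<delta>0\<close> is left open
  so that it can be made small against it.\<close>

theorem sparse_lower_bound_event:
  assumes c: "0 < c" "lower_bound_const \<psi> \<phi> b c" and C: "0 < C" "balancing_const \<psi> \<phi> b c C"
    and \<delta>0: "0 < \<delta>0"
  shows "\<exists>C0>0. \<forall>(j0::nat) (m::nat) (s::nat) \<gamma> \<tau>. 1 \<le> j0 \<and> 2 \<le> s \<and> \<tau> = (real j0)\<^sup>2 * 2 ^ (2 * j0) * real s \<and>
      0 < \<gamma> \<and> \<gamma> < 1 \<and> sample_count C0 j0 \<tau> \<gamma> \<le> real m \<longrightarrow>
      (\<exists>E\<in>sets (iid_uniform_disc m (real_of_int \<lceil>C * real j0\<rceil>)). 1 - \<gamma> / 2 \<le> measure (iid_uniform_disc m (real_of_int \<lceil>C * real j0\<rceil>)) E \<and>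
        (\<forall>t\<in>E. \<forall>z. 3 * c / (256 * disc_vol * (real_of_int \<lceil>C * real j0\<rceil>)\<^sup>2) * (\<Sum>i\<in>\<Lambda> j0. (cmod (z i))\<^sup>2)
           - \<delta>0 / ((real_of_int \<lceil>C * real j0\<rceil>)\<^sup>2 * real s) * (\<Sum>i\<in>\<Lambda> j0. cmod (z i))\<^sup>2
           \<le> (\<Sum>k=1..m. (cmod (forward j0 z (t k)))\<^sup>2) / real m))"
proof -
  note R = scale_const
  \<comment> \<open>The ratio \<open>B\<^sup>2 / \<delta>\<close> is at most
    \<open>G * \<tau>\<close>: the factor \<open>(C + 1)\<^sup>2\<close> comes from N at most (C +
    1) j0, and the square of j0 goes into \<open>\<tau>\<close>.\<close>
  define G where "G = max 1 (2 * scale_const * (C + 1)\<^sup>2 / \<delta>0)"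
  define Aa where "Aa = 1 + ln (16 * G)"
  define H where "H = ln (5 * count_const) + 3"
  define C0 where "C0 = G * (4100 * Aa\<^sup>2 * H + 12)"
  have G1: "1 \<le> G" by (simp add: G_def)
  have H0: "0 \<le> H" using count_const_ge by (simp add: H_def)
  have "0 < C0" unfolding C0_def using G1 H0 by (intro mult_pos_pos add_nonneg_pos mult_nonneg_nonneg) auto
  moreover
  { fix j0 m s :: nat and \<gamma> \<tau> :: real
    assume j0: "1 \<le> j0" and s: "2 \<le> s" and \<tau>: "\<tau> = (real j0)\<^sup>2 * 2 ^ (2 * j0) * real s"
      and \<gamma>: "0 < \<gamma>" "\<gamma> < 1" and m: "sample_count C0 j0 \<tau> \<gamma> \<le> real m"
    define N where "N = real_of_int \<lceil>C * real j0\<rceil>"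
    have Cj: "0 < C * real j0" using C(1) j0 by simp
    have N: "1 \<le> N" "N \<le> (C + 1) * real j0"
    proof -
      have "1 \<le> \<lceil>C * real j0\<rceil>" using Cj by linarith
      then show "1 \<le> N" by (simp add: N_def)
      have "N \<le> C * real j0 + 1 * 1" unfolding N_def by linarith
      also have "\<dots> \<le> C * real j0 + 1 * real j0" using j0 by simp
      finally show "N \<le> (C + 1) * real j0" by (simp add: distrib_right)
    qed
    have N0: "0 < N" using N by simp
    have \<tau>8: "8 \<le> \<tau>"
    proof -
      have "1 * 2 ^ 2 * 2 \<le> (real j0)\<^sup>2 * 2 ^ (2 * j0) * real s"
        using j0 s by (intro mult_mono power_increasing one_le_power) auto
      then show ?thesis by (simp add: \<tau>)
    qed
    define P where "P = uniform_measure lborel (cball (0 :: real ^ 2) N)"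
    interpret P: prob_space P unfolding P_def by (rule disc_measure(2)[OF N0])
    have spP: "space P = UNIV" by (simp add: P_def)
    have stP: "sets P = sets borel" by (simp add: P_def)
    have mP: "borel_measurable P = borel_measurable borel" by (rule measurable_cong_sets) (simp_all add: stP)
    \<comment> \<open>\<open>None\<close> stands for the zero function. It takes up the mass that
      the weights leave over, since those of the other elements only sum to at most 1.\<close>
    define I where "I = insert None (Some ` (\<Lambda> j0 \<times> {..<4::nat}))"
    \<comment> \<open>The factor sqrt s sets the radius of the l1 ball, and sqrt 2 compensates the
      quarter parts.\<close>
    define d where "d o' t = (case o' of None \<Rightarrow> 0 | Some (i, k) \<Rightarrow> of_real (sqrt (2 * real s) * weight i) * \<i> ^ k * U (watm i) t)" for o' t
    have finI: "finite I" "I \<noteq> {}" by (auto simp: I_def finite_dict_le)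
    have cardI: "real (card I) \<le> 5 * count_const * 8 ^ j0" "1 \<le> real (card I)"
    proof -
      have "card (Some ` (\<Lambda> j0 \<times> {..<4::nat})) = 4 * card (\<Lambda> j0)"
        by (subst card_image) (auto simp: card_cartesian_product)
      then have "card I = 4 * card (\<Lambda> j0) + 1" unfolding I_def by (subst card_insert_disjoint) (auto simp: finite_dict_le)
      then have "real (card I) = 4 * real (card (\<Lambda> j0)) + 1" by simp
      moreover have "1 * 1 \<le> count_const * 8 ^ j0" using count_const_ge by (intro mult_mono) auto
      ultimately show "real (card I) \<le> 5 * count_const * 8 ^ j0" "1 \<le> real (card I)" using card_dict_le[of j0] by simp_all
    qed
    define B where "B = sqrt (2 * real s * scale_const) * 2 ^ j0"
    have B0: "0 < B" using s R by (simp add: B_def)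
    have B2: "B\<^sup>2 = 2 * real s * scale_const * 2 ^ (2 * j0)"
      using R by (simp add: B_def power_mult_distrib flip: power_mult)
    have dm: "d i \<in> borel_measurable P" for i
    proof (cases i)
      case None
      then show ?thesis by (simp add: d_def[abs_def])
    next
      case (Some p)
      obtain l k where p: "p = (l, k)" by fastforce
      show ?thesis
        unfolding mP d_def[abs_def] Some p option.case prod.case
        by (intro borel_measurable_times borel_measurable_const U_measurable watm_integrable)
    qed
    have db: "cmod (d i t) \<le> B" if "i \<in> I" for i t
    proof (cases i)
      case None
      then show ?thesis using B0 by (simp add: d_def)
    next
      case (Some p)
      obtain l k where lk: "p = (l, k)" by fastforce
      have "(l, k) \<in> \<Lambda> j0 \<times> {..<4}" using that unfolding I_def Some lk by blast
      then have p: "i = Some (l, k)" "l \<in> \<Lambda> j0" by (simp_all only: Some lk mem_Times_iff fst_conv)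
      have "cmod (d i t) = sqrt (2 * real s) * (weight l * cmod (U (watm l) t))"
        using weight_pos[of l] by (simp add: p d_def norm_mult norm_power)
      also have "\<dots> \<le> sqrt (2 * real s) * (sqrt scale_const * 2 ^ j0)"
        by (intro mult_left_mono weighted_atom_bound p) auto
      also have "\<dots> = B" by (simp add: B_def real_sqrt_mult)
      finally show ?thesis .
    qed
    define \<delta> where "\<delta> = \<delta>0 / N\<^sup>2"
    have \<delta>: "0 < \<delta>" using \<delta>0 N0 by (simp add: \<delta>_def)
    define y where "y = ln (1 / \<gamma>)"
    have y0: "0 \<le> y" using \<gamma> by (simp add: y_def)
    have q: "0 < B\<^sup>2 / \<delta>" "B\<^sup>2 / \<delta> \<le> G * \<tau>"
    proof -
      show "0 < B\<^sup>2 / \<delta>" using B0 \<delta> by simp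
      have "B\<^sup>2 / \<delta> = (2 * scale_const / \<delta>0) * (2 ^ (2 * j0) * real s * N\<^sup>2)"
        using N0 by (simp add: B2 \<delta>_def)
      also have "\<dots> \<le> (2 * scale_const / \<delta>0) * (2 ^ (2 * j0) * real s * ((C + 1) * real j0)\<^sup>2)"
        using R \<delta>0 N by (intro mult_left_mono power_mono) auto
      also have "\<dots> = (2 * scale_const * (C + 1)\<^sup>2 / \<delta>0) * \<tau>" by (simp add: \<tau> power_mult_distrib)
      also have "\<dots> \<le> G * \<tau>" using \<tau>8 by (intro mult_right_mono) (auto simp: G_def)
      finally show "B\<^sup>2 / \<delta> \<le> G * \<tau>" .
    qed
    have m': "G * (4100 * Aa\<^sup>2 * H + 12) * \<tau> * max (real j0 * (ln \<tau>) ^ 3) y \<le> real m"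
      using m unfolding sample_count_def C0_def y_def .
    note par = sampling_parameters[OF G1 count_const_ge \<tau>8 j0 cardI(2,1) q y0 m'[unfolded Aa_def H_def], folded Aa_def]
    have m0: "0 < m"
    proof -
      have "0 < 4 * (2 + y)" using y0 by simp
      then have "0 < real m / (B\<^sup>2 / \<delta>)" using par(6) by (rule less_le_trans)
      then show ?thesis by (cases "m = 0") auto
    qed
    have "\<exists>E\<in>sets (Pi\<^sub>M {1..m} (\<lambda>_. P)). 1 - \<gamma> / 2 \<le> measure (Pi\<^sub>M {1..m} (\<lambda>_. P)) E \<and>
      (\<forall>t\<in>E. \<forall>p. (\<forall>i\<in>I. 0 \<le> p i) \<and> (\<Sum>i\<in>I. p i) = 1 \<longrightarrow>
         3 / 128 * P.expectation (\<lambda>x. (cmod (\<Sum>i\<in>I. of_real (p i) * d i x))\<^sup>2) - \<delta>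
           \<le> (\<Sum>k=1..m. (cmod (\<Sum>i\<in>I. of_real (p i) * d i (t k)))\<^sup>2) / real m)"
    proof (rule P.sampling_lower_bound[OF finI dm db B0 \<delta> \<gamma> m0 par(1,2) _ par(4)])
      show "ln (16 * B\<^sup>2 / \<delta>) \<le> Aa * ln \<tau>" using par(3) by simp
      show "2050 * real (nat \<lceil>Aa * ln \<tau>\<rceil>) * (Aa * ln \<tau>) * ln (real (card I)) \<le> real m * \<delta> / B\<^sup>2" using par(5) by simp
      show "4 * (2 + ln (1 / \<gamma>)) \<le> real m * \<delta> / B\<^sup>2" using par(6) unfolding y_def by simp
    qed
    then obtain E where E: "E \<in> sets (Pi\<^sub>M {1..m} (\<lambda>_. P))" "1 - \<gamma> / 2 \<le> measure (Pi\<^sub>M {1..m} (\<lambda>_. P)) E"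
      and Elb: "\<And>t p. t \<in> E \<Longrightarrow> (\<And>i. i \<in> I \<Longrightarrow> 0 \<le> p i) \<Longrightarrow> (\<Sum>i\<in>I. p i) = 1 \<Longrightarrow>
         3 / 128 * P.expectation (\<lambda>x. (cmod (\<Sum>i\<in>I. of_real (p i) * d i x))\<^sup>2) - \<delta>
           \<le> (\<Sum>k=1..m. (cmod (\<Sum>i\<in>I. of_real (p i) * d i (t k)))\<^sup>2) / real m"
      by blast
    have PiM_eq: "iid_uniform_disc m N = Pi\<^sub>M {1..m} (\<lambda>_. P)" by (simp add: iid_uniform_disc_def P_def)
    have "3 * c / (256 * disc_vol * N\<^sup>2) * (\<Sum>i\<in>\<Lambda> j0. (cmod (z i))\<^sup>2) - \<delta>0 / (N\<^sup>2 * real s) * (\<Sum>i\<in>\<Lambda> j0. cmod (z i))\<^sup>2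
           \<le> (\<Sum>k=1..m. (cmod (forward j0 z (t k)))\<^sup>2) / real m" if tE: "t \<in> E" for t z
    proof -
      define l where "l = (\<Sum>i\<in>\<Lambda> j0. cmod (z i))"
      have l0: "0 \<le> l" by (simp add: l_def sum_nonneg)
      show ?thesis
      proof (cases "l = 0")
        case True
        then have "z i = 0" if "i \<in> \<Lambda> j0" for i using that finite_dict_le by (simp add: l_def sum_nonneg_eq_0_iff)
        then show ?thesis by (simp add: sum_nonneg)
      next
        case False
        then have lp: "0 < l" using l0 by simp
        define p1 where "p1 i k = quarter_part k (z i) / (sqrt 2 * l)" for i k
        define p where "p o' = (case o' of None \<Rightarrow> 1 - (\<Sum>i\<in>\<Lambda> j0. \<Sum>k<4. p1 i k) | Some (i, k) \<Rightarrow> p1 i k)" for o'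
        have p1_0: "0 \<le> p1 i k" for i k using lp by (simp add: p1_def quarter_part_def)
        have sumI: "(\<Sum>o'\<in>I. g o') = g None + (\<Sum>i\<in>\<Lambda> j0. \<Sum>k<4. g (Some (i, k)))" for g :: "_ \<Rightarrow> 'z::comm_monoid_add"
        proof -
          have "(\<Sum>o'\<in>I. g o') = g None + (\<Sum>o'\<in>Some ` (\<Lambda> j0 \<times> {..<4}). g o')"
            unfolding I_def by (subst sum.insert) (auto simp: finite_dict_le)
          also have "(\<Sum>o'\<in>Some ` (\<Lambda> j0 \<times> {..<4}). g o') = (\<Sum>q\<in>\<Lambda> j0 \<times> {..<4}. g (Some q))"
            by (subst sum.reindex) auto
          also have "\<dots> = (\<Sum>i\<in>\<Lambda> j0. \<Sum>k<4. g (Some (i, k)))"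
            by (subst sum.cartesian_product) (simp add: case_prod_unfold)
          finally show ?thesis .
        qed
        have p1s: "(\<Sum>i\<in>\<Lambda> j0. \<Sum>k<4. p1 i k) \<le> 1"
        proof -
          have "(\<Sum>k<4. p1 i k) \<le> cmod (z i) / l" for i
          proof -
            have "(\<Sum>k<4. p1 i k) = (\<Sum>k<4. quarter_part k (z i)) / (sqrt 2 * l)" by (simp add: p1_def sum_divide_distrib)
            also have "\<dots> \<le> (sqrt 2 * cmod (z i)) / (sqrt 2 * l)"
              using lp by (intro divide_right_mono quarter_part_sum) auto
            finally show ?thesis by simp
          qed
          then have "(\<Sum>i\<in>\<Lambda> j0. \<Sum>k<4. p1 i k) \<le> (\<Sum>i\<in>\<Lambda> j0. cmod (z i) / l)" by (intro sum_mono)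
          also have "\<dots> = 1" using lp by (simp add: l_def flip: sum_divide_distrib)
          finally show ?thesis .
        qed
        have pI: "0 \<le> p o'" for o' using p1_0 p1s by (auto simp: p_def split: option.split)
        have psum: "(\<Sum>o'\<in>I. p o') = 1" unfolding sumI by (simp add: p_def)
        have f: "(\<Sum>o'\<in>I. of_real (p o') * d o' x) = of_real (sqrt (real s) / l) * forward j0 z x" for x
        proof -
          have "(\<Sum>k<4. of_real (p1 i k) * (of_real (sqrt (2 * real s) * weight i) * \<i> ^ k * U (watm i) x))
             = of_real (sqrt (real s) / l) * (of_real (weight i) * z i * U (watm i) x)" for i
          proof -
            have "(\<Sum>k<4. of_real (p1 i k) * (of_real (sqrt (2 * real s) * weight i) * \<i> ^ k * U (watm i) x))
              = of_real (sqrt (2 * real s) * weight i / (sqrt 2 * l)) * U (watm i) x * (\<Sum>k<4. of_real (quarter_part k (z i)) * \<i> ^ k)"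
              unfolding sum_distrib_left p1_def by (intro sum.cong refl) simp
            also have "sqrt (2 * real s) * weight i / (sqrt 2 * l) = sqrt (real s) / l * weight i"
              by (simp add: real_sqrt_mult)
            finally show ?thesis unfolding quarter_part_sum(1) by (simp add: mult_ac)
          qed
          then show ?thesis unfolding sumI by (simp add: p_def d_def forward_def sum_distrib_left)
        qed
        \<comment> \<open>The square of the scaling factor from \<open>z\<close> to the convex hull;
          dividing the estimate by it turns \<open>\<delta>\<close> into the penalty with
          \<open>l\<^sup>2 / s\<close>.\<close>
        define \<theta> where "\<theta> = real s / l\<^sup>2"
        have \<theta>: "0 < \<theta>" using s lp by (simp add: \<theta>_def)
        have f2: "(cmod (\<Sum>o'\<in>I. of_real (p o') * d o' x))\<^sup>2 = \<theta> * (cmod (forward j0 z x))\<^sup>2" for x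
          unfolding f using lp by (simp add: norm_mult norm_divide power_mult_distrib power_divide \<theta>_def)
        have Ef: "c / 2 * (\<Sum>i\<in>\<Lambda> j0. (cmod (z i))\<^sup>2) / (disc_vol * N\<^sup>2) \<le> P.expectation (\<lambda>x. (cmod (forward j0 z x))\<^sup>2)"
        proof -
          \<comment> \<open>The weights are moved into the coefficients, where they cancel those of
            the lower bound and leave the plain sum of squares.\<close>
          define x' where "x' i = (if i \<in> \<Lambda> j0 then of_real (weight i) * z i else 0)" for i
          have x'0: "\<forall>i. i \<notin> \<Lambda> j0 \<longrightarrow> x' i = 0" by (simp add: x'_def)
          have fw: "forward j0 z t = (\<Sum>i\<in>\<Lambda> j0. x' i * U (watm i) t)" for t
            unfolding forward_def by (intro sum.cong refl) (simp add: x'_def)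
          have "(\<Sum>i\<in>\<Lambda> j0. 2 powr (- 2 * b * real (scale i)) * (cmod (x' i))\<^sup>2) = (\<Sum>i\<in>\<Lambda> j0. (cmod (z i))\<^sup>2)"
          proof (intro sum.cong refl)
            fix i assume i: "i \<in> \<Lambda> j0"
            have "2 powr (- 2 * b * real (scale i)) * (weight i)\<^sup>2 = 1"
              unfolding weight_def power2_eq_square powr_add[symmetric] by simp
            moreover have "(cmod (x' i))\<^sup>2 = (weight i)\<^sup>2 * (cmod (z i))\<^sup>2"
              using i weight_pos[of i] by (simp add: x'_def norm_mult power_mult_distrib)
            ultimately show "2 powr (- 2 * b * real (scale i)) * (cmod (x' i))\<^sup>2 = (cmod (z i))\<^sup>2" by (simp flip: mult.assoc)
          qed
          then have le: "c / 2 * (\<Sum>i\<in>\<Lambda> j0. (cmod (z i))\<^sup>2) \<le> (LINT t|lborel. indicator (cball 0 N) t * (cmod (forward j0 z t))\<^sup>2)"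
            using forward_lower_bound[OF c C(2) j0 x'0] unfolding fw N_def by simp
          have eq: "P.expectation (\<lambda>x. (cmod (forward j0 z x))\<^sup>2) = (LINT t|lborel. indicator (cball 0 N) t * (cmod (forward j0 z t))\<^sup>2) / (disc_vol * N\<^sup>2)"
            unfolding P_def using forward_measurable[of j0 z] by (intro disc_expectation N0) measurable
          show ?thesis unfolding eq by (rule divide_right_mono[OF le]) simp
        qed
        have "3 / 128 * (\<theta> * P.expectation (\<lambda>x. (cmod (forward j0 z x))\<^sup>2)) - \<delta> \<le> \<theta> * (\<Sum>k=1..m. (cmod (forward j0 z (t k)))\<^sup>2) / real m"
          using Elb[OF tE pI psum] unfolding f2 by (simp add: sum_distrib_left)
        then have "\<theta> * (3 / 128 * P.expectation (\<lambda>x. (cmod (forward j0 z x))\<^sup>2) - \<delta> / \<theta>) \<le> \<theta> * ((\<Sum>k=1..m. (cmod (forward j0 z (t k)))\<^sup>2) / real m)"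
          using \<theta> by (simp add: right_diff_distrib)
        then have "3 / 128 * P.expectation (\<lambda>x. (cmod (forward j0 z x))\<^sup>2) - \<delta> / \<theta> \<le> (\<Sum>k=1..m. (cmod (forward j0 z (t k)))\<^sup>2) / real m"
          using \<theta> by (subst (asm) mult_le_cancel_left_pos) auto
        moreover have "3 / 128 * (c / 2 * (\<Sum>i\<in>\<Lambda> j0. (cmod (z i))\<^sup>2) / (disc_vol * N\<^sup>2)) \<le> 3 / 128 * P.expectation (\<lambda>x. (cmod (forward j0 z x))\<^sup>2)"
          by (intro mult_left_mono Ef) simp
        moreover have "3 / 128 * (c / 2 * (\<Sum>i\<in>\<Lambda> j0. (cmod (z i))\<^sup>2) / (disc_vol * N\<^sup>2)) = 3 * c / (256 * disc_vol * N\<^sup>2) * (\<Sum>i\<in>\<Lambda> j0. (cmod (z i))\<^sup>2)"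
          by simp
        moreover have "\<delta> / \<theta> = \<delta>0 / (N\<^sup>2 * real s) * l\<^sup>2" by (simp add: \<delta>_def \<theta>_def)
        ultimately show ?thesis unfolding l_def by linarith
      qed
    qed
    then have "\<exists>E\<in>sets (iid_uniform_disc m N). 1 - \<gamma> / 2 \<le> measure (iid_uniform_disc m N) E \<and>
        (\<forall>t\<in>E. \<forall>z. 3 * c / (256 * disc_vol * N\<^sup>2) * (\<Sum>i\<in>\<Lambda> j0. (cmod (z i))\<^sup>2)
           - \<delta>0 / (N\<^sup>2 * real s) * (\<Sum>i\<in>\<Lambda> j0. cmod (z i))\<^sup>2
           \<le> (\<Sum>k=1..m. (cmod (forward j0 z (t k)))\<^sup>2) / real m)"
      unfolding PiM_eq using E by blast
    note this[unfolded N_def] }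
  ultimately show ?thesis by blast
qed

end

section \<open>The event for the truncation error\<close>

lemma sample_count_mono:
  "C0 \<le> C0' \<Longrightarrow> 0 \<le> \<tau> \<Longrightarrow> 0 < \<gamma> \<Longrightarrow> \<gamma> < 1 \<Longrightarrow> sample_count C0 j0 \<tau> \<gamma> \<le> sample_count C0' j0 \<tau> \<gamma>"
  unfolding sample_count_def by (intro mult_right_mono) (auto simp: le_max_iff_disj)

text \<open>The sup bound and the mean-square bound of the truncation error differ by the factor
  \<open>4 ^ j0\<close>; this many samples, times the logarithm, make its empirical mean comparable
  to the mean-square bound.\<close>

lemma sample_count_lower:
  assumes C0: "1 \<le> C0" and j0: "1 \<le> j0" and s: "2 \<le> s" and \<tau>: "\<tau> = (real j0)\<^sup>2 * 2 ^ (2 * j0) * real s"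
    and \<gamma>: "0 < \<gamma>" "\<gamma> < 1" and m: "sample_count C0 j0 \<tau> \<gamma> \<le> real m"
  shows "(2 + ln (1 / \<gamma>)) * 4 ^ j0 \<le> 3 * real m"
proof -
  define M where "M = max (real j0 * (ln \<tau>) ^ 3) (ln (1 / \<gamma>))"
  have t: "1 * 2 ^ (2 * j0) * 2 \<le> \<tau>" unfolding \<tau> using j0 s by (intro mult_mono one_le_power) auto
  have "(2::real) ^ 2 \<le> 2 ^ (2 * j0)" using j0 by (intro power_increasing) auto
  then have "8 \<le> \<tau>" using t by simp
  then have "1 \<le> ln \<tau>" by (rule ln_ge_one)
  then have "1 * 1 \<le> real j0 * (ln \<tau>) ^ 3" using j0 by (intro mult_mono one_le_power) auto
  then have M: "1 \<le> M" "ln (1 / \<gamma>) \<le> M" by (auto simp: M_def)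
  have four: "(2::real) ^ (2 * j0) = 4 ^ j0" by (simp add: power_mult)
  have t4: "4 ^ j0 \<le> \<tau>" using t zero_le_power[of "4 :: real" j0] unfolding four by linarith
  have "4 ^ j0 * M \<le> 1 * \<tau> * M" using t4 M by (simp add: mult_right_mono)
  also have "\<dots> \<le> C0 * \<tau> * M" using C0 \<open>8 \<le> \<tau>\<close> M by (intro mult_right_mono) auto
  also have "\<dots> \<le> real m" using m unfolding sample_count_def M_def .
  finally have "4 ^ j0 * M \<le> real m" .
  moreover have "(2 + ln (1 / \<gamma>)) * 4 ^ j0 \<le> (3 * M) * 4 ^ j0" using M by (intro mult_right_mono) auto
  moreover have "(3 * M) * 4 ^ j0 = 3 * (4 ^ j0 * M)" by simp
  ultimately show ?thesis by linarith
qed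

context wavelet_recovery
begin

lemma prob_space_iid: "0 < N \<Longrightarrow> prob_space (iid_uniform_disc m N)"
  unfolding iid_uniform_disc_def by (intro prob_space_PiM disc_measure(2))

text \<open>In \<open>tail_event\<close> the summand 3 comes from the deviation in Chernoff's bound,
  and \<open>2 / disc_vol\<close> from twice the mean.\<close>

definition tail_const :: real where
  "tail_const = sqrt (4 * scale_const * (3 + 2 / disc_vol))"

text \<open>The squared error divided by its sup bound \<open>D\<close> has values in [0, 1] and
  mean of order \<open>1 / 4 ^ j0\<close>, so Chernoff's upper bound applies. The event depends on
  \<open>u\<close>, in contrast to that of \<open>sparse_lower_bound_event\<close>.\<close>

lemma tail_event:
  assumes u: "u \<in> Ltwo_disc" and r: "ell2_norm \<Gamma> (proj_le_perp \<psi> \<phi> j0 (analysis_op \<psi> \<phi> u)) \<le> r" "0 \<le> r"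
    and N: "1 \<le> N" and \<gamma>: "0 < \<gamma>" "\<gamma> < 1" and m: "(2 + ln (1 / \<gamma>)) * 4 ^ j0 \<le> 3 * real m"
  shows "\<exists>E\<in>sets (iid_uniform_disc m N). 1 - \<gamma> / 2 < measure (iid_uniform_disc m N) E \<and>
    (\<forall>t\<in>E. (\<Sum>k=1..m. (cmod (U u (t k) - U (trunc u j0) (t k)))\<^sup>2) \<le> real m * (tail_const * 2 powr (- b * real j0) * r)\<^sup>2)"
proof -
  have N0: "0 < N" using N by simp
  define w where "w t = U u t - U (trunc u j0) t" for t
  have wm: "w \<in> borel_measurable borel" unfolding w_def[abs_def] by (rule tail_bounds(3)[OF u r])
  define q where "q = 2 powr (- b * real j0)"
  have q0: "0 < q" by (simp add: q_def)
  have q2: "2 powr (- 2 * b * real j0) = q\<^sup>2" unfolding q_def power2_eq_square powr_add[symmetric] by (simp add: mult.assoc)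
  have q4: "2 powr (- 2 * (b - 1) * real j0) = q\<^sup>2 * 4 ^ j0"
  proof -
    have "(4::real) ^ j0 = 2 powr (2 * real j0)" by (simp add: powr_powr[symmetric] powr_realpow)
    then show ?thesis unfolding q2[symmetric] by (simp add: powr_add[symmetric] algebra_simps)
  qed
  define D where "D = 4 * scale_const * q\<^sup>2 * 4 ^ j0 * r\<^sup>2"
  have R: "0 < scale_const" using scale_const by simp
  have sup: "(cmod (w t))\<^sup>2 \<le> D" for t
    using tail_bounds(1)[OF u r, of t] unfolding w_def[symmetric] q4 D_def by (simp add: mult_ac)
  have mean: "(LINT t|lborel. indicator (cball 0 N) t * (cmod (w t))\<^sup>2) \<le> D / 4 ^ j0"
    using tail_bounds(2)[OF u r N0] unfolding w_def[symmetric] q2 D_def by simp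
  interpret Q: prob_space "iid_uniform_disc m N" by (rule prob_space_iid[OF N0])
  show ?thesis
  proof (cases "r = 0")
    \<comment> \<open>For r = 0 the normalising constant \<open>D\<close> is 0, but then the error
      vanishes identically.\<close>
    case True
    then have "w t = 0" for t using sup[of t] by (simp add: D_def)
    then show ?thesis
      using \<gamma> by (intro bexI[of _ "space (iid_uniform_disc m N)"]) (simp_all add: Q.prob_space w_def[symmetric])
  next
    case False
    then have D0: "0 < D" using r(2) R q0 by (simp add: D_def)
    define P where "P = uniform_measure lborel (cball (0 :: real ^ 2) N)"
    interpret P: prob_space P unfolding P_def by (rule disc_measure(2)[OF N0])
    have mP: "borel_measurable P = (borel_measurable borel :: (real ^ 2 \<Rightarrow> real) set)" by (rule measurable_cong_sets) (simp_all add: P_def)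
    have PiM_eq: "iid_uniform_disc m N = Pi\<^sub>M {1..m} (\<lambda>_. P)" by (simp add: iid_uniform_disc_def P_def)
    define h where "h t = (cmod (w t))\<^sup>2 / D" for t
    have hm: "h \<in> borel_measurable borel" unfolding h_def[abs_def] using wm by measurable
    have h: "0 \<le> h t \<and> h t \<le> 1" for t using sup[of t] D0 by (simp add: h_def)
    have Eh: "P.expectation h \<le> 1 / (disc_vol * 4 ^ j0)"
    proof -
      have "P.expectation h = (LINT t|lborel. indicator (cball 0 N) t * (cmod (w t))\<^sup>2) / D / (disc_vol * N\<^sup>2)"
        unfolding P_def disc_expectation[OF N0 hm] by (simp add: h_def)
      also have "\<dots> \<le> (D / 4 ^ j0) / D / (disc_vol * N\<^sup>2)"
        using D0 by (intro divide_right_mono mean) auto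
      also have "\<dots> = 1 / (disc_vol * 4 ^ j0) / N\<^sup>2" using D0 by simp
      also have "\<dots> \<le> 1 / (disc_vol * 4 ^ j0) / 1" using N by (intro divide_left_mono) auto
      finally show ?thesis by simp
    qed
    \<comment> \<open>The summand 2 makes the failure probability strictly smaller than
      \<open>\<gamma> / 2\<close>, from which the strict inequality of the final result is
      obtained.\<close>
    define x where "x = 2 + ln (1 / \<gamma>)"
    define F where "F = {t \<in> space (Pi\<^sub>M {1..m} (\<lambda>_. P)). x + real m * (2 * P.expectation h) \<le> (\<Sum>k=1..m. h (t k))}"
    have Fm: "F \<in> sets (Pi\<^sub>M {1..m} (\<lambda>_. P))"
    proof -
      have [measurable]: "h \<in> borel_measurable P" using hm unfolding mP .
      have [measurable]: "(\<lambda>t. \<Sum>k=1..m. h (t k)) \<in> borel_measurable (Pi\<^sub>M {1..m} (\<lambda>_. P))"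
        by (intro borel_measurable_sum measurable_compose[OF measurable_component_singleton]) simp_all
      show ?thesis unfolding F_def by measurable
    qed
    have "Q.prob F \<le> exp (- x)"
      unfolding F_def PiM_eq by (rule P.chernoff_upper) (use hm h in \<open>simp_all add: mP\<close>)
    also have "\<dots> = exp (- 2) * \<gamma>" using \<gamma> by (simp add: x_def exp_diff ln_div exp_minus field_simps)
    also have "\<dots> < \<gamma> / 2"
    proof -
      have "2 < exp (2 :: real)" using exp_ge_add_one_self[of "2 :: real"] by simp
      then have "exp (- 2) < (1 / 2 :: real)" by (simp add: exp_minus field_simps)
      then show ?thesis using \<gamma> by simp
    qed
    finally have pF: "Q.prob F < \<gamma> / 2" .
    show ?thesis
    proof (intro bexI conjI ballI)
      show "space (iid_uniform_disc m N) - F \<in> sets (iid_uniform_disc m N)" using Fm unfolding PiM_eq by auto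
      show "1 - \<gamma> / 2 < Q.prob (space (iid_uniform_disc m N) - F)"
        using pF Q.prob_compl[of F] Fm unfolding PiM_eq by simp
      fix t assume t: "t \<in> space (iid_uniform_disc m N) - F"
      have "(\<Sum>k=1..m. (cmod (w (t k)))\<^sup>2) = D * (\<Sum>k=1..m. h (t k))" using D0 by (simp add: h_def sum_distrib_left)
      also have "\<dots> \<le> D * (x + real m * (2 * P.expectation h))"
        using t D0 by (intro mult_left_mono) (auto simp: F_def PiM_eq)
      also have "\<dots> \<le> D * (3 * real m / 4 ^ j0 + real m * (2 * (1 / (disc_vol * 4 ^ j0))))"
        using m D0 by (intro mult_left_mono add_mono Eh) (auto simp: x_def pos_le_divide_eq)
      also have "\<dots> = real m * (4 * scale_const * (3 + 2 / disc_vol) * q\<^sup>2 * r\<^sup>2)"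
        by (simp add: D_def field_simps)
      also have "4 * scale_const * (3 + 2 / disc_vol) * q\<^sup>2 * r\<^sup>2 = (tail_const * q * r)\<^sup>2"
        using R by (simp add: tail_const_def power_mult_distrib)
      finally show "(\<Sum>k=1..m. (cmod (U u (t k) - U (trunc u j0) (t k)))\<^sup>2) \<le> real m * (tail_const * 2 powr (- b * real j0) * r)\<^sup>2"
        unfolding w_def q_def .
    qed
  qed
qed

section \<open>The recovery error\<close>

lemma analysis_lincomb:
  assumes "i \<in> \<Lambda> J"
  shows "analysis_op \<psi> \<phi> (\<lambda>x. \<Sum>k\<in>\<Lambda> J. a k * watm k x) i = a i"
proof -
  have "analysis_op \<psi> \<phi> (\<lambda>x. \<Sum>k\<in>\<Lambda> J. a k * watm k x) i = Ltwo_inner (\<lambda>x. \<Sum>k\<in>\<Lambda> J. a k * watm k x) (watm i)"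
    using assms dict_le_subset(1)[of J] by (intro analysis_dict) (rule subsetD)
  also have "\<dots> = (\<Sum>k\<in>\<Lambda> J. a k * Ltwo_inner (watm k) (watm i))" by (rule Ltwo_inner_lincomb_left[OF watom_Ltwo watom_Ltwo])
  also have "\<dots> = (\<Sum>k\<in>\<Lambda> J. if k = i then a k else 0)"
    using assms by (intro sum.cong refl) (simp add: watm_on[OF dict_le_subset(3)])
  also have "\<dots> = a i" using assms by (simp add: sum.delta[OF finite_dict_le])
  finally show ?thesis .
qed

lemma span_expansion:
  assumes "v \<in> fun_span watm (\<Lambda> J)"
  shows "v = (\<lambda>x. \<Sum>i\<in>\<Lambda> J. analysis_op \<psi> \<phi> v i * watm i x)"
proof -
  obtain S a where S: "finite S" "S \<subseteq> \<Lambda> J" "v = (\<lambda>x. \<Sum>i\<in>S. a i * watm i x)"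
    using assms unfolding fun_span_def by blast
  define a' where "a' i = (if i \<in> S then a i else 0)" for i
  have v: "v = (\<lambda>x. \<Sum>i\<in>\<Lambda> J. a' i * watm i x)"
    unfolding S(3) by (rule ext, rule sum.mono_neutral_cong_left[OF finite_dict_le S(2)]) (auto simp: a'_def)
  have "analysis_op \<psi> \<phi> v i = a' i" if "i \<in> \<Lambda> J" for i unfolding v by (rule analysis_lincomb[OF that])
  then have "(\<Sum>i\<in>\<Lambda> J. a' i * watm i x) = (\<Sum>i\<in>\<Lambda> J. analysis_op \<psi> \<phi> v i * watm i x)" for x
    by (intro sum.cong refl) simp
  then show ?thesis by (subst v) (rule ext)
qed

text \<open>The factor \<open>\<kappa> / 16\<close> is chosen for the cone: there the squared l1
  norm is at most \<open>8 * s * Z\<close> plus \<open>8 * \<sigma>\<^sup>2\<close>, and 8/16 of the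
  main term is absorbed. The noise enters through \<open>\<beta> + T\<close>, with \<open>T\<close>
  a mean-square bound for the forward image of the truncation error.\<close>

lemma recovery_bound:
  fixes \<beta> T N \<kappa> r :: real
  assumes u: "u \<in> Ltwo_disc" and r: "ell2_norm \<Gamma> (proj_le_perp \<psi> \<phi> j0 (analysis_op \<psi> \<phi> u)) \<le> r" "0 \<le> r"
    and m: "0 < m" and s: "0 < s" and N: "0 < N" and \<kappa>: "0 < \<kappa>" and \<beta>: "0 \<le> \<beta>" and T: "0 \<le> T"
    and re: "\<And>z. \<kappa> / N\<^sup>2 * (\<Sum>i\<in>\<Lambda> j0. (cmod (z i))\<^sup>2) - (\<kappa> / 16) / (N\<^sup>2 * real s) * (\<Sum>i\<in>\<Lambda> j0. cmod (z i))\<^sup>2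
           \<le> (\<Sum>k=1..m. (cmod (forward j0 z (t k)))\<^sup>2) / real m"
    and tail: "(\<Sum>k=1..m. (cmod (U u (t k) - U (trunc u j0) (t k)))\<^sup>2) \<le> real m * T\<^sup>2"
    and \<epsilon>: "\<And>k. k \<in> {1..m} \<Longrightarrow> cmod (\<epsilon> k) \<le> \<beta>"
    and sol: "recovery_solution \<psi> \<phi> b j0 m t (\<lambda>k. U u (t k) + \<epsilon> k) (\<beta> + T) v"
  defines "\<sigma> \<equiv> best_approx1 (\<Lambda> j0) s (W_inv b (proj_le \<psi> \<phi> j0 (analysis_op \<psi> \<phi> u)))"
  shows "Ltwo_norm (\<lambda>x. u x - v x) \<le> r + 2 powr (b * real j0) * (sqrt (8 / \<kappa>) * N * (\<beta> + T) + \<sigma> / sqrt (real s))"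
proof -
  define \<eta> where "\<eta> = \<beta> + T"
  have \<eta>0: "0 \<le> \<eta>" using \<beta> T by (simp add: \<eta>_def)
  define y where "y k = U u (t k) + \<epsilon> k" for k
  have uL: "u \<in> Ltwo" using u by (simp add: Ltwo_disc_def)
  \<comment> \<open>The truncated expansion of \<open>u\<close> is feasible: Minkowski's inequality
    adds the truncation error \<open>T\<close> and the noise \<open>\<beta>\<close> in the discrete
    mean-square norm. Hence the minimiser can be compared with it.\<close>
  have resid: "(\<Sum>k=1..m. (cmod (U (trunc u j0) (t k) - y k))\<^sup>2) \<le> real m * \<eta>\<^sup>2"
  proof -
    let ?w = "\<lambda>k. cmod (U u (t k) - U (trunc u j0) (t k))"
    have "L2_set (\<lambda>k. cmod (U (trunc u j0) (t k) - y k)) {1..m} \<le> L2_set (\<lambda>k. ?w k + \<beta>) {1..m}"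
    proof (rule L2_set_mono)
      fix k assume k: "k \<in> {1..m}"
      have "cmod (U (trunc u j0) (t k) - y k) = cmod ((U u (t k) - U (trunc u j0) (t k)) + \<epsilon> k)"
        unfolding y_def by (subst norm_minus_cancel[symmetric]) (simp add: algebra_simps)
      also have "\<dots> \<le> ?w k + \<beta>" using \<epsilon>[OF k] norm_triangle_ineq[of "U u (t k) - U (trunc u j0) (t k)" "\<epsilon> k"] by linarith
      finally show "cmod (U (trunc u j0) (t k) - y k) \<le> ?w k + \<beta>" .
    qed simp
    also have "\<dots> \<le> L2_set ?w {1..m} + L2_set (\<lambda>_. \<beta>) {1..m}" by (rule L2_set_triangle_ineq)
    also have "L2_set ?w {1..m} \<le> sqrt (real m) * T"
      unfolding L2_set_def using tail T by (intro real_le_lsqrt) (auto simp: power_mult_distrib)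
    also have "L2_set (\<lambda>_. \<beta>) {1..m} = sqrt (real m) * \<beta>"
      using \<beta> by (simp add: L2_set_def real_sqrt_mult)
    finally have "L2_set (\<lambda>k. cmod (U (trunc u j0) (t k) - y k)) {1..m} \<le> sqrt (real m) * \<eta>"
      by (simp add: \<eta>_def algebra_simps)
    then have "(L2_set (\<lambda>k. cmod (U (trunc u j0) (t k) - y k)) {1..m})\<^sup>2 \<le> (sqrt (real m) * \<eta>)\<^sup>2"
      by (intro power_mono L2_set_nonneg)
    then show ?thesis by (simp add: L2_set_def power_mult_distrib sum_nonneg)
  qed
  have tr_span: "trunc u j0 \<in> fun_span watm (\<Lambda> j0)"
    unfolding trunc_def[abs_def] by (rule fun_spanI[OF finite_dict_le order_refl])
  have tr_feas: "1 / real m * (\<Sum>k=1..m. (cmod (U (trunc u j0) (t k) - y k))\<^sup>2) \<le> \<eta>\<^sup>2"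
    using resid m by (simp add: divide_le_eq mult.commute)
  have v: "v \<in> fun_span watm (\<Lambda> j0)" "1 / real m * (\<Sum>k=1..m. (cmod (U v (t k) - y k))\<^sup>2) \<le> \<eta>\<^sup>2"
    and opt: "ell1_norm (\<Lambda> j0) (W_inv b (analysis_op \<psi> \<phi> v)) \<le> ell1_norm (\<Lambda> j0) (W_inv b (analysis_op \<psi> \<phi> (trunc u j0)))"
    using sol tr_span tr_feas unfolding recovery_solution_def is_arg_min_def y_def \<eta>_def by (blast, blast, force simp: not_less)
  define z where "z = W_inv b (analysis_op \<psi> \<phi> v)"
  define x where "x = W_inv b (proj_le \<psi> \<phi> j0 (analysis_op \<psi> \<phi> u))"
  have Wt: "W_inv b f i = f i / of_real (weight i)" for f i by (simp add: W_inv_def weight_def)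
  have w_nz: "weight i \<noteq> 0" for i using weight_pos[of i] by simp
  have x_eq: "x i = analysis_op \<psi> \<phi> u i / of_real (weight i)" if "i \<in> \<Lambda> j0" for i
    using that by (simp add: x_def Wt proj_le_def)
  have "(\<Sum>i\<in>\<Lambda> j0. cmod (z i)) \<le> (\<Sum>i\<in>\<Lambda> j0. cmod (W_inv b (analysis_op \<psi> \<phi> (trunc u j0)) i))"
    using opt unfolding ell1_norm_finite[OF finite_dict_le] z_def .
  also have "\<dots> = (\<Sum>i\<in>\<Lambda> j0. cmod (x i))"
  proof (intro sum.cong refl arg_cong[where f = cmod])
    fix i assume i: "i \<in> \<Lambda> j0"
    show "W_inv b (analysis_op \<psi> \<phi> (trunc u j0)) i = x i"
      unfolding x_eq[OF i] Wt trunc_def[abs_def] analysis_lincomb[OF i] ..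
  qed
  finally have zx: "(\<Sum>i\<in>\<Lambda> j0. cmod (z i)) \<le> (\<Sum>i\<in>\<Lambda> j0. cmod (x i))" .
  define e where "e i = z i - x i" for i
  define Z where "Z = (\<Sum>i\<in>\<Lambda> j0. (cmod (e i))\<^sup>2)"
  have Z0: "0 \<le> Z" by (simp add: Z_def sum_nonneg)
  have \<sigma>0: "0 \<le> \<sigma>" unfolding \<sigma>_def x_def[symmetric] by (rule l1_cone_best_approx(2)[OF finite_dict_le zx])
  have cone: "(\<Sum>i\<in>\<Lambda> j0. cmod (e i)) \<le> 2 * sqrt (real s) * sqrt Z + 2 * \<sigma>"
    unfolding \<sigma>_def x_def[symmetric] Z_def e_def by (rule l1_cone_best_approx(1)[OF finite_dict_le zx])
  have cone2: "(\<Sum>i\<in>\<Lambda> j0. cmod (e i))\<^sup>2 \<le> 8 * real s * Z + 8 * \<sigma>\<^sup>2"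
  proof -
    have sq: "(p + q)\<^sup>2 \<le> 2 * p\<^sup>2 + 2 * q\<^sup>2" for p q :: real
      using zero_le_power2[of "p - q"] unfolding power2_eq_square by (simp add: algebra_simps)
    have "(\<Sum>i\<in>\<Lambda> j0. cmod (e i))\<^sup>2 \<le> (2 * sqrt (real s) * sqrt Z + 2 * \<sigma>)\<^sup>2"
      by (intro power_mono cone sum_nonneg) simp
    also have "\<dots> \<le> 2 * (2 * sqrt (real s) * sqrt Z)\<^sup>2 + 2 * (2 * \<sigma>)\<^sup>2" by (rule sq)
    also have "\<dots> = 8 * real s * Z + 8 * \<sigma>\<^sup>2" using Z0 by (simp add: power_mult_distrib)
    finally show ?thesis .
  qed
  have fwd: "forward j0 e t' = U v t' - U (trunc u j0) t'" for t'
  proof -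
    have "U v t' = (\<Sum>i\<in>\<Lambda> j0. analysis_op \<psi> \<phi> v i * U (watm i) t')"
      by (subst span_expansion[OF v(1)]) (rule U_lincomb[OF watm_integrable])
    moreover have "forward j0 e t' = (\<Sum>i\<in>\<Lambda> j0. analysis_op \<psi> \<phi> v i * U (watm i) t' - analysis_op \<psi> \<phi> u i * U (watm i) t')"
      unfolding forward_def
      by (intro sum.cong refl) (simp add: e_def x_eq z_def Wt w_nz right_diff_distrib left_diff_distrib)
    ultimately show ?thesis by (simp add: U_trunc sum_subtractf)
  qed
  \<comment> \<open>Both the minimiser and the truncated expansion fit the data up to
    \<open>\<eta>\<close>, so their difference has empirical mean square at most 4 times
    \<open>\<eta>\<^sup>2\<close>.\<close>
  have mean: "(\<Sum>k=1..m. (cmod (forward j0 e (t k)))\<^sup>2) / real m \<le> 4 * \<eta>\<^sup>2"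
  proof -
    have "(cmod (forward j0 e (t k)))\<^sup>2 \<le> 2 * (cmod (U v (t k) - y k))\<^sup>2 + 2 * (cmod (U (trunc u j0) (t k) - y k))\<^sup>2" for k
    proof -
      have sq: "(p + q)\<^sup>2 \<le> 2 * p\<^sup>2 + 2 * q\<^sup>2" for p q :: real
        using zero_le_power2[of "p - q"] unfolding power2_eq_square by (simp add: algebra_simps)
      have "cmod (forward j0 e (t k)) \<le> cmod (U v (t k) - y k) + cmod (U (trunc u j0) (t k) - y k)"
        using norm_triangle_ineq4[of "U v (t k) - y k" "U (trunc u j0) (t k) - y k"] by (simp add: fwd)
      then have "(cmod (forward j0 e (t k)))\<^sup>2 \<le> (cmod (U v (t k) - y k) + cmod (U (trunc u j0) (t k) - y k))\<^sup>2"
        by (intro power_mono) auto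
      then show ?thesis using sq order_trans by blast
    qed
    then have "(\<Sum>k=1..m. (cmod (forward j0 e (t k)))\<^sup>2) \<le>
        (\<Sum>k=1..m. 2 * (cmod (U v (t k) - y k))\<^sup>2 + 2 * (cmod (U (trunc u j0) (t k) - y k))\<^sup>2)" by (intro sum_mono)
    also have "\<dots> = 2 * (\<Sum>k=1..m. (cmod (U v (t k) - y k))\<^sup>2) + 2 * (\<Sum>k=1..m. (cmod (U (trunc u j0) (t k) - y k))\<^sup>2)"
      by (simp add: sum.distrib sum_distrib_left)
    also have "\<dots> \<le> 2 * (real m * \<eta>\<^sup>2) + 2 * (real m * \<eta>\<^sup>2)"
      using resid v(2) m by (intro add_mono mult_left_mono) (auto simp: divide_le_eq mult.commute)
    finally show ?thesis using m by (simp add: divide_le_eq mult_ac)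
  qed
  have Zb: "Z \<le> 8 / \<kappa> * (N * \<eta>)\<^sup>2 + \<sigma>\<^sup>2 / real s"
  proof -
    have "\<kappa> / N\<^sup>2 * Z - (\<kappa> / 16) / (N\<^sup>2 * real s) * (8 * real s * Z + 8 * \<sigma>\<^sup>2)
      \<le> \<kappa> / N\<^sup>2 * Z - (\<kappa> / 16) / (N\<^sup>2 * real s) * (\<Sum>i\<in>\<Lambda> j0. cmod (e i))\<^sup>2"
      using \<kappa> by (intro diff_left_mono mult_left_mono cone2) auto
    also have "\<dots> \<le> 4 * \<eta>\<^sup>2" using re[of e] mean unfolding Z_def by linarith
    also have "\<kappa> / N\<^sup>2 * Z - (\<kappa> / 16) / (N\<^sup>2 * real s) * (8 * real s * Z + 8 * \<sigma>\<^sup>2) = \<kappa> / (2 * N\<^sup>2) * (Z - \<sigma>\<^sup>2 / real s)"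
      using N s by (simp add: field_simps)
    finally have "Z - \<sigma>\<^sup>2 / real s \<le> 4 * \<eta>\<^sup>2 / (\<kappa> / (2 * N\<^sup>2))"
      using \<kappa> N by (subst pos_le_divide_eq) (simp_all add: mult.commute)
    also have "\<dots> = 8 / \<kappa> * (N * \<eta>)\<^sup>2" by (simp add: power_mult_distrib)
    finally show ?thesis by simp
  qed
  have sZ: "sqrt Z \<le> sqrt (8 / \<kappa>) * N * \<eta> + \<sigma> / sqrt (real s)"
  proof -
    have "sqrt Z \<le> sqrt (8 / \<kappa> * (N * \<eta>)\<^sup>2 + \<sigma>\<^sup>2 / real s)" using Zb by simp
    also have "\<dots> \<le> sqrt (8 / \<kappa> * (N * \<eta>)\<^sup>2) + sqrt (\<sigma>\<^sup>2 / real s)"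
      using \<kappa> by (intro sqrt_add_le_add_sqrt) auto
    also have "\<dots> = sqrt (8 / \<kappa>) * N * \<eta> + \<sigma> / sqrt (real s)"
      using N \<eta>0 \<sigma>0 by (simp add: real_sqrt_mult real_sqrt_divide)
    finally show ?thesis .
  qed
  have "(Ltwo_norm (\<lambda>x. trunc u j0 x - v x))\<^sup>2 \<le> (2 powr (b * real j0) * sqrt Z)\<^sup>2"
  proof -
    have "trunc u j0 y' - v y' = (\<Sum>i\<in>\<Lambda> j0. (analysis_op \<psi> \<phi> u i - analysis_op \<psi> \<phi> v i) * watm i y')" for y'
      by (subst span_expansion[OF v(1)]) (simp add: trunc_def left_diff_distrib sum_subtractf)
    then have "(Ltwo_norm (\<lambda>x. trunc u j0 x - v x))\<^sup>2 = (\<Sum>i\<in>\<Lambda> j0. (cmod (analysis_op \<psi> \<phi> u i - analysis_op \<psi> \<phi> v i))\<^sup>2)"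
      using orthonormal_sum_square[OF finite_dict_le watom_Ltwo watm_on[OF dict_le_subset(3)]] by simp
    also have "\<dots> \<le> (\<Sum>i\<in>\<Lambda> j0. (2 powr (b * real j0))\<^sup>2 * (cmod (e i))\<^sup>2)"
    proof (intro sum_mono)
      fix i assume i: "i \<in> \<Lambda> j0"
      have "analysis_op \<psi> \<phi> u i - analysis_op \<psi> \<phi> v i = - (of_real (weight i) * e i)"
        by (simp add: e_def x_eq[OF i] z_def Wt w_nz right_diff_distrib)
      then have "(cmod (analysis_op \<psi> \<phi> u i - analysis_op \<psi> \<phi> v i))\<^sup>2 = (weight i)\<^sup>2 * (cmod (e i))\<^sup>2"
        by (simp only: norm_minus_cancel norm_mult norm_of_real power_mult_distrib power2_abs)
      also have "\<dots> \<le> (2 powr (b * real j0))\<^sup>2 * (cmod (e i))\<^sup>2"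
        using i b weight_pos[of i] by (intro mult_right_mono power_mono) (auto simp: weight_def dict_index_le_def)
      finally show "(cmod (analysis_op \<psi> \<phi> u i - analysis_op \<psi> \<phi> v i))\<^sup>2 \<le> (2 powr (b * real j0))\<^sup>2 * (cmod (e i))\<^sup>2" .
    qed
    also have "\<dots> = (2 powr (b * real j0) * sqrt Z)\<^sup>2" using Z0 by (simp add: Z_def power_mult_distrib sum_distrib_left)
    finally show ?thesis .
  qed
  then have "Ltwo_norm (\<lambda>x. trunc u j0 x - v x) \<le> 2 powr (b * real j0) * sqrt Z"
    by (rule power2_le_imp_le) (use Z0 in simp)
  also have "\<dots> \<le> 2 powr (b * real j0) * (sqrt (8 / \<kappa>) * N * \<eta> + \<sigma> / sqrt (real s))" by (intro mult_left_mono sZ) simp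
  finally have tv: "Ltwo_norm (\<lambda>x. trunc u j0 x - v x) \<le> 2 powr (b * real j0) * (sqrt (8 / \<kappa>) * N * \<eta> + \<sigma> / sqrt (real s))" .
  have vL: "v \<in> Ltwo" by (rule fun_span_Ltwo[OF watom_Ltwo v(1)])
  show ?thesis
    using Ltwo_triangle_diff[OF uL trunc_Ltwo[of u j0] vL] residual_le[OF u r] tv unfolding \<eta>_def by linarith
qed

end

theorem theorem3p2:
  fixes V :: "int \<Rightarrow> (real \<Rightarrow> complex) set"
    and \<psi> \<phi> :: "real \<Rightarrow> complex"
    and \<rho> :: nat
    and b c C :: real
  assumes "regular_mra \<rho> V"
    and "scaling_function V \<psi>" and "mra_wavelet V \<phi>"
    and "compact (ess_support \<psi>)" and "compact (ess_support \<phi>)"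
    and "2 < b" and "b < real \<rho>"
    and "0 < c" and "lower_bound_const \<psi> \<phi> b c"
    and "0 < C" and "balancing_const \<psi> \<phi> b c C"
  shows "\<exists>C0>0. \<exists>C1>0. \<exists>C2>0. \<exists>C3>0.
    \<forall>(j0::nat) (u::real ^ 2 \<Rightarrow> complex) (r::real) (m::nat) (\<beta>::real) (s::nat) (\<gamma>::real) (\<tau>::real).
      1 \<le> j0 \<and> u \<in> Ltwo_disc \<and> 0 \<le> r \<and>
      ell2_norm (dict_index \<psi> \<phi>) (proj_le_perp \<psi> \<phi> j0 (analysis_op \<psi> \<phi> u)) \<le> r \<and>
      0 \<le> \<beta> \<and> 2 \<le> s \<and> s \<le> card (dict_index_le \<psi> \<phi> j0) \<and>
      \<tau> = (real j0)\<^sup>2 * 2 ^ (2 * j0) * real s \<and>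
      0 < \<gamma> \<and> \<gamma> < 1 \<and>
      real m \<ge> C0 * \<tau> * max (real j0 * (ln \<tau>) ^ 3) (ln (1 / \<gamma>)) \<longrightarrow>
      (\<exists>E \<in> sets (iid_uniform_disc m (real_of_int \<lceil>C * real j0\<rceil>)).
         measure (iid_uniform_disc m (real_of_int \<lceil>C * real j0\<rceil>)) E > 1 - \<gamma> \<and>
         (\<forall>t\<in>E. \<forall>\<epsilon> :: nat \<Rightarrow> complex. (\<forall>k\<in>{1..m}. cmod (\<epsilon> k) \<le> \<beta>) \<longrightarrow>
            (\<forall>v. recovery_solution \<psi> \<phi> b j0 m t (\<lambda>k. bessel_conv b u (t k) + \<epsilon> k)
                   (\<beta> + C3 * real j0 * 2 powr (- b * real j0) * r) v \<longrightarrow>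
               Ltwo_norm (\<lambda>x. u x - v x)
                 \<le> C1 * 2 powr (b * real j0)
                     * (best_approx1 (dict_index_le \<psi> \<phi> j0) s
                          (W_inv b (proj_le \<psi> \<phi> j0 (analysis_op \<psi> \<phi> u))) / sqrt (real s))
                   + C2 * real j0 * (2 powr (b * real j0) * \<beta> + real j0 * r))))"
proof -
  interpret wavelet_recovery V \<psi> \<phi> \<rho> b
    using assms by unfold_locales
  define \<kappa> where "\<kappa> = 3 * c / (256 * disc_vol)"
  have \<kappa>: "0 < \<kappa>" using assms(8) by (simp add: \<kappa>_def)
  obtain C' where C': "0 < C'" and sparse: "\<And>(j0::nat) (m::nat) (s::nat) \<gamma> \<tau>. 1 \<le> j0 \<and> 2 \<le> s \<and> \<tau> = (real j0)\<^sup>2 * 2 ^ (2 * j0) * real s \<and>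
      0 < \<gamma> \<and> \<gamma> < 1 \<and> sample_count C' j0 \<tau> \<gamma> \<le> real m \<Longrightarrow>
      (\<exists>E\<in>sets (iid_uniform_disc m (real_of_int \<lceil>C * real j0\<rceil>)). 1 - \<gamma> / 2 \<le> measure (iid_uniform_disc m (real_of_int \<lceil>C * real j0\<rceil>)) E \<and>
        (\<forall>t\<in>E. \<forall>z. 3 * c / (256 * disc_vol * (real_of_int \<lceil>C * real j0\<rceil>)\<^sup>2) * (\<Sum>i\<in>\<Lambda> j0. (cmod (z i))\<^sup>2)
           - (\<kappa> / 16) / ((real_of_int \<lceil>C * real j0\<rceil>)\<^sup>2 * real s) * (\<Sum>i\<in>\<Lambda> j0. cmod (z i))\<^sup>2
           \<le> (\<Sum>k=1..m. (cmod (forward j0 z (t k)))\<^sup>2) / real m))"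
    using sparse_lower_bound_event[OF assms(8-11), of "\<kappa> / 16"] \<kappa> by auto
  define C0 where "C0 = max C' 1"
  define C3 where "C3 = tail_const"
  \<comment> \<open>The factor C + 1 is from N at most (C + 1) j0, the factor 1 + C3 collects noise
    and truncation error, and the final 1 is for the residual \<open>r\<close> itself.\<close>
  define C2 where "C2 = sqrt (8 / \<kappa>) * (C + 1) * (1 + C3) + 1"
  have C3: "0 < C3" using scale_const by (simp add: C3_def tail_const_def add_pos_nonneg)
  have C2: "0 < C2" using \<kappa> C3 assms(10) by (simp add: C2_def add_nonneg_pos)
  { fix j0 m s :: nat and u :: "real ^ 2 \<Rightarrow> complex" and r \<beta> \<gamma> \<tau> :: real
    assume j0: "1 \<le> j0" and u: "u \<in> Ltwo_disc" and r: "0 \<le> r"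
      "ell2_norm \<Gamma> (proj_le_perp \<psi> \<phi> j0 (analysis_op \<psi> \<phi> u)) \<le> r"
      and \<beta>: "0 \<le> \<beta>" and s: "2 \<le> s" and \<tau>: "\<tau> = (real j0)\<^sup>2 * 2 ^ (2 * j0) * real s"
      and \<gamma>: "0 < \<gamma>" "\<gamma> < 1" and m: "C0 * \<tau> * max (real j0 * (ln \<tau>) ^ 3) (ln (1 / \<gamma>)) \<le> real m"
    define N where "N = real_of_int \<lceil>C * real j0\<rceil>"
    have N: "1 \<le> N" "N \<le> (C + 1) * real j0"
    proof -
      have "0 < C * real j0" using assms(10) j0 by simp
      then have "1 \<le> \<lceil>C * real j0\<rceil>" by linarith
      then show "1 \<le> N" by (simp add: N_def)
      have "N \<le> C * real j0 + 1 * 1" unfolding N_def by linarith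
      also have "\<dots> \<le> C * real j0 + 1 * real j0" using j0 by simp
      finally show "N \<le> (C + 1) * real j0" by (simp add: distrib_right)
    qed
    have mC: "sample_count C0 j0 \<tau> \<gamma> \<le> real m" using m by (simp add: sample_count_def)
    moreover have "sample_count C' j0 \<tau> \<gamma> \<le> sample_count C0 j0 \<tau> \<gamma>"
      using \<gamma> \<tau> by (intro sample_count_mono) (auto simp: C0_def)
    ultimately have "sample_count C' j0 \<tau> \<gamma> \<le> real m" by linarith
    then obtain E1 where E1: "E1 \<in> sets (iid_uniform_disc m N)" "1 - \<gamma> / 2 \<le> measure (iid_uniform_disc m N) E1"
      and re: "\<And>t z. t \<in> E1 \<Longrightarrow> 3 * c / (256 * disc_vol * N\<^sup>2) * (\<Sum>i\<in>\<Lambda> j0. (cmod (z i))\<^sup>2)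
           - (\<kappa> / 16) / (N\<^sup>2 * real s) * (\<Sum>i\<in>\<Lambda> j0. cmod (z i))\<^sup>2
           \<le> (\<Sum>k=1..m. (cmod (forward j0 z (t k)))\<^sup>2) / real m"
      using sparse[of j0 s \<tau> \<gamma> m, folded N_def] j0 s \<tau> \<gamma> by blast
    have m3: "(2 + ln (1 / \<gamma>)) * 4 ^ j0 \<le> 3 * real m"
      by (rule sample_count_lower[OF _ j0 s \<tau> \<gamma> mC]) (simp add: C0_def)
    have m0: "0 < m"
    proof -
      have "0 < (2 + ln (1 / \<gamma>)) * 4 ^ j0" using \<gamma> by (intro mult_pos_pos add_pos_nonneg) auto
      then show ?thesis using m3 by (cases "m = 0") auto
    qed
    obtain E2 where E2: "E2 \<in> sets (iid_uniform_disc m N)" "1 - \<gamma> / 2 < measure (iid_uniform_disc m N) E2"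
      and tail: "\<And>t. t \<in> E2 \<Longrightarrow> (\<Sum>k=1..m. (cmod (U u (t k) - U (trunc u j0) (t k)))\<^sup>2) \<le> real m * (C3 * 2 powr (- b * real j0) * r)\<^sup>2"
      using tail_event[OF u r(2,1) N(1) \<gamma> m3] unfolding C3_def by blast
    interpret Q: prob_space "iid_uniform_disc m N" using N by (intro prob_space_iid) simp
    have "Q.prob (E1 \<inter> E2) > 1 - \<gamma>"
    proof -
      \<comment> \<open>Inclusion and exclusion; the strict inequality for \<open>E2\<close> makes
        the conclusion strict.\<close>
      have "Q.prob (E1 \<union> E2) = Q.prob E1 + Q.prob E2 - Q.prob (E1 \<inter> E2)"
        using E1 E2 by (intro measure_Un3) (auto simp: fmeasurable_def Q.emeasure_eq_measure)
      then show ?thesis using E1(2) E2(2) Q.prob_le_1[of "E1 \<union> E2"] by linarith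
    qed
    moreover have "Ltwo_norm (\<lambda>x. u x - v x) \<le> 1 * 2 powr (b * real j0)
          * (best_approx1 (\<Lambda> j0) s (W_inv b (proj_le \<psi> \<phi> j0 (analysis_op \<psi> \<phi> u))) / sqrt (real s))
          + C2 * real j0 * (2 powr (b * real j0) * \<beta> + real j0 * r)"
      if t: "t \<in> E1 \<inter> E2" and \<epsilon>: "\<forall>k\<in>{1..m}. cmod (\<epsilon> k) \<le> \<beta>"
        and v: "recovery_solution \<psi> \<phi> b j0 m t (\<lambda>k. U u (t k) + \<epsilon> k) (\<beta> + C3 * real j0 * 2 powr (- b * real j0) * r) v"
      for t \<epsilon> v
    proof -
      define T where "T = C3 * real j0 * 2 powr (- b * real j0) * r"
      define \<sigma> where "\<sigma> = best_approx1 (\<Lambda> j0) s (W_inv b (proj_le \<psi> \<phi> j0 (analysis_op \<psi> \<phi> u)))"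
      have T0: "0 \<le> T" using C3 r by (simp add: T_def)
      \<comment> \<open>The bound on the event carries no factor j0. It is inserted as 1 here and
        then enlarged to j0, to match the tolerance in the minimisation problem.\<close>
      have "(\<Sum>k=1..m. (cmod (U u (t k) - U (trunc u j0) (t k)))\<^sup>2) \<le> real m * (C3 * 1 * 2 powr (- b * real j0) * r)\<^sup>2"
        using tail[of t] t by simp
      also have "\<dots> \<le> real m * T\<^sup>2"
        unfolding T_def using C3 r j0 by (intro mult_left_mono power_mono mult_mono) auto
      finally have tl: "(\<Sum>k=1..m. (cmod (U u (t k) - U (trunc u j0) (t k)))\<^sup>2) \<le> real m * T\<^sup>2" .
      have re': "\<kappa> / N\<^sup>2 * (\<Sum>i\<in>\<Lambda> j0. (cmod (z i))\<^sup>2) - (\<kappa> / 16) / (N\<^sup>2 * real s) * (\<Sum>i\<in>\<Lambda> j0. cmod (z i))\<^sup>2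
           \<le> (\<Sum>k=1..m. (cmod (forward j0 z (t k)))\<^sup>2) / real m" for z
        using re[of t z] t by (simp add: \<kappa>_def)
      have "Ltwo_norm (\<lambda>x. u x - v x) \<le> r + 2 powr (b * real j0) * (sqrt (8 / \<kappa>) * N * (\<beta> + T) + \<sigma> / sqrt (real s))"
        unfolding \<sigma>_def
        by (rule recovery_bound[OF u r(2,1) m0 _ _ \<kappa> \<beta> T0 re' tl _ v[folded T_def]]) (use s N \<epsilon> in auto)
      also have "\<dots> = 2 powr (b * real j0) * (\<sigma> / sqrt (real s)) + (sqrt (8 / \<kappa>) * N * (2 powr (b * real j0) * (\<beta> + T)) + r)"
        by (simp add: algebra_simps)
      \<comment> \<open>The factor 2^(b j0) from undoing \<open>W\<close> cancels the decay 2^(-b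
        j0) in \<open>T\<close>; this leaves j0 r, and the radius N contributes the second factor
        j0.\<close>
      also have "2 powr (b * real j0) * (\<beta> + T) = 2 powr (b * real j0) * \<beta> + C3 * (real j0 * r)"
        by (simp add: T_def distrib_left powr_minus field_simps)
      also have "sqrt (8 / \<kappa>) * N * (2 powr (b * real j0) * \<beta> + C3 * (real j0 * r)) + r \<le> C2 * real j0 * (2 powr (b * real j0) * \<beta> + real j0 * r)"
      proof -
        define X where "X = 2 powr (b * real j0) * \<beta> + real j0 * r"
        have parts: "0 \<le> 2 powr (b * real j0) * \<beta>" "0 \<le> real j0 * r" using \<beta> r by auto
        then have X0: "0 \<le> X" by (simp add: X_def)
        have "2 powr (b * real j0) * \<beta> + C3 * (real j0 * r) \<le> X + C3 * X"
          using parts C3 by (intro add_mono mult_left_mono) (auto simp: X_def)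
        also have "\<dots> = (1 + C3) * X" by (simp add: distrib_right)
        finally have "sqrt (8 / \<kappa>) * N * (2 powr (b * real j0) * \<beta> + C3 * (real j0 * r)) \<le> sqrt (8 / \<kappa>) * ((C + 1) * real j0) * ((1 + C3) * X)"
          using \<kappa> N C3 parts assms(10) by (intro mult_mono) auto
        moreover have "1 * r \<le> real j0 * r" using j0 r by (intro mult_right_mono) auto
        moreover have "1 * X \<le> real j0 * X" using j0 X0 by (intro mult_right_mono) auto
        ultimately have "sqrt (8 / \<kappa>) * N * (2 powr (b * real j0) * \<beta> + C3 * (real j0 * r)) + r
            \<le> sqrt (8 / \<kappa>) * ((C + 1) * real j0) * ((1 + C3) * X) + real j0 * X" using parts by (simp add: X_def)
        also have "\<dots> = C2 * real j0 * X" by (simp add: C2_def algebra_simps)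
        finally show ?thesis unfolding X_def .
      qed
      finally show ?thesis by (simp add: \<sigma>_def)
    qed
    ultimately have "\<exists>E \<in> sets (iid_uniform_disc m N). measure (iid_uniform_disc m N) E > 1 - \<gamma> \<and>
         (\<forall>t\<in>E. \<forall>\<epsilon> :: nat \<Rightarrow> complex. (\<forall>k\<in>{1..m}. cmod (\<epsilon> k) \<le> \<beta>) \<longrightarrow>
            (\<forall>v. recovery_solution \<psi> \<phi> b j0 m t (\<lambda>k. bessel_conv b u (t k) + \<epsilon> k)
                   (\<beta> + C3 * real j0 * 2 powr (- b * real j0) * r) v \<longrightarrow>
               Ltwo_norm (\<lambda>x. u x - v x)
                 \<le> 1 * 2 powr (b * real j0)
                     * (best_approx1 (dict_index_le \<psi> \<phi> j0) s
                          (W_inv b (proj_le \<psi> \<phi> j0 (analysis_op \<psi> \<phi> u))) / sqrt (real s))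
                   + C2 * real j0 * (2 powr (b * real j0) * \<beta> + real j0 * r)))"
      using E1(1) E2(1) by (intro bexI[of _ "E1 \<inter> E2"] conjI ballI allI impI) auto
    note this[unfolded N_def] }
  note main = this
  have C0: "0 < C0" by (simp add: C0_def)
  show ?thesis
    by (rule exI[of _ C0], intro conjI C0, rule exI[of _ 1], intro conjI zero_less_one, rule exI[of _ C2], intro conjI C2,
        rule exI[of _ C3], intro conjI C3 allI impI) (elim conjE, rule main)
qed

end
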